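(* Let $\mathcal{B}$ be a von Neumann subalgebra of a finite von Neumann algebra $\mathcal{A}$, with the trace on $\mathcal{B}$ being the restriction of the trace on $\mathcal{A}$, and let $i_*(M)=\mathcal{A}\otimes_{\mathcal{B}}M$ for a $\mathcal{B}$-module $M$. Then for every $\mathcal{B}$-module $M$: (1) $i_*(\mathbf{t}M)=\mathbf{t}\,i_*(M)$ and $i_*(\mathbf{p}M)=\mathbf{p}\,i_*(M)$. (2) $i_*(\mathbf{T}M)=\mathbf{T}\,i_*(M)$ and $i_*(\mathbf{P}M)=\mathbf{P}\,i_*(M)$.
   Context: A von Neumann algebra $\mathcal{A}\subseteq\mathcal{B}(H)$ is finite if it has a normal faithful trace $\mathrm{tr}_{\mathcal{A}}$; such a trace is fixed and extended to square matrices by summing the diagonal traces. A von Neumann subalgebra of $\mathcal{A}$ is a $C^*$-subalgebra $\mathcal{B}$ with $\mathcal{B}''=\mathcal{B}$, commutants computed in $\mathcal{B}(H)$; the trace used on $\mathcal{B}$ is $\mathrm{tr}_{\mathcal{B}}=\mathrm{tr}_{\mathcal{A}}|_{\mathcal{B}}$. Modules are left modules. The following definitions are stated for $\mathcal{A}$ and apply likewise to $\mathcal{B}$. Dimension: if $P$ is a finitely generated projective $\mathcal{A}$-module, choose $n$ and $f:\mathcal{A}^n\to\mathcal{A}^n$ with $f=f^2=f^*$ and image (isomorphic to) $P$, and put $\dim_{\mathcal{A}}(P)=\mathrm{tr}_{\mathcal{A}}(f)$; for any $\mathcal{A}$-module $M$, $\dim_{\mathcal{A}}(M)=\sup\{\dim_{\mathcal{A}}(P):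 P\text{ a finitely generated projective submodule of }M\}$. $\mathcal{U}(\mathcal{A})$ is the algebra of operators affiliated to $\mathcal{A}$ (closed densely defined operators on $l^2(\mathcal{A})$, the completion of $\mathcal{A}$ for $\langle a,b\rangle=\mathrm{tr}_{\mathcal{A}}(ab^* )$, commuting with the commutant of $\mathcal{A}$); it equals the classical ring of quotients of the Ore ring $\mathcal{A}$. For an $\mathcal{A}$-module $M$: $\mathbf{T}M$ is the largest submodule of dimension zero, $\mathbf{P}M=M/\mathbf{T}M$, $\mathbf{t}M=\ker(M\to\mathcal{U}(\mathcal{A})\otimes_{\mathcal{A}}M)$, $\mathbf{p}M=M/\mathbf{t}M$. In the claim the operations on $M$ are those for $\mathcal{B}$ and the operations on $i_*(M)$ are those for $\mathcal{A}$; since $i_*$ is exact, $i_*$ of a submodule (quotient) of $M$ is identified with a submodule (quotient) of $i_*(M)$. *)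

theory Defs
  imports
    "HOL-Analysis.Analysis"
    "HOL-Algebra.AbelCoset"
    "HOL-Algebra.Module"
    "HOL-Algebra.Generated_Groups"
    "HOL-Library.Poly_Mapping"
    "HOL-Library.Nonpos_Ints"
begin

section \<open>Complex Hilbert spaces and bounded operators\<close>

text \<open>The inner product is linear in the first argument.\<close>

class complex_hilbert = banach +
  fixes scaleC :: "complex \<Rightarrow> 'a \<Rightarrow> 'a"  (infixr \<open>*\<^sub>C\<close> 75)
    and cinner :: "'a \<Rightarrow> 'a \<Rightarrow> complex"
  assumes scaleC_add_right: "c *\<^sub>C (x + y) = c *\<^sub>C x + c *\<^sub>C y"
    and scaleC_add_left: "(c + d) *\<^sub>C x = c *\<^sub>C x + d *\<^sub>C x"
    and scaleC_scaleC: "c *\<^sub>C d *\<^sub>C x = (c * d) *\<^sub>C x"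
    and scaleC_of_real: "complex_of_real r *\<^sub>C x = scaleR r x"
    and cinner_commute: "cinner x y = cnj (cinner y x)"
    and cinner_add_left: "cinner (x + y) z = cinner x z + cinner y z"
    and cinner_scaleC_left: "cinner (c *\<^sub>C x) y = c * cinner x y"
    and cinner_self: "cinner x x = complex_of_real ((norm x)\<^sup>2)"

text \<open>\<open>'h \<Rightarrow>\<^sub>L 'h\<close> consists of the real-linear bounded operators, so complex linearity
  has to be required separately.\<close>

definition bounded_ops :: "('h::complex_hilbert \<Rightarrow>\<^sub>L 'h) set" where
  "bounded_ops = {f. \<forall>c x. blinfun_apply f (c *\<^sub>C x) = c *\<^sub>C blinfun_apply f x}"

definition op_scale :: "complex \<Rightarrow> ('h::complex_hilbert \<Rightarrow>\<^sub>L 'h) \<Rightarrow> ('h \<Rightarrow>\<^sub>L 'h)" where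
  "op_scale c f = Blinfun (\<lambda>x. c *\<^sub>C blinfun_apply f x)"

definition op_adj :: "('h::complex_hilbert \<Rightarrow>\<^sub>L 'h) \<Rightarrow> ('h \<Rightarrow>\<^sub>L 'h)" where
  "op_adj f = (THE g. \<forall>x y. cinner (blinfun_apply f x) y = cinner x (blinfun_apply g y))"

definition op_le :: "('h::complex_hilbert \<Rightarrow>\<^sub>L 'h) \<Rightarrow> ('h \<Rightarrow>\<^sub>L 'h) \<Rightarrow> bool" where
  "op_le f g \<longleftrightarrow> (\<forall>x. cinner (blinfun_apply (g - f) x) x \<in> \<real>\<^sub>\<ge>\<^sub>0)"

definition commutant :: "('h::complex_hilbert \<Rightarrow>\<^sub>L 'h) set \<Rightarrow> ('h \<Rightarrow>\<^sub>L 'h) set" where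
  "commutant S = {f \<in> bounded_ops. \<forall>g\<in>S. f o\<^sub>L g = g o\<^sub>L f}"

section \<open>Finite von Neumann algebras\<close>

definition c_star_algebra :: "('h::complex_hilbert \<Rightarrow>\<^sub>L 'h) set \<Rightarrow> bool" where
  "c_star_algebra A \<longleftrightarrow> A \<subseteq> bounded_ops \<and> 0 \<in> A \<and>
     (\<forall>a\<in>A. \<forall>b\<in>A. a + b \<in> A) \<and> (\<forall>c. \<forall>a\<in>A. op_scale c a \<in> A) \<and>
     (\<forall>a\<in>A. \<forall>b\<in>A. a o\<^sub>L b \<in> A) \<and> (\<forall>a\<in>A. op_adj a \<in> A) \<and> closed A"

definition von_neumann_algebra :: "('h::complex_hilbert \<Rightarrow>\<^sub>L 'h) set \<Rightarrow> bool" where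
  "von_neumann_algebra A \<longleftrightarrow> c_star_algebra A \<and> commutant (commutant A) = A"

definition von_neumann_subalgebra ::
    "('h::complex_hilbert \<Rightarrow>\<^sub>L 'h) set \<Rightarrow> ('h \<Rightarrow>\<^sub>L 'h) set \<Rightarrow> bool" where
  "von_neumann_subalgebra B A \<longleftrightarrow> B \<subseteq> A \<and> von_neumann_algebra B"

text \<open>A finite trace; normality is compatibility with suprema of upward directed
  families of positive elements. The trace need not be normalised, and only the
  values on \<open>A\<close> matter.\<close>

definition normal_faithful_trace ::
    "('h::complex_hilbert \<Rightarrow>\<^sub>L 'h) set \<Rightarrow> (('h \<Rightarrow>\<^sub>L 'h) \<Rightarrow> complex) \<Rightarrow> bool" where
  "normal_faithful_trace A tr \<longleftrightarrow>
     (\<forall>a\<in>A. \<forall>b\<in>A. tr (a + b) = tr a + tr b) \<and>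
     (\<forall>c. \<forall>a\<in>A. tr (op_scale c a) = c * tr a) \<and>
     (\<forall>a\<in>A. \<forall>b\<in>A. tr (a o\<^sub>L b) = tr (b o\<^sub>L a)) \<and>
     (\<forall>a\<in>A. op_le 0 a \<longrightarrow> tr a \<in> \<real>\<^sub>\<ge>\<^sub>0) \<and>
     (\<forall>a\<in>A. op_le 0 a \<and> tr a = 0 \<longrightarrow> a = 0) \<and>
     (\<forall>D s. D \<subseteq> A \<and> D \<noteq> {} \<and> (\<forall>d\<in>D. op_le 0 d) \<and>
        (\<forall>d\<in>D. \<forall>e\<in>D. \<exists>f\<in>D. op_le d f \<and> op_le e f) \<and>
        s \<in> A \<and> (\<forall>d\<in>D. op_le d s) \<and> (\<forall>u\<in>A. (\<forall>d\<in>D. op_le d u) \<longrightarrow> op_le s u)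
        \<longrightarrow> Re (tr s) = (SUP d\<in>D. Re (tr d)))"

definition vn_ring :: "('h::complex_hilbert \<Rightarrow>\<^sub>L 'h) set \<Rightarrow> ('h \<Rightarrow>\<^sub>L 'h) ring" where
  "vn_ring A = \<lparr>carrier = A, monoid.mult = (o\<^sub>L), one = id_blinfun, zero = 0, add = (+)\<rparr>"

section \<open>Left modules\<close>

text \<open>The locale \<^locale>\<open>module\<close> requires a commutative ring; only its record type and
  \<^locale>\<open>submodule\<close> are used. The ring multiplication and unit that the record
  type provides for the module are irrelevant.\<close>

locale left_module = R?: ring R + M?: abelian_group M
  for R :: "('a, 'r) ring_scheme" (structure) and M :: "('a, 'b, 'm) module_scheme" (structure) +
  assumes lsmult_closed: "\<lbrakk>a \<in> carrier R; x \<in> carrier M\<rbrakk> \<Longrightarrow> a \<odot>\<^bsub>M\<^esub> x \<in> carrier M"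
    and lsmult_l_distr: "\<lbrakk>a \<in> carrier R; b \<in> carrier R; x \<in> carrier M\<rbrakk> \<Longrightarrow>
      (a \<oplus>\<^bsub>R\<^esub> b) \<odot>\<^bsub>M\<^esub> x = a \<odot>\<^bsub>M\<^esub> x \<oplus>\<^bsub>M\<^esub> b \<odot>\<^bsub>M\<^esub> x"
    and lsmult_r_distr: "\<lbrakk>a \<in> carrier R; x \<in> carrier M; y \<in> carrier M\<rbrakk> \<Longrightarrow>
      a \<odot>\<^bsub>M\<^esub> (x \<oplus>\<^bsub>M\<^esub> y) = a \<odot>\<^bsub>M\<^esub> x \<oplus>\<^bsub>M\<^esub> a \<odot>\<^bsub>M\<^esub> y"
    and lsmult_assoc: "\<lbrakk>a \<in> carrier R; b \<in> carrier R; x \<in> carrier M\<rbrakk> \<Longrightarrow>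
      (a \<otimes>\<^bsub>R\<^esub> b) \<odot>\<^bsub>M\<^esub> x = a \<odot>\<^bsub>M\<^esub> (b \<odot>\<^bsub>M\<^esub> x)"
    and lsmult_one: "x \<in> carrier M \<Longrightarrow> \<one>\<^bsub>R\<^esub> \<odot>\<^bsub>M\<^esub> x = x"

definition left_module_hom ::
    "('a, 'r) ring_scheme \<Rightarrow> ('a, 'b, 'm) module_scheme \<Rightarrow> ('a, 'c, 'n) module_scheme \<Rightarrow> ('b \<Rightarrow> 'c) set"
  where
  "left_module_hom R M N = {h \<in> carrier M \<rightarrow> carrier N.
     (\<forall>x\<in>carrier M. \<forall>y\<in>carrier M. h (x \<oplus>\<^bsub>M\<^esub> y) = h x \<oplus>\<^bsub>N\<^esub> h y) \<and>
     (\<forall>a\<in>carrier R. \<forall>x\<in>carrier M. h (a \<odot>\<^bsub>M\<^esub> x) = a \<odot>\<^bsub>N\<^esub> h x)}"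

definition left_module_iso ::
    "('a, 'r) ring_scheme \<Rightarrow> ('a, 'b, 'm) module_scheme \<Rightarrow> ('a, 'c, 'n) module_scheme \<Rightarrow> ('b \<Rightarrow> 'c) set"
  where
  "left_module_iso R M N = {h \<in> left_module_hom R M N. bij_betw h (carrier M) (carrier N)}"

definition quot_module :: "('a, 'b, 'm) module_scheme \<Rightarrow> 'b set \<Rightarrow> ('a, 'b set) module" where
  "quot_module M N = \<lparr>carrier = a_rcosets\<^bsub>M\<^esub> N, monoid.mult = undefined, one = undefined,
     zero = N, add = set_add M, smult = (\<lambda>a C. \<Union>x\<in>C. N +>\<^bsub>M\<^esub> (a \<odot>\<^bsub>M\<^esub> x))\<rparr>"

definition free_module :: "('a, 'r) ring_scheme \<Rightarrow> nat \<Rightarrow> ('a, nat \<Rightarrow> 'a) module" where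
  "free_module R n = \<lparr>carrier = {..<n} \<rightarrow>\<^sub>E carrier R, monoid.mult = undefined, one = undefined,
     zero = (\<lambda>i\<in>{..<n}. \<zero>\<^bsub>R\<^esub>), add = (\<lambda>x y. \<lambda>i\<in>{..<n}. x i \<oplus>\<^bsub>R\<^esub> y i),
     smult = (\<lambda>a x. \<lambda>i\<in>{..<n}. a \<otimes>\<^bsub>R\<^esub> x i)\<rparr>"

text \<open>Finitely generated projective modules: those isomorphic to a direct summand of some
  \<open>R\<^sup>n\<close>.\<close>

definition fg_projective :: "('a, 'r) ring_scheme \<Rightarrow> ('a, 'b, 'm) module_scheme \<Rightarrow> bool" where
  "fg_projective R P \<longleftrightarrow> (\<exists>n S Q. submodule S R (free_module R n) \<and> submodule Q R (free_module R n) \<and>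
     S <+>\<^bsub>free_module R n\<^esub> Q = carrier (free_module R n) \<and> S \<inter> Q = {\<zero>\<^bsub>free_module R n\<^esub>} \<and>
     left_module_iso R P ((free_module R n)\<lparr>carrier := S\<rparr>) \<noteq> {})"

section \<open>Extension of scalars\<close>

text \<open>For a ring homomorphism \<open>\<phi> : R \<rightarrow> T\<close> the tensor product \<open>T \<otimes>\<^sub>R M\<close>, with \<open>T\<close> a right
  \<open>R\<close>-module via \<open>\<phi>\<close>, is the free abelian group on \<open>T \<times> M\<close> modulo the subgroup generated by
  the usual relations. The free abelian group carries \<open>t \<cdot> (x, m) = (t x, m)\<close>, which makes
  only the quotient a \<open>T\<close>-module.\<close>

definition tensor_free ::
    "('t, 's) ring_scheme \<Rightarrow> ('r, 'm, 'k) module_scheme \<Rightarrow> ('t, ('t \<times> 'm) \<Rightarrow>\<^sub>0 int) module" where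
  "tensor_free T M = \<lparr>carrier = {c. Poly_Mapping.keys c \<subseteq> carrier T \<times> carrier M},
     monoid.mult = undefined, one = undefined, zero = 0, add = (+),
     smult = (\<lambda>t. frag_extend (\<lambda>(x, m). frag_of (t \<otimes>\<^bsub>T\<^esub> x, m)))\<rparr>"

definition tensor_rel ::
    "('t, 's) ring_scheme \<Rightarrow> ('r \<Rightarrow> 't) \<Rightarrow> ('r, 'q) ring_scheme \<Rightarrow> ('r, 'm, 'k) module_scheme
      \<Rightarrow> (('t \<times> 'm) \<Rightarrow>\<^sub>0 int) set" where
  "tensor_rel T \<phi> R M = generate (add_monoid (tensor_free T M))
    ({frag_of (x \<oplus>\<^bsub>T\<^esub> y, m) - frag_of (x, m) - frag_of (y, m) |x y m.
        x \<in> carrier T \<and> y \<in> carrier T \<and> m \<in> carrier M} \<union>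
     {frag_of (x, m \<oplus>\<^bsub>M\<^esub> n) - frag_of (x, m) - frag_of (x, n) |x m n.
        x \<in> carrier T \<and> m \<in> carrier M \<and> n \<in> carrier M} \<union>
     {frag_of (x \<otimes>\<^bsub>T\<^esub> \<phi> r, m) - frag_of (x, r \<odot>\<^bsub>M\<^esub> m) |x r m.
        x \<in> carrier T \<and> r \<in> carrier R \<and> m \<in> carrier M})"

definition ext_scalars ::
    "('t, 's) ring_scheme \<Rightarrow> ('r \<Rightarrow> 't) \<Rightarrow> ('r, 'q) ring_scheme \<Rightarrow> ('r, 'm, 'k) module_scheme
      \<Rightarrow> ('t, (('t \<times> 'm) \<Rightarrow>\<^sub>0 int) set) module" where
  "ext_scalars T \<phi> R M = quot_module (tensor_free T M) (tensor_rel T \<phi> R M)"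

definition pure_tensor ::
    "('t, 's) ring_scheme \<Rightarrow> ('r \<Rightarrow> 't) \<Rightarrow> ('r, 'q) ring_scheme \<Rightarrow> ('r, 'm, 'k) module_scheme
      \<Rightarrow> 't \<Rightarrow> 'm \<Rightarrow> (('t \<times> 'm) \<Rightarrow>\<^sub>0 int) set" where
  "pure_tensor T \<phi> R M x m = tensor_rel T \<phi> R M +>\<^bsub>tensor_free T M\<^esub> frag_of (x, m)"

text \<open>The map \<open>id \<otimes> h : T \<otimes>\<^sub>R M \<rightarrow> T \<otimes>\<^sub>R N\<close> for \<open>h : M \<rightarrow> N\<close>.\<close>

definition ext_scalars_map ::
    "('t, 's) ring_scheme \<Rightarrow> ('r \<Rightarrow> 't) \<Rightarrow> ('r, 'q) ring_scheme \<Rightarrow> ('r, 'n, 'k) module_scheme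
      \<Rightarrow> ('m \<Rightarrow> 'n) \<Rightarrow> (('t \<times> 'm) \<Rightarrow>\<^sub>0 int) set \<Rightarrow> (('t \<times> 'n) \<Rightarrow>\<^sub>0 int) set" where
  "ext_scalars_map T \<phi> R N h C = (\<Union>z\<in>C. tensor_rel T \<phi> R N +>\<^bsub>tensor_free T N\<^esub>
     frag_extend (\<lambda>(x, m). frag_of (x, h m)) z)"

section \<open>The dimension and the dimension-zero part\<close>

text \<open>A matrix \<open>F\<close> acts on row vectors by \<open>x \<mapsto> x F\<close>; these are the endomorphisms of the
  left module \<open>A\<^sup>n\<close>, and the adjoint of \<open>F\<close> has entries \<open>(F\<^sub>j\<^sub>i)\<^sup>*\<close>.\<close>

definition projection_matrix ::
    "('h::complex_hilbert \<Rightarrow>\<^sub>L 'h) set \<Rightarrow> nat \<Rightarrow> (nat \<Rightarrow> nat \<Rightarrow> 'h \<Rightarrow>\<^sub>L 'h) \<Rightarrow> bool" where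
  "projection_matrix A n F \<longleftrightarrow> (\<forall>i<n. \<forall>j<n. F i j \<in> A \<and>
     (\<Sum>k<n. F i k o\<^sub>L F k j) = F i j \<and> op_adj (F j i) = F i j)"

definition matrix_image ::
    "('h::complex_hilbert \<Rightarrow>\<^sub>L 'h) set \<Rightarrow> nat \<Rightarrow> (nat \<Rightarrow> nat \<Rightarrow> 'h \<Rightarrow>\<^sub>L 'h) \<Rightarrow> (nat \<Rightarrow> 'h \<Rightarrow>\<^sub>L 'h) set" where
  "matrix_image A n F =
     (\<lambda>x. \<lambda>j\<in>{..<n}. \<Sum>i<n. x i o\<^sub>L F i j) ` carrier (free_module (vn_ring A) n)"

definition vn_dim_proj ::
    "('h::complex_hilbert \<Rightarrow>\<^sub>L 'h) set \<Rightarrow> (('h \<Rightarrow>\<^sub>L 'h) \<Rightarrow> complex)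
      \<Rightarrow> ('h \<Rightarrow>\<^sub>L 'h, 'm, 'k) module_scheme \<Rightarrow> real" where
  "vn_dim_proj A tr P = (SOME d. \<exists>n F. projection_matrix A n F \<and>
     left_module_iso (vn_ring A) P ((free_module (vn_ring A) n)\<lparr>carrier := matrix_image A n F\<rparr>) \<noteq> {} \<and>
     d = Re (\<Sum>i<n. tr (F i i)))"

definition vn_dim ::
    "('h::complex_hilbert \<Rightarrow>\<^sub>L 'h) set \<Rightarrow> (('h \<Rightarrow>\<^sub>L 'h) \<Rightarrow> complex)
      \<Rightarrow> ('h \<Rightarrow>\<^sub>L 'h, 'm, 'k) module_scheme \<Rightarrow> ereal" where
  "vn_dim A tr M = Sup {ereal (vn_dim_proj A tr (M\<lparr>carrier := P\<rparr>)) |P.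
     submodule P (vn_ring A) M \<and> fg_projective (vn_ring A) (M\<lparr>carrier := P\<rparr>)}"

text \<open>\<open>\<^bold>TM\<close>; the greatest element is taken with respect to inclusion.\<close>

definition dim_torsion ::
    "('h::complex_hilbert \<Rightarrow>\<^sub>L 'h) set \<Rightarrow> (('h \<Rightarrow>\<^sub>L 'h) \<Rightarrow> complex)
      \<Rightarrow> ('h \<Rightarrow>\<^sub>L 'h, 'm, 'k) module_scheme \<Rightarrow> 'm set" where
  "dim_torsion A tr M =
     (GREATEST N. submodule N (vn_ring A) M \<and> vn_dim A tr (M\<lparr>carrier := N\<rparr>) = 0)"

section \<open>Affiliated operators and the torsion part\<close>

text \<open>\<open>\<iota>\<close> exhibits the Hilbert space \<open>'l\<close> as the completion \<open>l\<^sup>2(A)\<close> of \<open>A\<close> for the inner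
  product \<open>\<langle>a, b\<rangle> = tr (a b\<^sup>*)\<close>.\<close>

definition l2_completion ::
    "('h::complex_hilbert \<Rightarrow>\<^sub>L 'h) set \<Rightarrow> (('h \<Rightarrow>\<^sub>L 'h) \<Rightarrow> complex)
      \<Rightarrow> (('h \<Rightarrow>\<^sub>L 'h) \<Rightarrow> 'l::complex_hilbert) \<Rightarrow> bool" where
  "l2_completion A tr \<iota> \<longleftrightarrow>
     (\<forall>a\<in>A. \<forall>b\<in>A. \<iota> (a + b) = \<iota> a + \<iota> b) \<and>
     (\<forall>c. \<forall>a\<in>A. \<iota> (op_scale c a) = c *\<^sub>C \<iota> a) \<and>
     (\<forall>a\<in>A. \<forall>b\<in>A. cinner (\<iota> a) (\<iota> b) = tr (a o\<^sub>L op_adj b)) \<and>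
     closure (\<iota> ` A) = UNIV"

text \<open>The left regular representation of \<open>A\<close> on \<open>l\<^sup>2(A)\<close>.\<close>

definition l2_action ::
    "('h::complex_hilbert \<Rightarrow>\<^sub>L 'h) set \<Rightarrow> (('h \<Rightarrow>\<^sub>L 'h) \<Rightarrow> 'l::complex_hilbert)
      \<Rightarrow> ('h \<Rightarrow>\<^sub>L 'h) \<Rightarrow> ('l \<Rightarrow>\<^sub>L 'l)" where
  "l2_action A \<iota> a = (THE f. f \<in> bounded_ops \<and> (\<forall>x\<in>A. blinfun_apply f (\<iota> x) = \<iota> (a o\<^sub>L x)))"

text \<open>Unbounded operators are represented by their graphs.\<close>

definition closed_densely_defined :: "('l::complex_hilbert \<times> 'l) set \<Rightarrow> bool" where
  "closed_densely_defined G \<longleftrightarrow> single_valued G \<and> closed G \<and> closure (Domain G) = UNIV \<and>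
     (0, 0) \<in> G \<and> (\<forall>(x, y)\<in>G. \<forall>(x', y')\<in>G. (x + x', y + y') \<in> G) \<and>
     (\<forall>c. \<forall>(x, y)\<in>G. (c *\<^sub>C x, c *\<^sub>C y) \<in> G)"

definition op_graph :: "('l::complex_hilbert \<Rightarrow>\<^sub>L 'l) \<Rightarrow> ('l \<times> 'l) set" where
  "op_graph f = {(x, blinfun_apply f x) |x. True}"

definition affiliated :: "('l::complex_hilbert \<Rightarrow>\<^sub>L 'l) set \<Rightarrow> ('l \<times> 'l) set set" where
  "affiliated N = {G. closed_densely_defined G \<and>
     (\<forall>S\<in>commutant N. \<forall>(x, y)\<in>G. (blinfun_apply S x, blinfun_apply S y) \<in> G)}"

text \<open>The algebra \<open>\<U>(A)\<close>; sum and product are the closures of the algebraic sum and of the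
  composition.\<close>

definition affiliated_ring ::
    "('h::complex_hilbert \<Rightarrow>\<^sub>L 'h) set \<Rightarrow> (('h \<Rightarrow>\<^sub>L 'h) \<Rightarrow> 'l::complex_hilbert) \<Rightarrow> ('l \<times> 'l) set ring" where
  "affiliated_ring A \<iota> = \<lparr>carrier = affiliated (l2_action A \<iota> ` A),
     monoid.mult = (\<lambda>G K. closure {(x, z). \<exists>y. (x, y) \<in> K \<and> (y, z) \<in> G}),
     one = op_graph id_blinfun, zero = op_graph 0,
     add = (\<lambda>G K. closure {(x, y + z) |x y z. (x, y) \<in> G \<and> (x, z) \<in> K})\<rparr>"

text \<open>\<open>\<^bold>tM\<close>, the kernel of \<open>M \<rightarrow> \<U>(A) \<otimes>\<^sub>A M\<close>, \<open>m \<mapsto> 1 \<otimes> m\<close>.\<close>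

definition alg_torsion ::
    "('h::complex_hilbert \<Rightarrow>\<^sub>L 'h) set \<Rightarrow> (('h \<Rightarrow>\<^sub>L 'h) \<Rightarrow> 'l::complex_hilbert)
      \<Rightarrow> ('h \<Rightarrow>\<^sub>L 'h, 'm, 'k) module_scheme \<Rightarrow> 'm set" where
  "alg_torsion A \<iota> M = (let U = affiliated_ring A \<iota>; \<phi> = (\<lambda>a. op_graph (l2_action A \<iota> a)) in
     {m \<in> carrier M. pure_tensor U \<phi> (vn_ring A) M \<one>\<^bsub>U\<^esub> m = \<zero>\<^bsub>ext_scalars U \<phi> (vn_ring A) M\<^esub>})"

section \<open>Induction along an inclusion of von Neumann algebras\<close>

definition induction ::
    "('h::complex_hilbert \<Rightarrow>\<^sub>L 'h) set \<Rightarrow> ('h \<Rightarrow>\<^sub>L 'h) set \<Rightarrow> ('h \<Rightarrow>\<^sub>L 'h, 'm, 'k) module_scheme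
      \<Rightarrow> ('h \<Rightarrow>\<^sub>L 'h, ((('h \<Rightarrow>\<^sub>L 'h) \<times> 'm) \<Rightarrow>\<^sub>0 int) set) module" where
  "induction A B M = ext_scalars (vn_ring A) (\<lambda>b. b) (vn_ring B) M"

definition induction_map ::
    "('h::complex_hilbert \<Rightarrow>\<^sub>L 'h) set \<Rightarrow> ('h \<Rightarrow>\<^sub>L 'h) set \<Rightarrow> ('h \<Rightarrow>\<^sub>L 'h, 'n, 'k) module_scheme
      \<Rightarrow> ('m \<Rightarrow> 'n) \<Rightarrow> ((('h \<Rightarrow>\<^sub>L 'h) \<times> 'm) \<Rightarrow>\<^sub>0 int) set \<Rightarrow> ((('h \<Rightarrow>\<^sub>L 'h) \<times> 'n) \<Rightarrow>\<^sub>0 int) set" where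
  "induction_map A B N h = ext_scalars_map (vn_ring A) (\<lambda>b. b) (vn_ring B) N h"

text \<open>\<open>i\<^sub>*(N) = L\<close> as submodules of \<open>i\<^sub>*(M)\<close>: the map induced by the inclusion of \<open>N\<close> is an
  isomorphism of \<open>i\<^sub>*(N)\<close> onto the submodule \<open>L\<close>.\<close>

definition induced_submodule_eq ::
    "('h::complex_hilbert \<Rightarrow>\<^sub>L 'h) set \<Rightarrow> ('h \<Rightarrow>\<^sub>L 'h) set \<Rightarrow> ('h \<Rightarrow>\<^sub>L 'h, 'm, 'k) module_scheme
      \<Rightarrow> 'm set \<Rightarrow> ((('h \<Rightarrow>\<^sub>L 'h) \<times> 'm) \<Rightarrow>\<^sub>0 int) set set \<Rightarrow> bool" where
  "induced_submodule_eq A B M N L \<longleftrightarrow>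
     submodule N (vn_ring B) M \<and> submodule L (vn_ring A) (induction A B M) \<and>
     induction_map A B M (\<lambda>x. x) \<in> left_module_iso (vn_ring A)
       (induction A B (M\<lparr>carrier := N\<rparr>)) ((induction A B M)\<lparr>carrier := L\<rparr>)"

text \<open>\<open>i\<^sub>*(M / N) = i\<^sub>*(M) / L\<close> as quotients of \<open>i\<^sub>*(M)\<close>: they are isomorphic by an isomorphism
  compatible with the maps from \<open>i\<^sub>*(M)\<close>.\<close>

definition induced_quotient_eq ::
    "('h::complex_hilbert \<Rightarrow>\<^sub>L 'h) set \<Rightarrow> ('h \<Rightarrow>\<^sub>L 'h) set \<Rightarrow> ('h \<Rightarrow>\<^sub>L 'h, 'm, 'k) module_scheme
      \<Rightarrow> 'm set \<Rightarrow> ((('h \<Rightarrow>\<^sub>L 'h) \<times> 'm) \<Rightarrow>\<^sub>0 int) set set \<Rightarrow> bool" where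
  "induced_quotient_eq A B M N L \<longleftrightarrow>
     submodule N (vn_ring B) M \<and> submodule L (vn_ring A) (induction A B M) \<and>
     (\<exists>\<Phi> \<in> left_module_iso (vn_ring A)
          (induction A B (quot_module M N)) (quot_module (induction A B M) L).
        \<forall>x\<in>carrier (induction A B M).
          \<Phi> (induction_map A B (quot_module M N) (\<lambda>m. N +>\<^bsub>M\<^esub> m) x) = L +>\<^bsub>induction A B M\<^esub> x)"

end

theory Submission
  imports Defs "HOL-Algebra.Free_Abelian_Groups"
begin

text \<open>Let \<open>\<nu> c\<close> be the trace of the projection onto the kernel of \<open>c\<close>, and let \<open>tors A tr E M\<close> consist
  of the \<open>m\<close> such that for every \<open>e \<in> E\<close> some \<open>c \<in> A\<close> with \<open>\<nu> c \<le> e\<close> kills \<open>m\<close>. Clearing denominators in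
  \<open>\<U>(A)\<close> gives \<open>\<^bold>tM\<close> for \<open>E = {0}\<close>, and an element generates a submodule of dimension zero iff it lies in
  the set for \<open>E = {0<..}\<close>, which gives \<open>\<^bold>TM\<close>.

  \<open>A\<close> is flat over \<open>B\<close> since the projection onto a column over \<open>B\<close> has entries in \<open>B\<close>. If \<open>s\<close> kills
  \<open>\<Sum>\<^sub>i \<gamma>\<^sub>i \<otimes> x\<^sub>i\<close>, then \<open>s \<gamma>\<close> is an \<open>A\<close>-combination of rows over \<open>B\<close> that are relations among the \<open>x\<^sub>i\<close>.
  Let \<open>e\<close> be the projection onto the span of these rows, for all \<open>s\<close> of a sequence with \<open>\<nu> s\<close> tending
  to \<open>0\<close>. Its entries lie in \<open>B\<close>, its rows applied to the \<open>x\<^sub>j\<close> give torsion elements, and \<open>\<gamma> = \<gamma> e\<close>, so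
  \<open>\<Sum>\<^sub>i \<gamma>\<^sub>i \<otimes> x\<^sub>i = \<Sum>\<^sub>i \<gamma>\<^sub>i \<otimes> \<Sum>\<^sub>j e\<^sub>i\<^sub>j x\<^sub>j\<close> comes from the torsion submodule.\<close>

section \<open>Hilbert space geometry\<close>

text \<open>Both torsion parts are described by annihilators and the nullity \<open>\<nu>\<close>.
  Since \<open>\<nu>\<close> is computed from the operator and the trace alone, it has the same
  value in \<open>B\<close> and in \<open>A\<close>; this is how the restriction of the trace
  enters. Kernel and range projections are produced as strong limits of resolvents, because inverses
  and strong limits remain in a bicommutant: projections made from rows over \<open>B\<close>
  automatically have entries in \<open>B\<close>, and the limits are monotone where the trace is
  taken, so normality computes their ranks. The concrete form of \<U>(A) creates the main analytic
  obstacle. A fraction is read off from the projection onto the graph of an affiliated operator, but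
  its entries are only known to commute with the commutant of the left regular representation; that
  they come from \<open>A\<close> is the commutation theorem. For the part of dimension zero the
  obstacle is that no single annihilator suffices. Infinitely many rows enter, and a row of the
  limit projection need not lie in any finite stage; the trace gap to the finite stages bounds the
  nullity of operators that carry it into the stronger torsion part.\<close>

notation blinfun_compose (infixl \<open>\<cdot>\<close> 70)

interpretation comp: bounded_bilinear "blinfun_compose :: ('b::real_normed_vector \<Rightarrow>\<^sub>L 'c::real_normed_vector) \<Rightarrow> ('a::real_normed_vector \<Rightarrow>\<^sub>L 'b) \<Rightarrow> ('a \<Rightarrow>\<^sub>L 'c)"
  by (rule bounded_bilinear_blinfun_compose)

lemma comp_assoc: "(a \<cdot> b) \<cdot> c = a \<cdot> (b \<cdot> c)"
  by (rule blinfun_eqI) simp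

lemma comp_id [simp]: "a \<cdot> id_blinfun = a" "id_blinfun \<cdot> a = a"
  by (auto intro: blinfun_eqI)

lemmas comp_simps = comp.add_left comp.add_right comp.diff_left comp.diff_right
  comp.minus_left comp.minus_right comp.scaleR_left comp.scaleR_right

lemma scaleC_diff_right: "c *\<^sub>C (x - y) = c *\<^sub>C x - c *\<^sub>C (y::'a::complex_hilbert)"
  by (metis add_diff_cancel_right' diff_add_cancel scaleC_add_right)

lemma scaleC_zero_right [simp]: "c *\<^sub>C 0 = (0::'a::complex_hilbert)"
  using scaleC_diff_right[of c 0 0] by simp

lemma scaleC_one [simp]: "1 *\<^sub>C x = (x::'a::complex_hilbert)"
  using scaleC_of_real[of 1 x] by simp

lemma scaleC_zero_left [simp]: "0 *\<^sub>C x = (0::'a::complex_hilbert)"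
  using scaleC_of_real[of 0 x] by simp

lemma scaleC_minus_left: "(- c) *\<^sub>C x = - (c *\<^sub>C (x::'a::complex_hilbert))"
  using scaleC_add_left[of c "-c" x] by (simp add: add_eq_0_iff)

lemma scaleC_scaleR: "c *\<^sub>C (r *\<^sub>R x) = r *\<^sub>R (c *\<^sub>C (x::'a::complex_hilbert))"
  unfolding scaleC_of_real[symmetric] scaleC_scaleC by (simp only: mult.commute)

lemma cinner_add_right: "cinner x (y + z) = cinner x y + cinner x (z::'a::complex_hilbert)"
  by (metis cinner_add_left cinner_commute complex_cnj_add)

lemma cinner_scaleC_right: "cinner x (c *\<^sub>C y) = cnj c * cinner x (y::'a::complex_hilbert)"
  by (metis cinner_commute cinner_scaleC_left complex_cnj_mult)

lemma cinner_scaleR_left: "cinner (r *\<^sub>R x) y = r *\<^sub>R cinner x (y::'a::complex_hilbert)"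
  by (metis cinner_scaleC_left scaleC_of_real scaleR_conv_of_real)

lemma cinner_scaleR_right: "cinner x (r *\<^sub>R y) = r *\<^sub>R cinner x (y::'a::complex_hilbert)"
  by (metis cinner_scaleC_right complex_cnj_complex_of_real scaleC_of_real scaleR_conv_of_real)

lemma Re_cinner_self: "Re (cinner x x) = (norm (x::'a::complex_hilbert))\<^sup>2"
  by (simp add: cinner_self)

lemma Re_cinner_commute: "Re (cinner x y) = Re (cinner y (x::'a::complex_hilbert))"
  by (subst cinner_commute) simp

lemma norm_add_sq: "(norm (x + y))\<^sup>2 = (norm x)\<^sup>2 + 2 * Re (cinner x y) + (norm (y::'a::complex_hilbert))\<^sup>2"
  by (simp flip: Re_cinner_self add: cinner_add_left cinner_add_right Re_cinner_commute[of y x])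

lemma norm_scaleC: "norm (c *\<^sub>C x) = cmod c * norm (x::'a::complex_hilbert)"
proof -
  have "complex_of_real ((norm (c *\<^sub>C x))\<^sup>2) = c * cnj c * complex_of_real ((norm x)\<^sup>2)"
    unfolding cinner_self[symmetric] by (simp add: cinner_scaleC_left cinner_scaleC_right)
  also have "\<dots> = complex_of_real ((cmod c * norm x)\<^sup>2)"
    by (simp flip: complex_norm_square add: power_mult_distrib)
  finally have "(norm (c *\<^sub>C x))\<^sup>2 = (cmod c * norm x)\<^sup>2"
    using of_real_eq_iff by blast
  then show ?thesis by (simp add: power2_eq_iff_nonneg)
qed

text \<open>For unit vectors the inequality is \<open>0 \<le> (norm (u + v))^2\<close>, with the
  sign of \<open>y\<close> reversed in \<open>v\<close>.\<close>

lemma Re_cinner_le: "Re (cinner x y) \<le> norm x * norm (y::'a::complex_hilbert)"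
proof (cases "x = 0 \<or> y = 0")
  case True
  then show ?thesis
    using cinner_scaleR_left[of 0 x y] cinner_scaleR_right[of x 0 y] by auto
next
  case False
  define u where "u = (1 / norm x) *\<^sub>R x"
  define v where "v = (- 1 / norm y) *\<^sub>R y"
  have n: "norm u = 1" "norm v = 1" using False by (auto simp: u_def v_def)
  have "0 \<le> 1 + Re (cinner u v)"
    using norm_add_sq[of u v] n zero_le_power2[of "norm (u + v)"] by simp
  then have "0 \<le> 1 - Re (cinner x y) / (norm x * norm y)"
    unfolding u_def v_def cinner_scaleR_left cinner_scaleR_right by (simp add: mult.commute)
  then show ?thesis using False by (simp add: field_simps)
qed

lemma cmod_cinner_le: "cmod (cinner x y) \<le> norm x * norm (y::'a::complex_hilbert)"
proof (cases "cinner x y = 0")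
  case False
  \<comment> \<open>\<open>c\<close> is the unit scalar that rotates the inner product onto its
    modulus.\<close>
  define c where "c = cnj (cinner x y) / cmod (cinner x y)"
  have "c * cinner x y = cmod (cinner x y)"
    using complex_norm_square[of "cinner x y"] False by (simp add: c_def power2_eq_square mult.commute divide_eq_eq)
  then have "cmod (cinner x y) = Re (cinner (c *\<^sub>C x) y)"
    by (simp add: cinner_scaleC_left)
  also have "\<dots> \<le> norm (c *\<^sub>C x) * norm y" by (rule Re_cinner_le)
  also have "\<dots> = norm x * norm y"
    using False by (simp add: norm_scaleC c_def norm_divide)
  finally show ?thesis .
qed simp

interpretation cinner: bounded_bilinear "cinner :: 'a::complex_hilbert \<Rightarrow> 'a \<Rightarrow> complex"
proof
  show "\<exists>K. \<forall>a b. norm (cinner a (b::'a)) \<le> norm a * norm b * K"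
    by (rule exI[of _ 1]) (simp add: cmod_cinner_le)
qed (simp_all add: cinner_add_left cinner_add_right cinner_scaleR_left cinner_scaleR_right)

declare cinner.zero_left [simp] cinner.zero_right [simp]

lemma bounded_linear_scaleC: "bounded_linear (\<lambda>x::'a::complex_hilbert. c *\<^sub>C x)"
  by (rule bounded_linear_intro[where K="cmod c"])
     (simp_all add: scaleC_add_right scaleC_scaleR norm_scaleC mult.commute)

lemmas tendsto_scaleC = bounded_linear.tendsto[OF bounded_linear_scaleC]

lemma cinner_eqI: "(\<And>z. cinner x z = cinner y (z::'a::complex_hilbert)) \<Longrightarrow> x = y"
proof -
  assume "\<And>z. cinner x z = cinner y z"
  then have "cinner (x - y) (x - y) = 0" by (simp add: cinner.diff_left)
  then show ?thesis by (simp add: cinner_self)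
qed

lemma Re_cinner_eqI: "(\<And>z. Re (cinner x z) = Re (cinner y (z::'a::complex_hilbert))) \<Longrightarrow> x = y"
proof -
  assume "\<And>z. Re (cinner x z) = Re (cinner y z)"
  then have "Re (cinner (x - y) (x - y)) = 0" by (simp add: cinner.diff_left)
  then show ?thesis by (simp add: Re_cinner_self)
qed

definition csubspace :: "'a::complex_hilbert set \<Rightarrow> bool" where
  "csubspace V \<longleftrightarrow> 0 \<in> V \<and> (\<forall>x\<in>V. \<forall>y\<in>V. x + y \<in> V) \<and> (\<forall>c. \<forall>x\<in>V. c *\<^sub>C x \<in> V)"

lemma csubspace_subspace: "csubspace V \<Longrightarrow> subspace V"
  unfolding csubspace_def subspace_def by (metis scaleC_of_real)

lemma csubspace_diff: "csubspace V \<Longrightarrow> x \<in> V \<Longrightarrow> y \<in> V \<Longrightarrow> x - y \<in> V"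
  using csubspace_subspace subspace_diff by blast

text \<open>A minimising sequence is Cauchy by the parallelogram law.\<close>

lemma orthogonal_projection_exists:
  fixes V :: "'a::complex_hilbert set"
  assumes V: "csubspace V" "closed V"
  shows "\<exists>p\<in>V. \<forall>v\<in>V. cinner (x - p) v = 0"
proof -
  define D where "D = (\<lambda>v. (norm (x - v))\<^sup>2) ` V"
  define d where "d = Inf D"
  have V0: "0 \<in> V" using V by (auto simp: csubspace_def)
  have ne: "D \<noteq> {}" using V0 by (auto simp: D_def)
  have bd: "bdd_below D" by (rule bdd_belowI[of _ 0]) (auto simp: D_def)
  have dle: "d \<le> (norm (x - v))\<^sup>2" if "v \<in> V" for v
    unfolding d_def by (rule cInf_lower[OF _ bd]) (use that in \<open>auto simp: D_def\<close>)
  have "\<exists>v\<in>V. (norm (x - v))\<^sup>2 < d + 1 / Suc n" for n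
  proof -
    have "Inf D < d + 1 / Suc n" by (simp add: d_def)
    from cInf_lessD[OF ne this] show ?thesis by (auto simp: D_def)
  qed
  then obtain v where v: "\<And>n. v n \<in> V" "\<And>n. (norm (x - v n))\<^sup>2 < d + 1 / Suc n" by metis
  have est: "(norm (v m - v n))\<^sup>2 \<le> 2 / Suc n + 2 / Suc m" for m n
  proof -
    have mid: "(1/2) *\<^sub>R (v m + v n) \<in> V"
      using V v csubspace_subspace subspace_scale subspace_add by blast
    have "(norm ((x - v m) + (x - v n)))\<^sup>2 = (norm (2 *\<^sub>R (x - (1/2) *\<^sub>R (v m + v n))))\<^sup>2"
      by (simp add: scaleR_2 scaleR_diff_right algebra_simps)
    also have "\<dots> \<ge> 4 * d" using dle[OF mid] by (simp only: norm_scaleR power_mult_distrib) simp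
    finally have a: "4 * d \<le> (norm ((x - v m) + (x - v n)))\<^sup>2" .
    have "(norm (v m - v n))\<^sup>2 = (norm ((x - v n) + (- (x - v m))))\<^sup>2" by simp
    also have "\<dots> = 2 * (norm (x - v m))\<^sup>2 + 2 * (norm (x - v n))\<^sup>2 - (norm ((x - v m) + (x - v n)))\<^sup>2"
      unfolding norm_add_sq norm_minus_cancel cinner.minus_right Re_cinner_commute[of "x - v m" "x - v n"] by simp
    finally show ?thesis using a v(2)[of m] v(2)[of n] by linarith
  qed
  have "Cauchy v"
  proof (rule metric_CauchyI)
    fix e :: real assume e: "0 < e"
    obtain N where N: "4 / e\<^sup>2 < real N" using reals_Archimedean2 by blast
    have "dist (v m) (v n) < e" if "m \<ge> N" "n \<ge> N" for m n
    proof -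
      have "4 / e\<^sup>2 < Suc m" "4 / e\<^sup>2 < Suc n" using N that by linarith+
      then have "4 / Suc m < e\<^sup>2" "4 / Suc n < e\<^sup>2" using e by (auto simp: field_simps)
      then have "(norm (v m - v n))\<^sup>2 < e\<^sup>2" using est[of m n] by auto
      then show ?thesis using e by (simp add: dist_norm power_less_imp_less_base)
    qed
    then show "\<exists>M. \<forall>m\<ge>M. \<forall>n\<ge>M. dist (v m) (v n) < e" by blast
  qed
  then obtain p where p: "v \<longlonglongrightarrow> p" using Cauchy_convergent_iff convergent_def by blast
  have pV: "p \<in> V" using closed_sequentially[OF V(2)] v(1) p by blast
  have "(\<lambda>n. (norm (x - v n))\<^sup>2) \<longlonglongrightarrow> (norm (x - p))\<^sup>2" by (intro tendsto_intros p)
  moreover have "(\<lambda>n. d + 1 / Suc n) \<longlonglongrightarrow> d + 0"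
    by (intro tendsto_intros LIMSEQ_Suc[OF lim_1_over_n])
  ultimately have "(norm (x - p))\<^sup>2 \<le> d + 0"
    by (rule LIMSEQ_le) (use v(2) less_imp_le in blast)
  then have min: "(norm (x - p))\<^sup>2 \<le> (norm (x - v))\<^sup>2" if "v \<in> V" for v
    using dle[OF that] by linarith
  have Re0: "Re (cinner (x - p) v) = 0" if vV: "v \<in> V" for v
  proof (cases "v = 0")
    case False
    define r where "r = Re (cinner (x - p) v)"
    \<comment> \<open>\<open>t\<close> minimises the squared norm of \<open>(x - p) - t v\<close>
      along the line through \<open>p\<close> in direction \<open>v\<close>; minimality of
      \<open>p\<close> then forces \<open>t * r \<le> 0\<close>.\<close>
    define t where "t = r / (norm v)\<^sup>2"
    have "p + t *\<^sub>R v \<in> V"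
      using V vV pV csubspace_subspace subspace_scale subspace_add by blast
    from min[OF this] have "(norm (x - p))\<^sup>2 \<le> (norm ((x - p) + (- t) *\<^sub>R v))\<^sup>2" by (simp add: diff_diff_eq)
    then have "2 * t * r \<le> t\<^sup>2 * (norm v)\<^sup>2"
      unfolding norm_add_sq by (simp add: cinner_scaleR_right r_def power_mult_distrib cinner.minus_right)
    moreover have "t * (norm v)\<^sup>2 = r" using False by (simp add: t_def)
    then have "t\<^sup>2 * (norm v)\<^sup>2 = t * r" by (simp add: power2_eq_square mult.assoc)
    moreover have "t * r = r\<^sup>2 / (norm v)\<^sup>2" by (simp add: t_def power2_eq_square)
    ultimately have "r\<^sup>2 / (norm v)\<^sup>2 \<le> 0" by simp
    then have "r = 0" using False by (simp add: divide_le_0_iff)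
    then show ?thesis by (simp add: r_def)
  qed simp
  have "cinner (x - p) v = 0" if vV: "v \<in> V" for v
  proof -
    \<comment> \<open>The imaginary part is the real part of the pairing with the rotated
      vector.\<close>
    have "\<i> *\<^sub>C v \<in> V" using V vV by (auto simp: csubspace_def)
    then have "Re (cinner (x - p) (\<i> *\<^sub>C v)) = 0" by (rule Re0)
    then have "Im (cinner (x - p) v) = 0" by (simp add: cinner_scaleC_right)
    then show ?thesis using Re0[OF vV] by (simp add: complex_eq_iff)
  qed
  then show ?thesis using pV by blast
qed

section \<open>Bounded operators and adjoints\<close>

lemma bounded_opsD: "f \<in> bounded_ops \<Longrightarrow> f (c *\<^sub>C x) = c *\<^sub>C f x"
  by (auto simp: bounded_ops_def)

lemma op_scale_apply [simp]: "op_scale c f x = c *\<^sub>C f x"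
  unfolding op_scale_def
  by (subst bounded_linear_Blinfun_apply)
     (auto intro: bounded_linear_compose[OF bounded_linear_scaleC blinfun.bounded_linear_right])

lemma bounded_ops_id [simp]: "id_blinfun \<in> bounded_ops" by (simp add: bounded_ops_def)
lemma bounded_ops_zero [simp]: "0 \<in> bounded_ops" by (simp add: bounded_ops_def)
lemma bounded_ops_add: "f \<in> bounded_ops \<Longrightarrow> g \<in> bounded_ops \<Longrightarrow> f + g \<in> bounded_ops"
  by (simp add: bounded_ops_def blinfun.add_left scaleC_add_right)
lemma bounded_ops_diff: "f \<in> bounded_ops \<Longrightarrow> g \<in> bounded_ops \<Longrightarrow> f - g \<in> bounded_ops"
  by (simp add: bounded_ops_def blinfun.diff_left scaleC_diff_right)
lemma bounded_ops_comp: "f \<in> bounded_ops \<Longrightarrow> g \<in> bounded_ops \<Longrightarrow> f \<cdot> g \<in> bounded_ops"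
  by (simp add: bounded_ops_def)
lemma bounded_ops_scaleR: "f \<in> bounded_ops \<Longrightarrow> r *\<^sub>R f \<in> bounded_ops"
  by (simp add: bounded_ops_def blinfun.scaleR_left scaleC_scaleR)
lemma bounded_ops_op_scale: "f \<in> bounded_ops \<Longrightarrow> op_scale c f \<in> bounded_ops"
  by (simp add: bounded_ops_def scaleC_scaleC mult.commute)
lemma bounded_ops_sum: "(\<And>i. i \<in> I \<Longrightarrow> f i \<in> bounded_ops) \<Longrightarrow> sum f I \<in> bounded_ops"
  by (induction I rule: infinite_finite_induct) (auto intro: bounded_ops_add)

lemma op_scale_comp: "op_scale c a \<cdot> b = op_scale c (a \<cdot> b)" by (rule blinfun_eqI) simp
lemma comp_op_scale: "a \<in> bounded_ops \<Longrightarrow> a \<cdot> op_scale c b = op_scale c (a \<cdot> b)"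
  by (rule blinfun_eqI) (simp add: bounded_opsD)

lemmas bounded_ops_intros = bounded_ops_add bounded_ops_diff bounded_ops_comp bounded_ops_scaleR
  bounded_ops_op_scale bounded_ops_sum bounded_ops_id bounded_ops_zero

lemma scaleR_eq_op_scale: "r *\<^sub>R f = op_scale (complex_of_real r) f"
  by (rule blinfun_eqI) (simp add: scaleC_of_real blinfun.scaleR_left)

lemma riesz_representation:
  fixes f :: "'a::complex_hilbert \<Rightarrow> complex"
  assumes f: "bounded_linear f" "\<And>c x. f (c *\<^sub>C x) = c * f x"
  shows "\<exists>y. \<forall>x. f x = cinner x y"
proof (cases "\<forall>x. f x = 0")
  case True
  then show ?thesis by (intro exI[of _ 0]) (simp add: cinner.zero_right)
next
  case False
  then obtain z where z: "f z \<noteq> 0" by blast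
  interpret f: bounded_linear f by fact
  define V where "V = {x. f x = 0}"
  have "csubspace V" by (auto simp: V_def csubspace_def f.add f.zero f)
  moreover have "closed V" unfolding V_def
    by (intro closed_Collect_eq continuous_on_const linear_continuous_on f)
  ultimately obtain p where p: "p \<in> V" "\<And>v. v \<in> V \<Longrightarrow> cinner (z - p) v = 0"
    using orthogonal_projection_exists by blast
  \<comment> \<open>\<open>w\<close> spans the orthogonal complement of the kernel of
    \<open>f\<close>. The combination \<open>f w *\<^sub>C x - f x *\<^sub>C w\<close> used below is
    built to lie in that kernel.\<close>
  define w where "w = z - p"
  have fw: "f w \<noteq> 0" using z p by (simp add: w_def f.diff V_def)
  then have w0: "w \<noteq> 0" using f.zero by auto
  have "f x = cinner x ((cnj (f w) / (norm w)\<^sup>2) *\<^sub>C w)" for x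
  proof -
    have "f w *\<^sub>C x - f x *\<^sub>C w \<in> V" by (simp add: V_def f.diff f)
    then have "cinner w (f w *\<^sub>C x - f x *\<^sub>C w) = 0" using p by (simp add: w_def)
    then have "cinner (f w *\<^sub>C x - f x *\<^sub>C w) w = 0"
      by (metis cinner_commute complex_cnj_zero)
    then have "f w * cinner x w = f x * (norm w)\<^sup>2"
      by (simp add: cinner.diff_left cinner_scaleC_left cinner_self)
    then show ?thesis using w0 by (simp add: cinner_scaleC_right field_simps)
  qed
  then show ?thesis by blast
qed

text \<open>The vector that represents \<open>x \<mapsto> cinner (T x) y\<close> depends linearly on
  \<open>y\<close> because it is unique; the norm bound comes from pairing \<open>g y\<close> with
  itself.\<close>

lemma op_adj_exists:
  fixes T :: "'a::complex_hilbert \<Rightarrow>\<^sub>L 'a"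
  assumes T: "T \<in> bounded_ops"
  shows "\<exists>g\<in>bounded_ops. \<forall>x y. cinner (T x) y = cinner x (blinfun_apply g y)"
proof -
  have "\<exists>z. \<forall>x. cinner (T x) y = cinner x z" for y
    by (rule riesz_representation)
       (auto simp: bounded_opsD[OF T] cinner_scaleC_left
         intro: bounded_linear_compose[OF cinner.bounded_linear_left blinfun.bounded_linear_right])
  then obtain g where g: "\<And>x y. cinner (T x) y = cinner x (g y)" by metis
  have g': "cinner (g y) x = cinner y (T x)" for x y
    by (metis g cinner_commute)
  have add: "g (x + y) = g x + g y" for x y
    by (rule cinner_eqI) (simp add: g' cinner_add_left)
  have sc: "g (c *\<^sub>C x) = c *\<^sub>C g x" for c x
    by (rule cinner_eqI) (simp add: g' cinner_scaleC_left)
  have nrm: "norm (g y) \<le> norm y * norm T" for y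
  proof (cases "g y = 0")
    case False
    have "(norm (g y))\<^sup>2 = Re (cinner y (T (g y)))" by (simp flip: Re_cinner_self add: g')
    also have "\<dots> \<le> norm y * (norm T * norm (g y))"
      by (rule order_trans[OF Re_cinner_le]) (simp add: norm_blinfun mult_left_mono)
    finally show ?thesis using False by (simp add: power2_eq_square)
  qed simp
  have bl: "bounded_linear g"
    by (rule bounded_linear_intro[where K="norm T"])
       (use add sc nrm in \<open>auto simp flip: scaleC_of_real\<close>)
  show ?thesis
    by (rule bexI[of _ "Blinfun g"])
       (auto simp: bounded_linear_Blinfun_apply[OF bl] g bounded_ops_def sc)
qed

lemma op_adjI:
  assumes "\<And>x y. cinner (blinfun_apply f x) y = cinner x (blinfun_apply g y)"
  shows "op_adj f = g"
  unfolding op_adj_def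
proof (rule the_equality)
  fix g' assume "\<forall>x y. cinner (blinfun_apply f x) y = cinner x (blinfun_apply g' y)"
  then have "cinner (g' y) x = cinner (g y) x" for x y
    using assms by (metis cinner_commute)
  then show "g' = g" by (intro blinfun_eqI cinner_eqI)
qed (use assms in blast)

lemma op_adj: "T \<in> bounded_ops \<Longrightarrow> cinner (T x) y = cinner x (op_adj T y)"
  and op_adj_bounded_ops: "T \<in> bounded_ops \<Longrightarrow> op_adj T \<in> bounded_ops"
  using op_adj_exists op_adjI by metis+

lemma op_adj': "T \<in> bounded_ops \<Longrightarrow> cinner (op_adj T x) y = cinner x (T y)"
  by (metis cinner_commute op_adj)

lemma op_adj_adj [simp]: "T \<in> bounded_ops \<Longrightarrow> op_adj (op_adj T) = T"
  by (rule op_adjI) (rule op_adj')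

lemma op_adj_comp: "S \<in> bounded_ops \<Longrightarrow> T \<in> bounded_ops \<Longrightarrow> op_adj (S \<cdot> T) = op_adj T \<cdot> op_adj S"
  by (rule op_adjI) (simp add: op_adj)

lemma op_adj_add: "S \<in> bounded_ops \<Longrightarrow> T \<in> bounded_ops \<Longrightarrow> op_adj (S + T) = op_adj S + op_adj T"
  by (rule op_adjI) (simp add: op_adj blinfun.add_left cinner_add_left cinner_add_right)

lemma op_adj_diff: "S \<in> bounded_ops \<Longrightarrow> T \<in> bounded_ops \<Longrightarrow> op_adj (S - T) = op_adj S - op_adj T"
  by (rule op_adjI) (simp add: op_adj blinfun.diff_left cinner.diff_left cinner.diff_right)

lemma op_adj_scale: "T \<in> bounded_ops \<Longrightarrow> op_adj (op_scale c T) = op_scale (cnj c) (op_adj T)"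
  by (rule op_adjI) (simp add: op_adj cinner_scaleC_left cinner_scaleC_right)

lemma op_adj_scaleR: "T \<in> bounded_ops \<Longrightarrow> op_adj (r *\<^sub>R T) = r *\<^sub>R op_adj T"
  by (simp add: scaleR_eq_op_scale op_adj_scale)

lemma op_adj_id [simp]: "op_adj id_blinfun = id_blinfun" by (rule op_adjI) simp
lemma op_adj_zero [simp]: "op_adj 0 = 0" by (rule op_adjI) simp

lemma op_adj_sum: "(\<And>i. i \<in> I \<Longrightarrow> f i \<in> bounded_ops) \<Longrightarrow> op_adj (sum f I) = (\<Sum>i\<in>I. op_adj (f i))"
  by (induction I rule: infinite_finite_induct) (auto simp: op_adj_add bounded_ops_sum)

lemma norm_adj_comp_le:
  assumes "T \<in> bounded_ops"
  shows "(norm (T x))\<^sup>2 = Re (cinner ((op_adj T \<cdot> T) x) x)"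
  using op_adj'[OF assms, of "T x" x] by (simp add: Re_cinner_self)

lemma adj_comp_zero: "T \<in> bounded_ops \<Longrightarrow> op_adj T \<cdot> T = 0 \<Longrightarrow> T = 0"
  using norm_adj_comp_le[of T] by (intro blinfun_eqI) simp

section \<open>Positive operators\<close>

definition sa :: "('a::complex_hilbert \<Rightarrow>\<^sub>L 'a) \<Rightarrow> bool" where
  "sa a \<longleftrightarrow> a \<in> bounded_ops \<and> op_adj a = a"

text \<open>Self-adjointness is included because the form is tested through real parts only;
  \<open>psd_op_le\<close> leads back to the order \<open>op_le\<close>.\<close>

definition psd :: "('a::complex_hilbert \<Rightarrow>\<^sub>L 'a) \<Rightarrow> bool" where
  "psd a \<longleftrightarrow> sa a \<and> (\<forall>x. 0 \<le> Re (cinner (blinfun_apply a x) x))"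

lemma sa_cinner: "sa a \<Longrightarrow> cinner (a x) y = cinner x (a y)"
  by (metis op_adj sa_def)

lemma saI: "a \<in> bounded_ops \<Longrightarrow> (\<And>x y. cinner (blinfun_apply a x) y = cinner x (blinfun_apply a y)) \<Longrightarrow> sa a"
  unfolding sa_def using op_adjI by blast

lemma sa_bounded_ops: "sa a \<Longrightarrow> a \<in> bounded_ops" by (simp add: sa_def)
lemma psd_sa: "psd a \<Longrightarrow> sa a" by (simp add: psd_def)
lemma psd_bounded_ops: "psd a \<Longrightarrow> a \<in> bounded_ops" by (simp add: psd_def sa_def)
lemma psd_nonneg: "psd a \<Longrightarrow> 0 \<le> Re (cinner (a x) x)" by (simp add: psd_def)

lemma sa_add: "sa a \<Longrightarrow> sa b \<Longrightarrow> sa (a + b)" by (simp add: sa_def op_adj_add bounded_ops_add)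
lemma sa_diff: "sa a \<Longrightarrow> sa b \<Longrightarrow> sa (a - b)" by (simp add: sa_def op_adj_diff bounded_ops_diff)
lemma sa_scaleR: "sa a \<Longrightarrow> sa (r *\<^sub>R a)" by (simp add: sa_def op_adj_scaleR bounded_ops_scaleR)
lemma sa_id [simp]: "sa id_blinfun" by (simp add: sa_def)
lemma sa_zero [simp]: "sa 0" by (simp add: sa_def)

lemma psd_add: "psd a \<Longrightarrow> psd b \<Longrightarrow> psd (a + b)"
  by (simp add: psd_def sa_add blinfun.add_left cinner_add_left)
lemma psd_scaleR: "psd a \<Longrightarrow> 0 \<le> r \<Longrightarrow> psd (r *\<^sub>R a)"
  by (simp add: psd_def sa_scaleR blinfun.scaleR_left cinner_scaleR_left)
lemma psd_id [simp]: "psd id_blinfun" by (simp add: psd_def Re_cinner_self)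
lemma psd_zero [simp]: "psd 0" by (simp add: psd_def)
lemma psd_sum: "(\<And>i. i \<in> I \<Longrightarrow> psd (f i)) \<Longrightarrow> psd (sum f I)"
  by (induction I rule: infinite_finite_induct) (auto intro: psd_add)
lemma psd_trans: "psd (b - a) \<Longrightarrow> psd (c - b) \<Longrightarrow> psd (c - a)"
  using psd_add[of "b - a" "c - b"] by simp

lemma psd_conj:
  assumes "psd a" "b \<in> bounded_ops"
  shows "psd (op_adj b \<cdot> a \<cdot> b)"
  using assms unfolding psd_def sa_def
  by (auto simp: op_adj_comp bounded_ops_comp op_adj_bounded_ops comp_assoc op_adj')

lemma psd_adj_comp: "b \<in> bounded_ops \<Longrightarrow> psd (op_adj b \<cdot> b)"
  using psd_conj[OF psd_id, of b] by simp

lemma psd_norm_bound: "sa a \<Longrightarrow> psd (norm a *\<^sub>R id_blinfun - a)"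
proof -
  assume a: "sa a"
  have "Re (cinner (a x) x) \<le> norm a * (norm x)\<^sup>2" for x
  proof -
    have "Re (cinner (a x) x) \<le> norm (a x) * norm x" by (rule Re_cinner_le)
    also have "\<dots> \<le> (norm a * norm x) * norm x" by (intro mult_right_mono norm_blinfun norm_ge_zero)
    finally show ?thesis by (simp add: power2_eq_square mult.assoc)
  qed
  then show ?thesis using a
    by (auto simp: psd_def sa_diff sa_scaleR blinfun.diff_left blinfun.scaleR_left
        cinner.diff_left cinner_scaleR_left Re_cinner_self)
qed

text \<open>By polarisation: a form that vanishes at \<open>x\<close>, \<open>y\<close> and
  \<open>x + y\<close> has no real cross term.\<close>

lemma psd_antisym: assumes "psd a" "psd (- a)" shows "a = 0"
proof (rule blinfun_eqI)
  fix x
  have q: "Re (cinner (a y) y) = 0" for y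
    using psd_nonneg[OF assms(1), of y] psd_nonneg[OF assms(2), of y] by (simp add: blinfun.minus_left cinner.minus_left)
  have "Re (cinner (a x) y) = 0" for y
  proof -
    have "Re (cinner (a (x + y)) (x + y)) = 2 * Re (cinner (a x) y)"
      using q[of x] q[of y] sa_cinner[OF psd_sa[OF assms(1)], of y x] Re_cinner_commute[of y "a x"]
      by (simp add: blinfun.add_right cinner_add_left cinner_add_right)
    then show ?thesis using q by simp
  qed
  then show "a x = blinfun_apply 0 x" by (intro Re_cinner_eqI) simp
qed

text \<open>This is \<open>d^2 \<le> C d\<close> for \<open>0 \<le> d \<le> C\<close>, obtained
  without a square root of \<open>d\<close>: positivity of \<open>d\<close> is tested at
  \<open>x - d x / C\<close>.\<close>

lemma psd_norm_sq_le:
  assumes "psd d" "psd (C *\<^sub>R id_blinfun - d)" "C > 0"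
  shows "(norm (d x))\<^sup>2 \<le> C * Re (cinner (d x) x)"
proof -
  define v where "v = x - (1 / C) *\<^sub>R d x"
  have e1: "Re (cinner (d v) v) = Re (cinner (d x) x) - 2 / C * (norm (d x))\<^sup>2 + (1 / C)\<^sup>2 * Re (cinner (d (d x)) (d x))"
    using sa_cinner[OF psd_sa[OF assms(1)], of "d x" x]
    by (simp add: v_def blinfun.diff_right blinfun.scaleR_right cinner.diff_left cinner.diff_right
        cinner_scaleR_left cinner_scaleR_right Re_cinner_self power2_eq_square diff_divide_distrib)
  have "Re (cinner (d (d x)) (d x)) \<le> C * (norm (d x))\<^sup>2"
    using psd_nonneg[OF assms(2), of "d x"]
    by (simp add: blinfun.diff_left blinfun.scaleR_left cinner.diff_left cinner_scaleR_left Re_cinner_self)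
  then have "(1 / C)\<^sup>2 * Re (cinner (d (d x)) (d x)) \<le> (1 / C)\<^sup>2 * (C * (norm (d x))\<^sup>2)"
    by (intro mult_left_mono) auto
  also have "\<dots> = 1 / C * (norm (d x))\<^sup>2" using assms(3) by (simp add: power2_eq_square)
  finally have "0 \<le> Re (cinner (d x) x) - 1 / C * (norm (d x))\<^sup>2"
    using e1 psd_nonneg[OF assms(1), of v] by simp
  then show ?thesis using assms(3) by (simp add: field_simps)
qed

section \<open>Inverses and monotone limits\<close>

definition proj :: "'a::complex_hilbert set \<Rightarrow> 'a \<Rightarrow>\<^sub>L 'a" where
  "proj V = (SOME E. sa E \<and> (\<forall>x. blinfun_apply E x \<in> V) \<and> (\<forall>x\<in>V. blinfun_apply E x = x))"

lemma proj:
  fixes V :: "'a::complex_hilbert set"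
  assumes V: "csubspace V" "closed V"
  shows proj_sa: "sa (proj V)" and proj_in: "proj V x \<in> V" and proj_id: "x \<in> V \<Longrightarrow> proj V x = x"
proof -
  obtain e where e: "\<And>x. e x \<in> V" "\<And>x v. v \<in> V \<Longrightarrow> cinner (x - e x) v = 0"
    using orthogonal_projection_exists[OF V] by metis
  have uniq: "y = e x" if "y \<in> V" "\<And>v. v \<in> V \<Longrightarrow> cinner (x - y) v = 0" for x y
  proof -
    have d: "y - e x \<in> V" by (intro csubspace_diff V that e)
    have "cinner (y - e x) (y - e x) = cinner (x - e x) (y - e x) - cinner (x - y) (y - e x)"
      by (simp flip: cinner.diff_left)
    then have "cinner (y - e x) (y - e x) = 0" using that(2)[OF d] e(2)[OF d] by simp
    then show ?thesis by (simp add: cinner_self)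
  qed
  have add: "e (x + y) = e x + e y" for x y
  proof (rule uniq[symmetric])
    show "e x + e y \<in> V" using V e by (auto simp: csubspace_def)
    show "cinner (x + y - (e x + e y)) v = 0" if "v \<in> V" for v
      using e(2)[OF that, of x] e(2)[OF that, of y] by (simp add: cinner.diff_left cinner_add_left)
  qed
  have sc: "e (c *\<^sub>C x) = c *\<^sub>C e x" for c x
  proof (rule uniq[symmetric])
    show "c *\<^sub>C e x \<in> V" using V e by (auto simp: csubspace_def)
    show "cinner (c *\<^sub>C x - c *\<^sub>C e x) v = 0" if "v \<in> V" for v
      using e(2)[OF that, of x] by (simp flip: scaleC_diff_right add: cinner_scaleC_left)
  qed
  have se: "cinner (e x) y = cinner (e x) (e y)" for x y
    using e(2)[OF e(1), of y x] cinner_commute[of "e x" "y - e y"] by (simp add: cinner.diff_right)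
  have nrm: "norm (e x) \<le> norm x * 1" for x
  proof -
    have "(norm x)\<^sup>2 = (norm ((x - e x) + e x))\<^sup>2" by simp
    also have "\<dots> = (norm (x - e x))\<^sup>2 + (norm (e x))\<^sup>2"
      unfolding norm_add_sq e(2)[OF e(1)] by simp
    finally have "(norm (e x))\<^sup>2 \<le> (norm x)\<^sup>2" by simp
    then show ?thesis by simp
  qed
  have bl: "bounded_linear e"
    by (rule bounded_linear_intro[where K=1]) (use add sc nrm in \<open>auto simp flip: scaleC_of_real\<close>)
  note ap = bounded_linear_Blinfun_apply[OF bl]
  have "sa (Blinfun e)"
  proof (rule saI)
    show "cinner (Blinfun e x) y = cinner x (Blinfun e y)" for x y
      using se[of x y] se[of y x] cinner_commute[of x "e y"] cinner_commute[of "e x" "e y"] by (simp add: ap)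
  qed (simp add: bounded_ops_def ap sc)
  moreover have "e x = x" if "x \<in> V" for x by (rule uniq[symmetric]) (use that in auto)
  ultimately have "\<exists>E. sa E \<and> (\<forall>x. blinfun_apply E x \<in> V) \<and> (\<forall>x\<in>V. blinfun_apply E x = x)"
    by (intro exI[of _ "Blinfun e"]) (simp add: ap e)
  from someI_ex[OF this] show "sa (proj V)" "proj V x \<in> V" "x \<in> V \<Longrightarrow> proj V x = x"
    unfolding proj_def by auto
qed

text \<open>With \<open>E\<close> the projection, invariance under the adjoint of \<open>S\<close>
  gives \<open>E S = E S E\<close>, and invariance under \<open>S\<close> gives
  \<open>E S E = S E\<close>.\<close>

lemma proj_commutes:
  assumes V: "csubspace V" "closed V" and S: "S \<in> bounded_ops"
    and inv: "\<And>x. x \<in> V \<Longrightarrow> blinfun_apply S x \<in> V" "\<And>x. x \<in> V \<Longrightarrow> blinfun_apply (op_adj S) x \<in> V"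
  shows "proj V \<cdot> S = S \<cdot> proj V"
proof (rule blinfun_eqI, rule cinner_eqI)
  fix x z
  let ?E = "proj V"
  have "cinner (?E (S x)) z = cinner x (op_adj S (?E z))"
    using sa_cinner[OF proj_sa[OF V]] op_adj[OF S] by simp
  also have "\<dots> = cinner x (?E (op_adj S (?E z)))"
    using proj_id[OF V inv(2)[OF proj_in[OF V]]] by simp
  also have "\<dots> = cinner (?E (S (?E x))) z"
    using sa_cinner[OF proj_sa[OF V]] op_adj[OF S] by simp
  also have "\<dots> = cinner (S (?E x)) z" using proj_id[OF V inv(1)[OF proj_in[OF V]]] by simp
  finally show "cinner ((?E \<cdot> S) x) z = cinner ((S \<cdot> ?E) x) z" by simp
qed

text \<open>The norm bound belongs to the choice because \<open>oinv\<close> is meant for operators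
  that do not shrink norms; their inverses are contractions.\<close>

definition oinv :: "('a::complex_hilbert \<Rightarrow>\<^sub>L 'a) \<Rightarrow> ('a \<Rightarrow>\<^sub>L 'a)" where
  "oinv T = (SOME w. w \<in> bounded_ops \<and> T \<cdot> w = id_blinfun \<and> w \<cdot> T = id_blinfun \<and> norm w \<le> 1)"

text \<open>The first bound makes the range closed, the bound for the adjoint makes the orthogonal
  complement of the range trivial.\<close>

lemma bounded_below_inverse:
  fixes T :: "'a::complex_hilbert \<Rightarrow>\<^sub>L 'a"
  assumes T: "T \<in> bounded_ops" and b1: "\<And>x. norm x \<le> norm (T x)" and b2: "\<And>x. norm x \<le> norm (op_adj T x)"
  shows oinv_bounded_ops: "oinv T \<in> bounded_ops"
    and oinv_right: "T \<cdot> oinv T = id_blinfun"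
    and oinv_left: "oinv T \<cdot> T = id_blinfun"
    and norm_oinv: "norm (oinv T) \<le> 1"
proof -
  have sub: "csubspace (range T)"
    unfolding csubspace_def
  proof (intro conjI ballI allI)
    show "0 \<in> range T" using blinfun.zero_right[of T] by (metis rangeI)
    fix x y assume "x \<in> range T" "y \<in> range T"
    then show "x + y \<in> range T" by (auto simp flip: blinfun.add_right)
  next
    fix c x assume "x \<in> range T" then show "c *\<^sub>C x \<in> range T" by (auto simp flip: bounded_opsD[OF T])
  qed
  have "complete (range T)"
    by (rule complete_isometric_image[of 1]) (use b1 in \<open>auto simp: blinfun.bounded_linear_right complete_UNIV\<close>)
  then have cl: "closed (range T)" by (rule complete_imp_closed)
  have "\<exists>x. T x = z" for z
  proof -
    obtain p where p: "p \<in> range T" "\<And>v. v \<in> range T \<Longrightarrow> cinner (z - p) v = 0"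
      using orthogonal_projection_exists[OF sub cl] by blast
    have "op_adj T (z - p) = 0"
      by (rule cinner_eqI) (use p(2) op_adj'[OF T] in auto)
    then have "z - p = 0" using b2[of "z - p"] by simp
    then show ?thesis using p(1) by auto
  qed
  then obtain w where w: "\<And>z. T (w z) = z" by metis
  have inj: "x = y" if "T x = T y" for x y
    using b1[of "x - y"] that by (simp add: blinfun.diff_right)
  have w': "w (T x) = x" for x by (rule inj) (simp add: w)
  have sc: "w (c *\<^sub>C x) = c *\<^sub>C w x" for c x by (rule inj) (simp add: w bounded_opsD[OF T])
  have nrm: "norm (w x) \<le> norm x * 1" for x using b1[of "w x"] by (simp add: w)
  have add: "w (x + y) = w x + w y" for x y by (rule inj) (simp add: w blinfun.add_right)
  have bl: "bounded_linear w"
    by (rule bounded_linear_intro[where K=1]) (use add sc nrm in \<open>auto simp flip: scaleC_of_real\<close>)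
  note ap = bounded_linear_Blinfun_apply[OF bl]
  have "\<exists>w. w \<in> bounded_ops \<and> T \<cdot> w = id_blinfun \<and> w \<cdot> T = id_blinfun \<and> norm w \<le> 1"
  proof (intro exI conjI)
    show "Blinfun w \<in> bounded_ops" by (simp add: bounded_ops_def ap sc)
    show "T \<cdot> Blinfun w = id_blinfun" by (rule blinfun_eqI) (simp add: ap w)
    show "Blinfun w \<cdot> T = id_blinfun" by (rule blinfun_eqI) (simp add: ap w')
    show "norm (Blinfun w) \<le> 1" by (rule norm_blinfun_bound) (use nrm in \<open>auto simp: ap\<close>)
  qed
  from someI_ex[OF this] show "oinv T \<in> bounded_ops" "T \<cdot> oinv T = id_blinfun" "oinv T \<cdot> T = id_blinfun"
    "norm (oinv T) \<le> 1"
    unfolding oinv_def by auto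
qed

lemma inverse_commutes:
  assumes "T \<cdot> w = id_blinfun" "w \<cdot> T = id_blinfun" "S \<cdot> T = T \<cdot> S"
  shows "S \<cdot> w = w \<cdot> S"
proof -
  have "S \<cdot> w = w \<cdot> (T \<cdot> S) \<cdot> w" using assms(2) by (simp flip: comp_assoc)
  also have "\<dots> = w \<cdot> S" using assms(1) by (simp flip: assms(3) add: comp_assoc)
  finally show ?thesis .
qed

text \<open>The cross term \<open>2 * Re (cinner (y x) x)\<close> is nonnegative, so
  \<open>T\<close> does not shrink norms; \<open>T\<close> is self-adjoint, so the same bound serves
  for the adjoint.\<close>

lemma psd_inverse:
  assumes y: "psd y"
  defines "T \<equiv> id_blinfun + y"
  shows inv1p_right: "T \<cdot> oinv T = id_blinfun"
    and inv1p_left: "oinv T \<cdot> T = id_blinfun"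
    and inv1p_norm: "norm (oinv T) \<le> 1"
    and inv1p_psd: "psd (oinv T)"
    and inv1p_le: "psd (id_blinfun - oinv T)"
proof -
  have T: "sa T" by (simp add: T_def sa_add psd_sa y)
  have b: "norm x \<le> norm (T x)" for x
  proof -
    have "(norm (T x))\<^sup>2 = (norm x)\<^sup>2 + 2 * Re (cinner (y x) x) + (norm (y x))\<^sup>2"
      by (simp add: T_def blinfun.add_left norm_add_sq Re_cinner_commute[of x])
    then have "(norm x)\<^sup>2 \<le> (norm (T x))\<^sup>2" using psd_nonneg[OF y, of x] by simp
    then show ?thesis by simp
  qed
  note I = bounded_below_inverse[OF sa_bounded_ops[OF T] b]
  have b2: "norm x \<le> norm (op_adj T x)" for x using b T by (simp add: sa_def)
  show 1: "T \<cdot> oinv T = id_blinfun" and 2: "oinv T \<cdot> T = id_blinfun" and 3: "norm (oinv T) \<le> 1"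
    using I(2,3,4) b2 by blast+
  define w where "w = oinv T"
  have Tw: "T (w x) = x" for x using 1 by (metis blinfun_apply_blinfun_compose id_blinfun.rep_eq id_apply w_def)
  have w: "sa w"
  proof (rule saI)
    show "w \<in> bounded_ops" using I(1) b2 by (simp add: w_def)
    show "cinner (w x) y = cinner x (w y)" for x y
      using sa_cinner[OF T, of "w x" "w y"] by (simp add: Tw)
  qed
  have ge: "(norm (w x))\<^sup>2 \<le> Re (cinner (w x) x)" for x
  proof -
    have "Re (cinner (w x) (T (w x))) = (norm (w x))\<^sup>2 + Re (cinner (y (w x)) (w x))"
      by (simp add: T_def blinfun.add_left cinner_add_right Re_cinner_self Re_cinner_commute[of "w x" "y (w x)"])
    then show ?thesis using psd_nonneg[OF y, of "w x"] by (simp add: Tw)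
  qed
  show "psd (oinv T)"
    unfolding psd_def using w ge by (auto simp: w_def intro: order_trans[OF zero_le_power2])
  have "Re (cinner (w x) x) \<le> (norm x)\<^sup>2" for x
  proof -
    have "Re (cinner (w x) x) \<le> norm (w x) * norm x" by (rule Re_cinner_le)
    also have "\<dots> \<le> norm x * norm x"
      by (intro mult_right_mono) (use b[of "w x"] in \<open>auto simp: Tw\<close>)
    finally show ?thesis by (simp add: power2_eq_square)
  qed
  then show "psd (id_blinfun - oinv T)"
    using w by (simp add: psd_def sa_diff w_def blinfun.diff_left cinner.diff_left Re_cinner_self)
qed

text \<open>The variational formula \<open>\<langle>a\<^sup>-\<^sup>1 x, x\<rangle> = sup\<^sub>v (2 Re \<langle>v, x\<rangle> - \<langle>a v, v\<rangle>)\<close> for \<open>a = 1 + y\<close>.\<close>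

lemma inv1p_variational:
  assumes y: "psd y"
  shows "2 * Re (cinner v x) - (norm v)\<^sup>2 - Re (cinner (y v) v) \<le> Re (cinner (oinv (id_blinfun + y) x) x)"
proof -
  define T where "T = id_blinfun + y"
  define u where "u = oinv T x"
  have Tu: "T u = x" using inv1p_right[OF y] unfolding u_def T_def
    by (metis blinfun_apply_blinfun_compose id_blinfun.rep_eq id_apply)
  have T: "psd T" by (simp add: T_def psd_add y)
  have "0 \<le> Re (cinner (T (v - u)) (v - u))" by (rule psd_nonneg[OF T])
  also have "\<dots> = Re (cinner (T v) v) - 2 * Re (cinner v x) + Re (cinner u x)"
    using sa_cinner[OF psd_sa[OF T], of v u]
    by (simp add: blinfun.diff_right cinner.diff_left cinner.diff_right Tu Re_cinner_commute[of x])
  finally show ?thesis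
    by (simp add: T_def u_def blinfun.add_left cinner_add_left Re_cinner_self)
qed

text \<open>The variational expression decreases when \<open>y\<close> grows. The vector at which
  the expression for \<open>z\<close> attains its supremum is inserted into the one for
  \<open>y\<close>.\<close>

lemma inv1p_antimono:
  assumes y: "psd y" and z: "psd z" and yz: "psd (z - y)"
  shows "psd (oinv (id_blinfun + y) - oinv (id_blinfun + z))"
proof -
  have "Re (cinner (oinv (id_blinfun + z) x) x) \<le> Re (cinner (oinv (id_blinfun + y) x) x)" for x
  proof -
    define v where "v = oinv (id_blinfun + z) x"
    have e: "(id_blinfun + z) v = x" using inv1p_right[OF z] unfolding v_def
      by (metis blinfun_apply_blinfun_compose id_blinfun.rep_eq id_apply)
    have "Re (cinner v x) = (norm v)\<^sup>2 + Re (cinner (z v) v)"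
      unfolding e[symmetric]
      by (simp add: blinfun.add_left cinner_add_right Re_cinner_self Re_cinner_commute[of v "z v"])
    moreover have "Re (cinner (y v) v) \<le> Re (cinner (z v) v)"
      using psd_nonneg[OF yz, of v] by (simp add: blinfun.diff_left cinner.diff_left)
    ultimately show ?thesis using inv1p_variational[OF y, of v x] by (simp add: v_def)
  qed
  then show ?thesis
    using psd_sa[OF inv1p_psd[OF y]] psd_sa[OF inv1p_psd[OF z]]
    by (simp add: psd_def sa_diff blinfun.diff_left cinner.diff_left)
qed

lemma strong_limit_exists:
  fixes f :: "nat \<Rightarrow> 'a::complex_hilbert \<Rightarrow>\<^sub>L 'a"
  assumes f: "\<And>n. f n \<in> bounded_ops" and bd: "\<And>n. norm (f n) \<le> C" and C: "\<And>x. Cauchy (\<lambda>n. f n x)"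
  shows "\<exists>s\<in>bounded_ops. norm s \<le> C \<and> (\<forall>x. (\<lambda>n. f n x) \<longlonglongrightarrow> blinfun_apply s x)"
proof -
  have "\<forall>x. \<exists>l. (\<lambda>n. f n x) \<longlonglongrightarrow> l"
    using C by (simp add: Cauchy_convergent_iff convergent_def)
  from choice[OF this] obtain s where s: "\<And>x. (\<lambda>n. f n x) \<longlonglongrightarrow> s x" by blast
  have C0: "0 \<le> C" using bd[of 0] norm_ge_zero order_trans by blast
  have nrm: "norm (s x) \<le> norm x * C" for x
  proof (rule LIMSEQ_le_const2)
    show "(\<lambda>n. norm (f n x)) \<longlonglongrightarrow> norm (s x)" by (intro tendsto_intros s)
    have "norm (f n x) \<le> norm x * C" for n
      using norm_blinfun[of "f n" x] mult_right_mono[OF bd[of n] norm_ge_zero[of x]] by (simp add: mult.commute)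
    then show "\<exists>N. \<forall>n\<ge>N. norm (f n x) \<le> norm x * C" by blast
  qed
  have add: "s (x + y) = s x + s y" for x y
    by (rule LIMSEQ_unique[OF s]) (auto simp: blinfun.add_right intro: tendsto_add s)
  have sc: "s (c *\<^sub>C x) = c *\<^sub>C s x" for c x
    by (rule LIMSEQ_unique[OF s]) (auto simp: bounded_opsD[OF f] intro: tendsto_scaleC s)
  have bl: "bounded_linear s"
    by (rule bounded_linear_intro[where K=C]) (use add sc nrm in \<open>auto simp flip: scaleC_of_real\<close>)
  note ap = bounded_linear_Blinfun_apply[OF bl]
  show ?thesis
    by (rule bexI[of _ "Blinfun s"])
       (use s nrm C0 in \<open>auto simp: ap bounded_ops_def sc mult.commute intro!: norm_blinfun_bound\<close>)
qed

text \<open>Strong convergence of a sequence. Complex linearity of the limit is recorded because the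
  type contains all real-linear bounded operators.\<close>

definition sot :: "(nat \<Rightarrow> 'a::complex_hilbert \<Rightarrow>\<^sub>L 'a) \<Rightarrow> ('a \<Rightarrow>\<^sub>L 'a) \<Rightarrow> bool" where
  "sot f s \<longleftrightarrow> s \<in> bounded_ops \<and> (\<forall>x. (\<lambda>n. blinfun_apply (f n) x) \<longlonglongrightarrow> blinfun_apply s x)"

lemma sotD: "sot f s \<Longrightarrow> (\<lambda>n. f n x) \<longlonglongrightarrow> blinfun_apply s x" by (simp add: sot_def)

lemma sot_unique: "sot f s \<Longrightarrow> sot f t \<Longrightarrow> s = t"
  by (rule blinfun_eqI) (metis LIMSEQ_unique sotD)

lemma sot_const: "s \<in> bounded_ops \<Longrightarrow> sot (\<lambda>n. s) s" by (simp add: sot_def)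

lemma sot_add: "sot f s \<Longrightarrow> sot g t \<Longrightarrow> sot (\<lambda>n. f n + g n) (s + t)"
  by (auto simp: sot_def bounded_ops_add blinfun.add_left intro: tendsto_add)

lemma sot_diff: "sot f s \<Longrightarrow> sot g t \<Longrightarrow> sot (\<lambda>n. f n - g n) (s - t)"
  by (auto simp: sot_def bounded_ops_diff blinfun.diff_left intro: tendsto_diff)

lemma sot_sum: "(\<And>i. i \<in> I \<Longrightarrow> sot (f i) (s i)) \<Longrightarrow> sot (\<lambda>n. \<Sum>i\<in>I. f i n) (sum s I)"
  by (induction I rule: infinite_finite_induct) (auto intro: sot_add sot_const)

lemma sot_comp_left: "b \<in> bounded_ops \<Longrightarrow> sot f s \<Longrightarrow> sot (\<lambda>n. b \<cdot> f n) (b \<cdot> s)"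
  by (auto simp: sot_def bounded_ops_comp intro: blinfun.tendsto)

lemma sot_comp_right: "b \<in> bounded_ops \<Longrightarrow> sot f s \<Longrightarrow> sot (\<lambda>n. f n \<cdot> b) (s \<cdot> b)"
  by (auto simp: sot_def bounded_ops_comp)

lemma sot_norm: "s \<in> bounded_ops \<Longrightarrow> (\<lambda>n. norm (f n - s)) \<longlonglongrightarrow> 0 \<Longrightarrow> sot f s"
  unfolding sot_def
  by (auto intro!: tendsto_intros blinfun.tendsto simp: LIM_zero_iff tendsto_norm_zero_iff)

lemma sot_cong_eventually: "sot f s \<Longrightarrow> (\<And>n. n \<ge> N \<Longrightarrow> g n = f n) \<Longrightarrow> sot g s"
  unfolding sot_def by (metis (mono_tags, lifting) eventually_sequentiallyI tendsto_cong)

text \<open>Taking adjoints is not strongly continuous, so the convergence of the adjoints is a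
  hypothesis; the two limits are then compared in inner products.\<close>

lemma sot_adj: "sot f s \<Longrightarrow> sot (\<lambda>n. op_adj (f n)) t \<Longrightarrow> (\<And>n. f n \<in> bounded_ops) \<Longrightarrow> op_adj s = t"
proof (rule op_adjI)
  fix x y assume a: "sot f s" "sot (\<lambda>n. op_adj (f n)) t" "\<And>n. f n \<in> bounded_ops"
  have "(\<lambda>n. cinner (f n x) y) \<longlonglongrightarrow> cinner (s x) y" by (intro cinner.tendsto sotD a tendsto_const)
  moreover have "(\<lambda>n. cinner (f n x) y) \<longlonglongrightarrow> cinner x (t y)"
    unfolding op_adj[OF a(3)] by (intro cinner.tendsto sotD a tendsto_const)
  ultimately show "cinner (s x) y = cinner x (t y)" by (rule LIMSEQ_unique)
qed

lemma sot_sa: "sot f s \<Longrightarrow> (\<And>n. sa (f n)) \<Longrightarrow> sa s"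
  using sot_adj[of f s s] by (simp add: sa_def sot_def)

lemma sot_psd_ge: "sot f s \<Longrightarrow> (\<And>n. sa (f n)) \<Longrightarrow> psd (f k) \<Longrightarrow> (\<And>n. n \<ge> k \<Longrightarrow> psd (f n)) \<Longrightarrow> psd s"
  unfolding psd_def
proof (intro conjI allI)
  assume a: "sot f s" "\<And>n. n \<ge> k \<Longrightarrow> sa (f n) \<and> (\<forall>x. 0 \<le> Re (cinner (blinfun_apply (f n) x) x))"
  fix x
  have "(\<lambda>n. Re (cinner (f n x) x)) \<longlonglongrightarrow> Re (cinner (s x) x)" by (intro tendsto_intros cinner.tendsto sotD a)
  then show "0 \<le> Re (cinner (s x) x)" by (rule LIMSEQ_le_const) (use a in blast)
qed (rule sot_sa)

lemma psd_mono_seq: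
  fixes y :: "nat \<Rightarrow> 'a::complex_hilbert \<Rightarrow>\<^sub>L 'a"
  assumes "\<And>n. psd (y (Suc n) - y n)" "m \<le> n"
  shows "psd (y n - y m)"
  using assms(2) by (induction n rule: dec_induct) (use assms(1) psd_trans in \<open>auto\<close>)

lemma psd_norm_le:
  assumes "psd d" "psd (C *\<^sub>R id_blinfun - d)" "C > 0"
  shows "norm d \<le> C"
proof (rule norm_blinfun_bound)
  fix x
  have "(norm (d x))\<^sup>2 \<le> C * Re (cinner (d x) x)" by (rule psd_norm_sq_le[OF assms])
  also have "\<dots> \<le> C * (C * (norm x)\<^sup>2)"
    using psd_nonneg[OF assms(2), of x] assms(3)
    by (intro mult_left_mono) (auto simp: blinfun.diff_left blinfun.scaleR_left cinner.diff_left cinner_scaleR_left Re_cinner_self)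
  also have "\<dots> = (C * norm x)\<^sup>2" by (simp add: power2_eq_square)
  finally show "norm (d x) \<le> C * norm x" using assms(3) by (simp add: power2_le_iff_abs_le)
qed (use assms in auto)

text \<open>A bounded increasing real sequence \<open>q\<close> controls the vectors. In the
  applications \<open>q\<close> is the value of an increasing sequence of quadratic forms.\<close>

lemma Cauchy_increments:
  fixes f :: "nat \<Rightarrow> 'a::real_normed_vector" and q :: "nat \<Rightarrow> real"
  assumes inc: "incseq q" and bd: "\<And>n. q n \<le> B" and C: "C > 0"
    and est: "\<And>m n. m \<le> n \<Longrightarrow> (norm (f n - f m))\<^sup>2 \<le> C * (q n - q m)"
  shows "Cauchy f"
proof (rule metric_CauchyI)
  have cq: "Cauchy q"
    using incseq_convergent[OF inc] bd convergentI Cauchy_convergent_iff by metis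
  fix e :: real assume e: "0 < e"
  then have "e\<^sup>2 / C > 0" using C by simp
  then obtain N where N: "\<And>m n. m \<ge> N \<Longrightarrow> n \<ge> N \<Longrightarrow> dist (q m) (q n) < e\<^sup>2 / C"
    using metric_CauchyD[OF cq] by metis
  have main: "norm (f n - f m) < e" if "N \<le> m" "m \<le> n" for m n
  proof -
    have "q n - q m < e\<^sup>2 / C" using N[of n m] that by (auto simp: dist_real_def)
    then have "C * (q n - q m) < e\<^sup>2" using C by (simp add: field_simps)
    then have "(norm (f n - f m))\<^sup>2 < e\<^sup>2" using est[OF that(2)] by linarith
    then show ?thesis using e by (simp add: power_less_imp_less_base)
  qed
  have "dist (f m) (f n) < e" if "N \<le> m" "N \<le> n" for m n
    using main[of m n] main[of n m] that by (metis dist_norm dist_commute nle_le)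
  then show "\<exists>M. \<forall>m\<ge>M. \<forall>n\<ge>M. dist (f m) (f n) < e" by blast
qed

text \<open>\<open>psd_norm_sq_le\<close>, applied to the increments \<open>y n - y m\<close>, turns
  convergence of the quadratic forms into norm convergence of the vectors
  \<open>y n x\<close>.\<close>

lemma monotone_limit:
  fixes y :: "nat \<Rightarrow> 'a::complex_hilbert \<Rightarrow>\<^sub>L 'a"
  assumes inc: "\<And>n. psd (y (Suc n) - y n)" and pos: "psd (y 0)" and bd: "\<And>n. psd (C *\<^sub>R id_blinfun - y n)"
    and C: "C > 0"
  shows "\<exists>s. sot y s \<and> sa s \<and> (\<forall>n. psd (s - y n)) \<and> norm s \<le> C"
proof -
  have p: "psd (y n)" for n
    using psd_add[OF psd_mono_seq[of y, OF inc le0] pos, of n] by simp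
  have nb: "norm (y n) \<le> C" for n by (rule psd_norm_le[OF p bd C])
  have "Cauchy (\<lambda>n. y n x)" for x
  proof -
    define q where "q = (\<lambda>n. Re (cinner (y n x) x))"
    have inc: "incseq q"
    proof (rule incseq_SucI)
      show "q n \<le> q (Suc n)" for n
        using psd_nonneg[OF assms(1)[of n], of x] by (simp add: q_def blinfun.diff_left cinner.diff_left)
    qed
    have bq: "q n \<le> C * (norm x)\<^sup>2" for n
      using psd_nonneg[OF bd[of n], of x]
      by (simp add: q_def blinfun.diff_left blinfun.scaleR_left cinner.diff_left cinner_scaleR_left Re_cinner_self)
    have est: "(norm (y n x - y m x))\<^sup>2 \<le> C * (q n - q m)" if "m \<le> n" for m n
    proof -
      have d: "psd (y n - y m)" by (rule psd_mono_seq[of y, OF assms(1) that])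
      have "psd (C *\<^sub>R id_blinfun - (y n - y m))" using psd_add[OF bd[of n] p[of m]] by (simp add: algebra_simps)
      from psd_norm_sq_le[OF d this C, of x] show ?thesis
        by (simp add: q_def blinfun.diff_left cinner.diff_left)
    qed
    show ?thesis by (rule Cauchy_increments[OF inc bq C est])
  qed
  then obtain s where s: "s \<in> bounded_ops" "norm s \<le> C" "\<And>x. (\<lambda>n. y n x) \<longlonglongrightarrow> blinfun_apply s x"
    using strong_limit_exists[of y C] nb p psd_bounded_ops by metis
  then have st: "sot y s" by (simp add: sot_def)
  have "sa s" by (rule sot_sa[OF st psd_sa[OF p]])
  moreover have "psd (s - y n)" for n
    by (rule sot_psd_ge[OF sot_diff[OF st sot_const], where k=n])
       (auto intro: psd_bounded_ops p sa_diff psd_sa psd_mono_seq[of y] inc)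
  ultimately show ?thesis using st s by blast
qed

section \<open>Kernel projections as strong limits of resolvents\<close>

definition res :: "nat \<Rightarrow> ('a::complex_hilbert \<Rightarrow>\<^sub>L 'a) \<Rightarrow> ('a \<Rightarrow>\<^sub>L 'a)" where
  "res n h = oinv (id_blinfun + real n *\<^sub>R h)"

text \<open>On the spectrum of \<open>h\<close> the functions \<open>1 / (1 + n \<lambda>)\<close>
  decrease to the indicator of \<open>\<lambda> = 0\<close>, so the limit is the projection onto the
  kernel of \<open>h\<close>.\<close>

definition kerp :: "('a::complex_hilbert \<Rightarrow>\<^sub>L 'a) \<Rightarrow> ('a \<Rightarrow>\<^sub>L 'a)" where
  "kerp h = (THE s. sot (\<lambda>n. res n h) s)"

lemma res:
  assumes "psd h"
  shows res_psd: "psd (res n h)" and res_le: "psd (id_blinfun - res n h)"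
    and res_right: "res n h + real n *\<^sub>R (h \<cdot> res n h) = id_blinfun"
    and res_left: "res n h + real n *\<^sub>R (res n h \<cdot> h) = id_blinfun"
    and res_antimono: "psd (res n h - res (Suc n) h)"
    and res_norm: "norm (res n h) \<le> 1"
proof -
  have p: "psd (real n *\<^sub>R h)" for n by (rule psd_scaleR[OF assms]) simp
  show "psd (res n h)" "psd (id_blinfun - res n h)" "norm (res n h) \<le> 1"
    unfolding res_def by (rule inv1p_psd[OF p] inv1p_le[OF p] inv1p_norm[OF p])+
  show "res n h + real n *\<^sub>R (h \<cdot> res n h) = id_blinfun" "res n h + real n *\<^sub>R (res n h \<cdot> h) = id_blinfun"
    using inv1p_right[OF p, of n] inv1p_left[OF p, of n] by (simp_all add: res_def comp_simps)
  show "psd (res n h - res (Suc n) h)"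
    unfolding res_def by (rule inv1p_antimono[OF p p]) (simp add: scaleR_left_distrib assms)
qed

lemma kerp_sot: assumes h: "psd h" shows "sot (\<lambda>n. res n h) (kerp h)"
proof -
  have "\<exists>s. sot (\<lambda>n. id_blinfun - res n h) s \<and> sa s \<and> (\<forall>n. psd (s - (id_blinfun - res n h))) \<and> norm s \<le> 1"
    by (rule monotone_limit) (use res[OF h] in \<open>auto simp: psd_bounded_ops\<close>)
  then obtain s where "sot (\<lambda>n. id_blinfun - res n h) s" by blast
  from sot_diff[OF sot_const[OF bounded_ops_id] this]
  have s: "sot (\<lambda>n. res n h) (id_blinfun - s)" by simp
  show ?thesis unfolding kerp_def
    by (rule theI[where P="sot (\<lambda>n. res n h)"], rule s) (rule sot_unique[OF _ s])
qed

lemma kerp: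
  assumes h: "psd h"
  shows kerp_sa: "sa (kerp h)" and comp_kerp: "h \<cdot> kerp h = 0" and kerp_comp: "kerp h \<cdot> h = 0"
    and kerp_fix: "y \<in> bounded_ops \<Longrightarrow> h \<cdot> y = 0 \<Longrightarrow> kerp h \<cdot> y = y"
    and kerp_idem: "kerp h \<cdot> kerp h = kerp h"
proof -
  note S = kerp_sot[OF h]
  have hb: "h \<in> bounded_ops" and kb: "kerp h \<in> bounded_ops" using h psd_bounded_ops S by (auto simp: sot_def)
  show sa: "sa (kerp h)" by (rule sot_sa[OF S]) (simp add: res[OF h] psd_sa)
  \<comment> \<open>The resolvent equation makes \<open>h \<cdot> res n h\<close> of norm at most
    \<open>2 / n\<close>; hence the limit is annihilated by \<open>h\<close>.\<close>
  have eq: "h \<cdot> res n h = (1 / real n) *\<^sub>R (id_blinfun - res n h)" if "n > 0" for n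
  proof -
    have "real n *\<^sub>R (h \<cdot> res n h) = id_blinfun - res n h"
      using res_right[OF h, of n] by (simp add: eq_diff_eq add.commute)
    then have "(1 / real n) *\<^sub>R (real n *\<^sub>R (h \<cdot> res n h)) = (1 / real n) *\<^sub>R (id_blinfun - res n h)" by simp
    then show ?thesis using that by simp
  qed
  have "(\<lambda>n. norm (h \<cdot> res n h)) \<longlonglongrightarrow> 0"
  proof (rule tendsto_sandwich[OF _ _ tendsto_const])
    show "(\<lambda>n. 2 * (1 / real n)) \<longlonglongrightarrow> 0" using tendsto_mult_right_zero[OF lim_1_over_n] by simp
    have "norm (h \<cdot> res n h) \<le> 2 * (1 / real n)" if "n > 0" for n
    proof -
      have "norm (id_blinfun - res n h) \<le> 1 + 1"
        by (rule norm_triangle_le_diff) (intro add_mono norm_blinfun_id_le res_norm[OF h])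
      then show ?thesis using that by (simp add: eq divide_right_mono)
    qed
    then show "\<forall>\<^sub>F n in sequentially. norm (h \<cdot> res n h) \<le> 2 * (1 / real n)"
      by (intro eventually_sequentiallyI[of 1]) auto
  qed simp
  then have "sot (\<lambda>n. h \<cdot> res n h) 0" by (intro sot_norm) simp_all
  then show hk: "h \<cdot> kerp h = 0" using sot_comp_left[OF hb S] sot_unique by blast
  then have "op_adj (h \<cdot> kerp h) = 0" by simp
  then show "kerp h \<cdot> h = 0" using sa psd_sa[OF h] by (simp add: op_adj_comp sa_def)
  show fixy: "kerp h \<cdot> y = y" if y: "y \<in> bounded_ops" "h \<cdot> y = 0" for y
  proof -
    have "res n h \<cdot> y = y" for n
    proof -
      have "(res n h + real n *\<^sub>R (res n h \<cdot> h)) \<cdot> y = y" by (simp add: res_left[OF h])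
      then show ?thesis by (simp add: comp_simps comp_assoc y)
    qed
    then show ?thesis using sot_comp_right[OF y(1) S] sot_unique[OF _ sot_const[OF y(1)]] by simp
  qed
  show "kerp h \<cdot> kerp h = kerp h" by (rule fixy[OF kb hk])
qed

lemma kerp_eqI:
  assumes h: "psd h" and g: "sa g" "h \<cdot> g = 0" and fixg: "g \<cdot> kerp h = kerp h"
  shows "kerp h = g"
proof -
  have "op_adj (g \<cdot> kerp h) = kerp h \<cdot> g"
    using g kerp_sa[OF h] by (simp add: op_adj_comp sa_def)
  also have "\<dots> = g" by (rule kerp_fix[OF h sa_bounded_ops[OF g(1)] g(2)])
  finally show ?thesis using fixg kerp_sa[OF h] by (simp add: sa_def)
qed

text \<open>The Gram operator \<beta>* \<beta> of the column; its kernel is the common kernel of the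
  entries.\<close>

definition colh :: "'i set \<Rightarrow> ('i \<Rightarrow> 'a::complex_hilbert \<Rightarrow>\<^sub>L 'a) \<Rightarrow> ('a \<Rightarrow>\<^sub>L 'a)" where
  "colh I \<beta> = (\<Sum>i\<in>I. op_adj (\<beta> i) \<cdot> \<beta> i)"

text \<open>For \<open>n > 0\<close> these are the entries of \<beta> (1/n + h)^-1 \<beta>*, with
  \<open>h\<close> the Gram operator, that is of g / (1/n + g) for g = \<beta> \<beta>*. The
  matrices increase to the projection onto the closed range of \<beta>.\<close>

definition approx :: "'i set \<Rightarrow> ('i \<Rightarrow> 'a::complex_hilbert \<Rightarrow>\<^sub>L 'a) \<Rightarrow> 'i \<Rightarrow> 'i \<Rightarrow> nat \<Rightarrow> ('a \<Rightarrow>\<^sub>L 'a)" where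
  "approx I \<beta> i j n = \<beta> i \<cdot> (real n *\<^sub>R res n (colh I \<beta>)) \<cdot> op_adj (\<beta> j)"

text \<open>The projection onto the closed range of the column \<open>\<beta>\<close>.\<close>

definition colproj :: "'i set \<Rightarrow> ('i \<Rightarrow> 'a::complex_hilbert \<Rightarrow>\<^sub>L 'a) \<Rightarrow> 'i \<Rightarrow> 'i \<Rightarrow> ('a \<Rightarrow>\<^sub>L 'a)" where
  "colproj I \<beta> i j = (THE s. sot (approx I \<beta> i j) s)"

text \<open>With \<open>w n\<close> as (1/n + h)^-1 this says
  \<open>(w n - w m) h (w n - w m) \<le> w n - w m\<close>; for scalars it follows from
  \<open>h * w n \<le> 1\<close>. It yields both the Cauchy property of the approximants and the
  monotonicity of their diagonal entries.\<close>

lemma resolvent_increment: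
  assumes h: "psd h" and mn: "m \<le> n"
  defines "w \<equiv> \<lambda>n. real n *\<^sub>R res n h"
  shows "Re (cinner (h ((w n - w m) v)) ((w n - w m) v)) \<le> Re (cinner (w n v) v) - Re (cinner (w m v) v)"
proof -
  define a where "a = res n h v"
  define b where "b = res m h v"
  have va: "v = a + real n *\<^sub>R h a" and vb: "v = b + real m *\<^sub>R h b"
    using arg_cong[OF res_right[OF h, of n], of "\<lambda>f. blinfun_apply f v"]
          arg_cong[OF res_right[OF h, of m], of "\<lambda>f. blinfun_apply f v"]
    by (simp_all add: a_def b_def blinfun.add_left blinfun.scaleR_left)
  have d: "(w n - w m) v = real n *\<^sub>R a - real m *\<^sub>R b"
    by (simp add: w_def a_def b_def blinfun.diff_left blinfun.scaleR_left)
  have hd: "h ((w n - w m) v) = b - a"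
  proof -
    have "real n *\<^sub>R h a = v - a" "real m *\<^sub>R h b = v - b"
      by (simp_all add: va[symmetric] vb[symmetric] eq_diff_eq add.commute)
    then show ?thesis by (simp add: d blinfun.diff_right blinfun.scaleR_right)
  qed
  have hab: "Re (cinner a (h b)) = Re (cinner (h a) b)"
    using sa_cinner[OF psd_sa[OF h]] by simp
  have nv: "real n * Re (cinner a v) - real m * Re (cinner b v) = (real n - real m) * Re (cinner a b)"
  proof -
    have "real n * Re (cinner a v) = real n * Re (cinner a b) + real m * (real n * Re (cinner (h a) b))"
      by (subst vb) (simp add: cinner_add_right cinner_scaleR_right hab algebra_simps)
    moreover have "Re (cinner v b) = Re (cinner a b) + real n * Re (cinner (h a) b)"
      by (subst va) (simp add: cinner_add_left cinner_scaleR_left)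
    ultimately show ?thesis by (simp add: Re_cinner_commute[of b v] algebra_simps)
  qed
  have e1: "Re (cinner (w n v) v) - Re (cinner (w m v) v) = (real n - real m) * Re (cinner a b)"
    using nv by (simp add: w_def a_def b_def blinfun.scaleR_left cinner_scaleR_left)
  have e2: "Re (cinner (h ((w n - w m) v)) ((w n - w m) v))
      = (real n + real m) * Re (cinner a b) - real n * (norm a)\<^sup>2 - real m * (norm b)\<^sup>2"
    unfolding hd unfolding d
    by (simp add: cinner.diff_left cinner.diff_right cinner_scaleR_right Re_cinner_self Re_cinner_commute[of b a] algebra_simps)
  have nab: "(norm (a - b))\<^sup>2 = (norm a)\<^sup>2 - 2 * Re (cinner a b) + (norm b)\<^sup>2"
    using norm_add_sq[of a "- b"] by (simp add: cinner.minus_right)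
  \<comment> \<open>Expressed in \<open>a\<close> and \<open>b\<close>, the defect is a combination
    of squares with nonnegative coefficients.\<close>
  have "Re (cinner (w n v) v) - Re (cinner (w m v) v) - Re (cinner (h ((w n - w m) v)) ((w n - w m) v))
     = (real n - real m) * (norm a)\<^sup>2 + real m * (norm (a - b))\<^sup>2"
    unfolding e1 e2 nab by (simp add: algebra_simps)
  also have "\<dots> \<ge> 0" using mn by simp
  finally show ?thesis by simp
qed

context
  fixes I :: "'i set" and \<beta> :: "'i \<Rightarrow> 'a::complex_hilbert \<Rightarrow>\<^sub>L 'a"
  assumes fin: "finite I" and bops: "\<And>i. i \<in> I \<Longrightarrow> \<beta> i \<in> bounded_ops"
begin

lemma colh_psd: "psd (colh I \<beta>)"
  unfolding colh_def by (intro psd_sum psd_adj_comp bops)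

lemma col_le_colh: assumes "i \<in> I" shows "(norm (\<beta> i u))\<^sup>2 \<le> Re (cinner (colh I \<beta> u) u)"
proof -
  have "Re (cinner (colh I \<beta> u) u) = (\<Sum>i\<in>I. (norm (\<beta> i u))\<^sup>2)"
    unfolding colh_def blinfun.sum_left cinner.sum_left Re_sum
    by (intro sum.cong refl) (simp add: op_adj' bops Re_cinner_self)
  then show ?thesis using member_le_sum[OF assms, of "\<lambda>i. (norm (\<beta> i u))\<^sup>2"] fin by simp
qed

text \<open>\<open>resolvent_increment\<close> bounds the increments of the vectors by those of the
  quadratic form of \<open>w n\<close> at \<open>op_adj (\<beta> j) x\<close>, which increases and
  stays below the squared norm of \<open>x\<close>.\<close>

lemma colproj_sot: assumes i: "i \<in> I" and j: "j \<in> I" shows "sot (approx I \<beta> i j) (colproj I \<beta> i j)"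
proof -
  define h where "h = colh I \<beta>"
  define w where "w = (\<lambda>n. real n *\<^sub>R res n h)"
  have h: "psd h" by (simp add: h_def colh_psd)
  have wb: "w n \<in> bounded_ops" for n by (simp add: w_def bounded_ops_scaleR psd_bounded_ops res[OF h])
  have ap: "approx I \<beta> i j n x = \<beta> i (w n (op_adj (\<beta> j) x))" for i n x by (simp add: approx_def w_def h_def)
  have w0: "w 0 = 0" by (simp add: w_def)
  have inc: "(norm (\<beta> i ((w n - w m) v)))\<^sup>2 \<le> Re (cinner (w n v) v) - Re (cinner (w m v) v)"
    if "m \<le> n" "i \<in> I" for i m n v
    using order_trans[OF col_le_colh[OF that(2)] resolvent_increment[OF h that(1), of v, folded w_def, unfolded h_def]]
    by (simp add: h_def w_def)
  \<comment> \<open>With \<open>p\<close> the norm of \<open>\<beta> j (w n v)\<close>, the form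
    \<open>Q\<close> at \<open>v\<close> satisfies \<open>p^2 \<le> Q \<le> p * norm x\<close>. This
    gives \<open>p \<le> norm x\<close> and then the bound on \<open>Q\<close>.\<close>
  have q: "Re (cinner (w n (op_adj (\<beta> j) x)) (op_adj (\<beta> j) x)) \<le> (norm x)\<^sup>2" for n x
  proof -
    define v where "v = op_adj (\<beta> j) x"
    have 1: "(norm (\<beta> j (w n v)))\<^sup>2 \<le> Re (cinner (w n v) v)"
      using inc[of 0 n j v] j by (simp add: w0)
    have "Re (cinner (w n v) v) = Re (cinner (\<beta> j (w n v)) x)" by (simp add: v_def op_adj[OF bops[OF j]])
    then have 2: "Re (cinner (w n v) v) \<le> norm (\<beta> j (w n v)) * norm x" using Re_cinner_le by metis
    have "norm (\<beta> j (w n v)) \<le> norm x"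
    proof (cases "norm (\<beta> j (w n v)) = 0")
      case False
      have "norm (\<beta> j (w n v)) * norm (\<beta> j (w n v)) \<le> norm (\<beta> j (w n v)) * norm x"
        using 1 2 by (simp add: power2_eq_square)
      then show ?thesis using False by (simp add: mult_le_cancel_left)
    qed simp
    then have "norm (\<beta> j (w n v)) * norm x \<le> norm x * norm x" by (intro mult_right_mono) auto
    with 2 show ?thesis by (simp add: v_def power2_eq_square)
  qed
  have "\<exists>s\<in>bounded_ops. norm s \<le> 1 \<and> (\<forall>x. (\<lambda>n. approx I \<beta> i j n x) \<longlonglongrightarrow> blinfun_apply s x)"
  proof (rule strong_limit_exists)
    show "approx I \<beta> i j n \<in> bounded_ops" for n
      unfolding approx_def using wb[of n] i j
      by (auto simp: w_def h_def intro!: bounded_ops_comp bops op_adj_bounded_ops)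
    show "norm (approx I \<beta> i j n) \<le> 1" for n
    proof (rule norm_blinfun_bound)
      fix x
      have "(norm (\<beta> i (w n (op_adj (\<beta> j) x))))\<^sup>2 \<le> (norm x)\<^sup>2"
        using order_trans[OF inc[of 0 n i "op_adj (\<beta> j) x"] order_trans[OF _ q[of n x]]] i by (simp add: w0)
      then show "norm (approx I \<beta> i j n x) \<le> 1 * norm x" by (simp add: ap)
    qed simp
    show "Cauchy (\<lambda>n. approx I \<beta> i j n x)" for x
    proof (rule Cauchy_increments[where C=1])
      let ?q = "\<lambda>n. Re (cinner (w n (op_adj (\<beta> j) x)) (op_adj (\<beta> j) x))"
      show "incseq ?q"
      proof (rule incseq_SucI)
        show "?q k \<le> ?q (Suc k)" for k
          using order_trans[OF zero_le_power2 inc[of k "Suc k" i "op_adj (\<beta> j) x"]] i by simp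
      qed
      show "?q n \<le> (norm x)\<^sup>2" for n by (rule q)
      show "(norm (approx I \<beta> i j n x - approx I \<beta> i j m x))\<^sup>2 \<le> 1 * (?q n - ?q m)" if "m \<le> n" for m n
        using inc[OF that i, of "op_adj (\<beta> j) x"] by (simp add: ap blinfun.diff_left blinfun.diff_right)
    qed simp
  qed
  then obtain s where s: "sot (approx I \<beta> i j) s" by (auto simp: sot_def)
  show ?thesis unfolding colproj_def
    by (rule theI[where P="sot (approx I \<beta> i j)"], rule s) (rule sot_unique[OF _ s])
qed

lemma approx_bounded_ops: "i \<in> I \<Longrightarrow> j \<in> I \<Longrightarrow> approx I \<beta> i j n \<in> bounded_ops"
  unfolding approx_def by (intro bounded_ops_intros bops op_adj_bounded_ops psd_bounded_ops res_psd colh_psd)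

lemma colproj_bounded_ops: "i \<in> I \<Longrightarrow> j \<in> I \<Longrightarrow> colproj I \<beta> i j \<in> bounded_ops"
  using colproj_sot by (simp add: sot_def)

lemma colproj_adj: assumes "i \<in> I" "j \<in> I" shows "op_adj (colproj I \<beta> j i) = colproj I \<beta> i j"
proof (rule sot_adj[OF colproj_sot])
  have "sa (res n (colh I \<beta>))" for n by (intro psd_sa res_psd colh_psd)
  then have "op_adj (approx I \<beta> j i n) = approx I \<beta> i j n" for n
    unfolding approx_def using assms
    by (simp add: op_adj_comp bounded_ops_intros bops op_adj_bounded_ops sa_def op_adj_scaleR comp_assoc)
  then show "sot (\<lambda>n. op_adj (approx I \<beta> j i n)) (colproj I \<beta> i j)"
    using colproj_sot[OF assms] by simp
qed (use assms approx_bounded_ops in auto)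

lemma kills_colh: "i \<in> I \<Longrightarrow> \<beta> i \<cdot> kerp (colh I \<beta>) = 0"
proof -
  assume i: "i \<in> I"
  have "colh I \<beta> (kerp (colh I \<beta>) x) = 0" for x
    using arg_cong[OF comp_kerp[OF colh_psd], of "\<lambda>f. blinfun_apply f x"] by simp
  then have "norm (\<beta> i (kerp (colh I \<beta>) x)) = 0" for x
    using col_le_colh[OF i, of "kerp (colh I \<beta>) x"] by simp
  then show ?thesis by (intro blinfun_eqI) simp
qed

text \<open>The approximants turn the column into \<open>\<beta> i \<cdot> (1 - res n h)\<close>,
  and the limiting defect \<open>\<beta> i \<cdot> kerp h\<close> vanishes.\<close>

lemma colproj_fix: assumes i: "i \<in> I" shows "(\<Sum>j\<in>I. colproj I \<beta> i j \<cdot> \<beta> j) = \<beta> i"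
proof (rule sot_unique)
  let ?h = "colh I \<beta>"
  show "sot (\<lambda>n. \<Sum>j\<in>I. approx I \<beta> i j n \<cdot> \<beta> j) (\<Sum>j\<in>I. colproj I \<beta> i j \<cdot> \<beta> j)"
    by (intro sot_sum sot_comp_right colproj_sot i bops)
  have "(\<Sum>j\<in>I. approx I \<beta> i j n \<cdot> \<beta> j) = \<beta> i - \<beta> i \<cdot> res n ?h" for n
  proof -
    have "(\<Sum>j\<in>I. approx I \<beta> i j n \<cdot> \<beta> j) = \<beta> i \<cdot> (real n *\<^sub>R (res n ?h \<cdot> ?h))"
      unfolding approx_def by (simp add: colh_def comp_assoc comp.sum_right comp.scaleR_left comp.scaleR_right scaleR_sum_right)
    moreover have "real n *\<^sub>R (res n ?h \<cdot> ?h) = id_blinfun - res n ?h"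
      using res_left[OF colh_psd, of n] by (simp add: eq_diff_eq add.commute)
    ultimately show ?thesis by (simp only: comp.diff_right comp_id)
  qed
  then have "(\<lambda>n. \<Sum>j\<in>I. approx I \<beta> i j n \<cdot> \<beta> j) = (\<lambda>n. \<beta> i - \<beta> i \<cdot> res n ?h)" by simp
  moreover have "sot (\<lambda>n. \<beta> i - \<beta> i \<cdot> res n ?h) (\<beta> i - \<beta> i \<cdot> kerp ?h)"
    by (intro sot_diff sot_const sot_comp_left kerp_sot colh_psd bops i)
  ultimately show "sot (\<lambda>n. \<Sum>j\<in>I. approx I \<beta> i j n \<cdot> \<beta> j) (\<beta> i)" by (simp add: kills_colh i)
qed

text \<open>Every approximant begins with an entry of the column, so a row that annihilates the
  column annihilates each approximant before the limit is taken.\<close>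

lemma colproj_left:
  assumes a: "\<And>i. i \<in> I \<Longrightarrow> a i \<in> bounded_ops" and z: "(\<Sum>i\<in>I. a i \<cdot> \<beta> i) = 0" and j: "j \<in> I"
  shows "(\<Sum>i\<in>I. a i \<cdot> colproj I \<beta> i j) = 0"
proof (rule sot_unique)
  show "sot (\<lambda>n. \<Sum>i\<in>I. a i \<cdot> approx I \<beta> i j n) (\<Sum>i\<in>I. a i \<cdot> colproj I \<beta> i j)"
    by (intro sot_sum sot_comp_left colproj_sot j a)
  have "(\<Sum>i\<in>I. a i \<cdot> approx I \<beta> i j n) = 0" for n
    unfolding approx_def comp_assoc[symmetric] comp.sum_left[symmetric] z by simp
  then show "sot (\<lambda>n. \<Sum>i\<in>I. a i \<cdot> approx I \<beta> i j n) 0" by (simp add: sot_const)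
qed

text \<open>Every approximant ends with an adjoint entry, where the multiplication by
  \<open>g\<close> can be carried out. In this way the range projection is compared with other
  projections that fix the row of adjoints.\<close>

lemma colproj_right:
  assumes g: "\<And>k. k \<in> I \<Longrightarrow> g k \<in> bounded_ops"
    and eq: "(\<Sum>k\<in>I. op_adj (\<beta> k) \<cdot> g k) = op_adj (\<beta> j)" and i: "i \<in> I" and j: "j \<in> I"
  shows "(\<Sum>k\<in>I. colproj I \<beta> i k \<cdot> g k) = colproj I \<beta> i j"
proof (rule sot_unique)
  show "sot (\<lambda>n. \<Sum>k\<in>I. approx I \<beta> i k n \<cdot> g k) (\<Sum>k\<in>I. colproj I \<beta> i k \<cdot> g k)"
    by (intro sot_sum sot_comp_right colproj_sot i g)
  have "(\<Sum>k\<in>I. approx I \<beta> i k n \<cdot> g k) = approx I \<beta> i j n" for n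
    unfolding approx_def comp_assoc comp.sum_right[symmetric] eq ..
  then show "sot (\<lambda>n. \<Sum>k\<in>I. approx I \<beta> i k n \<cdot> g k) (colproj I \<beta> i j)"
    using colproj_sot[OF i j] by simp
qed

lemma colproj_idem: assumes i: "i \<in> I" and j: "j \<in> I"
  shows "(\<Sum>k\<in>I. colproj I \<beta> i k \<cdot> colproj I \<beta> k j) = colproj I \<beta> i j"
proof (rule sot_unique)
  show "sot (\<lambda>n. \<Sum>k\<in>I. colproj I \<beta> i k \<cdot> approx I \<beta> k j n) (\<Sum>k\<in>I. colproj I \<beta> i k \<cdot> colproj I \<beta> k j)"
    by (intro sot_sum sot_comp_left colproj_sot j colproj_bounded_ops i)
  have "(\<Sum>k\<in>I. colproj I \<beta> i k \<cdot> approx I \<beta> k j n) = approx I \<beta> i j n" for n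
    unfolding approx_def comp_assoc[symmetric] comp.sum_left[symmetric] colproj_fix[OF i] ..
  then show "sot (\<lambda>n. \<Sum>k\<in>I. colproj I \<beta> i k \<cdot> approx I \<beta> k j n) (colproj I \<beta> i j)"
    using colproj_sot[OF i j] by simp
qed

end

section \<open>The rank function of a finite von Neumann algebra\<close>

text \<open>Normality is stated for increasing sequences with a strong limit, the form in which the
  limits below arise. Both \<open>A\<close> and \<open>B\<close> are instances with the same
  \<open>tr\<close>.\<close>

locale tracial_algebra =
  fixes A :: "('h::complex_hilbert \<Rightarrow>\<^sub>L 'h) set" and tr :: "('h \<Rightarrow>\<^sub>L 'h) \<Rightarrow> complex"
  assumes ops: "A \<subseteq> bounded_ops"
    and zero_in [simp]: "0 \<in> A"
    and add_in: "a \<in> A \<Longrightarrow> b \<in> A \<Longrightarrow> a + b \<in> A"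
    and scale_in: "a \<in> A \<Longrightarrow> op_scale c a \<in> A"
    and comp_in: "a \<in> A \<Longrightarrow> b \<in> A \<Longrightarrow> a \<cdot> b \<in> A"
    and adj_in: "a \<in> A \<Longrightarrow> op_adj a \<in> A"
    and bicommutant: "commutant (commutant A) = A"
    and tr_add: "a \<in> A \<Longrightarrow> b \<in> A \<Longrightarrow> tr (a + b) = tr a + tr b"
    and tr_scale: "a \<in> A \<Longrightarrow> tr (op_scale c a) = c * tr a"
    and tr_comm: "a \<in> A \<Longrightarrow> b \<in> A \<Longrightarrow> tr (a \<cdot> b) = tr (b \<cdot> a)"
    and tr_nonneg: "a \<in> A \<Longrightarrow> psd a \<Longrightarrow> tr a \<in> \<real>\<^sub>\<ge>\<^sub>0"
    and tr_faithful: "a \<in> A \<Longrightarrow> psd a \<Longrightarrow> tr a = 0 \<Longrightarrow> a = 0"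
    and tr_increasing: "(\<And>n. f n \<in> A) \<Longrightarrow> psd (f 0) \<Longrightarrow> (\<And>n. psd (f (Suc n) - f n)) \<Longrightarrow> sot f s \<Longrightarrow>
      (\<lambda>n. Re (tr (f n))) \<longlonglongrightarrow> Re (tr s)"
begin

definition \<tau> :: "('h \<Rightarrow>\<^sub>L 'h) \<Rightarrow> real" where "\<tau> a = Re (tr a)"

lemma bops: "a \<in> A \<Longrightarrow> a \<in> bounded_ops" using ops by blast

lemma bicommutantI:
  assumes "a \<in> bounded_ops" "\<And>S. S \<in> commutant A \<Longrightarrow> a \<cdot> S = S \<cdot> a"
  shows "a \<in> A"
  using assms bicommutant unfolding commutant_def[of "commutant A"] by blast

lemma commutant_commutes: "S \<in> commutant A \<Longrightarrow> a \<in> A \<Longrightarrow> S \<cdot> a = a \<cdot> S"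
  by (auto simp: commutant_def)

lemma id_in [simp]: "id_blinfun \<in> A" by (rule bicommutantI) auto

lemma scaleR_in: "a \<in> A \<Longrightarrow> r *\<^sub>R a \<in> A" by (simp add: scaleR_eq_op_scale scale_in)

lemma diff_in: "a \<in> A \<Longrightarrow> b \<in> A \<Longrightarrow> a - b \<in> A"
  using add_in[of a "(-1) *\<^sub>R b"] scaleR_in[of b "-1"] by simp

lemma sum_in: "(\<And>i. i \<in> I \<Longrightarrow> f i \<in> A) \<Longrightarrow> sum f I \<in> A"
  by (induction I rule: infinite_finite_induct) (auto intro: add_in)

lemma inverse_in:
  assumes "T \<in> A" "w \<in> bounded_ops" "T \<cdot> w = id_blinfun" "w \<cdot> T = id_blinfun"
  shows "w \<in> A"
  by (rule bicommutantI[OF assms(2)])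
     (metis assms(1,3,4) commutant_commutes inverse_commutes)

lemma sot_in: assumes "sot f s" "\<And>n. f n \<in> A" shows "s \<in> A"
proof (rule bicommutantI)
  show s: "s \<in> bounded_ops" using assms by (simp add: sot_def)
  fix S assume S: "S \<in> commutant A"
  then have Sb: "S \<in> bounded_ops" by (simp add: commutant_def)
  have "f n \<cdot> S = S \<cdot> f n" for n using commutant_commutes[OF S assms(2)] by simp
  then show "s \<cdot> S = S \<cdot> s"
    using sot_comp_right[OF Sb assms(1)] sot_comp_left[OF Sb assms(1)] by (auto intro: sot_unique)
qed

lemma res_in: "h \<in> A \<Longrightarrow> psd h \<Longrightarrow> res n h \<in> A"
  unfolding res_def
  by (rule inverse_in[where T="id_blinfun + real n *\<^sub>R h"])
     (auto intro!: add_in scaleR_in psd_bounded_ops inv1p_psd inv1p_right inv1p_left psd_scaleR)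

lemma kerp_in: "h \<in> A \<Longrightarrow> psd h \<Longrightarrow> kerp h \<in> A"
  using sot_in[OF kerp_sot] res_in by blast

lemmas in_intros = add_in scaleR_in diff_in sum_in comp_in adj_in scale_in zero_in id_in

lemma \<tau>_add: "a \<in> A \<Longrightarrow> b \<in> A \<Longrightarrow> \<tau> (a + b) = \<tau> a + \<tau> b" by (simp add: \<tau>_def tr_add)
lemma \<tau>_scaleR: "a \<in> A \<Longrightarrow> \<tau> (r *\<^sub>R a) = r * \<tau> a" by (simp add: \<tau>_def tr_scale scaleR_eq_op_scale)
lemma \<tau>_zero [simp]: "\<tau> 0 = 0" using \<tau>_scaleR[of 0 0] by simp
lemma \<tau>_diff: "a \<in> A \<Longrightarrow> b \<in> A \<Longrightarrow> \<tau> (a - b) = \<tau> a - \<tau> b"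
  using \<tau>_add[of "a - b" b] by (simp add: diff_in)
lemma \<tau>_sum: "(\<And>i. i \<in> I \<Longrightarrow> f i \<in> A) \<Longrightarrow> \<tau> (sum f I) = (\<Sum>i\<in>I. \<tau> (f i))"
  by (induction I rule: infinite_finite_induct) (auto simp: \<tau>_add sum_in)
lemma \<tau>_comm: "a \<in> A \<Longrightarrow> b \<in> A \<Longrightarrow> \<tau> (a \<cdot> b) = \<tau> (b \<cdot> a)" by (simp add: \<tau>_def tr_comm)
lemma \<tau>_nonneg: "a \<in> A \<Longrightarrow> psd a \<Longrightarrow> 0 \<le> \<tau> a"
  using tr_nonneg by (auto simp: \<tau>_def complex_nonneg_Reals_iff)
lemma \<tau>_mono: "a \<in> A \<Longrightarrow> b \<in> A \<Longrightarrow> psd (b - a) \<Longrightarrow> \<tau> a \<le> \<tau> b"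
  using \<tau>_nonneg[of "b - a"] by (simp add: \<tau>_diff diff_in)
lemma \<tau>_faithful: "a \<in> A \<Longrightarrow> psd a \<Longrightarrow> \<tau> a \<le> 0 \<Longrightarrow> a = 0"
  using tr_nonneg[of a] tr_faithful[of a] by (auto simp: \<tau>_def complex_nonneg_Reals_iff complex_eq_iff)
lemma \<tau>_adj_comp_zero: "a \<in> A \<Longrightarrow> \<tau> (op_adj a \<cdot> a) \<le> 0 \<Longrightarrow> a = 0"
  using \<tau>_faithful[of "op_adj a \<cdot> a"] adj_comp_zero[of a] by (auto simp: adj_in bops comp_in psd_adj_comp)

lemma \<tau>_decreasing:
  assumes f: "\<And>n. f n \<in> A" and dec: "\<And>n. psd (f n - f (Suc n))" and s: "sot f s"
  shows "(\<lambda>n. \<tau> (f n)) \<longlonglongrightarrow> \<tau> s"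
proof -
  have sA: "s \<in> A" by (rule sot_in[OF s f])
  have "(\<lambda>n. Re (tr (f 0 - f n))) \<longlonglongrightarrow> Re (tr (f 0 - s))"
    by (rule tr_increasing) (use f dec in \<open>auto intro: diff_in sot_diff[OF sot_const s] bops\<close>)
  then have "(\<lambda>n. \<tau> (f 0) - \<tau> (f n)) \<longlonglongrightarrow> \<tau> (f 0) - \<tau> s"
    by (simp flip: \<tau>_def add: \<tau>_diff f sA)
  from tendsto_diff[OF tendsto_const[of "\<tau> (f 0)"] this] show ?thesis by simp
qed

lemma \<tau>_kerp: "h \<in> A \<Longrightarrow> psd h \<Longrightarrow> (\<lambda>n. \<tau> (res n h)) \<longlonglongrightarrow> \<tau> (kerp h)"
  by (rule \<tau>_decreasing) (auto simp: res_in res_antimono kerp_sot)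

definition null :: "('h \<Rightarrow>\<^sub>L 'h) \<Rightarrow> ('h \<Rightarrow>\<^sub>L 'h)" where "null c = kerp (op_adj c \<cdot> c)"

text \<open>The algebra does not occur in this value: an element of \<open>B\<close> has the same
  nullity when it is regarded as an element of \<open>A\<close>.\<close>

definition \<nu> :: "('h \<Rightarrow>\<^sub>L 'h) \<Rightarrow> real" where "\<nu> c = \<tau> (null c)"

lemma null:
  assumes c: "c \<in> A"
  shows null_in: "null c \<in> A" and null_sa: "sa (null c)" and null_idem: "null c \<cdot> null c = null c"
    and comp_null: "c \<cdot> null c = 0" and null_fix: "y \<in> bounded_ops \<Longrightarrow> c \<cdot> y = 0 \<Longrightarrow> null c \<cdot> y = y"
proof -
  have p: "psd (op_adj c \<cdot> c)" by (intro psd_adj_comp bops c)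
  show "null c \<in> A" unfolding null_def by (intro kerp_in p in_intros c)
  show sa: "sa (null c)" and "null c \<cdot> null c = null c" unfolding null_def by (rule kerp_sa[OF p] kerp_idem[OF p])+
  show "c \<cdot> null c = 0"
  proof (rule blinfun_eqI)
    fix x
    have "(norm (c (null c x)))\<^sup>2 = 0"
      using norm_adj_comp_le[OF bops[OF c], of "null c x"]
        arg_cong[OF comp_kerp[OF p], of "\<lambda>f. blinfun_apply f x"] by (simp add: null_def)
    then show "(c \<cdot> null c) x = blinfun_apply 0 x" by simp
  qed
  show "null c \<cdot> y = y" if "y \<in> bounded_ops" "c \<cdot> y = 0"
    unfolding null_def by (rule kerp_fix[OF p that(1)]) (simp add: comp_assoc that)
qed

lemma proj_psd: "sa z \<Longrightarrow> z \<cdot> z = z \<Longrightarrow> psd z"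
  using psd_adj_comp[of z] by (simp add: sa_def)

lemma null_psd: "c \<in> A \<Longrightarrow> psd (null c)" by (intro proj_psd null)

lemma \<nu>_nonneg: "c \<in> A \<Longrightarrow> 0 \<le> \<nu> c" unfolding \<nu>_def by (intro \<tau>_nonneg null_in null_psd)

lemma proj_diff_psd:
  assumes "sa z" "z \<cdot> z = z" "sa n" "n \<cdot> n = n" "n \<cdot> z = z"
  shows "psd (n - z)"
proof -
  have "z \<cdot> n = z"
    using arg_cong[OF assms(5), of op_adj] assms(1,3) by (simp add: op_adj_comp sa_def)
  then show ?thesis using assms by (intro proj_psd) (auto simp: sa_diff comp_simps)
qed

lemma \<tau>_le_\<nu>:
  assumes "y \<in> A" "z \<in> A" "sa z" "z \<cdot> z = z" "y \<cdot> z = 0"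
  shows "\<tau> z \<le> \<nu> y"
  unfolding \<nu>_def using assms null[OF assms(1)] by (intro \<tau>_mono proj_diff_psd) (auto simp: bops)

lemma \<nu>_zero_iff: "c \<in> A \<Longrightarrow> \<nu> c \<le> 0 \<longleftrightarrow> null c = 0"
  using \<tau>_faithful[OF null_in null_psd] by (auto simp: \<nu>_def)

lemma \<nu>_zero_iff_cancel: "c \<in> A \<Longrightarrow> \<nu> c \<le> 0 \<longleftrightarrow> (\<forall>y\<in>A. c \<cdot> y = 0 \<longrightarrow> y = 0)"
  unfolding \<nu>_zero_iff by (metis bops comp.zero_left comp_null null_fix null_in)

lemma \<nu>_id [simp]: "\<nu> id_blinfun = 0"
  using \<nu>_zero_iff_cancel[of id_blinfun] \<nu>_nonneg[of id_blinfun] by simp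

section \<open>Projections with entries in the algebra and their traces\<close>

definition pmat :: "'i set \<Rightarrow> ('i \<Rightarrow> 'i \<Rightarrow> 'h \<Rightarrow>\<^sub>L 'h) \<Rightarrow> bool" where
  "pmat I g \<longleftrightarrow> (\<forall>i\<in>I. \<forall>j\<in>I. g i j \<in> A \<and> op_adj (g j i) = g i j \<and> (\<Sum>k\<in>I. g i k \<cdot> g k j) = g i j)"

lemma pmatD:
  assumes "pmat I g" "i \<in> I" "j \<in> I"
  shows pmat_in: "g i j \<in> A" and pmat_adj: "op_adj (g j i) = g i j" and pmat_idem: "(\<Sum>k\<in>I. g i k \<cdot> g k j) = g i j"
  using assms by (auto simp: pmat_def)

lemma pmat_diag:
  assumes g: "pmat I g" and i: "i \<in> I"
  shows "g i i = (\<Sum>k\<in>I. op_adj (g k i) \<cdot> g k i)"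
  using pmat_idem[OF g i i] pmat_adj[OF g i] by simp

lemma pmat_diag_psd: "pmat I g \<Longrightarrow> i \<in> I \<Longrightarrow> psd (g i i)"
  by (subst pmat_diag) (auto intro!: psd_sum psd_adj_comp bops simp: pmat_in)

lemma pmat_diag_ge: 
  assumes g: "pmat I g" and fin: "finite I" and i: "i \<in> I" and j: "j \<in> I"
  shows "psd (g j j - (op_adj (g i j) \<cdot> g i j))"
proof -
  have "g j j - (op_adj (g i j) \<cdot> g i j) = (\<Sum>k\<in>I - {i}. op_adj (g k j) \<cdot> g k j)"
    by (subst pmat_diag[OF g j]) (simp add: sum.remove[OF fin i])
  also have "psd \<dots>" by (intro psd_sum psd_adj_comp bops pmat_in[OF g]) (use j in auto)
  finally show ?thesis .
qed

lemma pmat_diff: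
  assumes g: "pmat I g" and r: "pmat I r"
    and rg: "\<And>i j. i \<in> I \<Longrightarrow> j \<in> I \<Longrightarrow> (\<Sum>k\<in>I. r i k \<cdot> g k j) = r i j"
  shows "pmat I (\<lambda>i j. g i j - r i j)"
  unfolding pmat_def
proof (intro ballI conjI)
  fix i j assume i: "i \<in> I" and j: "j \<in> I"
  show "g i j - r i j \<in> A" by (intro diff_in pmat_in[OF g i j] pmat_in[OF r i j])
  show "op_adj (g j i - r j i) = g i j - r i j"
    by (simp add: op_adj_diff bops pmat_in[OF g j i] pmat_in[OF r j i] pmat_adj[OF g i j] pmat_adj[OF r i j])
  \<comment> \<open>The hypothesis is the product \<open>r g = r\<close>; its adjoint supplies the
    product in the other order.\<close>
  have "op_adj (\<Sum>k\<in>I. r j k \<cdot> g k i) = (\<Sum>k\<in>I. g i k \<cdot> r k j)"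
    by (subst op_adj_sum)
       (auto intro!: bounded_ops_comp sum.cong simp: pmat_in[OF g] pmat_in[OF r] op_adj_comp
          pmat_adj[OF g] pmat_adj[OF r] bops i j)
  then have gr: "(\<Sum>k\<in>I. g i k \<cdot> r k j) = r i j" using rg[OF j i] pmat_adj[OF r i j] by simp
  show "(\<Sum>k\<in>I. (g i k - r i k) \<cdot> (g k j - r k j)) = g i j - r i j"
    by (simp add: comp_simps sum_subtractf gr rg[OF i j] pmat_idem[OF g i j] pmat_idem[OF r i j])
qed

definition Tr :: "'i set \<Rightarrow> ('i \<Rightarrow> 'i \<Rightarrow> 'h \<Rightarrow>\<^sub>L 'h) \<Rightarrow> real" where
  "Tr I g = (\<Sum>i\<in>I. \<tau> (g i i))"

lemma Tr_nonneg: "pmat I g \<Longrightarrow> 0 \<le> Tr I g"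
  unfolding Tr_def by (intro sum_nonneg \<tau>_nonneg pmat_in pmat_diag_psd)

lemma Tr_mono:
  assumes "pmat I g" "pmat I r" "\<And>i j. i \<in> I \<Longrightarrow> j \<in> I \<Longrightarrow> (\<Sum>k\<in>I. r i k \<cdot> g k j) = r i j"
  shows "Tr I r \<le> Tr I g"
  using Tr_nonneg[OF pmat_diff[OF assms]] assms
  by (simp add: Tr_def \<tau>_diff pmat_in sum_subtractf)

context
  fixes I :: "'i set" and \<beta> :: "'i \<Rightarrow> 'h \<Rightarrow>\<^sub>L 'h"
  assumes fin: "finite I" and bA: "\<And>i. i \<in> I \<Longrightarrow> \<beta> i \<in> A"
begin

lemma colh_in: "colh I \<beta> \<in> A" unfolding colh_def by (intro in_intros bA)

lemma colh_psd': "psd (colh I \<beta>)" by (intro colh_psd fin bops bA)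

lemma approx_in: "i \<in> I \<Longrightarrow> j \<in> I \<Longrightarrow> approx I \<beta> i j n \<in> A"
  unfolding approx_def by (intro in_intros bA res_in colh_in colh_psd')

lemma colproj_in: "i \<in> I \<Longrightarrow> j \<in> I \<Longrightarrow> colproj I \<beta> i j \<in> A"
  using sot_in[OF colproj_sot[where \<beta>=\<beta>, OF fin bops[OF bA]]] approx_in by blast

lemma colproj_pmat: "pmat I (colproj I \<beta>)"
  unfolding pmat_def
  using colproj_in colproj_adj[where \<beta>=\<beta>, OF fin bops[OF bA]] colproj_idem[where \<beta>=\<beta>, OF fin bops[OF bA]] by blast

text \<open>Rank plus nullity for a column. By the trace property the diagonal of the
  \<open>n\<close>-th approximant has trace \<tau>(n res n h \<cdot> h), which equals \<tau>(1 - res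
  n h), and normality allows passing to the limit on both sides.\<close>

lemma Tr_colproj: "Tr I (colproj I \<beta>) = \<tau> id_blinfun - \<tau> (kerp (colh I \<beta>))"
proof (rule LIMSEQ_unique)
  let ?h = "colh I \<beta>"
  have "(\<lambda>n. Re (tr (approx I \<beta> i i n))) \<longlonglongrightarrow> Re (tr (colproj I \<beta> i i))" if i: "i \<in> I" for i
  proof (rule tr_increasing)
    show "approx I \<beta> i i n \<in> A" for n by (intro approx_in i)
    show "psd (approx I \<beta> i i 0)" by (simp add: approx_def)
    show "psd (approx I \<beta> i i (Suc n) - approx I \<beta> i i n)" for n
    proof -
      define d where "d = real (Suc n) *\<^sub>R res (Suc n) ?h - real n *\<^sub>R res n ?h"
      have "psd d"
        unfolding psd_def d_def
      proof (intro conjI allI)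
        show "sa (real (Suc n) *\<^sub>R res (Suc n) ?h - real n *\<^sub>R res n ?h)"
          by (intro sa_diff sa_scaleR psd_sa res_psd colh_psd')
        show "0 \<le> Re (cinner ((real (Suc n) *\<^sub>R res (Suc n) ?h - real n *\<^sub>R res n ?h) x) x)" for x
          using order_trans[OF psd_nonneg[OF colh_psd'] resolvent_increment[OF colh_psd', of n "Suc n" x]]
          by (simp add: blinfun.diff_left cinner.diff_left)
      qed
      from psd_conj[OF this op_adj_bounded_ops[OF bops[OF bA[OF i]]]]
      show ?thesis by (simp add: approx_def d_def comp_simps bops bA i)
    qed
    show "sot (approx I \<beta> i i) (colproj I \<beta> i i)" by (rule colproj_sot[where \<beta>=\<beta>, OF fin bops[OF bA] i i])
  qed
  then show "(\<lambda>n. \<Sum>i\<in>I. \<tau> (approx I \<beta> i i n)) \<longlonglongrightarrow> Tr I (colproj I \<beta>)"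
    unfolding Tr_def \<tau>_def by (intro tendsto_sum)
  have "(\<Sum>i\<in>I. \<tau> (approx I \<beta> i i n)) = \<tau> id_blinfun - \<tau> (res n ?h)" for n
  proof -
    let ?w = "real n *\<^sub>R res n ?h"
    have w: "?w \<in> A" by (intro in_intros res_in colh_in colh_psd')
    have "\<tau> (approx I \<beta> i i n) = \<tau> (?w \<cdot> (op_adj (\<beta> i) \<cdot> \<beta> i))" if "i \<in> I" for i
    proof -
      have "\<tau> (approx I \<beta> i i n) = \<tau> (\<beta> i \<cdot> (?w \<cdot> op_adj (\<beta> i)))" by (simp add: approx_def comp_assoc)
      also have "\<dots> = \<tau> ((?w \<cdot> op_adj (\<beta> i)) \<cdot> \<beta> i)" by (intro \<tau>_comm in_intros bA that w)
      finally show ?thesis by (simp only: comp_assoc)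
    qed
    then have "(\<Sum>i\<in>I. \<tau> (approx I \<beta> i i n)) = (\<Sum>i\<in>I. \<tau> (?w \<cdot> (op_adj (\<beta> i) \<cdot> \<beta> i)))" by simp
    also have "\<dots> = \<tau> (?w \<cdot> ?h)"
      unfolding colh_def comp.sum_right[of _ _ I] by (subst \<tau>_sum) (use w in \<open>auto simp: colh_def intro!: comp_in adj_in bA\<close>)
    also have "?w \<cdot> ?h = id_blinfun - res n ?h"
      using res_left[OF colh_psd', of n] by (simp add: comp_simps eq_diff_eq add.commute)
    also have "\<tau> (id_blinfun - res n ?h) = \<tau> id_blinfun - \<tau> (res n ?h)"
      by (intro \<tau>_diff in_intros res_in colh_in colh_psd')
    finally show ?thesis .
  qed
  then show "(\<lambda>n. \<Sum>i\<in>I. \<tau> (approx I \<beta> i i n)) \<longlonglongrightarrow> \<tau> id_blinfun - \<tau> (kerp ?h)"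
    by (simp add: tendsto_diff \<tau>_kerp colh_in colh_psd')
qed

end

definition rowh :: "'i set \<Rightarrow> ('i \<Rightarrow> 'h \<Rightarrow>\<^sub>L 'h) \<Rightarrow> ('h \<Rightarrow>\<^sub>L 'h)" where
  "rowh I \<rho> = (\<Sum>i\<in>I. \<rho> i \<cdot> op_adj (\<rho> i))"

lemma rowh:
  assumes "finite I" "\<And>i. i \<in> I \<Longrightarrow> \<rho> i \<in> A"
  shows rowh_colh: "colh I (\<lambda>i. op_adj (\<rho> i)) = rowh I \<rho>"
    and rowh_psd: "psd (rowh I \<rho>)" and rowh_in: "rowh I \<rho> \<in> A"
    and kerp_rowh: "i \<in> I \<Longrightarrow> kerp (rowh I \<rho>) \<cdot> \<rho> i = 0"
proof -
  show e: "colh I (\<lambda>i. op_adj (\<rho> i)) = rowh I \<rho>"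
    unfolding colh_def rowh_def by (intro sum.cong refl) (simp add: bops assms)
  show p: "psd (rowh I \<rho>)" unfolding e[symmetric] by (intro colh_psd' assms adj_in)
  show "rowh I \<rho> \<in> A" unfolding e[symmetric] by (intro colh_in assms adj_in)
  assume i: "i \<in> I"
  have "op_adj (\<rho> i) \<cdot> kerp (rowh I \<rho>) = 0"
    using kills_colh[where \<beta>="\<lambda>i. op_adj (\<rho> i)", OF assms(1) bops[OF adj_in[OF assms(2)]] i] by (simp add: e)
  then have "op_adj (op_adj (\<rho> i) \<cdot> kerp (rowh I \<rho>)) = 0" by simp
  then show "kerp (rowh I \<rho>) \<cdot> \<rho> i = 0"
    using kerp_sa[OF p] by (simp add: op_adj_comp bops adj_in assms i sa_def)
qed

text \<open>Since \<open>g\<close> fixes the row, it dominates the range projection of the column of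
  adjoints, whose trace is known from \<open>Tr_colproj\<close>.\<close>

lemma row_rank_le:
  assumes fin: "finite I" and r: "\<And>i. i \<in> I \<Longrightarrow> \<rho> i \<in> A" and g: "pmat I g"
    and fixg: "\<And>j. j \<in> I \<Longrightarrow> (\<Sum>i\<in>I. \<rho> i \<cdot> g i j) = \<rho> j"
  shows "\<tau> id_blinfun - \<tau> (kerp (rowh I \<rho>)) \<le> Tr I g"
proof -
  let ?b = "\<lambda>i. op_adj (\<rho> i)"
  have bA: "?b i \<in> A" if "i \<in> I" for i by (intro adj_in r that)
  have "Tr I (colproj I ?b) \<le> Tr I g"
  proof (rule Tr_mono[OF g colproj_pmat[OF fin bA]])
    fix i j assume i: "i \<in> I" and j: "j \<in> I"
    show "(\<Sum>k\<in>I. colproj I ?b i k \<cdot> g k j) = colproj I ?b i j"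
      by (rule colproj_right[OF fin bops[OF bA] bops[OF pmat_in[OF g _ j]] _ i j])
         (simp_all add: bops r j fixg)
  qed
  then show ?thesis by (simp add: Tr_colproj[where \<beta>="?b", OF fin bA] rowh_colh[OF fin r])
qed

lemma null_colh: "kerp (colh {()} (\<lambda>_. c)) = null c"
  by (simp add: colh_def null_def)

text \<open>The range projection of \<open>c\<close> has trace
  \<open>\<tau> id_blinfun - \<nu> c\<close>, and its complement is the kernel projection of the
  adjoint. This does the work of a polar decomposition.\<close>

lemma \<nu>_adj: assumes c: "c \<in> A" shows "\<nu> (op_adj c) = \<nu> c"
proof -
  define P where "P = colproj {()} (\<lambda>_. c) () ()"
  note [simp] = c bops[OF c]
  have P: "P \<in> A" "sa P" "P \<cdot> c = c"
    unfolding P_def sa_def using colproj_in[of "{()}" "\<lambda>_. c"] colproj_adj[of "{()}" "\<lambda>_. c"] colproj_fix[of "{()}" "\<lambda>_. c"]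
    by (simp_all add: bops)
  have tr: "\<tau> P = \<tau> id_blinfun - \<nu> c"
    using Tr_colproj[of "{()}" "\<lambda>_. c"] by (simp add: Tr_def P_def \<nu>_def null_colh)
  let ?k = "null (op_adj c)"
  note n = null[OF adj_in[OF c]]
  have "op_adj (op_adj c \<cdot> ?k) = 0" by (simp add: comp_null adj_in)
  then have "?k \<cdot> c = 0" using n(2) by (simp add: op_adj_comp op_adj_bounded_ops sa_def)
  then have "?k \<cdot> P = 0"
    using colproj_left[of "{()}" "\<lambda>_. c" "\<lambda>_. ?k" "()"] by (simp add: P_def bops n(1))
  have "op_adj c \<cdot> P = op_adj (P \<cdot> c)" using P(2) by (simp add: op_adj_comp sa_def)
  then have "op_adj c \<cdot> P = op_adj c" by (simp add: P)
  then have "op_adj c \<cdot> (id_blinfun - P) = 0" by (simp add: comp_simps)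
  from n(5)[OF _ this] have "?k \<cdot> (id_blinfun - P) = id_blinfun - P"
    by (simp add: bounded_ops_diff bops P)
  then have "?k = id_blinfun - P" using \<open>?k \<cdot> P = 0\<close> by (simp add: comp_simps)
  then show ?thesis unfolding \<nu>_def[of "op_adj c"] using tr by (simp add: \<tau>_diff P)
qed

text \<open>Let \<open>g\<close> be the difference of the kernel projections of
  \<open>u \<cdot> c\<close> and of \<open>c\<close>. Then \<open>c\<close> is injective on the
  range of \<open>g\<close> and maps it into the kernel of \<open>u\<close>, which bounds the trace
  of \<open>g\<close> by \<open>\<nu> u\<close>.\<close>

lemma \<nu>_comp_le: assumes u: "u \<in> A" and c: "c \<in> A" shows "\<nu> (u \<cdot> c) \<le> \<nu> u + \<nu> c"
proof -
  let ?k1 = "null c" and ?k2 = "null (u \<cdot> c)"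
  have uc: "u \<cdot> c \<in> A" by (intro comp_in u c)
  note n1 = null[OF c] and n2 = null[OF uc] and nu = null[OF u]
  have k21: "?k2 \<cdot> ?k1 = ?k1" by (rule n2(5)) (simp_all add: bops n1 comp_assoc)
  have k12: "?k1 \<cdot> ?k2 = ?k1"
    using arg_cong[OF k21, of op_adj] n1(2) n2(2) by (simp add: op_adj_comp sa_def)
  define g where "g = ?k2 - ?k1"
  have g: "g \<in> A" "sa g" "g \<cdot> g = g"
    by (simp_all add: g_def diff_in n1 n2 sa_diff comp_simps k21 k12)
  define y where "y = c \<cdot> g"
  have y: "y \<in> A" by (simp add: y_def comp_in c g)
  have "c \<cdot> g = c \<cdot> ?k2" by (simp add: g_def comp_simps n1)
  then have "u \<cdot> y = 0" using n2(4) by (simp add: y_def comp_assoc)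
  then have "null u \<cdot> y = y" by (intro nu(5) bops y)
  moreover have "op_adj (null u \<cdot> y) = op_adj y \<cdot> null u"
    using nu(2) by (simp add: op_adj_comp bops y sa_def)
  ultimately have "op_adj y \<cdot> null u = op_adj y" by simp
  then have yu: "op_adj y \<cdot> (id_blinfun - null u) = 0" by (simp add: comp_simps)
  \<comment> \<open>The range of \<open>y\<close> lies under \<open>null u\<close>, which bounds the
    nullity of the adjoint from below; \<open>\<nu>_adj\<close> carries this over to
    \<open>y\<close>, whose rank turns out to be \<open>\<tau> g\<close>.\<close>
  have 1: "\<tau> (id_blinfun - null u) \<le> \<nu> (op_adj y)"
    by (rule \<tau>_le_\<nu>[OF adj_in[OF y] _ _ _ yu]) (simp_all add: diff_in nu sa_diff comp_simps)
  have yg: "y \<cdot> (id_blinfun - g) = 0" by (simp add: y_def comp_simps comp_assoc g)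
  let ?n = "null y"
  have "c \<cdot> (g \<cdot> ?n) = 0" using null(4)[OF y] by (simp add: y_def comp_assoc)
  then have "?k1 \<cdot> (g \<cdot> ?n) = g \<cdot> ?n" by (intro n1(5) bops comp_in g null_in y)
  moreover have "?k1 \<cdot> g = 0" by (simp add: g_def comp_simps k12 n1)
  ultimately have gn: "g \<cdot> ?n = 0" by (simp flip: comp_assoc)
  have "?n \<cdot> (id_blinfun - g) = id_blinfun - g" by (rule null(5)[OF y _ yg]) (simp add: bops diff_in g)
  moreover have "?n \<cdot> g = 0"
    using arg_cong[OF gn, of op_adj] g null_sa[OF y] by (simp add: op_adj_comp sa_def)
  ultimately have "?n = id_blinfun - g" by (simp add: comp_simps)
  then have "\<nu> y = \<tau> id_blinfun - \<tau> g" by (simp add: \<nu>_def[of y] \<tau>_diff g)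
  then have "\<tau> g \<le> \<nu> u" using 1 \<nu>_adj[OF y] nu(1) by (simp add: \<tau>_diff \<nu>_def[of u])
  then show ?thesis using n1(1) n2(1) by (simp add: g_def \<tau>_diff \<nu>_def)
qed

text \<open>The Ore condition, in the graded form that also bounds the rank. The column \<open>(c, a)\<close> spans
  the graph of \<open>a c\<^sup>-\<^sup>1\<close>; the second row of the projection onto it yields \<open>u a = x c\<close>.\<close>

lemma ore:
  assumes a: "a \<in> A" and c: "c \<in> A"
  shows "\<exists>u\<in>A. \<exists>x\<in>A. u \<cdot> a = x \<cdot> c \<and> \<nu> u \<le> \<nu> c"
proof -
  \<comment> \<open>\<open>True\<close> indexes the denominator \<open>c\<close>,
    \<open>False\<close> the numerator \<open>a\<close>.\<close>
  define \<beta> where "\<beta> = (\<lambda>b. if b then c else a)"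
  define P where "P = colproj UNIV \<beta>"
  have bA: "\<beta> i \<in> A" if "i \<in> UNIV" for i using a c by (simp add: \<beta>_def)
  have S: "(\<Sum>k\<in>UNIV. f k) = f True + f False" for f :: "bool \<Rightarrow> 'h \<Rightarrow>\<^sub>L 'h" by (simp add: UNIV_bool add.commute)
  have Pm: "pmat UNIV P" unfolding P_def by (rule colproj_pmat[OF _ bA]) auto
  have PA: "P i j \<in> A" and Padj: "op_adj (P i j) = P j i"
    and PP: "P i True \<cdot> P True j + P i False \<cdot> P False j = P i j" for i j
    using pmat_in[OF Pm, of i j] pmat_adj[OF Pm, of j i] pmat_idem[OF Pm, of i j] by (simp_all add: S)
  have fixP: "P i True \<cdot> c + P i False \<cdot> a = \<beta> i" for i
    using colproj_fix[of UNIV \<beta> i] bA by (simp add: S P_def bops \<beta>_def)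
  have Psa: "sa (P i i)" for i by (simp add: sa_def bops PA Padj)
  \<comment> \<open>Row \<open>False\<close> of the equation \<open>P \<beta> = \<beta>\<close>
    reads \<open>P False True \<cdot> c + P False False \<cdot> a = a\<close>.\<close>
  define u where "u = id_blinfun - P False False"
  have u: "u \<in> A" by (simp add: u_def diff_in PA)
  have eq: "u \<cdot> a = P False True \<cdot> c"
    using fixP[of False] by (simp add: u_def comp_simps \<beta>_def algebra_simps)
  let ?k = "null u"
  note n = null[OF u]
  have Pk: "P False False \<cdot> ?k = ?k" using n(4) by (simp add: u_def comp_simps)
  have kP: "?k \<cdot> P False False = ?k"
    using arg_cong[OF Pk, of op_adj] n(2) by (simp add: op_adj_comp bops PA Padj sa_def)
  \<comment> \<open>\<open>P False False\<close> acts as the identity on the kernel of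
    \<open>u\<close>. Compressing \<open>P P = P\<close> to this kernel leaves no room for the
    off-diagonal entry.\<close>
  have kP2: "?k \<cdot> P False True = 0"
  proof -
    have "op_adj (op_adj (?k \<cdot> P False True)) \<cdot> op_adj (?k \<cdot> P False True)
        = ?k \<cdot> (P False True \<cdot> P True False) \<cdot> ?k"
      using n(1,2) by (simp add: op_adj_comp bops PA Padj sa_def comp_assoc comp_in)
    also have "P False True \<cdot> P True False = P False False - P False False \<cdot> P False False"
      using PP[of False False] by (simp add: eq_diff_eq)
    also have "?k \<cdot> (P False False - P False False \<cdot> P False False) \<cdot> ?k = 0"
      by (simp add: comp_simps comp_assoc Pk kP n(3))
    finally have "op_adj (?k \<cdot> P False True) = 0"
      by (rule adj_comp_zero[rotated]) (intro bops adj_in comp_in n(1) PA)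
    then have "op_adj (op_adj (?k \<cdot> P False True)) = 0" by simp
    then show ?thesis by (subst (asm) op_adj_adj) (intro bops comp_in n(1) PA)
  qed
  have Pk2: "P True False \<cdot> ?k = 0"
    using arg_cong[OF kP2, of op_adj] n(1,2) by (simp add: op_adj_comp bops PA Padj sa_def)
  \<comment> \<open>The kernel of \<open>u\<close> splits off: \<open>P'\<close> is still a
    projection and still fixes the row \<open>P True\<close>, but its trace is smaller by
    \<open>\<nu> u\<close>.\<close>
  define P' where "P' = (\<lambda>i j. if i \<or> j then P i j else P i j - ?k)"
  have P'm: "pmat UNIV P'"
    unfolding pmat_def
  proof (intro ballI conjI)
    fix i j
    show "P' i j \<in> A" by (simp add: P'_def PA diff_in n)
    show "op_adj (P' j i) = P' i j"
      using n(1,2) by (auto simp: P'_def Padj op_adj_diff bops PA sa_def)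
    show "(\<Sum>k\<in>UNIV. P' i k \<cdot> P' k j) = P' i j"
      using PP[of i j] by (cases i; cases j) (simp_all add: S P'_def comp_simps kP Pk kP2 Pk2 n(3) algebra_simps)
  qed
  define \<rho> where "\<rho> = P True"
  have rank: "\<tau> id_blinfun - \<tau> (kerp (rowh UNIV \<rho>)) \<le> Tr UNIV P'"
  proof (rule row_rank_le[OF _ _ P'm])
    show "(\<Sum>i\<in>UNIV. \<rho> i \<cdot> P' i j) = \<rho> j" for j
      using PP[of True j] by (cases j) (simp_all add: S \<rho>_def P'_def comp_simps Pk2 algebra_simps)
  qed (simp_all add: \<rho>_def PA)
  have r: "rowh UNIV \<rho> = P True True"
    using PP[of True True] by (simp add: rowh_def \<rho>_def S Padj)
  have rho: "finite (UNIV :: bool set)" "\<And>i. i \<in> UNIV \<Longrightarrow> \<rho> i \<in> A" by (simp_all add: \<rho>_def PA)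
  \<comment> \<open>\<open>?z\<close> annihilates the row \<open>P True\<close>, hence also
    \<open>c\<close>, which is this row applied to the column; so its trace is at most
    \<open>\<nu> c\<close>.\<close>
  let ?z = "kerp (P True True)"
  have pp: "psd (P True True)" by (rule pmat_diag_psd[OF Pm]) simp
  have z: "?z \<in> A" by (intro kerp_in PA pp)
  have "?z \<cdot> (P True True \<cdot> c + P True False \<cdot> a) = 0"
    using kerp_rowh[where i=True and \<rho>=\<rho>, OF rho] kerp_rowh[where i=False and \<rho>=\<rho>, OF rho] unfolding r
    by (simp add: comp_simps \<rho>_def flip: comp_assoc)
  then have "?z \<cdot> c = 0" by (simp add: fixP \<beta>_def)
  moreover have "op_adj (?z \<cdot> c) = op_adj c \<cdot> ?z"
    using kerp_sa[OF pp] by (simp add: op_adj_comp bops c z sa_def)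
  ultimately have "op_adj c \<cdot> ?z = 0" by simp
  then have "\<tau> ?z \<le> \<nu> c"
    using \<tau>_le_\<nu>[OF adj_in[OF c] z kerp_sa[OF pp] kerp_idem[OF pp]] by (simp add: \<nu>_adj c)
  moreover have "Tr UNIV P' = Tr UNIV P - \<nu> u"
    by (simp add: Tr_def UNIV_bool P'_def \<tau>_diff PA n \<nu>_def)
  moreover have "Tr UNIV P \<le> \<tau> id_blinfun"
  proof -
    have hp: "psd (colh UNIV \<beta>)" by (rule colh_psd'[OF _ bA]) simp_all
    have "0 \<le> \<tau> (kerp (colh UNIV \<beta>))"
      by (intro \<tau>_nonneg kerp_in hp proj_psd kerp_sa kerp_idem colh_in[OF _ bA]) simp_all
    then show ?thesis using Tr_colproj[of UNIV \<beta>] bA by (simp add: P_def)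
  qed
  \<comment> \<open>Counting traces: \<open>\<tau> id_blinfun - \<tau> ?z \<le> Tr UNIV P' = Tr UNIV
    P - \<nu> u \<le> \<tau> id_blinfun - \<nu> u\<close>, and
    \<open>\<tau> ?z \<le> \<nu> c\<close>.\<close>
  ultimately have "\<nu> u \<le> \<nu> c" using rank r by simp
  then show ?thesis using eq u PA by blast
qed

end

section \<open>The left regular representation\<close>

text \<open>The graph of an affiliated operator is a closed subspace of this direct sum, so that the
  orthogonal projection onto the graph is available.\<close>

instantiation prod :: (complex_hilbert, complex_hilbert) complex_hilbert
begin

definition scaleC_prod :: "complex \<Rightarrow> 'a \<times> 'b \<Rightarrow> 'a \<times> 'b" where
  "scaleC_prod c z = (c *\<^sub>C fst z, c *\<^sub>C snd z)"

definition cinner_prod :: "'a \<times> 'b \<Rightarrow> 'a \<times> 'b \<Rightarrow> complex" where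
  "cinner_prod z w = cinner (fst z) (fst w) + cinner (snd z) (snd w)"

instance
proof
  fix x y z :: "'a \<times> 'b" and c d :: complex and r :: real
  show "c *\<^sub>C (x + y) = c *\<^sub>C x + c *\<^sub>C y" by (simp add: scaleC_prod_def scaleC_add_right)
  show "(c + d) *\<^sub>C x = c *\<^sub>C x + d *\<^sub>C x" by (simp add: scaleC_prod_def scaleC_add_left)
  show "c *\<^sub>C d *\<^sub>C x = (c * d) *\<^sub>C x" by (simp add: scaleC_prod_def scaleC_scaleC)
  show "complex_of_real r *\<^sub>C x = r *\<^sub>R x" by (simp add: scaleC_prod_def scaleC_of_real prod_eq_iff)
  show "cinner x y = cnj (cinner y x)"
    unfolding cinner_prod_def complex_cnj_add by (simp flip: cinner_commute)
  show "cinner (x + y) z = cinner x z + cinner y z" by (simp add: cinner_prod_def cinner_add_left)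
  show "cinner (c *\<^sub>C x) y = c * cinner x y"
    by (simp add: cinner_prod_def scaleC_prod_def cinner_scaleC_left distrib_left)
  show "cinner x x = complex_of_real ((norm x)\<^sup>2)"
    by (simp add: cinner_prod_def cinner_self norm_prod_def)
qed

end

lemma norm_adj_le: assumes T: "T \<in> bounded_ops" shows "norm (op_adj T) \<le> norm T"
proof (rule norm_blinfun_bound)
  fix x
  have "(norm (op_adj T x))\<^sup>2 = Re (cinner (T (op_adj T x)) x)"
    using op_adj[OF T, of "op_adj T x" x] by (simp add: Re_cinner_self)
  also have "\<dots> \<le> norm (T (op_adj T x)) * norm x" by (rule Re_cinner_le)
  also have "\<dots> \<le> (norm T * norm (op_adj T x)) * norm x" by (intro mult_right_mono norm_blinfun) simp
  finally show "norm (op_adj T x) \<le> norm T * norm x"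
    by (cases "norm (op_adj T x) = 0") (auto simp: power2_eq_square algebra_simps)
qed simp

locale l2_algebra = tracial_algebra A tr
  for A :: "('h::complex_hilbert \<Rightarrow>\<^sub>L 'h) set" and tr +
  fixes \<iota> :: "('h \<Rightarrow>\<^sub>L 'h) \<Rightarrow> 'l::complex_hilbert"
  assumes l2: "l2_completion A tr \<iota>"
begin

lemma \<iota>_add: "a \<in> A \<Longrightarrow> b \<in> A \<Longrightarrow> \<iota> (a + b) = \<iota> a + \<iota> b"
  and \<iota>_scale: "a \<in> A \<Longrightarrow> \<iota> (op_scale c a) = c *\<^sub>C \<iota> a"
  and \<iota>_cinner: "a \<in> A \<Longrightarrow> b \<in> A \<Longrightarrow> cinner (\<iota> a) (\<iota> b) = tr (a \<cdot> op_adj b)"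
  and \<iota>_dense: "closure (\<iota> ` A) = UNIV"
  using l2 unfolding l2_completion_def by auto

lemma \<iota>_scaleR: "a \<in> A \<Longrightarrow> \<iota> (r *\<^sub>R a) = r *\<^sub>R \<iota> a"
  by (simp add: scaleR_eq_op_scale \<iota>_scale scaleC_of_real)

lemma \<iota>_diff: "a \<in> A \<Longrightarrow> b \<in> A \<Longrightarrow> \<iota> (a - b) = \<iota> a - \<iota> b"
  using \<iota>_add[of "a - b" b] by (simp add: diff_in)

lemma \<iota>_norm: assumes "a \<in> A" shows "(norm (\<iota> a))\<^sup>2 = \<tau> (a \<cdot> op_adj a)" "(norm (\<iota> a))\<^sup>2 = \<tau> (op_adj a \<cdot> a)"
  using \<tau>_comm[OF assms adj_in[OF assms]] by (simp_all flip: Re_cinner_self add: \<tau>_def \<iota>_cinner assms)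

lemma \<iota>_eq_zero: "a \<in> A \<Longrightarrow> \<iota> a = 0 \<Longrightarrow> a = 0"
  using \<iota>_norm(2) \<tau>_adj_comp_zero by fastforce

lemma \<iota>_approx: "e > 0 \<Longrightarrow> \<exists>a\<in>A. norm (\<iota> a - \<xi>) < e"
  using \<iota>_dense closure_approachable[of \<xi> "\<iota> ` A"] by (auto simp: dist_norm)

lemma l2_ext_unique:
  assumes "\<And>x. x \<in> A \<Longrightarrow> blinfun_apply F (\<iota> x) = blinfun_apply G (\<iota> x)"
  shows "F = G"
proof (rule blinfun_eqI)
  fix \<xi>
  have "closed {\<xi>. blinfun_apply F \<xi> = blinfun_apply G \<xi>}"
    by (intro closed_Collect_eq linear_continuous_on blinfun.bounded_linear_right)
  then have "closure (\<iota> ` A) \<subseteq> {\<xi>. blinfun_apply F \<xi> = blinfun_apply G \<xi>}"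
    using assms by (intro closure_minimal) auto
  then show "F \<xi> = G \<xi>" using \<iota>_dense by auto
qed

lemma l2_ext_exists:
  assumes add: "\<And>x y. x \<in> A \<Longrightarrow> y \<in> A \<Longrightarrow> f (x + y) = f x + f y"
    and sc: "\<And>c x. x \<in> A \<Longrightarrow> f (op_scale c x) = c *\<^sub>C f x"
    and bd: "\<And>x. x \<in> A \<Longrightarrow> norm (f x) \<le> C * norm (\<iota> x)" and C: "C \<ge> 0"
  shows "\<exists>F\<in>bounded_ops. (\<forall>x\<in>A. blinfun_apply F (\<iota> x) = f x) \<and> norm F \<le> C"
proof -
  have diff: "f (x - y) = f x - f y" if "x \<in> A" "y \<in> A" for x y
    using add[of "x - y" y] that by (simp add: diff_in)
  have "\<exists>x. (\<forall>n. x n \<in> A) \<and> (\<lambda>n. \<iota> (x n)) \<longlonglongrightarrow> \<xi>" for \<xi>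
  proof -
    have "\<xi> \<in> closure (\<iota> ` A)" by (simp add: \<iota>_dense)
    then obtain s where s: "\<And>n. s n \<in> \<iota> ` A" "s \<longlonglongrightarrow> \<xi>" by (auto simp: closure_sequential)
    then have "\<forall>n. \<exists>x\<in>A. s n = \<iota> x" by blast
    then obtain x where x: "\<And>n. x n \<in> A \<and> s n = \<iota> (x n)" by metis
    then have "s = (\<lambda>n. \<iota> (x n))" by auto
    then show ?thesis using s(2) x by blast
  qed
  then have "\<forall>\<xi>. \<exists>x. (\<forall>n. x n \<in> A) \<and> (\<lambda>n. \<iota> (x n)) \<longlonglongrightarrow> \<xi>" by blast
  from choice[OF this] obtain X where X: "\<And>\<xi> n. X \<xi> n \<in> A" "\<And>\<xi>. (\<lambda>n. \<iota> (X \<xi> n)) \<longlonglongrightarrow> \<xi>" by blast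
  have conv: "convergent (\<lambda>n. f (X \<xi> n))" for \<xi>
  proof -
    have "Cauchy (\<lambda>n. \<iota> (X \<xi> n))" using X(2) convergentI Cauchy_convergent_iff by blast
    then have c: "\<And>e. e > 0 \<Longrightarrow> \<exists>M. \<forall>m\<ge>M. \<forall>n\<ge>M. norm (\<iota> (X \<xi> m) - \<iota> (X \<xi> n)) < e" 
      unfolding Cauchy_iff by blast
    have "Cauchy (\<lambda>n. f (X \<xi> n))"
      unfolding Cauchy_iff
    proof (intro allI impI)
      fix e :: real assume e: "0 < e"
      then obtain M where M: "\<And>m n. m \<ge> M \<Longrightarrow> n \<ge> M \<Longrightarrow> norm (\<iota> (X \<xi> m) - \<iota> (X \<xi> n)) < e / (C + 1)"
        using c[of "e / (C + 1)"] C by auto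
      have "norm (f (X \<xi> m) - f (X \<xi> n)) < e" if "m \<ge> M" "n \<ge> M" for m n
      proof -
        have "norm (f (X \<xi> m) - f (X \<xi> n)) \<le> C * norm (\<iota> (X \<xi> m) - \<iota> (X \<xi> n))"
          using bd[of "X \<xi> m - X \<xi> n"] by (simp add: diff X diff_in \<iota>_diff)
        also have "\<dots> \<le> C * (e / (C + 1))" using M[OF that] C by (intro mult_left_mono) auto
        also have "\<dots> < e" using e C by (simp add: field_simps)
        finally show ?thesis .
      qed
      then show "\<exists>M. \<forall>m\<ge>M. \<forall>n\<ge>M. norm (f (X \<xi> m) - f (X \<xi> n)) < e" by blast
    qed
    then show ?thesis by (simp add: Cauchy_convergent_iff)
  qed
  define F where "F = (\<lambda>\<xi>. lim (\<lambda>n. f (X \<xi> n)))"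
  \<comment> \<open>The value does not depend on the approximating sequence; additivity and
    homogeneity use the sum and the multiple of the chosen sequences.\<close>
  have F: "(\<lambda>n. f (y n)) \<longlonglongrightarrow> F \<xi>" if y: "\<And>n. y n \<in> A" "(\<lambda>n. \<iota> (y n)) \<longlonglongrightarrow> \<xi>" for y \<xi>
  proof -
    have 1: "(\<lambda>n. f (X \<xi> n)) \<longlonglongrightarrow> F \<xi>" using conv[of \<xi>] unfolding F_def convergent_LIMSEQ_iff .
    have "(\<lambda>n. C * norm (\<iota> (y n) - \<iota> (X \<xi> n))) \<longlonglongrightarrow> C * norm (\<xi> - \<xi>)" by (intro tendsto_intros y X)
    then have 0: "(\<lambda>n. C * norm (\<iota> (y n) - \<iota> (X \<xi> n))) \<longlonglongrightarrow> 0" by simp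
    have "norm (f (y n) - f (X \<xi> n)) \<le> C * norm (\<iota> (y n) - \<iota> (X \<xi> n))" for n
      using bd[of "y n - X \<xi> n"] by (simp add: diff X y diff_in \<iota>_diff)
    then have "(\<lambda>n. f (y n) - f (X \<xi> n)) \<longlonglongrightarrow> 0"
      by (intro Lim_null_comparison[OF _ 0] always_eventually) blast
    from tendsto_add[OF this 1] show ?thesis by simp
  qed
  have Fi: "F (\<iota> x) = f x" if "x \<in> A" for x
    by (rule LIMSEQ_unique[OF F[of "\<lambda>_. x"]]) (use that in auto)
  have Fadd: "F (\<xi> + \<eta>) = F \<xi> + F \<eta>" for \<xi> \<eta>
  proof (rule LIMSEQ_unique)
    show "(\<lambda>n. f (X \<xi> n + X \<eta> n)) \<longlonglongrightarrow> F (\<xi> + \<eta>)"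
      by (rule F) (auto simp: X add_in \<iota>_add intro: tendsto_add)
    show "(\<lambda>n. f (X \<xi> n + X \<eta> n)) \<longlonglongrightarrow> F \<xi> + F \<eta>"
      by (simp add: add X tendsto_add F)
  qed
  have Fsc: "F (c *\<^sub>C \<xi>) = c *\<^sub>C F \<xi>" for c \<xi>
  proof (rule LIMSEQ_unique)
    show "(\<lambda>n. f (op_scale c (X \<xi> n))) \<longlonglongrightarrow> F (c *\<^sub>C \<xi>)"
      by (rule F) (auto simp: X scale_in \<iota>_scale intro: tendsto_scaleC)
    show "(\<lambda>n. f (op_scale c (X \<xi> n))) \<longlonglongrightarrow> c *\<^sub>C F \<xi>"
      by (simp add: sc X tendsto_scaleC F)
  qed
  have Fbd: "norm (F \<xi>) \<le> norm \<xi> * C" for \<xi>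
  proof (rule LIMSEQ_le)
    show "(\<lambda>n. norm (f (X \<xi> n))) \<longlonglongrightarrow> norm (F \<xi>)" by (intro tendsto_norm F X)
    show "(\<lambda>n. C * norm (\<iota> (X \<xi> n))) \<longlonglongrightarrow> norm \<xi> * C"
      unfolding mult.commute[of "norm \<xi>"] by (intro tendsto_intros X)
    show "\<exists>N. \<forall>n\<ge>N. norm (f (X \<xi> n)) \<le> C * norm (\<iota> (X \<xi> n))" using bd X by blast
  qed
  have bl: "bounded_linear F"
    by (rule bounded_linear_intro[where K=C]) (use Fadd Fsc Fbd in \<open>auto simp flip: scaleC_of_real\<close>)
  note ap = bounded_linear_Blinfun_apply[OF bl]
  show ?thesis
    by (rule bexI[of _ "Blinfun F"])
       (use C Fbd in \<open>auto simp: ap bounded_ops_def Fsc Fi mult.commute intro!: norm_blinfun_bound\<close>)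
qed

lemma norm_\<iota>_comp_left: assumes "a \<in> A" "x \<in> A" shows "norm (\<iota> (a \<cdot> x)) \<le> norm a * norm (\<iota> x)"
proof -
  have p: "psd (norm (op_adj a \<cdot> a) *\<^sub>R id_blinfun - op_adj a \<cdot> a)"
    by (intro psd_norm_bound psd_sa psd_adj_comp bops assms)
  from psd_conj[OF p bops[OF assms(2)]]
  have p2: "psd (norm (op_adj a \<cdot> a) *\<^sub>R (op_adj x \<cdot> x) - op_adj (a \<cdot> x) \<cdot> (a \<cdot> x))"
    by (simp add: comp_simps comp_assoc op_adj_comp bops assms)
  have "norm (op_adj a \<cdot> a) \<le> norm a * norm a"
    using norm_blinfun_compose[of "op_adj a" a] mult_right_mono[OF norm_adj_le[OF bops[OF assms(1)]] norm_ge_zero[of a]]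
    by linarith
  then have "norm (op_adj a \<cdot> a) * (norm (\<iota> x))\<^sup>2 \<le> (norm a * norm a) * (norm (\<iota> x))\<^sup>2"
    by (rule mult_right_mono) simp
  then have "norm (op_adj a \<cdot> a) * (norm (\<iota> x))\<^sup>2 \<le> (norm a * norm (\<iota> x))\<^sup>2"
    by (simp add: power2_eq_square ac_simps)
  moreover have "(norm (\<iota> (a \<cdot> x)))\<^sup>2 \<le> norm (op_adj a \<cdot> a) * (norm (\<iota> x))\<^sup>2"
    using \<tau>_mono[OF _ _ p2] assms by (simp add: \<iota>_norm(2) in_intros \<tau>_scaleR)
  ultimately have "(norm (\<iota> (a \<cdot> x)))\<^sup>2 \<le> (norm a * norm (\<iota> x))\<^sup>2" by linarith
  then show ?thesis by (rule power2_le_imp_le) simp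
qed

lemma \<iota>_adj_norm: "a \<in> A \<Longrightarrow> norm (\<iota> (op_adj a)) = norm (\<iota> a)"
  using \<iota>_norm(1)[of a] \<iota>_norm(2)[of "op_adj a"]
  by (intro power2_eq_imp_eq[of "norm (\<iota> (op_adj a))"]) (simp_all add: adj_in bops)

text \<open>The adjoint preserves the norm of \<open>\<iota>\<close> by the trace property and
  exchanges right with left multiplication.\<close>

lemma norm_\<iota>_comp_right: assumes "b \<in> A" "x \<in> A" shows "norm (\<iota> (x \<cdot> b)) \<le> norm b * norm (\<iota> x)"
proof -
  have "norm (\<iota> (x \<cdot> b)) = norm (\<iota> (op_adj b \<cdot> op_adj x))"
    using \<iota>_adj_norm[of "x \<cdot> b"] assms by (simp add: comp_in op_adj_comp bops)
  also have "\<dots> \<le> norm (op_adj b) * norm (\<iota> (op_adj x))" by (intro norm_\<iota>_comp_left adj_in assms)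
  also have "\<dots> \<le> norm b * norm (\<iota> x)"
    using assms by (simp add: \<iota>_adj_norm norm_adj_le bops mult_right_mono)
  finally show ?thesis .
qed

definition L :: "('h \<Rightarrow>\<^sub>L 'h) \<Rightarrow> ('l \<Rightarrow>\<^sub>L 'l)" where "L = l2_action A \<iota>"

lemma L_action: assumes a: "a \<in> A" shows L_norm: "norm (L a) \<le> norm a" and L_bounded_ops: "L a \<in> bounded_ops"
  and L_\<iota>: "x \<in> A \<Longrightarrow> L a (\<iota> x) = \<iota> (a \<cdot> x)"
proof -
  have "\<exists>F\<in>bounded_ops. (\<forall>x\<in>A. blinfun_apply F (\<iota> x) = \<iota> (a \<cdot> x)) \<and> norm F \<le> norm a"
    by (rule l2_ext_exists)
       (use a in \<open>auto simp: comp_simps \<iota>_add comp_in comp_op_scale bops \<iota>_scale norm_\<iota>_comp_left\<close>)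
  then obtain F where F: "F \<in> bounded_ops" "\<forall>x\<in>A. blinfun_apply F (\<iota> x) = \<iota> (a \<cdot> x)" "norm F \<le> norm a" by blast
  have "L a = F" unfolding L_def l2_action_def
    by (rule the_equality) (use F in \<open>auto intro: l2_ext_unique\<close>)
  then show "norm (L a) \<le> norm a" "L a \<in> bounded_ops" "x \<in> A \<Longrightarrow> L a (\<iota> x) = \<iota> (a \<cdot> x)" using F by auto
qed

definition R :: "('h \<Rightarrow>\<^sub>L 'h) \<Rightarrow> ('l \<Rightarrow>\<^sub>L 'l)" where
  "R b = (SOME F. F \<in> bounded_ops \<and> (\<forall>x\<in>A. blinfun_apply F (\<iota> x) = \<iota> (x \<cdot> b)) \<and> norm F \<le> norm b)"

lemma R: assumes b: "b \<in> A" shows R_norm: "norm (R b) \<le> norm b" and R_bounded_ops: "R b \<in> bounded_ops"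
  and R_\<iota>: "x \<in> A \<Longrightarrow> R b (\<iota> x) = \<iota> (x \<cdot> b)"
proof -
  have "\<exists>F\<in>bounded_ops. (\<forall>x\<in>A. blinfun_apply F (\<iota> x) = \<iota> (x \<cdot> b)) \<and> norm F \<le> norm b"
    by (rule l2_ext_exists)
       (use b in \<open>auto simp: comp_simps \<iota>_add comp_in op_scale_comp bops \<iota>_scale norm_\<iota>_comp_right\<close>)
  then have "\<exists>F. F \<in> bounded_ops \<and> (\<forall>x\<in>A. blinfun_apply F (\<iota> x) = \<iota> (x \<cdot> b)) \<and> norm F \<le> norm b" by blast
  from someI_ex[OF this] show "norm (R b) \<le> norm b" "R b \<in> bounded_ops" "x \<in> A \<Longrightarrow> R b (\<iota> x) = \<iota> (x \<cdot> b)"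
    unfolding R_def by auto
qed

lemma L_add: "a \<in> A \<Longrightarrow> b \<in> A \<Longrightarrow> L (a + b) = L a + L b"
  by (rule l2_ext_unique) (simp add: L_\<iota> add_in blinfun.add_left comp_simps \<iota>_add comp_in)

lemma L_comp: "a \<in> A \<Longrightarrow> b \<in> A \<Longrightarrow> L (a \<cdot> b) = L a \<cdot> L b"
  by (rule l2_ext_unique) (simp add: L_\<iota> comp_in comp_assoc)

lemma L_scale: "a \<in> A \<Longrightarrow> L (op_scale c a) = op_scale c (L a)"
  by (rule l2_ext_unique) (simp add: L_\<iota> comp_in scale_in op_scale_comp \<iota>_scale)

lemma L_id: "L id_blinfun = id_blinfun" by (rule l2_ext_unique) (simp add: L_\<iota>)

lemma L_diff: "a \<in> A \<Longrightarrow> b \<in> A \<Longrightarrow> L (a - b) = L a - L b"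
  by (rule l2_ext_unique) (simp add: L_\<iota> diff_in blinfun.diff_left comp_simps \<iota>_diff comp_in)

lemma l2_adj_unique:
  assumes "F \<in> bounded_ops" "\<And>x y. x \<in> A \<Longrightarrow> y \<in> A \<Longrightarrow> cinner (blinfun_apply F (\<iota> x)) (\<iota> y) = cinner (\<iota> x) (blinfun_apply G (\<iota> y))"
  shows "op_adj F = G"
proof (rule l2_ext_unique, rule cinner_eqI)
  fix y z assume y: "y \<in> A"
  have "closed {z. cinner (op_adj F (\<iota> y)) z = cinner (G (\<iota> y)) z}"
    by (intro closed_Collect_eq linear_continuous_on cinner.bounded_linear_right)
  moreover have "cinner (op_adj F (\<iota> y)) (\<iota> x) = cinner (G (\<iota> y)) (\<iota> x)" if "x \<in> A" for x
    using assms(2)[OF that y] op_adj'[OF assms(1)] cinner_commute by metis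
  ultimately have "closure (\<iota> ` A) \<subseteq> {z. cinner (op_adj F (\<iota> y)) z = cinner (G (\<iota> y)) z}"
    by (intro closure_minimal) auto
  then show "cinner (op_adj F (\<iota> y)) z = cinner (G (\<iota> y)) z" using \<iota>_dense by auto
qed

lemma L_adj: assumes "a \<in> A" shows "L (op_adj a) = op_adj (L a)"
proof (rule sym, rule l2_adj_unique)
  fix x y assume xy: "x \<in> A" "y \<in> A"
  have "cinner (L a (\<iota> x)) (\<iota> y) = tr (a \<cdot> (x \<cdot> op_adj y))"
    using xy assms by (simp add: L_\<iota> \<iota>_cinner comp_in comp_assoc)
  also have "\<dots> = tr ((x \<cdot> op_adj y) \<cdot> a)" by (intro tr_comm in_intros xy assms)
  also have "\<dots> = cinner (\<iota> x) (L (op_adj a) (\<iota> y))"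
    using xy assms by (simp add: L_\<iota> \<iota>_cinner comp_in adj_in op_adj_comp bops comp_assoc)
  finally show "cinner (L a (\<iota> x)) (\<iota> y) = cinner (\<iota> x) (L (op_adj a) (\<iota> y))" .
qed (use assms L_bounded_ops in auto)

lemma R_adj: assumes "b \<in> A" shows "R (op_adj b) = op_adj (R b)"
proof (rule sym, rule l2_adj_unique)
  fix x y assume xy: "x \<in> A" "y \<in> A"
  show "cinner (R b (\<iota> x)) (\<iota> y) = cinner (\<iota> x) (R (op_adj b) (\<iota> y))"
    using xy assms by (simp add: R_\<iota> \<iota>_cinner comp_in adj_in op_adj_comp bops comp_assoc)
qed (use assms R_bounded_ops in auto)

lemma R_commutant: "b \<in> A \<Longrightarrow> R b \<in> commutant (L ` A)"
  unfolding commutant_def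
  by (auto simp: R_bounded_ops L_\<iota> R_\<iota> comp_in comp_assoc intro!: l2_ext_unique)

lemma L_inj: "a \<in> A \<Longrightarrow> L a = 0 \<Longrightarrow> a = 0"
  using L_\<iota>[of a id_blinfun] \<iota>_eq_zero[of a] by simp

text \<open>With \<open>z\<close> as y / (1 + y) these are \<open>z^2 \<le> z\<close> and
  \<open>(1 - z) y (1 - z) \<le> z\<close>. Splitting a vector into \<open>z x\<close> and
  \<open>x - z x\<close> lets the bounded operator \<open>z\<close> control what was only controlled
  by \<open>y\<close>.\<close>

lemma inv1p_split:
  assumes y: "psd y"
  defines "z \<equiv> id_blinfun - oinv (id_blinfun + y)"
  shows "(norm (z x))\<^sup>2 \<le> Re (cinner (z x) x)"
    and "Re (cinner (y (x - z x)) (x - z x)) \<le> Re (cinner (z x) x)"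
proof -
  let ?u = "oinv (id_blinfun + y) x"
  have u: "x - z x = ?u" by (simp add: z_def blinfun.diff_left)
  have "(id_blinfun + y) ?u = x"
    using arg_cong[OF inv1p_right[OF y], of "\<lambda>f. blinfun_apply f x"] by simp
  then have "y ?u = z x" by (simp add: z_def blinfun.diff_left blinfun.add_left eq_diff_eq add.commute)
  then have e: "Re (cinner (y ?u) ?u) = Re (cinner (z x) x) - (norm (z x))\<^sup>2"
    unfolding u[symmetric] by (simp add: cinner.diff_right Re_cinner_self)
  show "(norm (z x))\<^sup>2 \<le> Re (cinner (z x) x)" using e psd_nonneg[OF y, of ?u] by simp
  show "Re (cinner (y (x - z x)) (x - z x)) \<le> Re (cinner (z x) x)" using e by (simp add: u)
qed

text \<open>Operator norm bounded subsets of \<open>A\<close> that are Cauchy in \<open>l\<^sup>2\<close> converge in \<open>A\<close>: for a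
  rapidly Cauchy sequence \<open>b\<close> the bounded operators \<open>1 - (1 + y)\<^sup>-\<^sup>1\<close>, with \<open>y\<close> a weighted sum of
  the \<open>|b (k + 1) - b k|\<^sup>2\<close>, have small trace and dominate \<open>|b (n + m) - b n|\<^sup>2\<close>.\<close>

primrec tail :: "(nat \<Rightarrow> 'h \<Rightarrow>\<^sub>L 'h) \<Rightarrow> nat \<Rightarrow> nat \<Rightarrow> ('h \<Rightarrow>\<^sub>L 'h)" where
  "tail b 0 n = 0"
| "tail b (Suc m) n = 2 *\<^sub>R (op_adj (b (Suc n) - b n) \<cdot> (b (Suc n) - b n)) + 2 *\<^sub>R tail b m (Suc n)"

lemma l2_ball_closed:
  assumes C: "C \<ge> 0" and ap: "\<And>e. e > 0 \<Longrightarrow> \<exists>a\<in>A. norm a \<le> C \<and> norm (\<iota> a - \<xi>) < e"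
  shows "\<exists>a\<in>A. \<iota> a = \<xi>"
proof -
  \<comment> \<open>At this rate the differences satisfy \<tau>(d* d) \<le> 16^-n, which outweighs
    the doubling of the weights in \<open>tail\<close>.\<close>
  have "\<forall>n. \<exists>a. a \<in> A \<and> norm a \<le> C \<and> norm (\<iota> a - \<xi>) < (1/4) ^ n / 2" 
    using ap[of "(1/4) ^ n / 2" for n] by (metis divide_pos_pos zero_less_numeral zero_less_one zero_less_power)
  from choice[OF this] obtain b where b: "\<And>n. b n \<in> A" "\<And>n. norm (b n) \<le> C" "\<And>n. norm (\<iota> (b n) - \<xi>) < (1/4) ^ n / 2"
    by blast
  define d where "d = (\<lambda>n. b (Suc n) - b n)"
  have dA: "d n \<in> A" for n by (simp add: d_def diff_in b)
  have \<tau>d: "\<tau> (op_adj (d n) \<cdot> d n) \<le> (1/16) ^ n" for n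
  proof -
    have "norm (\<iota> (d n)) = norm ((\<iota> (b (Suc n)) - \<xi>) - (\<iota> (b n) - \<xi>))" by (simp add: d_def \<iota>_diff b)
    also have "\<dots> \<le> norm (\<iota> (b (Suc n)) - \<xi>) + norm (\<iota> (b n) - \<xi>)" by (rule norm_triangle_ineq4)
    also have "\<dots> \<le> (1/4) ^ n"
    proof -
      have "norm (\<iota> (b (Suc n)) - \<xi>) < (1/4) ^ n / 8" using b(3)[of "Suc n"] by simp
      moreover have "0 \<le> (1/4 :: real) ^ n" by simp
      ultimately show ?thesis using b(3)[of n] by linarith
    qed
    finally have "(norm (\<iota> (d n)))\<^sup>2 \<le> ((1/4) ^ n)\<^sup>2" by (intro power_mono) auto
    also have "((1/4) ^ n)\<^sup>2 = (1/16 :: real) ^ n" by (simp add: power2_eq_square flip: power_mult_distrib)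
    finally show ?thesis by (simp add: \<iota>_norm(2) dA)
  qed
  define y where "y = (\<lambda>n m. tail b m n)"
  have y0: "y n 0 = 0" and yS: "y n (Suc m) = 2 *\<^sub>R (op_adj (d n) \<cdot> d n) + 2 *\<^sub>R y (Suc n) m" for n m
    by (simp_all add: y_def d_def)
  have dd: "psd (op_adj (d n) \<cdot> d n)" for n by (intro psd_adj_comp bops dA)
  have ypsd: "psd (y n m)" and yA: "y n m \<in> A" for n m
    by (induction m arbitrary: n) (auto simp: y0 yS intro!: psd_add psd_scaleR dd in_intros dA)
  have yinc: "psd (y n (Suc m) - y n m)" for n m
  proof (induction m arbitrary: n)
    case (Suc m)
    have "y n (Suc (Suc m)) - y n (Suc m) = 2 *\<^sub>R (y (Suc n) (Suc m) - y (Suc n) m)"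
      by (subst (1 2) yS) (simp add: scaleR_diff_right)
    then show ?case by (simp add: psd_scaleR Suc)
  qed (simp add: y0 ypsd)
  have yinc2: "psd (y n (Suc m) - y (Suc n) m)" for n m
    using psd_add[OF psd_scaleR[OF dd, of 2 n] ypsd[of "Suc n" m]] by (simp add: yS scaleR_2)
  have \<tau>y: "\<tau> (y n m) \<le> 4 * (1/16) ^ n" for n m
  proof (induction m arbitrary: n)
    case (Suc m)
    have "\<tau> (y n (Suc m)) = 2 * \<tau> (op_adj (d n) \<cdot> d n) + 2 * \<tau> (y (Suc n) m)"
      by (simp add: yS \<tau>_add \<tau>_scaleR in_intros dA yA)
    moreover have "\<tau> (y (Suc n) m) \<le> (1/16) ^ n / 4" using Suc[of "Suc n"] by simp
    moreover have "0 \<le> (1/16 :: real) ^ n" by simp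
    ultimately show ?case using \<tau>d[of n] by linarith
  qed (simp add: y0)
  \<comment> \<open>The factors 2 in \<open>tail\<close> come from |p + q|^2 \<le> 2 |p|^2 + 2
    |q|^2.\<close>
  have bd: "(norm ((b (n + m) - b n) u))\<^sup>2 \<le> Re (cinner (y n m u) u)" for n m u
  proof (induction m arbitrary: n)
    case (Suc m)
    let ?p = "d n u" and ?q = "(b (Suc n + m) - b (Suc n)) u"
    have "(norm ((b (n + Suc m) - b n) u))\<^sup>2 = (norm (?p + ?q))\<^sup>2" by (simp add: d_def blinfun.diff_left)
    also have "\<dots> \<le> 2 * (norm ?p)\<^sup>2 + 2 * (norm ?q)\<^sup>2"
      using norm_add_sq[of ?p ?q] norm_add_sq[of ?p "- ?q"] zero_le_power2[of "norm (?p + - ?q)"]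
      by (simp add: cinner.minus_right)
    also have "\<dots> \<le> 2 * Re (cinner ((op_adj (d n) \<cdot> d n) u) u) + 2 * Re (cinner (y (Suc n) m u) u)"
      using Suc[of "Suc n"] norm_adj_comp_le[OF bops[OF dA[of n]], of u] by simp
    finally show ?case by (simp add: yS blinfun.add_left blinfun.scaleR_left cinner_add_left cinner_scaleR_left)
  qed (simp add: y0)
  \<comment> \<open>The \<open>y n m\<close> have small trace but no evident common norm bound; the
    \<open>z n m\<close> stay below the identity and increase in \<open>m\<close>, so they have
    strong limits.\<close>
  define z where "z = (\<lambda>n m. id_blinfun - oinv (id_blinfun + y n m))"
  have "oinv (id_blinfun + y n m) \<in> A" for n m
    by (rule inverse_in[OF _ psd_bounded_ops[OF inv1p_psd[OF ypsd]] inv1p_right[OF ypsd] inv1p_left[OF ypsd]])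
       (intro add_in id_in yA)
  then have zA: "z n m \<in> A" for n m by (simp add: z_def diff_in)
  have zpsd: "psd (z n m)" for n m unfolding z_def by (rule inv1p_le[OF ypsd])
  have z1: "psd (1 *\<^sub>R id_blinfun - z n m)" for n m unfolding z_def using inv1p_psd[OF ypsd[of n m]] by simp
  have zinc: "psd (z n (Suc m) - z n m)" for n m
    using inv1p_antimono[OF ypsd ypsd yinc] by (simp add: z_def)
  have zinc2: "psd (z n (Suc m) - z (Suc n) m)" for n m
    using inv1p_antimono[OF ypsd ypsd yinc2] by (simp add: z_def)
  have zy: "psd (y n m - z n m)" for n m
    unfolding psd_def
  proof (intro conjI allI)
    show "sa (y n m - z n m)" by (intro sa_diff psd_sa ypsd zpsd)
    show "0 \<le> Re (cinner ((y n m - z n m) x) x)" for x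
      using inv1p_variational[OF ypsd, of x x n m]
      by (simp add: z_def blinfun.diff_left cinner.diff_left Re_cinner_self)
  qed
  have "\<exists>s. sot (z n) s \<and> sa s \<and> (\<forall>m. psd (s - z n m)) \<and> norm s \<le> 1" for n
    by (rule monotone_limit[where y="z n" and C=1]) (use z1 in \<open>simp_all add: zinc zpsd\<close>)
  then have "\<forall>n. \<exists>s. sot (z n) s \<and> sa s \<and> (\<forall>m. psd (s - z n m))" by blast
  from choice[OF this] obtain Z where
    Z: "\<And>n. sot (z n) (Z n)" "\<And>n. sa (Z n)" "\<And>n m. psd (Z n - z n m)" by blast
  have ZA: "Z n \<in> A" for n by (rule sot_in[OF Z(1) zA])
  have Zpsd: "psd (Z n)" for n using psd_add[OF Z(3) zpsd, of n 0 n 0] by simp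
  have Z1: "psd (1 *\<^sub>R id_blinfun - Z n)" for n
    by (rule sot_psd_ge[OF sot_diff[OF sot_const Z(1)], of "1 *\<^sub>R id_blinfun" n 0])
       (use z1 psd_sa in auto)
  have Zdec: "psd (Z n - Z (Suc n))" for n
  proof (rule sot_psd_ge)
    have "sot (\<lambda>m. z n (Suc m)) (Z n)" using Z(1)[of n] by (auto simp: sot_def intro: LIMSEQ_Suc)
    then show "sot (\<lambda>m. z n (Suc m) - z (Suc n) m) (Z n - Z (Suc n))" by (rule sot_diff[OF _ Z(1)])
  qed (use zinc2 psd_sa in auto)
  have \<tau>Z: "\<tau> (Z n) \<le> 4 * (1/16) ^ n" for n
  proof (rule LIMSEQ_le_const2)
    show "(\<lambda>m. \<tau> (z n m)) \<longlonglongrightarrow> \<tau> (Z n)"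
      unfolding \<tau>_def by (rule tr_increasing[OF zA zpsd zinc Z(1)])
    show "\<exists>N. \<forall>m\<ge>N. \<tau> (z n m) \<le> 4 * (1/16) ^ n"
      using order_trans[OF \<tau>_mono[OF zA yA zy] \<tau>y] by blast
  qed
  have lim0: "(\<lambda>n. K * (4 * (1/16) ^ n)) \<longlonglongrightarrow> (0::real)" for K
    by (intro tendsto_mult_right_zero LIMSEQ_power_zero) simp
  have "\<exists>s. sot (\<lambda>n. id_blinfun - Z n) s \<and> sa s \<and> (\<forall>n. psd (s - (id_blinfun - Z n))) \<and> norm s \<le> 1"
    by (rule monotone_limit[where C=1]) (use Zdec Z1 Zpsd in simp_all)
  then obtain s where s: "sot (\<lambda>n. id_blinfun - Z n) s" by blast
  have s': "sot Z (id_blinfun - s)" using sot_diff[OF sot_const[OF bounded_ops_id] s] by simp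
  have "(\<lambda>n. \<tau> (Z n)) \<longlonglongrightarrow> \<tau> (id_blinfun - s)" by (rule \<tau>_decreasing[OF ZA Zdec s'])
  then have "\<tau> (id_blinfun - s) \<le> 0"
    by (rule LIMSEQ_le[OF _ lim0[of 1]]) (use \<tau>Z in auto)
  moreover have "psd (id_blinfun - s)" by (rule sot_psd_ge[OF s', of 0]) (auto simp: Z Zpsd)
  ultimately have "id_blinfun - s = 0" by (intro \<tau>_faithful sot_in[OF s' ZA])
  then have Z0: "sot Z 0" using s' by simp
  define K where "K = (1 + 2 * C)\<^sup>2"
  \<comment> \<open>On \<open>u = x - z n m x\<close> the difference is controlled by
    \<open>y n m\<close>, on \<open>z n m x\<close> by the operator norm \<open>2 * C\<close>; both
    parts are at most a multiple of \<open>sqrt q\<close>.\<close>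
  have est: "(norm ((b (n + m) - b n) x))\<^sup>2 \<le> K * Re (cinner (Z n x) x)" for n m x
  proof -
    define q where "q = Re (cinner (z n m x) x)"
    define u where "u = x - z n m x"
    have sp: "(norm (z n m x))\<^sup>2 \<le> q" "Re (cinner (y n m u) u) \<le> q"
      using inv1p_split[OF ypsd[of n m], of x] unfolding z_def q_def u_def by blast+
    have q0: "0 \<le> q" by (rule order_trans[OF zero_le_power2 sp(1)])
    have zq: "norm (z n m x) \<le> sqrt q" by (rule real_le_rsqrt[OF sp(1)])
    have uq: "norm ((b (n + m) - b n) u) \<le> sqrt q"
      by (rule real_le_rsqrt) (use order_trans[OF bd sp(2)] in \<open>simp add: u_def\<close>)
    have "norm (b (n + m) - b n) \<le> 2 * C"
      using norm_triangle_ineq4[of "b (n + m)" "b n"] b(2)[of n] b(2)[of "n + m"] by linarith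
    then have "norm ((b (n + m) - b n) (z n m x)) \<le> 2 * C * sqrt q"
      using zq C by (intro order_trans[OF norm_blinfun[of "b (n + m) - b n" "z n m x"]] mult_mono) auto
    moreover have "(b (n + m) - b n) x = (b (n + m) - b n) u + (b (n + m) - b n) (z n m x)"
      by (simp add: u_def flip: blinfun.add_right)
    ultimately have "norm ((b (n + m) - b n) x) \<le> (1 + 2 * C) * sqrt q"
      using uq norm_triangle_ineq[of "(b (n + m) - b n) u" "(b (n + m) - b n) (z n m x)"] by (simp add: algebra_simps)
    then have "(norm ((b (n + m) - b n) x))\<^sup>2 \<le> ((1 + 2 * C) * sqrt q)\<^sup>2" by (intro power_mono) auto
    also have "\<dots> = K * q" using q0 by (simp add: K_def power_mult_distrib)
    also have "\<dots> \<le> K * Re (cinner (Z n x) x)"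
      using psd_nonneg[OF Z(3)[of n m], of x]
      by (intro mult_left_mono) (auto simp: K_def q_def blinfun.diff_left cinner.diff_left)
    finally show ?thesis .
  qed
  have q0: "(\<lambda>n. K * Re (cinner (Z n x) x)) \<longlonglongrightarrow> 0" for x
  proof -
    have "(\<lambda>n. K * Re (cinner (Z n x) x)) \<longlonglongrightarrow> K * Re (cinner (blinfun_apply 0 x) x)"
      by (intro tendsto_intros cinner.tendsto sotD[OF Z0])
    then show ?thesis by simp
  qed
  have "Cauchy (\<lambda>n. b n x)" for x
  proof (rule CauchyI)
    fix e :: real assume e: "0 < e"
    then obtain N where N: "\<bar>K * Re (cinner (Z N x) x)\<bar> < (e / 2)\<^sup>2"
      using LIMSEQ_D[OF q0[of x], of "(e/2)\<^sup>2"] by auto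
    have "norm (b m x - b N x) < e / 2" if m: "m \<ge> N" for m
    proof -
      have "(norm (b m x - b N x))\<^sup>2 < (e / 2)\<^sup>2" using est[of N "m - N" x] N m by (simp add: blinfun.diff_left)
      then show ?thesis by (rule power_less_imp_less_base) (use e in simp)
    qed
    then have "norm ((b m x - b N x) - (b n x - b N x)) < e" if "m \<ge> N" "n \<ge> N" for m n
      using norm_triangle_ineq4[of "b m x - b N x" "b n x - b N x"] that by (smt (verit) field_sum_of_halves)
    then have "norm (b m x - b n x) < e" if "m \<ge> N" "n \<ge> N" for m n using that by simp
    then show "\<exists>M. \<forall>m\<ge>M. \<forall>n\<ge>M. norm (b m x - b n x) < e" by blast
  qed
  then obtain a where a: "a \<in> bounded_ops" "\<And>x. (\<lambda>n. b n x) \<longlonglongrightarrow> blinfun_apply a x"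
    using strong_limit_exists[where f=b and C=C, OF bops[OF b(1)] b(2)] by blast
  then have aA: "a \<in> A" using sot_in[of b a] b by (simp add: sot_def)
  \<comment> \<open>Letting \<open>m\<close> tend to infinity in \<open>est\<close> gives an
    operator inequality, and its trace is the distance from \<open>\<iota> a\<close> to
    \<open>\<iota> (b n)\<close>.\<close>
  have "psd (K *\<^sub>R Z n - op_adj (a - b n) \<cdot> (a - b n))" for n
    unfolding psd_def
  proof (intro conjI allI)
    show "sa (K *\<^sub>R Z n - op_adj (a - b n) \<cdot> (a - b n))"
      by (intro sa_diff sa_scaleR Z(2) psd_sa[OF psd_adj_comp] bops diff_in aA b(1))
    fix x
    have "(norm (a x - b n x))\<^sup>2 \<le> K * Re (cinner (Z n x) x)"
    proof (rule LIMSEQ_le_const2)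
      show "(\<lambda>m. (norm (b (m + n) x - b n x))\<^sup>2) \<longlonglongrightarrow> (norm (a x - b n x))\<^sup>2"
        by (intro tendsto_power tendsto_norm tendsto_diff tendsto_const LIMSEQ_ignore_initial_segment[OF a(2)])
      have "(norm (b (m + n) x - b n x))\<^sup>2 \<le> K * Re (cinner (Z n x) x)" for m
        using est[of n m x] by (simp add: blinfun.diff_left add.commute)
      then show "\<exists>N. \<forall>m\<ge>N. (norm (b (m + n) x - b n x))\<^sup>2 \<le> K * Re (cinner (Z n x) x)" by blast
    qed
    then show "0 \<le> Re (cinner ((K *\<^sub>R Z n - op_adj (a - b n) \<cdot> (a - b n)) x) x)"
      using norm_adj_comp_le[OF bops[OF diff_in[OF aA b(1)[of n]]], of x]
      by (simp add: blinfun.diff_left blinfun.scaleR_left cinner.diff_left cinner_scaleR_left)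
  qed
  then have "(norm (\<iota> a - \<iota> (b n)))\<^sup>2 \<le> K * (4 * (1/16) ^ n)" for n
  proof -
    have "(norm (\<iota> (a - b n)))\<^sup>2 \<le> \<tau> (K *\<^sub>R Z n)"
      unfolding \<iota>_norm(2)[OF diff_in[OF aA b(1)]]
      by (intro \<tau>_mono in_intros aA b(1) ZA) fact
    also have "\<dots> \<le> K * (4 * (1/16) ^ n)"
      using mult_left_mono[OF \<tau>Z[of n], of K] by (simp add: \<tau>_scaleR ZA K_def)
    finally show ?thesis by (simp add: \<iota>_diff aA b)
  qed
  then have "(\<lambda>n. (norm (\<iota> a - \<iota> (b n)))\<^sup>2) \<longlonglongrightarrow> 0"
    by (intro tendsto_sandwich[OF _ _ tendsto_const lim0[of K]]) auto
  moreover have "(\<lambda>n. (norm (\<iota> a - \<iota> (b n)))\<^sup>2) \<longlonglongrightarrow> (norm (\<iota> a - \<xi>))\<^sup>2"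
  proof (intro tendsto_intros)
    have "(\<lambda>n. norm (\<iota> (b n) - \<xi>)) \<longlonglongrightarrow> 0"
    proof (rule tendsto_sandwich[OF _ _ tendsto_const])
      show "(\<lambda>n. (1/4) ^ n / 2) \<longlonglongrightarrow> (0::real)"
        by (intro tendsto_divide_zero LIMSEQ_power_zero) simp
      show "\<forall>\<^sub>F n in sequentially. norm (\<iota> (b n) - \<xi>) \<le> (1/4) ^ n / 2"
        using b(3) less_imp_le by (intro always_eventually) blast
    qed simp
    then show "(\<lambda>n. \<iota> (b n)) \<longlonglongrightarrow> \<xi>" by (simp add: tendsto_norm_zero_iff LIM_zero_iff)
  qed
  ultimately have "(norm (\<iota> a - \<xi>))\<^sup>2 = 0" using LIMSEQ_unique by blast
  then show ?thesis using aA by (intro bexI[of _ a]) auto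
qed

end

section \<open>The commutation theorem and affiliated operators\<close>

lemma commutant_intros:
  shows commutant_add: "S \<in> commutant X \<Longrightarrow> T \<in> commutant X \<Longrightarrow> S + T \<in> commutant X"
    and commutant_comp: "S \<in> commutant X \<Longrightarrow> T \<in> commutant X \<Longrightarrow> S \<cdot> T \<in> commutant X"
    and commutant_id: "X \<subseteq> bounded_ops \<Longrightarrow> id_blinfun \<in> commutant X"
  unfolding commutant_def
  by (auto simp: bounded_ops_intros comp_simps comp_assoc simp flip: comp_assoc[of S])

lemma commutant_bounded_ops: "S \<in> commutant X \<Longrightarrow> S \<in> bounded_ops" by (simp add: commutant_def)

lemma commutant_eq: "S \<in> commutant X \<Longrightarrow> a \<in> X \<Longrightarrow> S \<cdot> a = a \<cdot> S" by (simp add: commutant_def)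

lemma commutant_scale: "X \<subseteq> bounded_ops \<Longrightarrow> S \<in> commutant X \<Longrightarrow> op_scale c S \<in> commutant X"
  by (auto simp: commutant_def bounded_ops_op_scale op_scale_comp comp_op_scale subset_iff)

lemma commutant_scaleR: "X \<subseteq> bounded_ops \<Longrightarrow> S \<in> commutant X \<Longrightarrow> r *\<^sub>R S \<in> commutant X"
  by (simp add: scaleR_eq_op_scale commutant_scale)

lemma commutant_subset: "commutant X \<subseteq> bounded_ops" by (auto simp: commutant_def)

lemma commutant_adj:
  assumes "X \<subseteq> bounded_ops" "\<And>a. a \<in> X \<Longrightarrow> op_adj a \<in> X" "S \<in> commutant X"
  shows "op_adj S \<in> commutant X"
proof -
  have S: "S \<in> bounded_ops" using assms(3) by (rule commutant_bounded_ops)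
  have "op_adj S \<cdot> a = a \<cdot> op_adj S" if a: "a \<in> X" for a
  proof -
    have ab: "a \<in> bounded_ops" using a assms(1) by blast
    have "op_adj (S \<cdot> op_adj a) = op_adj (op_adj a \<cdot> S)" using commutant_eq[OF assms(3) assms(2)[OF a]] by simp
    then show ?thesis using S ab by (simp add: op_adj_comp op_adj_bounded_ops)
  qed
  then show ?thesis using S by (simp add: commutant_def op_adj_bounded_ops)
qed

lemma commutant_inverse:
  assumes "T \<in> commutant X" "w \<in> bounded_ops" "T \<cdot> w = id_blinfun" "w \<cdot> T = id_blinfun"
  shows "w \<in> commutant X"
proof -
  have "a \<cdot> w = w \<cdot> a" if "a \<in> X" for a
    by (rule inverse_commutes[OF assms(3,4)]) (use commutant_eq[OF assms(1) that] in simp)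
  then show ?thesis using assms(2) by (simp add: commutant_def)
qed

lemma closed_commutant: "closed (commutant X)"
proof -
  have "closed {S :: 'a::complex_hilbert \<Rightarrow>\<^sub>L 'a. blinfun_apply S (c *\<^sub>C x) = c *\<^sub>C blinfun_apply S x}" for c x
    by (intro closed_Collect_eq linear_continuous_on blinfun.bounded_linear_left
        bounded_linear_compose[OF bounded_linear_scaleC blinfun.bounded_linear_left])
  then have "closed (bounded_ops :: ('a \<Rightarrow>\<^sub>L 'a) set)"
    unfolding bounded_ops_def by (intro closed_Collect_all) auto
  moreover have "closed {S. S \<cdot> g = g \<cdot> S}" for g :: "'a \<Rightarrow>\<^sub>L 'a"
    by (intro closed_Collect_eq linear_continuous_on comp.bounded_linear_left comp.bounded_linear_right)
  then have "closed (\<Inter>g\<in>X. {S. S \<cdot> g = g \<cdot> S})" by (intro closed_INT) auto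
  moreover have "commutant X = bounded_ops \<inter> (\<Inter>g\<in>X. {S. S \<cdot> g = g \<cdot> S})" by (auto simp: commutant_def)
  ultimately show ?thesis by (simp add: closed_Int)
qed

lemma closed_sa: "closed {S :: 'a::complex_hilbert \<Rightarrow>\<^sub>L 'a. sa S}"
proof -
  have 1: "sa S \<longleftrightarrow> S \<in> bounded_ops \<and> (\<forall>x y. cinner (blinfun_apply S x) y = cinner x (blinfun_apply S y))" for S :: "'a \<Rightarrow>\<^sub>L 'a"
    using sa_cinner sa_bounded_ops saI by metis
  have "(bounded_ops :: ('a \<Rightarrow>\<^sub>L 'a) set) = commutant {}" by (auto simp: commutant_def)
  then have "closed (bounded_ops :: ('a \<Rightarrow>\<^sub>L 'a) set)" using closed_commutant by metis
  moreover have "closed {S :: 'a \<Rightarrow>\<^sub>L 'a. cinner (blinfun_apply S x) y = cinner x (blinfun_apply S y)}" for x y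
    by (intro closed_Collect_eq linear_continuous_on blinfun.bounded_linear_left
        bounded_linear_compose[OF cinner.bounded_linear_left blinfun.bounded_linear_left]
        bounded_linear_compose[OF cinner.bounded_linear_right blinfun.bounded_linear_left])
  then have "closed {S :: 'a \<Rightarrow>\<^sub>L 'a. \<forall>x y. cinner (blinfun_apply S x) y = cinner x (blinfun_apply S y)}"
    by (intro closed_Collect_all) auto
  moreover have "{S :: 'a \<Rightarrow>\<^sub>L 'a. sa S} = bounded_ops \<inter>
      {S. \<forall>x y. cinner (blinfun_apply S x) y = cinner x (blinfun_apply S y)}" by (auto simp: 1)
  ultimately show ?thesis by (simp add: closed_Int)
qed

text \<open>For self-adjoint \<open>S\<close>, \<open>S + i\<close> is bounded below since \<open>|(S + i) x|\<^sup>2 = |S x|\<^sup>2 + |x|\<^sup>2\<close>.\<close>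

lemma cayley_denominator:
  assumes S: "sa S"
  defines "T \<equiv> S + op_scale \<i> id_blinfun"
  shows "T \<in> bounded_ops" "oinv T \<in> bounded_ops" "T \<cdot> oinv T = id_blinfun" "oinv T \<cdot> T = id_blinfun" "norm (oinv T) \<le> 1"
    and "op_adj T = S - op_scale \<i> id_blinfun"
proof -
  show T: "T \<in> bounded_ops" by (simp add: T_def bounded_ops_intros sa_bounded_ops S)
  have "op_adj T = S + op_scale (- \<i>) id_blinfun"
    using S by (simp add: T_def op_adj_add bounded_ops_intros sa_def op_adj_scale)
  also have "op_scale (- \<i>) id_blinfun = - op_scale \<i> id_blinfun"
    by (rule blinfun_eqI) (simp add: blinfun.minus_left scaleC_minus_left)
  finally show adj: "op_adj T = S - op_scale \<i> id_blinfun" by simp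
  have "Im (cinner (S x) x) = 0" for x
  proof -
    have "cinner (S x) x = cnj (cinner (S x) x)"
      using sa_cinner[OF S, of x x] cinner_commute[of x "S x"] by simp
    then have "Im (cinner (S x) x) = Im (cnj (cinner (S x) x))" by (rule arg_cong)
    then show ?thesis by simp
  qed
  then have "Re (cinner (S x) (\<i> *\<^sub>C x)) = 0" for x by (simp add: cinner_scaleC_right)
  then have n: "(norm (S x + \<i> *\<^sub>C x))\<^sup>2 = (norm (S x))\<^sup>2 + (norm x)\<^sup>2"
    "(norm (S x - \<i> *\<^sub>C x))\<^sup>2 = (norm (S x))\<^sup>2 + (norm x)\<^sup>2" for x
    using norm_add_sq[of "S x" "\<i> *\<^sub>C x"] norm_add_sq[of "S x" "- (\<i> *\<^sub>C x)"]
    by (simp_all add: norm_scaleC cinner.minus_right)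
  have b1: "norm x \<le> norm (T x)" for x
    by (rule power2_le_imp_le) (simp_all add: T_def blinfun.add_left n)
  have b2: "norm x \<le> norm (op_adj T x)" for x
    unfolding adj by (rule power2_le_imp_le) (simp_all add: blinfun.diff_left n)
  show "oinv T \<in> bounded_ops" "T \<cdot> oinv T = id_blinfun" "oinv T \<cdot> T = id_blinfun" "norm (oinv T) \<le> 1"
    by (rule bounded_below_inverse[OF T b1 b2])+
qed

section \<open>The bicommutant of the left regular representation\<close>

context l2_algebra
begin

abbreviation LA where "LA \<equiv> L ` A"

lemma LA_ops: "LA \<subseteq> bounded_ops" using L_bounded_ops by auto

lemma LA_adj: "S \<in> LA \<Longrightarrow> op_adj S \<in> LA" by (auto simp flip: L_adj intro!: imageI adj_in)

lemma comm_adj: "S \<in> commutant LA \<Longrightarrow> op_adj S \<in> commutant LA"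
  using commutant_adj[OF LA_ops LA_adj] by blast

lemma bicomm_adj: "S \<in> commutant (commutant LA) \<Longrightarrow> op_adj S \<in> commutant (commutant LA)"
  using commutant_adj[OF commutant_subset comm_adj] by blast

lemma bicomm_R: "T \<in> commutant (commutant LA) \<Longrightarrow> b \<in> A \<Longrightarrow> T \<cdot> R b = R b \<cdot> T"
  using commutant_eq R_commutant by blast

text \<open>\<open>T\<close> commutes with right multiplications, and these carry
  \<open>\<iota> id_blinfun\<close> to all of the dense set.\<close>

lemma bicomm_determined:
  assumes T: "T \<in> commutant (commutant LA)" and a: "a \<in> A" "T (\<iota> id_blinfun) = \<iota> a"
  shows "T = L a"
proof (rule l2_ext_unique)
  fix x assume x: "x \<in> A"
  have "T (\<iota> x) = (T \<cdot> R x) (\<iota> id_blinfun)" by (simp add: R_\<iota> x)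
  also have "\<dots> = R x (\<iota> a)" unfolding bicomm_R[OF T x] by (simp add: a)
  also have "\<dots> = L a (\<iota> x)" by (simp add: R_\<iota> L_\<iota> x a)
  finally show "T (\<iota> x) = L a (\<iota> x)" .
qed

lemma L_scaleR: "a \<in> A \<Longrightarrow> L (r *\<^sub>R a) = r *\<^sub>R L a"
  by (simp only: scaleR_eq_op_scale L_scale)

text \<open>Strong resolvent convergence: approximate \<open>S\<close> by self-adjoint \<open>a\<close> in \<open>A\<close> on the dense set
  \<open>\<iota> A\<close>; then \<open>(a + i)\<^sup>-\<^sup>1\<close> converges strongly to \<open>(S + i)\<^sup>-\<^sup>1\<close> and stays in the unit ball.\<close>

lemma bicomm_resolvent:
  assumes S: "S \<in> commutant (commutant LA)" "sa S"
  shows "\<exists>b\<in>A. L b = oinv (S + op_scale \<i> id_blinfun)"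
proof -
  define T where "T = S + op_scale \<i> id_blinfun"
  note C = cayley_denominator[OF S(2), folded T_def]
  let ?r = "oinv T" and ?e = "\<iota> id_blinfun"
  have "T \<in> commutant (commutant LA)"
    unfolding T_def by (intro commutant_add S commutant_scale commutant_id commutant_subset)
  then have r: "?r \<in> commutant (commutant LA)" by (rule commutant_inverse[OF _ C(2-4)])
  have Tr: "T (?r x) = x" "?r (T x) = x" for x
    using C(3,4) by (metis blinfun_apply_blinfun_compose id_blinfun.rep_eq id_apply)+
  have approx: "\<exists>a\<in>A. sa a \<and> norm (\<iota> a - S ?e) < \<delta>" if d: "\<delta> > 0" for \<delta>
  proof -
    obtain a where a: "a \<in> A" "norm (\<iota> a - S ?e) < \<delta>" using \<iota>_approx[OF d] by blast
    \<comment> \<open>\<open>S\<close> is self-adjoint and commutes with right multiplications, so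
      \<open>\<iota> (op_adj a)\<close> approximates \<open>S ?e\<close> as well as
      \<open>\<iota> a\<close> does; the mean of the two is self-adjoint.\<close>
    have sym: "cinner (\<iota> (op_adj a)) (S ?e) = cinner (S ?e) (\<iota> a)"
    proof -
      have "cinner (\<iota> (op_adj a)) (S ?e) = cinner ((S \<cdot> R (op_adj a)) ?e) ?e"
        using sa_cinner[OF S(2)] by (simp add: R_\<iota> adj_in a)
      also have "\<dots> = cinner (op_adj (R a) (S ?e)) ?e"
        unfolding bicomm_R[OF S(1) adj_in[OF a(1)]] by (simp add: R_adj a)
      also have "\<dots> = cinner (S ?e) (\<iota> a)" by (simp add: op_adj' R_bounded_ops a R_\<iota>)
      finally show ?thesis .
    qed
    have sq: "(norm (\<xi> - \<eta>))\<^sup>2 = (norm \<xi>)\<^sup>2 - 2 * Re (cinner \<xi> \<eta>) + (norm \<eta>)\<^sup>2" for \<xi> \<eta> :: 'l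
      using norm_add_sq[of \<xi> "- \<eta>"] by (simp add: cinner.minus_right)
    have "(norm (\<iota> (op_adj a) - S ?e))\<^sup>2 = (norm (\<iota> a - S ?e))\<^sup>2"
      unfolding sq sym \<iota>_adj_norm[OF a(1)] Re_cinner_commute[of "S ?e"] ..
    then have n: "norm (\<iota> (op_adj a) - S ?e) = norm (\<iota> a - S ?e)" by simp
    let ?a = "(1/2) *\<^sub>R (a + op_adj a)"
    have "\<iota> ?a - S ?e = (1/2) *\<^sub>R ((\<iota> a - S ?e) + (\<iota> (op_adj a) - S ?e))"
      by (simp add: \<iota>_scaleR \<iota>_add in_intros a algebra_simps flip: scaleR_add_left)
    then have "norm (\<iota> ?a - S ?e) < \<delta>"
      using norm_triangle_ineq[of "\<iota> a - S ?e" "\<iota> (op_adj a) - S ?e"] n a(2) by simp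
    moreover have "sa ?a"
      using a(1) by (simp add: sa_def bounded_ops_intros bops op_adj_bounded_ops op_adj_scaleR op_adj_add add.commute)
    ultimately show ?thesis using a(1) by (intro bexI[of _ ?a]) (auto intro: in_intros)
  qed
  have "\<exists>b\<in>A. \<iota> b = ?r ?e"
  proof (rule l2_ball_closed[of 1])
    fix e :: real assume e: "0 < e"
    define K where "K = norm T + 1"
    have K: "K > 0" by (simp add: K_def add_nonneg_pos)
    obtain y where y: "y \<in> A" "norm (\<iota> y - ?r ?e) < e / (4 * K)"
      using \<iota>_approx[of "e / (4 * K)"] e K by auto
    have "norm (T (\<iota> y) - ?e) = norm (T (\<iota> y - ?r ?e))" by (simp add: blinfun.diff_right Tr)
    also have "\<dots> \<le> norm T * (e / (4 * K))"
      using y by (intro order_trans[OF norm_blinfun] mult_left_mono) auto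
    also have "\<dots> \<le> e / 4" using e K by (simp add: K_def field_simps)
    finally have y2: "norm (T (\<iota> y) - ?e) \<le> e / 4" .
    define k where "k = norm y + 1"
    have k: "k > 0" by (simp add: k_def add_nonneg_pos)
    \<comment> \<open>\<open>a\<close> is chosen after \<open>y\<close>: replacing \<open>S\<close>
      by \<open>L a\<close> at \<open>\<iota> y\<close> costs \<open>R y (S ?e - \<iota> a)\<close>,
      whose norm involves the operator norm of \<open>y\<close>.\<close>
    obtain a where a: "a \<in> A" "sa a" "norm (\<iota> a - S ?e) < e / (4 * k)"
      using approx[of "e / (4 * k)"] e k by auto
    define w where "w = a + op_scale \<i> id_blinfun"
    note W = cayley_denominator[OF a(2), folded w_def]
    have wA: "w \<in> A" by (simp add: w_def in_intros a)
    have rA: "oinv w \<in> A" by (rule inverse_in[OF wA W(2-4)])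
    have "L (oinv w) \<cdot> L w = id_blinfun" by (simp flip: L_comp add: rA wA W(4) L_id)
    then have Lr: "L (oinv w) (L w \<xi>) = \<xi>" for \<xi>
      by (metis blinfun_apply_blinfun_compose id_blinfun.rep_eq id_apply)
    have nL: "norm (L (oinv w) \<xi>) \<le> norm \<xi>" for \<xi>
      using norm_blinfun[of "L (oinv w)" \<xi>] mult_right_mono[OF order_trans[OF L_norm[OF rA] W(5)] norm_ge_zero[of \<xi>]]
      by simp
    have Lw: "L w \<xi> = L a \<xi> + \<i> *\<^sub>C \<xi>" for \<xi>
      by (simp add: w_def L_add in_intros a L_scale L_id blinfun.add_left)
    have "S (\<iota> y) - L a (\<iota> y) = R y (S ?e - \<iota> a)"
    proof -
      have "R y (S ?e) = (S \<cdot> R y) ?e" unfolding bicomm_R[OF S(1) y(1)] by simp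
      then show ?thesis by (simp add: blinfun.diff_right R_\<iota> y a L_\<iota>)
    qed
    then have "norm (S (\<iota> y) - L a (\<iota> y)) \<le> norm y * norm (S ?e - \<iota> a)"
      using norm_blinfun[of "R y" "S ?e - \<iota> a"] mult_right_mono[OF R_norm[OF y(1)] norm_ge_zero[of "S ?e - \<iota> a"]]
      by simp
    also have "\<dots> \<le> norm y * (e / (4 * k))"
      using a(3) by (intro mult_left_mono) (auto simp: norm_minus_commute)
    also have "\<dots> \<le> e / 4" using e k by (simp add: k_def field_simps)
    finally have y3: "norm (S (\<iota> y) - L a (\<iota> y)) \<le> e / 4" .
    have "L (oinv w) (T (\<iota> y)) - \<iota> y = L (oinv w) (T (\<iota> y)) - L (oinv w) (L w (\<iota> y))" by (simp add: Lr)
    also have "\<dots> = L (oinv w) (S (\<iota> y) - L a (\<iota> y))"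
      by (simp add: T_def Lw blinfun.add_left flip: blinfun.diff_right)
    finally have 2: "norm (L (oinv w) (T (\<iota> y)) - \<iota> y) \<le> e / 4" using nL[of "S (\<iota> y) - L a (\<iota> y)"] y3 by simp
    have 1: "norm (L (oinv w) (?e - T (\<iota> y))) \<le> e / 4"
      using nL[of "?e - T (\<iota> y)"] y2 by (simp add: norm_minus_commute)
    have 3: "norm (\<iota> y - ?r ?e) \<le> e / 4"
    proof -
      have "1 \<le> K" by (simp add: K_def)
      then have "e / (4 * K) \<le> e / (4 * 1)" using e by (intro divide_left_mono) auto
      then show ?thesis using y(2) by simp
    qed
    \<comment> \<open>The three errors are \<open>?e\<close> against \<open>T (\<iota> y)\<close>,
      \<open>T\<close> against \<open>L w\<close> at \<open>\<iota> y\<close>, and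
      \<open>\<iota> y\<close> against \<open>?r ?e\<close>; the resolvent \<open>L (oinv w)\<close>
      is a contraction and does not enlarge them.\<close>
    have "\<iota> (oinv w) - ?r ?e = L (oinv w) (?e - T (\<iota> y)) + (L (oinv w) (T (\<iota> y)) - \<iota> y) + (\<iota> y - ?r ?e)"
      by (simp add: blinfun.diff_right L_\<iota> rA)
    also have "norm \<dots> \<le> e / 4 + e / 4 + e / 4"
      by (intro order_trans[OF norm_triangle_ineq] add_mono 1 2 3)
    also have "\<dots> < e" using e by simp
    finally show "\<exists>a\<in>A. norm a \<le> 1 \<and> norm (\<iota> a - ?r ?e) < e" using rA W(5) by blast
  qed simp
  then obtain b where "b \<in> A" "?r ?e = \<iota> b" by metis
  from bicomm_determined[OF r this] this show ?thesis unfolding T_def by metis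
qed

text \<open>A small self-adjoint \<open>T\<close> in the bicommutant is \<open>2 S (1 + S\<^sup>2)\<^sup>-\<^sup>1 = (S + i)\<^sup>-\<^sup>1 + (S - i)\<^sup>-\<^sup>1\<close>, where \<open>S\<close>
  is the fixed point of the contraction \<open>S \<mapsto> T (1 + S\<^sup>2) / 2\<close> of the unit ball.\<close>

lemma bicomm_small_sa:
  assumes T: "T \<in> commutant (commutant LA)" "sa T" "norm T \<le> 1/2"
  shows "\<exists>b\<in>A. L b = T"
proof -
  \<comment> \<open>Commutation with \<open>T\<close> is built into \<open>X\<close> because it
    makes \<open>f S\<close> self-adjoint.\<close>
  define X where "X = commutant (commutant LA) \<inter> {S. sa S} \<inter> {S. S \<cdot> T = T \<cdot> S} \<inter> cball 0 1"
  define f where "f = (\<lambda>S. (1/2) *\<^sub>R (T \<cdot> (id_blinfun + S \<cdot> S)))"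
  have "closed {S. S \<cdot> T = T \<cdot> S}"
    by (intro closed_Collect_eq linear_continuous_on comp.bounded_linear_left comp.bounded_linear_right)
  then have "closed X" unfolding X_def by (intro closed_Int closed_commutant closed_sa closed_cball)
  then have "complete X" by (simp add: complete_eq_closed)
  moreover have "0 \<in> X" using commutant_scaleR[OF commutant_subset T(1), of 0] by (simp add: X_def)
  moreover have "f S \<in> X" if "S \<in> X" for S
  proof -
    have S: "S \<in> commutant (commutant LA)" "sa S" "S \<cdot> T = T \<cdot> S" "norm S \<le> 1"
      using that by (auto simp: X_def)
    have SS: "(S \<cdot> S) \<cdot> T = T \<cdot> (S \<cdot> S)" using S(3) by (metis comp_assoc)
    have "f S \<in> commutant (commutant LA)"
      unfolding f_def by (intro commutant_scaleR commutant_comp commutant_add commutant_id T S commutant_subset)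
    moreover have "sa (f S)"
      using S(2) T(2) SS unfolding f_def sa_def
      by (simp add: bounded_ops_intros op_adj_scaleR op_adj_comp op_adj_add comp_simps)
    moreover have "f S \<cdot> T = T \<cdot> f S" using SS by (simp add: f_def comp_simps comp_assoc)
    moreover have "norm (f S) \<le> 1"
    proof -
      have "norm (S \<cdot> S) \<le> 1 * 1"
        by (rule order_trans[OF norm_blinfun_compose]) (use S(4) in \<open>intro mult_mono; simp\<close>)
      then have "norm (id_blinfun + S \<cdot> S) \<le> 2"
        using norm_triangle_ineq[of id_blinfun "S \<cdot> S"] norm_blinfun_id_le[where 'a='l] by linarith
      then have "norm (T \<cdot> (id_blinfun + S \<cdot> S)) \<le> (1/2) * 2"
        by (intro order_trans[OF norm_blinfun_compose] mult_mono T) auto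
      then show ?thesis by (simp add: f_def)
    qed
    ultimately show ?thesis by (simp add: X_def)
  qed
  \<comment> \<open>Squaring is 2-Lipschitz on the unit ball; the factor 1/2 in \<open>f\<close> and
    the bound 1/2 on \<open>T\<close> turn this into a contraction.\<close>
  moreover have "dist (f S) (f S') \<le> (1/2) * dist S S'" if "S \<in> X" "S' \<in> X" for S S'
  proof -
    have n: "norm S \<le> 1" "norm S' \<le> 1" using that by (auto simp: X_def)
    have e: "f S - f S' = (1/2) *\<^sub>R (T \<cdot> (S \<cdot> (S - S') + (S - S') \<cdot> S'))"
      by (simp add: f_def comp_simps scaleR_diff_right scaleR_add_right)
    have "norm (S \<cdot> (S - S')) \<le> 1 * norm (S - S')" "norm ((S - S') \<cdot> S') \<le> norm (S - S') * 1"
      by (rule order_trans[OF norm_blinfun_compose], use n in \<open>intro mult_mono; simp\<close>)+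
    then have "norm (S \<cdot> (S - S') + (S - S') \<cdot> S') \<le> 2 * norm (S - S')"
      using norm_triangle_ineq[of "S \<cdot> (S - S')" "(S - S') \<cdot> S'"] by linarith
    then have "norm (T \<cdot> (S \<cdot> (S - S') + (S - S') \<cdot> S')) \<le> (1/2) * (2 * norm (S - S'))"
      by (intro order_trans[OF norm_blinfun_compose] mult_mono T) auto
    then show ?thesis by (simp add: dist_norm e)
  qed
  ultimately have "\<exists>!S\<in>X. f S = S" by (intro Banach_fix[of X "1/2"]) auto
  then obtain S where "S \<in> X" "f S = S" by blast
  then have S: "S \<in> commutant (commutant LA)" "sa S" "S \<cdot> T = T \<cdot> S" and TS: "T + T \<cdot> S \<cdot> S = 2 *\<^sub>R S"
    by (auto simp: X_def f_def comp_simps comp_assoc dest: arg_cong[of _ _ "\<lambda>x. 2 *\<^sub>R x"])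
  obtain b where b: "b \<in> A" "L b = oinv (S + op_scale \<i> id_blinfun)" using bicomm_resolvent[OF S(1,2)] by blast
  define V where "V = S + op_scale \<i> id_blinfun"
  note C = cayley_denominator[OF S(2), folded V_def]
  let ?r = "oinv V" and ?s = "op_adj (oinv V)"
  have Sb: "S \<in> bounded_ops" "T \<in> bounded_ops" using S T sa_bounded_ops by auto
  have Vs: "op_adj V \<cdot> ?s = id_blinfun"
    using op_adj_comp[OF C(2,1)] C(4) by simp
  \<comment> \<open>With V V* = S^2 + 1 and V + V* = 2 S this is the fixed point equation;
    cancelling \<open>V\<close> on the left and its adjoint on the right leaves \<open>T\<close> as
    a sum of two resolvents.\<close>
  have "V \<cdot> T \<cdot> op_adj V = V + op_adj V"
  proof -
    have i: "op_scale \<i> (op_scale \<i> T) = - T"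
      by (rule blinfun_eqI) (simp add: scaleC_scaleC blinfun.minus_left scaleC_minus_left[of 1, simplified])
    have "V \<cdot> T \<cdot> op_adj V = T \<cdot> (V \<cdot> op_adj V)"
      using S(3) by (simp add: V_def comp_simps op_scale_comp comp_op_scale Sb flip: comp_assoc)
    also have "V \<cdot> op_adj V = S \<cdot> S + id_blinfun"
    proof (rule blinfun_eqI)
      show "(V \<cdot> op_adj V) x = (S \<cdot> S + id_blinfun) x" for x
        using scaleC_scaleC[of \<i> \<i> x] scaleC_minus_left[of 1 x] unfolding C(6)
        by (simp add: V_def blinfun.add_left blinfun.diff_left blinfun.diff_right bounded_opsD[OF Sb(1)] scaleC_diff_right)
    qed
    also have "T \<cdot> (S \<cdot> S + id_blinfun) = V + op_adj V"
      using TS unfolding C(6) by (simp add: comp_simps comp_assoc V_def scaleR_2 add.commute)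
    finally show ?thesis .
  qed
  then have "?r \<cdot> (V \<cdot> T \<cdot> op_adj V) \<cdot> ?s = ?r \<cdot> (V + op_adj V) \<cdot> ?s" by simp
  moreover have "?r \<cdot> (V \<cdot> T \<cdot> op_adj V) \<cdot> ?s = (?r \<cdot> V) \<cdot> T \<cdot> (op_adj V \<cdot> ?s)" by (simp only: comp_assoc)
  moreover have "?r \<cdot> (V + op_adj V) \<cdot> ?s = (?r \<cdot> V) \<cdot> ?s + ?r \<cdot> (op_adj V \<cdot> ?s)" by (simp only: comp_simps comp_assoc)
  ultimately have "T = ?s + ?r" by (simp add: C(4) Vs)
  then have "L (op_adj b + b) = T" using b by (simp add: L_add L_adj adj_in V_def)
  then show ?thesis using b(1) adj_in add_in by blast
qed

text \<open>Scaling reduces self-adjoint operators to small ones, and a general operator is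
  assembled from two self-adjoint ones.\<close>

lemma bicomm_LA: assumes T: "T \<in> commutant (commutant LA)" shows "\<exists>b\<in>A. L b = T"
proof -
  have sa: "\<exists>b\<in>A. L b = S" if S: "S \<in> commutant (commutant LA)" "sa S" for S
  proof -
    \<comment> \<open>The summand 1 keeps the factor positive when \<open>S = 0\<close>.\<close>
    define k where "k = 1 / (2 * norm S + 1)"
    have k: "k > 0" by (simp add: k_def add_nonneg_pos)
    have "0 < 1 + norm S * 2" by (simp add: add_pos_nonneg)
    then have "norm (k *\<^sub>R S) \<le> 1/2" by (simp add: k_def field_simps)
    with commutant_scaleR[OF commutant_subset S(1)] sa_scaleR[OF S(2)]
    have "\<exists>b\<in>A. L b = k *\<^sub>R S" by (rule bicomm_small_sa)
    then obtain b where b: "b \<in> A" "L b = k *\<^sub>R S" by blast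
    have "L ((1/k) *\<^sub>R b) = S" using k b by (simp add: L_scaleR)
    then show ?thesis using b(1) scaleR_in by blast
  qed
  note Tb = commutant_bounded_ops[OF T] and Ta = bicomm_adj[OF T]
  obtain b where b: "b \<in> A" "L b = T + op_adj T"
    using sa[of "T + op_adj T"] T Ta Tb
    by (auto simp: sa_def bounded_ops_add op_adj_bounded_ops op_adj_add add.commute intro: commutant_add)
  have d: "T - op_adj T \<in> commutant (commutant LA)"
    using commutant_add[OF T commutant_scaleR[OF commutant_subset Ta, of "-1"]] by simp
  have "op_adj (op_scale \<i> (T - op_adj T)) = op_scale \<i> (T - op_adj T)"
  proof -
    have "op_adj (op_scale \<i> (T - op_adj T)) = op_scale (- \<i>) (op_adj T - T)"
      using Tb by (simp add: op_adj_scale bounded_ops_diff op_adj_bounded_ops op_adj_diff)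
    also have "\<dots> = op_scale \<i> (T - op_adj T)"
      by (rule blinfun_eqI) (simp add: scaleC_minus_left blinfun.diff_left scaleC_diff_right)
    finally show ?thesis .
  qed
  then obtain c where c: "c \<in> A" "L c = op_scale \<i> (T - op_adj T)"
    using sa[OF commutant_scale[OF commutant_subset d, of \<i>]] Tb
    by (auto simp: sa_def bounded_ops_diff bounded_ops_op_scale op_adj_bounded_ops)
  \<comment> \<open>\<open>b\<close> represents T + T*, and -\<i> times \<open>c\<close> represents
    T - T*.\<close>
  have "L (op_scale (1/2) (b + op_scale (- \<i>) c)) = T"
  proof (rule blinfun_eqI)
    show "L (op_scale (1/2) (b + op_scale (- \<i>) c)) x = T x" for x
      using scaleC_add_left[of "1/2" "1/2" "T x"]
      by (simp add: L_scale L_add in_intros b c blinfun.add_left blinfun.diff_left scaleC_scaleC scaleC_add_right)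
  qed
  then show ?thesis by (rule bexI) (intro scale_in add_in b(1) c(1))
qed

text \<open>The commutant contains the adjoints of its elements, so invariance of \<open>V\<close>
  already makes the projection commute with it.\<close>

lemma proj_LA:
  assumes V: "csubspace V" "closed V" and inv: "\<And>S x. S \<in> commutant LA \<Longrightarrow> x \<in> V \<Longrightarrow> blinfun_apply S x \<in> V"
  shows "\<exists>a\<in>A. L a = proj V"
proof (rule bicomm_LA)
  have "proj V \<cdot> S = S \<cdot> proj V" if S: "S \<in> commutant LA" for S
    by (rule proj_commutes[OF V commutant_bounded_ops[OF S] inv[OF S] inv[OF comm_adj[OF S]]])
  then show "proj V \<in> commutant (commutant LA)"
    using sa_bounded_ops[OF proj_sa[OF V]] by (simp add: commutant_def)
qed

lemma csubspace_kernel: "F \<in> bounded_ops \<Longrightarrow> csubspace {x. blinfun_apply F x = 0}"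
  by (auto simp: csubspace_def blinfun.add_right bounded_opsD)

lemma closed_kernel: "closed {x. blinfun_apply F x = 0}"
  by (intro closed_Collect_eq linear_continuous_on blinfun.bounded_linear_right continuous_on_const)

text \<open>The kernel of \<open>L s\<close> is invariant under the commutant, so the projection
  onto it is \<open>L a\<close> with \<open>s \<cdot> a = 0\<close>; cancellation in
  \<open>A\<close> then excludes a kernel.\<close>

lemma \<nu>_zero_iff_inj: assumes s: "s \<in> A" shows "\<nu> s \<le> 0 \<longleftrightarrow> (\<forall>x. L s x = 0 \<longrightarrow> x = 0)"
proof
  assume n: "\<nu> s \<le> 0"
  let ?V = "{x. L s x = 0}"
  note V = csubspace_kernel[OF L_bounded_ops[OF s]] closed_kernel[of "L s"]
  have "\<exists>a\<in>A. L a = proj ?V"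
  proof (rule proj_LA[OF V])
    fix S x assume S: "S \<in> commutant LA" and x: "x \<in> ?V"
    have "L s (S x) = S (L s x)"
      using arg_cong[OF commutant_eq[OF S imageI[OF s]], of "\<lambda>f. blinfun_apply f x"] by simp
    then show "S x \<in> ?V" using x by simp
  qed
  then obtain a where a: "a \<in> A" "L a = proj ?V" by blast
  have "L (s \<cdot> a) = 0"
    by (rule blinfun_eqI) (use proj_in[OF V] in \<open>simp add: L_comp s a\<close>)
  then have "s \<cdot> a = 0" by (intro L_inj comp_in s a)
  then have "a = 0" using n \<nu>_zero_iff_cancel[OF s] a by blast
  then have "proj ?V x = 0" for x using a L_diff[of 0 0] by simp
  then show "\<forall>x. L s x = 0 \<longrightarrow> x = 0" using proj_id[OF V] by auto
next
  assume i: "\<forall>x. L s x = 0 \<longrightarrow> x = 0"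
  show "\<nu> s \<le> 0"
    unfolding \<nu>_zero_iff_cancel[OF s]
  proof (intro ballI impI)
    fix y assume y: "y \<in> A" "s \<cdot> y = 0"
    have "L s (\<iota> y) = \<iota> 0" using y by (simp add: L_\<iota> s)
    also have "\<iota> 0 = 0" using \<iota>_diff[of 0 0] by simp
    finally show "y = 0" using i \<iota>_eq_zero y by blast
  qed
qed

lemma dense_orthogonal:
  assumes "closure X = UNIV" "\<And>x. x \<in> X \<Longrightarrow> cinner z x = (0 :: complex)"
  shows "z = (0 :: 'a::complex_hilbert)"
proof -
  have "closed {x. cinner z x = 0}"
    by (intro closed_Collect_eq linear_continuous_on cinner.bounded_linear_right continuous_on_const)
  then have "closure X \<subseteq> {x. cinner z x = 0}" by (intro closure_minimal) (use assms(2) in auto)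
  then have "cinner z z = 0" using assms(1) by auto
  then show ?thesis by (simp add: cinner_self)
qed

lemma csubspace_range: "F \<in> bounded_ops \<Longrightarrow> csubspace (range (blinfun_apply F))"
  unfolding csubspace_def
  by (auto simp flip: blinfun.add_right bounded_opsD) (metis blinfun.zero_right rangeI)

lemma csubspace_closure:
  assumes "csubspace X" shows "csubspace (closure X)"
proof -
  have "x + y \<in> closure X" if "x \<in> closure X" "y \<in> closure X" for x y
  proof -
    from that obtain u v where u: "\<And>n. u n \<in> X" "u \<longlonglongrightarrow> x" and v: "\<And>n. v n \<in> X" "v \<longlonglongrightarrow> y"
      unfolding closure_sequential by blast
    have "(\<lambda>n. u n + v n) \<longlonglongrightarrow> x + y" by (intro tendsto_add u v)
    moreover have "\<forall>n. u n + v n \<in> X" using u v assms by (simp add: csubspace_def)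
    ultimately show ?thesis unfolding closure_sequential by (intro exI[of _ "\<lambda>n. u n + v n"]) simp
  qed
  moreover have "0 \<in> closure X" using assms closure_subset unfolding csubspace_def by blast
  moreover have "c *\<^sub>C x \<in> closure X" if "x \<in> closure X" for c x
  proof -
    have "(\<lambda>x. c *\<^sub>C x) ` closure X \<subseteq> closure ((\<lambda>x. c *\<^sub>C x) ` X)"
      by (intro continuous_image_closure_subset[of UNIV] linear_continuous_on bounded_linear_scaleC) auto
    also have "\<dots> \<subseteq> closure X" by (rule closure_mono) (use assms in \<open>auto simp: csubspace_def\<close>)
    finally show ?thesis using that by auto
  qed
  ultimately show ?thesis by (simp add: csubspace_def)
qed

text \<open>The orthogonal complement of the range is the kernel of the adjoint, which has the same
  nullity as \<open>s\<close>.\<close>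

lemma dense_range: assumes s: "s \<in> A" "\<nu> s \<le> 0" shows "closure (range (L s)) = UNIV"
proof -
  note V = csubspace_closure[OF csubspace_range[OF L_bounded_ops[OF s(1)]]] closed_closure
  have "x \<in> closure (range (L s))" for x
  proof -
    obtain p where p: "p \<in> closure (range (L s))" "\<And>v. v \<in> closure (range (L s)) \<Longrightarrow> cinner (x - p) v = 0"
      using orthogonal_projection_exists[OF V, of x] by blast
    have "L (op_adj s) (x - p) = 0"
    proof (rule cinner_eqI)
      fix z
      have "L s z \<in> closure (range (L s))" by (rule subsetD[OF closure_subset]) simp
      then show "cinner (L (op_adj s) (x - p)) z = cinner 0 z"
        using p(2) by (simp add: L_adj s op_adj' L_bounded_ops)
    qed
    moreover have "\<nu> (op_adj s) \<le> 0" using s by (simp add: \<nu>_adj)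
    ultimately have "x - p = 0" using \<nu>_zero_iff_inj[OF adj_in[OF s(1)]] by blast
    then show ?thesis using p by simp
  qed
  then show ?thesis by blast
qed

section \<open>Affiliated operators and the projections onto their graphs\<close>

lemma affiliatedD:
  assumes "G \<in> affiliated LA"
  shows affiliated_single: "(x, y) \<in> G \<Longrightarrow> (x, z) \<in> G \<Longrightarrow> y = z"
    and affiliated_closed: "closed G" and affiliated_dense: "closure (Domain G) = UNIV"
    and affiliated_subspace: "csubspace G"
    and affiliated_comm: "S \<in> commutant LA \<Longrightarrow> (x, y) \<in> G \<Longrightarrow> (S x, S y) \<in> G"
proof -
  have *: "single_valued G" "closed G" "closure (Domain G) = UNIV" "(0, 0) \<in> G"
    "\<And>x y x' y'. (x, y) \<in> G \<Longrightarrow> (x', y') \<in> G \<Longrightarrow> (x + x', y + y') \<in> G"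
    "\<And>c x y. (x, y) \<in> G \<Longrightarrow> (c *\<^sub>C x, c *\<^sub>C y) \<in> G"
    "\<And>S x y. S \<in> commutant LA \<Longrightarrow> (x, y) \<in> G \<Longrightarrow> (S x, S y) \<in> G"
    using assms unfolding affiliated_def closed_densely_defined_def by blast+
  then show "(x, y) \<in> G \<Longrightarrow> (x, z) \<in> G \<Longrightarrow> y = z" "closed G" "closure (Domain G) = UNIV"
    "S \<in> commutant LA \<Longrightarrow> (x, y) \<in> G \<Longrightarrow> (S x, S y) \<in> G"
    by (auto dest: single_valuedD)
  show "csubspace G"
    unfolding csubspace_def by (auto simp: scaleC_prod_def zero_prod_def *)
qed

lemma affiliatedI:
  assumes "\<And>x y z. (x, y) \<in> G \<Longrightarrow> (x, z) \<in> G \<Longrightarrow> y = z" "closed G" "closure (Domain G) = UNIV" "csubspace G"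
    "\<And>S x y. S \<in> commutant LA \<Longrightarrow> (x, y) \<in> G \<Longrightarrow> (blinfun_apply S x, blinfun_apply S y) \<in> G"
  shows "G \<in> affiliated LA"
proof -
  have "(x + x', y + y') \<in> G" if "(x, y) \<in> G" "(x', y') \<in> G" for x y x' y'
    using assms(4) that unfolding csubspace_def by fastforce
  moreover have "(c *\<^sub>C x, c *\<^sub>C y) \<in> G" if "(x, y) \<in> G" for c x y
    using assms(4) that unfolding csubspace_def scaleC_prod_def by fastforce
  moreover have "(0, 0) \<in> G" using assms(4) by (simp add: csubspace_def zero_prod_def)
  ultimately show ?thesis
    using assms unfolding affiliated_def closed_densely_defined_def single_valued_def by blast
qed

text \<open>The commutant acts diagonally on pairs and preserves the graph. Hence the four entries
  of the projection commute with it, and the commutation theorem places them in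
  \<open>A\<close>.\<close>

lemma graph_projection:
  assumes G: "G \<in> affiliated LA"
  obtains p q r t where "p \<in> A" "q \<in> A" "r \<in> A" "t \<in> A"
    "\<And>x y. proj G (x, y) = (L p x + L q y, L r x + L t y)"
proof -
  note V = affiliated_subspace[OF G] affiliated_closed[OF G]
  let ?E = "proj G"
  have Eb: "?E \<in> bounded_ops" by (intro sa_bounded_ops proj_sa V)
  have Ecomm: "?E (S x, S y) = (S (fst (?E (x, y))), S (snd (?E (x, y))))" if S: "S \<in> commutant LA" for S x y
  proof -
    let ?D = "\<lambda>S z. (blinfun_apply S (fst z), blinfun_apply S (snd z))"
    have bl: "bounded_linear (?D S)" for S :: "'l \<Rightarrow>\<^sub>L 'l"
      by (intro bounded_linear_Pair bounded_linear_compose[OF blinfun.bounded_linear_right]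
          bounded_linear_fst bounded_linear_snd)
    note ap = bounded_linear_Blinfun_apply[OF bl]
    have Sb: "S \<in> bounded_ops" by (rule commutant_bounded_ops[OF S])
    have Db: "Blinfun (?D S) \<in> bounded_ops"
      by (simp add: bounded_ops_def ap scaleC_prod_def bounded_opsD[OF Sb])
    have adj: "op_adj (Blinfun (?D S)) = Blinfun (?D (op_adj S))"
      by (rule op_adjI) (simp add: ap cinner_prod_def op_adj[OF Sb])
    have "?E \<cdot> Blinfun (?D S) = Blinfun (?D S) \<cdot> ?E"
      by (rule proj_commutes[OF V Db])
         (auto simp: ap adj intro: affiliated_comm[OF G S] affiliated_comm[OF G comm_adj[OF S]])
    from arg_cong[OF this, of "\<lambda>f. blinfun_apply f (x, y)"] show ?thesis by (simp add: ap)
  qed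
  have entry: "\<exists>a\<in>A. \<forall>x. L a x = f (?E (g x))"
    if f: "bounded_linear f" "\<And>c z. f (c *\<^sub>C z) = c *\<^sub>C f z"
      and g: "bounded_linear g" "\<And>c x. g (c *\<^sub>C x) = c *\<^sub>C g x"
      and fg: "\<And>S x. S \<in> commutant LA \<Longrightarrow> f (?E (g (blinfun_apply S x))) = S (f (?E (g x)))"
    for f :: "'l \<times> 'l \<Rightarrow> 'l" and g :: "'l \<Rightarrow> 'l \<times> 'l"
  proof -
    have bl: "bounded_linear (\<lambda>x. f (?E (g x)))"
      by (intro bounded_linear_compose[OF f(1)] bounded_linear_compose[OF blinfun.bounded_linear_right] g(1))
    note ap = bounded_linear_Blinfun_apply[OF bl]
    have "Blinfun (\<lambda>x. f (?E (g x))) \<in> commutant (commutant LA)"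
      unfolding commutant_def[of "commutant LA"]
      by (auto simp: bounded_ops_def ap f g bounded_opsD[OF Eb] fg intro!: blinfun_eqI)
    from bicomm_LA[OF this] obtain b where "b \<in> A" "L b = Blinfun (\<lambda>x. f (?E (g x)))" by blast
    then show ?thesis by (intro bexI[of _ b]) (simp_all add: ap)
  qed
  have 1: "bounded_linear (fst :: 'l \<times> 'l \<Rightarrow> 'l)" "\<And>c z. fst (c *\<^sub>C (z :: 'l \<times> 'l)) = c *\<^sub>C fst z"
    and 2: "bounded_linear (snd :: 'l \<times> 'l \<Rightarrow> 'l)" "\<And>c z. snd (c *\<^sub>C (z :: 'l \<times> 'l)) = c *\<^sub>C snd z"
    by (simp_all add: bounded_linear_fst bounded_linear_snd scaleC_prod_def)
  have 3: "bounded_linear (\<lambda>x :: 'l. (x, 0 :: 'l))" "\<And>c (x :: 'l). (c *\<^sub>C x, 0 :: 'l) = c *\<^sub>C (x, 0)"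
    and 4: "bounded_linear (\<lambda>x :: 'l. (0 :: 'l, x))" "\<And>c (x :: 'l). (0 :: 'l, c *\<^sub>C x) = c *\<^sub>C (0, x)"
    by (auto intro: bounded_linear_Pair bounded_linear_ident bounded_linear_zero simp: scaleC_prod_def)
  have c1: "?E (S x, 0) = (S (fst (?E (x, 0))), S (snd (?E (x, 0))))"
    and c2: "?E (0, S x) = (S (fst (?E (0, x))), S (snd (?E (0, x))))" if "S \<in> commutant LA" for S x
    using Ecomm[OF that, of x 0] Ecomm[OF that, of 0 x] by simp_all
  obtain p where p: "p \<in> A" "\<forall>x. L p x = fst (?E (x, 0))" using entry[OF 1 3] by (auto simp: c1)
  obtain q where q: "q \<in> A" "\<forall>x. L q x = fst (?E (0, x))" using entry[OF 1 4] by (auto simp: c2)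
  obtain r where r: "r \<in> A" "\<forall>x. L r x = snd (?E (x, 0))" using entry[OF 2 3] by (auto simp: c1)
  obtain t where t: "t \<in> A" "\<forall>x. L t x = snd (?E (0, x))" using entry[OF 2 4] by (auto simp: c2)
  have "?E (x, y) = (L p x + L q y, L r x + L t y)" for x y
    using blinfun.add_right[of ?E "(x, 0)" "(0, y)"] p q r t by (simp add: prod_eq_iff)
  then show thesis using that p q r t by blast
qed

text \<open>For \<open>(x, y)\<close> in the graph the second component of the projection gives
  \<open>r x + t y = y\<close>, that is \<open>(1 - t) y = r x\<close>. A vector fixed by
  \<open>t\<close> would give \<open>(0, y) \<in> G\<close>, so the denominator is
  injective.\<close>

lemma affiliated_left_fraction:
  assumes G: "G \<in> affiliated LA"
  shows "\<exists>s\<in>A. \<exists>a\<in>A. \<nu> s \<le> 0 \<and> (\<forall>(x, y)\<in>G. L s y = L a x)"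
proof -
  note V = affiliated_subspace[OF G] affiliated_closed[OF G]
  obtain p q r t where A: "p \<in> A" "q \<in> A" "r \<in> A" "t \<in> A"
    and E: "\<And>x y. proj G (x, y) = (L p x + L q y, L r x + L t y)" using graph_projection[OF G] by metis
  have "y = 0" if y: "L (id_blinfun - t) y = 0" for y
  proof -
    have ty: "L t y = y" using y by (simp add: L_diff A L_id blinfun.diff_left)
    have E0: "proj G (0, y) = (L q y, y)" by (simp add: E ty)
    \<comment> \<open>A projection satisfies <E v, v> = |E v|^2; the term |y|^2 cancels and leaves
      \<open>L q y = 0\<close>.\<close>
    have "cinner (proj G (0, y)) (0, y) = cinner (proj G (0, y)) (proj G (0, y))"
      using sa_cinner[OF proj_sa[OF V], of "(0, y)" "proj G (0, y)"] proj_id[OF V proj_in[OF V]] sa_cinner[OF proj_sa[OF V]]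
      by metis
    then have "cinner (L q y) (L q y) = 0" by (simp add: E0 cinner_prod_def)
    then have "L q y = 0" by (simp add: cinner_self)
    then have "(0, y) \<in> G" using proj_in[OF V, of "(0, y)"] E0 by simp
    moreover have "(0, 0) \<in> G" using V by (simp add: csubspace_def zero_prod_def)
    ultimately show "y = 0" by (rule affiliated_single[OF G])
  qed
  then have "\<nu> (id_blinfun - t) \<le> 0" using \<nu>_zero_iff_inj[of "id_blinfun - t"] by (simp add: diff_in A)
  moreover have "L (id_blinfun - t) y = L r x" if "(x, y) \<in> G" for x y
    using proj_id[OF V that] E[of x y] by (simp add: L_diff A L_id blinfun.diff_left diff_eq_eq)
  ultimately show ?thesis
    by (intro bexI[of _ "id_blinfun - t"] bexI[of _ r]) (auto simp: diff_in A)
qed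

text \<open>The first component of the projection always lies in the domain. A vector killed by
  \<open>p\<close> is orthogonal to the domain, which is dense.\<close>

lemma affiliated_domain:
  assumes G: "G \<in> affiliated LA"
  shows "\<exists>p\<in>A. \<nu> p \<le> 0 \<and> range (L p) \<subseteq> Domain G"
proof -
  note V = affiliated_subspace[OF G] affiliated_closed[OF G]
  obtain p q r t where A: "p \<in> A" "q \<in> A" "r \<in> A" "t \<in> A"
    and E: "\<And>x y. proj G (x, y) = (L p x + L q y, L r x + L t y)" using graph_projection[OF G] by metis
  have E0: "proj G (x, 0) = (L p x, L r x)" for x by (simp add: E)
  have "x = 0" if x: "L p x = 0" for x
  proof -
    have "cinner (proj G (x, 0)) (x, 0) = 0" by (simp add: E0 x cinner_prod_def)
    moreover have "cinner (proj G (x, 0)) (x, 0) = cinner (proj G (x, 0)) (proj G (x, 0))"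
      using sa_cinner[OF proj_sa[OF V]] proj_id[OF V proj_in[OF V]] by metis
    ultimately have z: "proj G (x, 0) = 0" by (simp add: cinner_self)
    have "cinner x u = 0" if u: "u \<in> Domain G" for u
    proof -
      obtain v where uv: "(u, v) \<in> G" using u by blast
      have "cinner x u = cinner (x, 0 :: 'l) (u, v)" by (simp add: cinner_prod_def)
      also have "\<dots> = cinner (proj G (x, 0)) (u, v)" using sa_cinner[OF proj_sa[OF V]] proj_id[OF V uv] by metis
      finally show ?thesis by (simp add: z)
    qed
    then show "x = 0" by (rule dense_orthogonal[OF affiliated_dense[OF G]])
  qed
  then have "\<nu> p \<le> 0" using \<nu>_zero_iff_inj[OF A(1)] by blast
  moreover have "L p x \<in> Domain G" for x using proj_in[OF V, of "(x, 0)"] by (auto simp: E0)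
  ultimately show ?thesis using A(1) by blast
qed

end

section \<open>Fractions and the operations on affiliated operators\<close>

context l2_algebra
begin

lemma common_denominator:
  assumes "s \<in> A" "\<nu> s \<le> 0" "t \<in> A" "\<nu> t \<le> 0"
  obtains u v where "u \<in> A" "v \<in> A" "u \<cdot> s = v \<cdot> t" "\<nu> (u \<cdot> s) \<le> 0"
proof -
  obtain u x where "u \<in> A" "x \<in> A" "u \<cdot> s = x \<cdot> t" "\<nu> u \<le> \<nu> t" using ore[OF assms(1,3)] by blast
  with \<nu>_comp_le[of u s] assms show thesis by (intro that[of u x]) auto
qed

lemma ore_right:
  assumes "a \<in> A" "c \<in> A"
  obtains u x where "u \<in> A" "x \<in> A" "a \<cdot> u = c \<cdot> x" "\<nu> u \<le> \<nu> c"
proof -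
  obtain u x where ux: "u \<in> A" "x \<in> A" "u \<cdot> op_adj a = x \<cdot> op_adj c" "\<nu> u \<le> \<nu> (op_adj c)"
    using ore[OF adj_in[OF assms(1)] adj_in[OF assms(2)]] by blast
  have "op_adj (u \<cdot> op_adj a) = a \<cdot> op_adj u" "op_adj (x \<cdot> op_adj c) = c \<cdot> op_adj x"
    using ux(1,2) assms by (simp_all add: op_adj_comp bops op_adj_bounded_ops)
  then have "a \<cdot> op_adj u = c \<cdot> op_adj x" using ux(3) by simp
  then show thesis using ux assms by (intro that[of "op_adj u" "op_adj x"]) (auto simp: adj_in \<nu>_adj)
qed

text \<open>Only the inclusion of s G in \<open>a\<close> is demanded, so the property passes to
  subsets and to closures.\<close>

definition lfrac :: "('h \<Rightarrow>\<^sub>L 'h) \<Rightarrow> ('h \<Rightarrow>\<^sub>L 'h) \<Rightarrow> ('l \<times> 'l) set \<Rightarrow> bool" where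
  "lfrac s a G \<longleftrightarrow> (\<forall>(x, y)\<in>G. L s y = L a x)"

lemma fracD: "lfrac s a G \<Longrightarrow> (x, y) \<in> G \<Longrightarrow> L s y = L a x" by (auto simp: lfrac_def)

lemma frac_comp: "lfrac s a G \<Longrightarrow> u \<in> A \<Longrightarrow> s \<in> A \<Longrightarrow> a \<in> A \<Longrightarrow> lfrac (u \<cdot> s) (u \<cdot> a) G"
  by (auto simp: lfrac_def L_comp)

lemma frac_subset: "lfrac s a Y \<Longrightarrow> X \<subseteq> Y \<Longrightarrow> lfrac s a X" by (auto simp: lfrac_def)

lemma frac_closure:
  assumes "lfrac s a X" shows "lfrac s a (closure X)"
proof -
  have "closed {z. L s (snd z) = L a (fst z)}"
    by (intro closed_Collect_eq linear_continuous_on bounded_linear_compose[OF blinfun.bounded_linear_right]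
        bounded_linear_snd bounded_linear_fst)
  then have "closure X \<subseteq> {z. L s (snd z) = L a (fst z)}"
    by (intro closure_minimal) (use assms in \<open>auto simp: lfrac_def\<close>)
  then show ?thesis by (auto simp: lfrac_def)
qed

text \<open>The domain is dense, so the numerator over a given denominator is determined; this makes
  the passage to numerators additive.\<close>

lemma frac_unique:
  assumes G: "G \<in> affiliated LA" and f: "lfrac s a G" "lfrac s b G" and ab: "a \<in> A" "b \<in> A"
  shows "a = b"
proof -
  have "closed {x. L a x = L b x}"
    by (intro closed_Collect_eq linear_continuous_on blinfun.bounded_linear_right)
  moreover have "Domain G \<subseteq> {x. L a x = L b x}" using f by (fastforce simp: lfrac_def)
  ultimately have "closure (Domain G) \<subseteq> {x. L a x = L b x}" by (rule closure_minimal[rotated])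
  then have "L (a - b) = 0"
    using affiliated_dense[OF G] by (intro blinfun_eqI) (auto simp: L_diff ab blinfun.diff_left)
  then have "a - b = 0" by (intro L_inj diff_in ab)
  then show ?thesis by simp
qed

text \<open>A fraction with injective denominator keeps the closure single valued, and an operator
  with dense range inside the domain keeps it densely defined.\<close>

lemma closure_affiliated:
  assumes X: "csubspace X" and comm: "\<And>S x y. S \<in> commutant LA \<Longrightarrow> (x, y) \<in> X \<Longrightarrow> (S x, S y) \<in> X"
    and s: "s \<in> A" "\<nu> s \<le> 0" "lfrac s a X" and p: "p \<in> A" "\<nu> p \<le> 0" "range (L p) \<subseteq> Domain X"
  shows "closure X \<in> affiliated LA"
proof (rule affiliatedI)
  fix x y z assume "(x, y) \<in> closure X" "(x, z) \<in> closure X"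
  then have "L s y = L s z" using fracD[OF frac_closure[OF s(3)]] by metis
  then have "L s (y - z) = 0" by (simp add: blinfun.diff_right)
  then have "y - z = 0" using \<nu>_zero_iff_inj s by blast
  then show "y = z" by simp
next
  have "Domain X \<subseteq> Domain (closure X)" using closure_subset by blast
  then have "closure (range (L p)) \<subseteq> closure (Domain (closure X))" using p by (intro closure_mono) blast
  then show "closure (Domain (closure X)) = UNIV" using dense_range[OF p(1,2)] by auto
next
  fix S x y assume S: "S \<in> commutant LA" and xy: "(x, y) \<in> closure X"
  let ?D = "\<lambda>z. (blinfun_apply S (fst z), blinfun_apply S (snd z))"
  have "bounded_linear ?D"
    by (intro bounded_linear_Pair bounded_linear_compose[OF blinfun.bounded_linear_right]
          bounded_linear_fst bounded_linear_snd)
  then have "?D ` closure X \<subseteq> closure (?D ` X)"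
    by (intro continuous_image_closure_subset[of UNIV] linear_continuous_on) auto
  also have "\<dots> \<subseteq> closure X" by (rule closure_mono) (use comm[OF S] in auto)
  finally show "(S x, S y) \<in> closure X" using xy by fastforce
qed (auto intro: csubspace_closure X)

lemma frac_add:
  assumes "lfrac s a G" "lfrac s b K" "a \<in> A" "b \<in> A"
  shows "lfrac s (a + b) (closure {(x, y + z) |x y z. (x, y) \<in> G \<and> (x, z) \<in> K})"
proof (rule frac_closure)
  have "L s (y + z) = L (a + b) x" if "(x, y) \<in> G" "(x, z) \<in> K" for x y z
    using fracD[OF assms(1) that(1)] fracD[OF assms(2) that(2)] assms(3,4)
    by (simp add: blinfun.add_right blinfun.add_left L_add)
  then show "lfrac s (a + b) {(x, y + z) |x y z. (x, y) \<in> G \<and> (x, z) \<in> K}" by (auto simp: lfrac_def)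
qed

lemma affiliated_add:
  assumes G: "G \<in> affiliated LA" and K: "K \<in> affiliated LA"
  shows "closure {(x, y + z) |x y z. (x, y) \<in> G \<and> (x, z) \<in> K} \<in> affiliated LA" (is "closure ?X \<in> _")
proof -
  obtain s a where s: "s \<in> A" "\<nu> s \<le> 0" "a \<in> A" "lfrac s a G"
    using affiliated_left_fraction[OF G] by (auto simp: lfrac_def)
  obtain t b where t: "t \<in> A" "\<nu> t \<le> 0" "b \<in> A" "lfrac t b K"
    using affiliated_left_fraction[OF K] by (auto simp: lfrac_def)
  obtain u v where uv: "u \<in> A" "v \<in> A" "u \<cdot> s = v \<cdot> t" "\<nu> (u \<cdot> s) \<le> 0"
    using common_denominator[OF s(1,2) t(1,2)] by blast
  obtain p where p: "p \<in> A" "\<nu> p \<le> 0" "range (L p) \<subseteq> Domain G" using affiliated_domain[OF G] by blast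
  obtain q where q: "q \<in> A" "\<nu> q \<le> 0" "range (L q) \<subseteq> Domain K" using affiliated_domain[OF K] by blast
  \<comment> \<open>The right Ore condition produces one dense subspace, the range of
    \<open>L (p \<cdot> w)\<close>, inside both domains.\<close>
  obtain w x where w: "w \<in> A" "x \<in> A" "p \<cdot> w = q \<cdot> x" "\<nu> w \<le> \<nu> q" using ore_right[OF p(1) q(1)] by blast
  show ?thesis
  proof (rule closure_affiliated)
    show "csubspace ?X"
      using affiliated_subspace[OF G] affiliated_subspace[OF K]
      unfolding csubspace_def zero_prod_def
    proof (intro conjI ballI allI; elim conjE)
      assume g: "\<forall>x\<in>G. \<forall>y\<in>G. x + y \<in> G" and k: "\<forall>x\<in>K. \<forall>y\<in>K. x + y \<in> K"
      fix z z' assume "z \<in> ?X" "z' \<in> ?X"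
      then obtain x a b x' a' b' where z: "z = (x, a + b)" "(x, a) \<in> G" "(x, b) \<in> K"
        "z' = (x', a' + b')" "(x', a') \<in> G" "(x', b') \<in> K" by blast
      then have "(x + x', a + a') \<in> G" "(x + x', b + b') \<in> K" using g k by fastforce+
      then show "z + z' \<in> ?X"
        using z by (intro CollectI exI[of _ "x + x'"] exI[of _ "a + a'"] exI[of _ "b + b'"]) (simp add: algebra_simps)
    next
      assume g: "\<forall>c. \<forall>x\<in>G. c *\<^sub>C x \<in> G" and k: "\<forall>c. \<forall>x\<in>K. c *\<^sub>C x \<in> K"
      fix c z assume "z \<in> ?X"
      then obtain x a b where z: "z = (x, a + b)" "(x, a) \<in> G" "(x, b) \<in> K" by blast
      then have "(c *\<^sub>C x, c *\<^sub>C a) \<in> G" "(c *\<^sub>C x, c *\<^sub>C b) \<in> K"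
        using g k by (fastforce simp: scaleC_prod_def)+
      then show "c *\<^sub>C z \<in> ?X" using z by (auto simp: scaleC_prod_def scaleC_add_right)
    next
      assume "(0, 0) \<in> G" "(0, 0) \<in> K"
      then show "(0, 0) \<in> ?X" by (intro CollectI exI[of _ 0]) simp
    qed
    show "(S x, S y) \<in> ?X" if "S \<in> commutant LA" "(x, y) \<in> ?X" for S x y
      using that(2) affiliated_comm[OF G that(1)] affiliated_comm[OF K that(1)]
      by (auto simp: blinfun.add_right) blast
    have "lfrac (u \<cdot> s) (u \<cdot> a) G" "lfrac (u \<cdot> s) (v \<cdot> b) K"
      using frac_comp[OF s(4) uv(1) s(1,3)] frac_comp[OF t(4) uv(2) t(1,3)] uv(3) by simp_all
    from frac_add[OF this] s t uv have "lfrac (u \<cdot> s) (u \<cdot> a + v \<cdot> b) (closure ?X)" by (simp add: comp_in)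
    then show "lfrac (u \<cdot> s) (u \<cdot> a + v \<cdot> b) ?X" by (rule frac_subset[OF _ closure_subset])
    show "range (L (p \<cdot> w)) \<subseteq> Domain ?X"
    proof
      fix \<xi> assume "\<xi> \<in> range (L (p \<cdot> w))"
      then obtain \<eta> where "\<xi> = L p (L w \<eta>)" by (auto simp: L_comp p(1) w(1))
      moreover have "L p (L w \<eta>) = L q (L x \<eta>)"
        using arg_cong[OF w(3), of "\<lambda>f. blinfun_apply (L f) \<eta>"] by (simp add: L_comp p(1) q(1) w(1,2))
      ultimately show "\<xi> \<in> Domain ?X" using p(3) q(3) by blast
    qed
    show "\<nu> (p \<cdot> w) \<le> 0" using \<nu>_comp_le[OF p(1) w(1)] p(2) w(4) q(2) by linarith
    show "p \<cdot> w \<in> A" "u \<cdot> s \<in> A" by (intro comp_in p(1) w(1) uv(1) s(1))+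
    show "\<nu> (u \<cdot> s) \<le> 0" by (rule uv(4))
  qed
qed

text \<open>Right multiplication by elements of \<open>A\<close> is the product that occurs in the
  tensor relations. The Ore condition pulls a dense part of the domain of \<open>G\<close> back
  along \<open>L r\<close>.\<close>

lemma affiliated_comp:
  assumes G: "G \<in> affiliated LA" and r: "r \<in> A"
  shows "closure {(x, z). \<exists>y. (x, y) \<in> op_graph (L r) \<and> (y, z) \<in> G} \<in> affiliated LA" (is "closure ?X \<in> _")
proof -
  have X: "?X = {(x, z). (L r x, z) \<in> G}" by (auto simp: op_graph_def)
  obtain s a where s: "s \<in> A" "\<nu> s \<le> 0" "a \<in> A" "lfrac s a G"
    using affiliated_left_fraction[OF G] by (auto simp: lfrac_def)
  obtain p where p: "p \<in> A" "\<nu> p \<le> 0" "range (L p) \<subseteq> Domain G" using affiliated_domain[OF G] by blast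
  obtain w x where w: "w \<in> A" "x \<in> A" "r \<cdot> w = p \<cdot> x" "\<nu> w \<le> \<nu> p" using ore_right[OF r p(1)] by blast
  show ?thesis unfolding X
  proof (rule closure_affiliated)
    let ?Y = "{(x, z). (L r x, z) \<in> G}"
    show "csubspace ?Y"
      using affiliated_subspace[OF G] unfolding csubspace_def zero_prod_def
    proof (intro conjI ballI allI; elim conjE)
      assume g: "\<forall>x\<in>G. \<forall>y\<in>G. x + y \<in> G"
      show "z + z' \<in> ?Y" if "z \<in> ?Y" "z' \<in> ?Y" for z z'
        using that g by (fastforce simp: blinfun.add_right)
    next
      assume g: "\<forall>c. \<forall>x\<in>G. c *\<^sub>C x \<in> G"
      show "c *\<^sub>C z \<in> ?Y" if "z \<in> ?Y" for c z
        using that g by (fastforce simp: scaleC_prod_def bounded_opsD[OF L_bounded_ops[OF r]])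
    qed auto
    show "(S x, S y) \<in> ?Y" if S: "S \<in> commutant LA" and xy: "(x, y) \<in> ?Y" for S x y
    proof -
      have "L r (S x) = S (L r x)"
        using arg_cong[OF commutant_eq[OF S imageI[OF r]], of "\<lambda>f. blinfun_apply f x"] by simp
      then show ?thesis using affiliated_comm[OF G S] xy by auto
    qed
    show "lfrac s (a \<cdot> r) ?Y" using s r by (auto simp: lfrac_def L_comp)
    show "range (L w) \<subseteq> Domain ?Y"
    proof
      fix \<xi> assume "\<xi> \<in> range (L w)"
      then obtain \<eta> where e: "\<xi> = L w \<eta>" by blast
      have "L r (L w \<eta>) = L p (L x \<eta>)"
        using arg_cong[OF w(3), of "\<lambda>f. blinfun_apply (L f) \<eta>"] by (simp add: L_comp p(1) r w(1,2))
      then show "\<xi> \<in> Domain ?Y" using p(3) e by blast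
    qed
    show "\<nu> w \<le> 0" using p w by simp
  qed (use s w in auto)
qed

lemma frac_comp_right:
  assumes "lfrac s a G" "a \<in> A" "r \<in> A"
  shows "lfrac s (a \<cdot> r) (closure {(x, z). \<exists>y. (x, y) \<in> op_graph (L r) \<and> (y, z) \<in> G})"
  by (rule frac_closure) (use assms in \<open>auto simp: lfrac_def op_graph_def L_comp\<close>)

lemma closed_op_graph: "closed (op_graph F)"
proof -
  have "op_graph F = {z. snd z = blinfun_apply F (fst z)}" by (auto simp: op_graph_def)
  moreover have "closed {z. snd z = blinfun_apply F (fst z)}"
    by (intro closed_Collect_eq linear_continuous_on bounded_linear_snd
        bounded_linear_compose[OF blinfun.bounded_linear_right] bounded_linear_fst)
  ultimately show ?thesis by simp
qed

lemma affiliated_op_graph: assumes a: "a \<in> A" shows "op_graph (L a) \<in> affiliated LA"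
proof (rule affiliatedI)
  show "closed (op_graph (L a))" by (rule closed_op_graph)
  show "csubspace (op_graph (L a))"
    using bounded_opsD[OF L_bounded_ops[OF a]]
    by (auto simp: csubspace_def op_graph_def zero_prod_def scaleC_prod_def blinfun.add_right)
  show "closure (Domain (op_graph (L a))) = UNIV" by (auto simp: op_graph_def Domain_unfold)
  fix S x y assume S: "S \<in> commutant LA" and xy: "(x, y) \<in> op_graph (L a)"
  then show "(S x, S y) \<in> op_graph (L a)"
    using arg_cong[OF commutant_eq[OF S imageI[OF a]], of "\<lambda>f. blinfun_apply f x"] by (auto simp: op_graph_def)
qed (auto simp: op_graph_def)

lemma affiliated_inverse:
  assumes s: "s \<in> A" "\<nu> s \<le> 0"
  shows "{(L s x, x) |x. True} \<in> affiliated LA" (is "?G \<in> _")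
proof (rule affiliatedI)
  have G: "?G = {z. L s (snd z) = fst z}" by (auto simp: prod_eq_iff)
  show "closed ?G" unfolding G
    by (intro closed_Collect_eq linear_continuous_on bounded_linear_fst
        bounded_linear_compose[OF blinfun.bounded_linear_right] bounded_linear_snd)
  show "csubspace ?G" unfolding G
    by (auto simp: csubspace_def scaleC_prod_def blinfun.add_right bounded_opsD[OF L_bounded_ops[OF s(1)]])
  have "Domain ?G = range (L s)" by auto
  then show "closure (Domain ?G) = UNIV" using dense_range[OF s] by simp
next
  fix x y z assume "(x, y) \<in> ?G" "(x, z) \<in> ?G"
  then have "L s (y - z) = 0" by (auto simp: blinfun.diff_right)
  then have "y - z = 0" using \<nu>_zero_iff_inj s by blast
  then show "y = z" by simp
next
  fix S x y assume S: "S \<in> commutant LA" and xy: "(x, y) \<in> ?G"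
  then show "(S x, S y) \<in> ?G"
    using arg_cong[OF commutant_eq[OF S imageI[OF s(1)]], of "\<lambda>f. blinfun_apply f y"] by auto
qed

lemma inverse_comp:
  assumes s: "s \<in> A" "\<nu> s \<le> 0"
  shows "closure {(x, z). \<exists>y. (x, y) \<in> op_graph (L s) \<and> (y, z) \<in> {(L s x, x) |x. True}} = op_graph id_blinfun"
proof -
  have "x = z" if "L s x = L s z" for x z
  proof -
    have "L s (x - z) = 0" using that by (simp add: blinfun.diff_right)
    then have "x - z = 0" using \<nu>_zero_iff_inj s by blast
    then show ?thesis by simp
  qed
  then have "{(x, z). \<exists>y. (x, y) \<in> op_graph (L s) \<and> (y, z) \<in> {(L s x, x) |x. True}} = op_graph id_blinfun"
    by (auto simp: op_graph_def)
  then show ?thesis by (simp add: closed_op_graph)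
qed

end

section \<open>Extension of scalars\<close>

lemma tensor_free_simps [simp]:
  "carrier (tensor_free T M) = {c. Poly_Mapping.keys c \<subseteq> carrier T \<times> carrier M}"
  "c \<oplus>\<^bsub>tensor_free T M\<^esub> d = c + d" "\<zero>\<^bsub>tensor_free T M\<^esub> = 0"
  by (simp_all add: tensor_free_def)

lemma keys_diffI: "Poly_Mapping.keys c \<subseteq> S \<Longrightarrow> Poly_Mapping.keys d \<subseteq> S \<Longrightarrow> Poly_Mapping.keys (c - d) \<subseteq> S"
  using keys_diff[of c d] by blast

lemma keys_addI: "Poly_Mapping.keys c \<subseteq> S \<Longrightarrow> Poly_Mapping.keys d \<subseteq> S \<Longrightarrow> Poly_Mapping.keys (c + d) \<subseteq> S"
  using Poly_Mapping.keys_add[of c d] by blast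

lemma abelian_group_tensor_free: "abelian_group (tensor_free T M)"
proof (rule abelian_groupI)
  fix x assume "x \<in> carrier (tensor_free T M)"
  then show "\<exists>y\<in>carrier (tensor_free T M). y \<oplus>\<^bsub>tensor_free T M\<^esub> x = \<zero>\<^bsub>tensor_free T M\<^esub>"
    by (intro bexI[of _ "- x"]) auto
qed (simp_all add: keys_addI add.assoc add.commute)

lemma tensor_free_inv: "c \<in> carrier (tensor_free T M) \<Longrightarrow> inv\<^bsub>add_monoid (tensor_free T M)\<^esub> c = - c"
  by (rule group.inv_equality[OF abelian_group.a_group[OF abelian_group_tensor_free]]) auto

text \<open>The assumptions on \<open>T\<close> are the closure properties established for the
  affiliated operators, so this setting covers both \<U>(A) and \<open>A\<close>.\<close>

locale scalar_extension = left_module R M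
  for T :: "('t, 's) ring_scheme" and \<phi> :: "'r \<Rightarrow> 't" and R :: "('r, 'q) ring_scheme" and M :: "('r, 'm, 'k) module_scheme" +
  assumes T_add: "x \<in> carrier T \<Longrightarrow> y \<in> carrier T \<Longrightarrow> x \<oplus>\<^bsub>T\<^esub> y \<in> carrier T"
    and T_mult: "x \<in> carrier T \<Longrightarrow> r \<in> carrier R \<Longrightarrow> x \<otimes>\<^bsub>T\<^esub> \<phi> r \<in> carrier T"
begin

abbreviation rel where "rel \<equiv> tensor_rel T \<phi> R M"
abbreviation base where "base \<equiv> carrier T \<times> carrier M"

lemma gens_keys:
  assumes "h \<in> {frag_of (x \<oplus>\<^bsub>T\<^esub> y, m) - frag_of (x, m) - frag_of (y, m) |x y m.
        x \<in> carrier T \<and> y \<in> carrier T \<and> m \<in> carrier M} \<union>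
     {frag_of (x, m \<oplus>\<^bsub>M\<^esub> n) - frag_of (x, m) - frag_of (x, n) |x m n.
        x \<in> carrier T \<and> m \<in> carrier M \<and> n \<in> carrier M} \<union>
     {frag_of (x \<otimes>\<^bsub>T\<^esub> \<phi> r, m) - frag_of (x, r \<odot>\<^bsub>M\<^esub> m) |x r m.
        x \<in> carrier T \<and> r \<in> carrier R \<and> m \<in> carrier M}"
  shows "Poly_Mapping.keys h \<subseteq> base"
  using assms
  by (elim UnE CollectE exE conjE; hypsubst; intro keys_diffI) (simp_all add: T_add T_mult lsmult_closed)

text \<open>The support condition is carried along so that homomorphism laws, which hold on the
  carrier only, can be used in the negation and addition cases.\<close>

lemma rel_induct [consumes 1, case_names zero add_left add_right mult uminus add]:
  assumes "c \<in> rel" and "P 0"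
    and 1: "\<And>x y m. x \<in> carrier T \<Longrightarrow> y \<in> carrier T \<Longrightarrow> m \<in> carrier M \<Longrightarrow>
      P (frag_of (x \<oplus>\<^bsub>T\<^esub> y, m) - frag_of (x, m) - frag_of (y, m))"
    and 2: "\<And>x m n. x \<in> carrier T \<Longrightarrow> m \<in> carrier M \<Longrightarrow> n \<in> carrier M \<Longrightarrow>
      P (frag_of (x, m \<oplus>\<^bsub>M\<^esub> n) - frag_of (x, m) - frag_of (x, n))"
    and 3: "\<And>x r m. x \<in> carrier T \<Longrightarrow> r \<in> carrier R \<Longrightarrow> m \<in> carrier M \<Longrightarrow>
      P (frag_of (x \<otimes>\<^bsub>T\<^esub> \<phi> r, m) - frag_of (x, r \<odot>\<^bsub>M\<^esub> m))"
    and neg: "\<And>c. Poly_Mapping.keys c \<subseteq> base \<Longrightarrow> P c \<Longrightarrow> P (- c)"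
    and add: "\<And>c d. Poly_Mapping.keys c \<subseteq> base \<Longrightarrow> Poly_Mapping.keys d \<subseteq> base \<Longrightarrow> P c \<Longrightarrow> P d \<Longrightarrow> P (c + d)"
  shows "Poly_Mapping.keys c \<subseteq> base \<and> P c"
  using assms(1) unfolding tensor_rel_def
proof (induction rule: generate.induct)
  case one
  show ?case using assms(2) by simp
next
  case (incl h)
  then have "P h" by (elim UnE CollectE exE conjE; hypsubst) (rule 1 2 3; assumption)+
  then show ?case using gens_keys[OF incl] by blast
next
  case (inv h)
  then have "P h" by (elim UnE CollectE exE conjE; hypsubst) (rule 1 2 3; assumption)+
  moreover have "inv\<^bsub>add_monoid (tensor_free T M)\<^esub> h = - h"
    by (rule tensor_free_inv) (use gens_keys[OF inv] in simp)
  ultimately show ?case using neg[of h] gens_keys[OF inv] by simp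
next
  case (eng h1 h2)
  then show ?case using add by (simp add: keys_addI)
qed

lemma rel_keys: "c \<in> rel \<Longrightarrow> Poly_Mapping.keys c \<subseteq> base"
  using rel_induct[of c "\<lambda>_. True"] by blast

lemma rel_gens:
  shows rel_add_left: "x \<in> carrier T \<Longrightarrow> y \<in> carrier T \<Longrightarrow> m \<in> carrier M \<Longrightarrow>
      frag_of (x \<oplus>\<^bsub>T\<^esub> y, m) - frag_of (x, m) - frag_of (y, m) \<in> rel"
    and rel_add_right: "x \<in> carrier T \<Longrightarrow> m \<in> carrier M \<Longrightarrow> n \<in> carrier M \<Longrightarrow>
      frag_of (x, m \<oplus>\<^bsub>M\<^esub> n) - frag_of (x, m) - frag_of (x, n) \<in> rel"
    and rel_mult: "x \<in> carrier T \<Longrightarrow> r \<in> carrier R \<Longrightarrow> m \<in> carrier M \<Longrightarrow>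
      frag_of (x \<otimes>\<^bsub>T\<^esub> \<phi> r, m) - frag_of (x, r \<odot>\<^bsub>M\<^esub> m) \<in> rel"
  unfolding tensor_rel_def by (rule generate.incl, blast)+

lemma rel_subgroup: "subgroup rel (add_monoid (tensor_free T M))"
  unfolding tensor_rel_def
  by (rule group.generate_is_subgroup[OF abelian_group.a_group[OF abelian_group_tensor_free]])
     (rule subsetI, drule gens_keys, simp)

lemma rel_zero: "0 \<in> rel" using subgroup.one_closed[OF rel_subgroup] by simp
lemma rel_add: "c \<in> rel \<Longrightarrow> d \<in> rel \<Longrightarrow> c + d \<in> rel" using subgroup.m_closed[OF rel_subgroup] by fastforce
lemma rel_uminus: assumes "c \<in> rel" shows "- c \<in> rel"
proof -
  have "inv\<^bsub>add_monoid (tensor_free T M)\<^esub> c = - c"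
    by (rule tensor_free_inv) (use rel_keys[OF assms] in simp)
  then show ?thesis using subgroup.m_inv_closed[OF rel_subgroup assms] by simp
qed
lemma rel_diff: "c \<in> rel \<Longrightarrow> d \<in> rel \<Longrightarrow> c - d \<in> rel"
  using rel_add[of c "- d"] rel_uminus[of d] by simp
lemma rel_sum: "(\<And>i. i \<in> I \<Longrightarrow> f i \<in> rel) \<Longrightarrow> sum f I \<in> rel"
  by (induction I rule: infinite_finite_induct) (auto intro: rel_zero rel_add)

lemma rel_frag_zero: "x \<in> carrier T \<Longrightarrow> frag_of (x, \<zero>\<^bsub>M\<^esub>) \<in> rel"
  using rel_uminus[OF rel_add_right[of x "\<zero>\<^bsub>M\<^esub>" "\<zero>\<^bsub>M\<^esub>"]] by simp

definition cls :: "('t \<times> 'm \<Rightarrow>\<^sub>0 int) \<Rightarrow> ('t \<times> 'm \<Rightarrow>\<^sub>0 int) set" where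
  "cls c = rel +>\<^bsub>tensor_free T M\<^esub> c"

lemma mem_cls: "d \<in> cls c \<longleftrightarrow> d - c \<in> rel"
proof
  assume "d \<in> cls c"
  then obtain r where "r \<in> rel" "d = r + c" by (auto simp: cls_def a_r_coset_def')
  then show "d - c \<in> rel" by simp
next
  assume d: "d - c \<in> rel"
  have "d = (d - c) + c" by simp
  then show "d \<in> cls c" using d unfolding cls_def a_r_coset_def' by (auto intro!: bexI[of _ "d - c"])
qed

lemma cls_eq_iff: "cls c = cls d \<longleftrightarrow> c - d \<in> rel"
proof
  assume "cls c = cls d"
  then show "c - d \<in> rel" using mem_cls[of c c] mem_cls[of c d] rel_zero by simp
next
  assume cd: "c - d \<in> rel"
  show "cls c = cls d"
  proof (intro Set.set_eqI iffI)
    fix e assume "e \<in> cls c"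
    then show "e \<in> cls d" using rel_add[OF _ cd, of "e - c"] by (simp add: mem_cls)
  next
    fix e assume "e \<in> cls d"
    then show "e \<in> cls c" using rel_diff[OF _ cd, of "e - d"] by (simp add: mem_cls)
  qed
qed

lemma cls_zero: "cls 0 = rel" by (auto simp: mem_cls)

lemma carrier_ext: "carrier (ext_scalars T \<phi> R M) = cls ` {c. Poly_Mapping.keys c \<subseteq> base}"
  by (auto simp: ext_scalars_def quot_module_def A_RCOSETS_def' cls_def)

lemma zero_ext: "\<zero>\<^bsub>ext_scalars T \<phi> R M\<^esub> = rel"
  by (simp add: ext_scalars_def quot_module_def)

lemma add_ext: "cls c \<oplus>\<^bsub>ext_scalars T \<phi> R M\<^esub> cls d = cls (c + d)"
proof -
  have "cls c \<oplus>\<^bsub>ext_scalars T \<phi> R M\<^esub> cls d = {x + y |x y. x \<in> cls c \<and> y \<in> cls d}"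
    by (auto simp: ext_scalars_def quot_module_def set_add_def')
  also have "\<dots> = cls (c + d)"
  proof (intro Set.set_eqI iffI)
    fix e assume "e \<in> {x + y |x y. x \<in> cls c \<and> y \<in> cls d}"
    then obtain x y where "e = x + y" "x - c \<in> rel" "y - d \<in> rel" by (auto simp: mem_cls)
    then show "e \<in> cls (c + d)" using rel_add[of "x - c" "y - d"] by (simp add: mem_cls algebra_simps)
  next
    fix e assume "e \<in> cls (c + d)"
    then have "(e - d) - c \<in> rel" by (simp add: mem_cls algebra_simps)
    then have "e - d \<in> cls c" "d \<in> cls d" by (simp_all add: mem_cls rel_zero)
    then show "e \<in> {x + y |x y. x \<in> cls c \<and> y \<in> cls d}" by (intro CollectI exI[of _ "e - d"] exI[of _ d]) simp
  qed
  finally show ?thesis .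
qed

lemma pure_tensor_eq_zero_iff:
  "pure_tensor T \<phi> R M x m = \<zero>\<^bsub>ext_scalars T \<phi> R M\<^esub> \<longleftrightarrow> frag_of (x, m) \<in> rel"
proof -
  have "pure_tensor T \<phi> R M x m = cls (frag_of (x, m))" by (simp add: pure_tensor_def cls_def)
  then show ?thesis using cls_eq_iff[of "frag_of (x, m)" 0] by (simp add: zero_ext cls_zero)
qed

end

lemma vn_ring_simps [simp]:
  "carrier (vn_ring A) = A" "a \<oplus>\<^bsub>vn_ring A\<^esub> b = a + b" "a \<otimes>\<^bsub>vn_ring A\<^esub> b = a \<cdot> b"
  "\<one>\<^bsub>vn_ring A\<^esub> = id_blinfun" "\<zero>\<^bsub>vn_ring A\<^esub> = 0"
  by (simp_all add: vn_ring_def)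

lemma (in tracial_algebra) ring_vn_ring: "ring (vn_ring A)"
proof (rule ringI)
  show "abelian_group (vn_ring A)"
  proof (rule abelian_groupI)
    show "\<exists>y\<in>carrier (vn_ring A). y \<oplus>\<^bsub>vn_ring A\<^esub> x = \<zero>\<^bsub>vn_ring A\<^esub>" if "x \<in> carrier (vn_ring A)" for x
      using that scaleR_in[of x "-1"] by (intro bexI[of _ "- x"]) auto
  qed (auto simp: add_in)
  show "Group.monoid (vn_ring A)" by (rule monoidI) (auto simp: comp_in comp_assoc)
qed (auto simp: comp_simps)

lemma left_module_zero:
  fixes R (structure) and M (structure)
  assumes "left_module R M"
  shows left_module_smult_zero: "a \<in> carrier R \<Longrightarrow> a \<odot>\<^bsub>M\<^esub> \<zero>\<^bsub>M\<^esub> = \<zero>\<^bsub>M\<^esub>"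
    and left_module_zero_smult: "x \<in> carrier M \<Longrightarrow> \<zero>\<^bsub>R\<^esub> \<odot>\<^bsub>M\<^esub> x = \<zero>\<^bsub>M\<^esub>"
proof -
  interpret left_module R M by fact
  show "a \<odot>\<^bsub>M\<^esub> \<zero>\<^bsub>M\<^esub> = \<zero>\<^bsub>M\<^esub>" if a: "a \<in> carrier R"
  proof -
    have "a \<odot>\<^bsub>M\<^esub> \<zero>\<^bsub>M\<^esub> \<oplus>\<^bsub>M\<^esub> a \<odot>\<^bsub>M\<^esub> \<zero>\<^bsub>M\<^esub> = a \<odot>\<^bsub>M\<^esub> \<zero>\<^bsub>M\<^esub>"
      using lsmult_r_distr[OF a M.zero_closed M.zero_closed] by simp
    then show ?thesis using lsmult_closed[OF a M.zero_closed] by (metis M.add.r_cancel_one')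
  qed
  show "\<zero>\<^bsub>R\<^esub> \<odot>\<^bsub>M\<^esub> x = \<zero>\<^bsub>M\<^esub>" if x: "x \<in> carrier M"
  proof -
    have "\<zero>\<^bsub>R\<^esub> \<odot>\<^bsub>M\<^esub> x \<oplus>\<^bsub>M\<^esub> \<zero>\<^bsub>R\<^esub> \<odot>\<^bsub>M\<^esub> x = \<zero>\<^bsub>R\<^esub> \<odot>\<^bsub>M\<^esub> x"
      using lsmult_l_distr[OF R.zero_closed R.zero_closed x] by simp
    then show ?thesis using lsmult_closed[OF R.zero_closed x] by (metis M.add.r_cancel_one')
  qed
qed

definition tors :: "('h::complex_hilbert \<Rightarrow>\<^sub>L 'h) set \<Rightarrow> (('h \<Rightarrow>\<^sub>L 'h) \<Rightarrow> complex) \<Rightarrow> real set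
    \<Rightarrow> ('h \<Rightarrow>\<^sub>L 'h, 'm, 'k) module_scheme \<Rightarrow> 'm set" where
  "tors A tr E M = {x \<in> carrier M. \<forall>e\<in>E. \<exists>c\<in>A. tracial_algebra.\<nu> tr c \<le> e \<and> c \<odot>\<^bsub>M\<^esub> x = \<zero>\<^bsub>M\<^esub>}"

context l2_algebra
begin

text \<open>The default 0 makes the numerator total, so that it extends to a homomorphism on the
  whole free group for every \<open>s\<close>. Its value has meaning only where \<open>s\<close> is
  a denominator of \<open>G\<close>.\<close>

definition numer :: "('h \<Rightarrow>\<^sub>L 'h) \<Rightarrow> ('l \<times> 'l) set \<Rightarrow> ('h \<Rightarrow>\<^sub>L 'h)" where
  "numer s G = (if \<exists>a\<in>A. lfrac s a G then SOME a. a \<in> A \<and> lfrac s a G else 0)"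

lemma numer_in: "numer s G \<in> A"
  unfolding numer_def using someI_ex[of "\<lambda>a. a \<in> A \<and> lfrac s a G"] by auto

lemma numer_eq: assumes "G \<in> affiliated LA" "a \<in> A" "lfrac s a G" shows "numer s G = a"
proof -
  have "numer s G \<in> A \<and> lfrac s (numer s G) G"
    unfolding numer_def using assms someI_ex[of "\<lambda>a. a \<in> A \<and> lfrac s a G"] by auto
  then show ?thesis using frac_unique[OF assms(1) _ assms(3) _ assms(2)] by blast
qed

lemma affiliated_ring_simps:
  "carrier (affiliated_ring A \<iota>) = affiliated LA"
  "G \<oplus>\<^bsub>affiliated_ring A \<iota>\<^esub> K = closure {(x, y + z) |x y z. (x, y) \<in> G \<and> (x, z) \<in> K}"
  "G \<otimes>\<^bsub>affiliated_ring A \<iota>\<^esub> K = closure {(x, z). \<exists>y. (x, y) \<in> K \<and> (y, z) \<in> G}"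
  "\<one>\<^bsub>affiliated_ring A \<iota>\<^esub> = op_graph id_blinfun"
  by (simp_all add: affiliated_ring_def L_def)

text \<open>If \<open>1 \<otimes> m = 0\<close> then only finitely many affiliated operators occur in the relations that witness
  this; multiplying with a common denominator \<open>s\<close> turns them into relations over \<open>A\<close>, whence \<open>s m = 0\<close>.\<close>

lemma alg_torsion_eq_tors:
  fixes M :: "('h \<Rightarrow>\<^sub>L 'h, 'm, 'k) module_scheme"
  assumes M: "left_module (vn_ring A) M"
  shows "alg_torsion A \<iota> M = tors A tr {0} M"
proof -
  let ?U = "affiliated_ring A \<iota>" and ?\<phi> = "\<lambda>a. op_graph (L a)"
  interpret M: left_module "vn_ring A" M by fact
  interpret T: scalar_extension ?U ?\<phi> "vn_ring A" M
    by unfold_locales (auto simp: affiliated_ring_simps affiliated_comp intro: affiliated_add)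
  have one: "op_graph id_blinfun \<in> affiliated LA" using affiliated_op_graph[of id_blinfun] by (simp add: L_id)
  have "alg_torsion A \<iota> M = {m \<in> carrier M. frag_of (\<one>\<^bsub>?U\<^esub>, m) \<in> T.rel}"
    unfolding alg_torsion_def Let_def L_def[symmetric] T.pure_tensor_eq_zero_iff ..
  also have "\<dots> = tors A tr {0} M"
  proof (intro Set.set_eqI iffI; clarsimp simp: tors_def affiliated_ring_simps)
    fix m assume m: "m \<in> carrier M" and rel: "frag_of (op_graph id_blinfun, m) \<in> T.rel"
    \<comment> \<open>\<open>h s\<close> plays the role of (x, m) \<mapsto> (s x) m.\<close>
    have "\<exists>h. h \<in> hom (free_Abelian_group T.base) (add_monoid M) \<and>
        (\<forall>z\<in>T.base. h (frag_of z) = numer s (fst z) \<odot>\<^bsub>M\<^esub> snd z)" for s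
      by (rule comm_group.free_Abelian_group_universal[OF M.a_comm_group,
            of "\<lambda>z. numer s (fst z) \<odot>\<^bsub>M\<^esub> snd z" T.base])
         (auto simp: numer_in intro!: M.lsmult_closed)
    then obtain h where h: "\<And>s. h s \<in> hom (free_Abelian_group T.base) (add_monoid M)"
      "\<And>s x m. x \<in> affiliated LA \<Longrightarrow> m \<in> carrier M \<Longrightarrow> h s (frag_of (x, m)) = numer s x \<odot>\<^bsub>M\<^esub> m"
      by (metis (no_types, lifting) SigmaI affiliated_ring_simps(1) fst_conv snd_conv)
    interpret H: group_hom "free_Abelian_group T.base" "add_monoid M" "h s" for s
      by (intro group_hom.intro group_hom_axioms.intro h group_free_Abelian_group M.a_group)
    have hadd: "h s (c + d) = h s c \<oplus>\<^bsub>M\<^esub> h s d"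
      if "Poly_Mapping.keys c \<subseteq> T.base" "Poly_Mapping.keys d \<subseteq> T.base" for s c d
      using H.hom_mult[of c d s] that by simp
    have hneg: "h s (- c) = \<ominus>\<^bsub>M\<^esub> h s c" if "Poly_Mapping.keys c \<subseteq> T.base" for s c
      using H.hom_inv[of c s] that by (simp add: a_inv_def)
    have hcl: "h s c \<in> carrier M" if "Poly_Mapping.keys c \<subseteq> T.base" for s c
      using H.hom_closed[of c s] that by simp
    have hdiff: "h s (c - d) = h s c \<ominus>\<^bsub>M\<^esub> h s d"
      if "Poly_Mapping.keys c \<subseteq> T.base" "Poly_Mapping.keys d \<subseteq> T.base" for s c d
      using hadd[of c "- d" s] hneg[of d s] that by (simp add: a_minus_def)
    have cancel: "(q \<oplus>\<^bsub>M\<^esub> r) \<ominus>\<^bsub>M\<^esub> q \<ominus>\<^bsub>M\<^esub> r = \<zero>\<^bsub>M\<^esub>"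
      if "q \<in> carrier M" "r \<in> carrier M" for q r
      using that by (simp add: a_minus_def M.a_assoc M.a_lcomm[of r "\<ominus>\<^bsub>M\<^esub> q"] M.r_neg)
    \<comment> \<open>All left multiples of \<open>s\<close> are required to work: when two elements
      are added, their denominators are replaced by a common multiple.\<close>
    let ?good = "\<lambda>c s. s \<in> A \<and> \<nu> s \<le> 0 \<and> (\<forall>w\<in>A. h (w \<cdot> s) c = \<zero>\<^bsub>M\<^esub>)"
    have "Poly_Mapping.keys (frag_of (op_graph id_blinfun, m)) \<subseteq> T.base \<and> (\<exists>s. ?good (frag_of (op_graph id_blinfun, m)) s)"
      using rel
    proof (induction rule: T.rel_induct)
      case zero
      have "h s 0 = \<zero>\<^bsub>M\<^esub>" for s using H.hom_one[of s] by simp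
      then show ?case by (intro exI[of _ id_blinfun]) simp
    next
      case (add_left x y n)
      then have xy: "x \<in> affiliated LA" "y \<in> affiliated LA" by (simp_all add: affiliated_ring_simps)
      have S: "x \<oplus>\<^bsub>?U\<^esub> y \<in> affiliated LA" unfolding affiliated_ring_simps by (rule affiliated_add[OF xy])
      obtain s a where s: "s \<in> A" "\<nu> s \<le> 0" "a \<in> A" "lfrac s a x"
        using affiliated_left_fraction[OF xy(1)] by (auto simp: lfrac_def)
      obtain t b where t: "t \<in> A" "\<nu> t \<le> 0" "b \<in> A" "lfrac t b y"
        using affiliated_left_fraction[OF xy(2)] by (auto simp: lfrac_def)
      obtain u v where uv: "u \<in> A" "v \<in> A" "u \<cdot> s = v \<cdot> t" "\<nu> (u \<cdot> s) \<le> 0"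
        using common_denominator[OF s(1,2) t(1,2)] by blast
      have "h (w \<cdot> (u \<cdot> s)) (frag_of (x \<oplus>\<^bsub>?U\<^esub> y, n) - frag_of (x, n) - frag_of (y, n)) = \<zero>\<^bsub>M\<^esub>" if w: "w \<in> A" for w
      proof -
        let ?s = "w \<cdot> (u \<cdot> s)" and ?a = "(w \<cdot> u) \<cdot> a" and ?b = "(w \<cdot> v) \<cdot> b"
        have fx: "lfrac ?s ?a x" using frac_comp[OF s(4) comp_in[OF w uv(1)] s(1,3)] by (simp add: comp_assoc)
        have fy: "lfrac ?s ?b y" using frac_comp[OF t(4) comp_in[OF w uv(2)] t(1,3)] by (simp add: comp_assoc uv(3))
        have ab: "?a \<in> A" "?b \<in> A" using w uv s t by (auto intro: comp_in)
        have "lfrac ?s (?a + ?b) (x \<oplus>\<^bsub>?U\<^esub> y)" unfolding affiliated_ring_simps by (rule frac_add[OF fx fy ab])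
        then have "numer ?s (x \<oplus>\<^bsub>?U\<^esub> y) = ?a + ?b" by (intro numer_eq S add_in ab)
        moreover have "numer ?s x = ?a" "numer ?s y = ?b" using fx fy ab xy by (auto intro: numer_eq)
        ultimately have "h ?s (frag_of (x \<oplus>\<^bsub>?U\<^esub> y, n)) = h ?s (frag_of (x, n)) \<oplus>\<^bsub>M\<^esub> h ?s (frag_of (y, n))"
          using M.lsmult_l_distr[of ?a ?b n] ab add_left(3) xy S by (simp add: h)
        moreover have k: "Poly_Mapping.keys (frag_of (x \<oplus>\<^bsub>?U\<^esub> y, n)) \<subseteq> T.base"
          "Poly_Mapping.keys (frag_of (x, n)) \<subseteq> T.base" "Poly_Mapping.keys (frag_of (y, n)) \<subseteq> T.base"
          using S xy add_left(3) by (simp_all add: affiliated_ring_simps(1))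
        ultimately show ?thesis
          by (simp only: hdiff keys_diffI[OF k(1,2)] k cancel[OF hcl[OF k(2)] hcl[OF k(3)]])
      qed
      then show ?case using comp_in[OF uv(1) s(1)] uv(4) by blast
    next
      case (add_right x n n')
      then have x: "x \<in> affiliated LA" by (simp add: affiliated_ring_simps)
      have "h w (frag_of (x, n \<oplus>\<^bsub>M\<^esub> n')) = h w (frag_of (x, n)) \<oplus>\<^bsub>M\<^esub> h w (frag_of (x, n'))" for w
        using add_right x M.lsmult_r_distr[of "numer w x" n n'] by (simp add: h numer_in)
      then have "h w (frag_of (x, n \<oplus>\<^bsub>M\<^esub> n') - frag_of (x, n) - frag_of (x, n')) = \<zero>\<^bsub>M\<^esub>" for w
        using add_right by (simp add: hdiff keys_diffI hcl cancel)
      then show ?case by (intro exI[of _ id_blinfun]) simp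
    next
      case (mult x r n)
      then have x: "x \<in> affiliated LA" and r: "r \<in> A" by (simp_all add: affiliated_ring_simps)
      let ?y = "x \<otimes>\<^bsub>?U\<^esub> op_graph (L r)"
      have y: "?y \<in> affiliated LA" unfolding affiliated_ring_simps by (rule affiliated_comp[OF x r])
      obtain s a where s: "s \<in> A" "\<nu> s \<le> 0" "a \<in> A" "lfrac s a x"
        using affiliated_left_fraction[OF x] by (auto simp: lfrac_def)
      have "h (w \<cdot> s) (frag_of (?y, n) - frag_of (x, r \<odot>\<^bsub>M\<^esub> n)) = \<zero>\<^bsub>M\<^esub>" if w: "w \<in> A" for w
      proof -
        have fx: "lfrac (w \<cdot> s) (w \<cdot> a) x" by (rule frac_comp[OF s(4) w s(1,3)])
        have wa: "w \<cdot> a \<in> A" by (intro comp_in w s)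
        have "lfrac (w \<cdot> s) ((w \<cdot> a) \<cdot> r) ?y" unfolding affiliated_ring_simps by (rule frac_comp_right[OF fx wa r])
        then have "numer (w \<cdot> s) ?y = (w \<cdot> a) \<cdot> r" by (intro numer_eq y comp_in[OF wa r])
        moreover have "numer (w \<cdot> s) x = w \<cdot> a" by (intro numer_eq x wa fx)
        ultimately have "h (w \<cdot> s) (frag_of (?y, n)) = h (w \<cdot> s) (frag_of (x, r \<odot>\<^bsub>M\<^esub> n))"
          using M.lsmult_assoc[of "w \<cdot> a" r n] M.lsmult_closed[of r n] wa r x y mult(3) by (simp add: h)
        then show ?thesis
          using mult y M.lsmult_closed[of r n] r by (simp add: hdiff hcl affiliated_ring_simps(1) M.r_neg a_minus_def)
      qed
      then show ?case using s by blast
    next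
      case (uminus c)
      then show ?case by (auto simp: hneg)
    next
      case (add c d)
      then obtain s t where s: "?good c s" and t: "?good d t" by blast
      obtain u v where uv: "u \<in> A" "v \<in> A" "u \<cdot> s = v \<cdot> t" "\<nu> (u \<cdot> s) \<le> 0"
        using common_denominator[of s t] s t by blast
      have "h (w \<cdot> (u \<cdot> s)) (c + d) = \<zero>\<^bsub>M\<^esub>" if w: "w \<in> A" for w
      proof -
        have "h ((w \<cdot> u) \<cdot> s) c = \<zero>\<^bsub>M\<^esub>" "h ((w \<cdot> v) \<cdot> t) d = \<zero>\<^bsub>M\<^esub>"
          using s t comp_in[OF w uv(1)] comp_in[OF w uv(2)] by blast+
        then show ?thesis using uv(3) add by (simp add: hadd comp_assoc)
      qed
      then show ?case using comp_in[OF uv(1), of s] s uv(4) by blast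
    qed
    then obtain s where s: "s \<in> A" "\<nu> s \<le> 0" "h (id_blinfun \<cdot> s) (frag_of (op_graph id_blinfun, m)) = \<zero>\<^bsub>M\<^esub>"
      using id_in by blast
    have "numer s (op_graph id_blinfun) = s"
      by (rule numer_eq[OF one s(1)]) (auto simp: lfrac_def op_graph_def)
    then have "s \<odot>\<^bsub>M\<^esub> m = \<zero>\<^bsub>M\<^esub>" using s m one by (simp add: h)
    then show "\<exists>c\<in>A. \<nu> c \<le> 0 \<and> c \<odot>\<^bsub>M\<^esub> m = \<zero>\<^bsub>M\<^esub>" using s by blast
  next
    fix m c assume m: "m \<in> carrier M" and c: "c \<in> A" "\<nu> c \<le> 0" "c \<odot>\<^bsub>M\<^esub> m = \<zero>\<^bsub>M\<^esub>"
    \<comment> \<open>With \<open>?x\<close> the inverse of \<open>c\<close> in \<U>(A), 1 \<otimes>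
      m = ?x c \<otimes> m = ?x \<otimes> c m = 0.\<close>
    let ?x = "{(L c z, z) |z. True}"
    have x: "?x \<in> affiliated LA" by (rule affiliated_inverse[OF c(1,2)])
    have "frag_of (?x \<otimes>\<^bsub>?U\<^esub> op_graph (L c), m) - frag_of (?x, c \<odot>\<^bsub>M\<^esub> m) \<in> T.rel"
      by (rule T.rel_mult) (use x c m in \<open>auto simp: affiliated_ring_simps\<close>)
    then have "frag_of (op_graph id_blinfun, m) - frag_of (?x, \<zero>\<^bsub>M\<^esub>) \<in> T.rel"
      using inverse_comp[OF c(1,2)] by (simp add: affiliated_ring_simps c(3))
    from T.rel_add[OF this T.rel_frag_zero[of ?x]] x
    show "frag_of (op_graph id_blinfun, m) \<in> T.rel" by (simp add: affiliated_ring_simps)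
  qed
  finally show ?thesis .
qed

end

section \<open>Torsion submodules\<close>

lemma left_module_uminus:
  fixes R (structure) and M (structure)
  assumes "left_module R M" "x \<in> carrier M"
  shows "(\<ominus>\<^bsub>R\<^esub> \<one>\<^bsub>R\<^esub>) \<odot>\<^bsub>M\<^esub> x = \<ominus>\<^bsub>M\<^esub> x"
proof -
  interpret left_module R M by fact
  have "(\<ominus>\<^bsub>R\<^esub> \<one>\<^bsub>R\<^esub>) \<odot>\<^bsub>M\<^esub> x \<oplus>\<^bsub>M\<^esub> x = (\<ominus>\<^bsub>R\<^esub> \<one>\<^bsub>R\<^esub> \<oplus>\<^bsub>R\<^esub> \<one>\<^bsub>R\<^esub>) \<odot>\<^bsub>M\<^esub> x"
    using assms(2) by (simp add: lsmult_l_distr lsmult_one)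
  also have "\<dots> = \<zero>\<^bsub>M\<^esub>" using left_module_zero_smult[OF assms(1)] assms(2) by (simp add: R.l_neg)
  finally show ?thesis using M.minus_equality assms(2) lsmult_closed by fastforce
qed

lemma left_module_submoduleI:
  fixes R (structure) and M (structure)
  assumes M: "left_module R M" and N: "N \<subseteq> carrier M" "\<zero>\<^bsub>M\<^esub> \<in> N"
    and add: "\<And>x y. x \<in> N \<Longrightarrow> y \<in> N \<Longrightarrow> x \<oplus>\<^bsub>M\<^esub> y \<in> N"
    and smult: "\<And>a x. a \<in> carrier R \<Longrightarrow> x \<in> N \<Longrightarrow> a \<odot>\<^bsub>M\<^esub> x \<in> N"
  shows "submodule N R M"
proof -
  interpret left_module R M by fact
  have "\<ominus>\<^bsub>M\<^esub> x \<in> N" if "x \<in> N" for x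
    using left_module_uminus[OF M, of x] smult[of "\<ominus>\<^bsub>R\<^esub> \<one>\<^bsub>R\<^esub>" x] that N(1) by auto
  then show ?thesis
    by (intro submodule.intro subgroup.intro submodule_axioms.intro)
       (use N add smult in \<open>auto simp: a_inv_def\<close>)
qed

lemma submoduleD:
  assumes "submodule N R M"
  shows submodule_subset: "N \<subseteq> carrier M" and submodule_zero: "\<zero>\<^bsub>M\<^esub> \<in> N"
    and submodule_add: "x \<in> N \<Longrightarrow> y \<in> N \<Longrightarrow> x \<oplus>\<^bsub>M\<^esub> y \<in> N"
    and submodule_smult: "a \<in> carrier R \<Longrightarrow> x \<in> N \<Longrightarrow> a \<odot>\<^bsub>M\<^esub> x \<in> N"
  using assms unfolding submodule_def subgroup_def submodule_axioms_def by auto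

lemma left_module_submodule:
  assumes M: "left_module R M" and N: "submodule N R M"
  shows "left_module R (M\<lparr>carrier := N\<rparr>)"
proof -
  interpret left_module R M by fact
  note S = submoduleD[OF N]
  have sub: "x \<in> carrier M" if "x \<in> N" for x using that S(1) by blast
  have neg: "\<ominus>\<^bsub>M\<^esub> x \<in> N" if "x \<in> N" for x
    using subgroup.m_inv_closed[of N "add_monoid M" x] N that by (simp add: submodule_def a_inv_def)
  show ?thesis
  proof (intro left_module.intro left_module_axioms.intro)
    show "abelian_group (M\<lparr>carrier := N\<rparr>)"
    proof (rule abelian_groupI)
      fix x assume "x \<in> carrier (M\<lparr>carrier := N\<rparr>)"
      then show "\<exists>y\<in>carrier (M\<lparr>carrier := N\<rparr>). y \<oplus>\<^bsub>M\<lparr>carrier := N\<rparr>\<^esub> x = \<zero>\<^bsub>M\<lparr>carrier := N\<rparr>\<^esub>"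
        using neg by (intro bexI[of _ "\<ominus>\<^bsub>M\<^esub> x"]) (auto simp: sub M.l_neg)
    qed (use S sub in \<open>auto simp: M.a_ac\<close>)
  qed (use S sub R.ring_axioms in \<open>auto simp: lsmult_l_distr lsmult_r_distr lsmult_assoc lsmult_one\<close>)
qed

context tracial_algebra
begin

text \<open>Sums are killed by a common left multiple of two annihilators, scalar multiples by the
  Ore exchange \<open>u \<cdot> a = v \<cdot> c\<close>. Nullities add in a common multiple, hence
  the closure of \<open>E\<close> under halving.\<close>

lemma tors_submodule:
  fixes M :: "('h \<Rightarrow>\<^sub>L 'h, 'm, 'k) module_scheme"
  assumes M: "left_module (vn_ring A) M" and E: "\<And>e. e \<in> E \<Longrightarrow> 0 \<le> e \<and> e / 2 \<in> E"
  shows "submodule (tors A tr E M) (vn_ring A) M"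
proof -
  interpret M: left_module "vn_ring A" M by fact
  note z = left_module_smult_zero[OF M]
  show ?thesis
  proof (rule left_module_submoduleI[OF M])
    show "tors A tr E M \<subseteq> carrier M" by (auto simp: tors_def)
    show "\<zero>\<^bsub>M\<^esub> \<in> tors A tr E M"
      unfolding tors_def using E z[of id_blinfun] by (auto intro!: bexI[of _ id_blinfun])
    fix x y assume "x \<in> tors A tr E M" "y \<in> tors A tr E M"
    then have xy: "x \<in> carrier M" "y \<in> carrier M"
      "\<And>e. e \<in> E \<Longrightarrow> \<exists>c\<in>A. \<nu> c \<le> e \<and> c \<odot>\<^bsub>M\<^esub> x = \<zero>\<^bsub>M\<^esub>" "\<And>e. e \<in> E \<Longrightarrow> \<exists>c\<in>A. \<nu> c \<le> e \<and> c \<odot>\<^bsub>M\<^esub> y = \<zero>\<^bsub>M\<^esub>"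
      by (auto simp: tors_def)
    have "\<exists>c\<in>A. \<nu> c \<le> e \<and> c \<odot>\<^bsub>M\<^esub> (x \<oplus>\<^bsub>M\<^esub> y) = \<zero>\<^bsub>M\<^esub>" if e: "e \<in> E" for e
    proof -
      obtain c d where c: "c \<in> A" "\<nu> c \<le> e / 2" "c \<odot>\<^bsub>M\<^esub> x = \<zero>\<^bsub>M\<^esub>" and d: "d \<in> A" "\<nu> d \<le> e / 2" "d \<odot>\<^bsub>M\<^esub> y = \<zero>\<^bsub>M\<^esub>"
        using xy(3,4)[of "e / 2"] E[OF e] by blast
      obtain u v where u: "u \<in> A" "v \<in> A" "u \<cdot> c = v \<cdot> d" "\<nu> u \<le> \<nu> d" using ore[OF c(1) d(1)] by blast
      have "\<nu> (u \<cdot> c) \<le> e" using \<nu>_comp_le[OF u(1) c(1)] u(4) c(2) d(2) by simp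
      moreover have "(u \<cdot> c) \<odot>\<^bsub>M\<^esub> x = \<zero>\<^bsub>M\<^esub>" using M.lsmult_assoc[of u c x] u(1) c xy(1) z[of u] by simp
      moreover have "(u \<cdot> c) \<odot>\<^bsub>M\<^esub> y = \<zero>\<^bsub>M\<^esub>" unfolding u(3) using M.lsmult_assoc[of v d y] u(2) d xy(2) z[of v] by simp
      ultimately show ?thesis
        using M.lsmult_r_distr[of "u \<cdot> c" x y] xy u(1) c(1) comp_in by (intro bexI[of _ "u \<cdot> c"]) auto
    qed
    then show "x \<oplus>\<^bsub>M\<^esub> y \<in> tors A tr E M" using xy by (auto simp: tors_def)
  next
    fix a x assume a: "a \<in> carrier (vn_ring A)" and x: "x \<in> tors A tr E M"
    then have aA: "a \<in> A" and xM: "x \<in> carrier M" by (auto simp: tors_def)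
    have "\<exists>c\<in>A. \<nu> c \<le> e \<and> c \<odot>\<^bsub>M\<^esub> (a \<odot>\<^bsub>M\<^esub> x) = \<zero>\<^bsub>M\<^esub>" if e: "e \<in> E" for e
    proof -
      obtain c where c: "c \<in> A" "\<nu> c \<le> e" "c \<odot>\<^bsub>M\<^esub> x = \<zero>\<^bsub>M\<^esub>" using x e by (auto simp: tors_def)
      obtain u v where u: "u \<in> A" "v \<in> A" "u \<cdot> a = v \<cdot> c" "\<nu> u \<le> \<nu> c" using ore[OF aA c(1)] by blast
      have "u \<odot>\<^bsub>M\<^esub> (a \<odot>\<^bsub>M\<^esub> x) = (v \<cdot> c) \<odot>\<^bsub>M\<^esub> x" using M.lsmult_assoc[of u a x] u(1,3) aA xM by simp
      also have "\<dots> = \<zero>\<^bsub>M\<^esub>" using M.lsmult_assoc[of v c x] u(2) c xM z[of v] by simp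
      finally show ?thesis using u c by (intro bexI[of _ u]) auto
    qed
    then show "a \<odot>\<^bsub>M\<^esub> x \<in> tors A tr E M" using M.lsmult_closed[OF a xM] by (auto simp: tors_def)
  qed
qed

lemma null_eq_kerp: assumes "h \<in> A" "psd h" shows "null h = kerp h"
  unfolding null_def
proof (rule kerp_eqI)
  show "psd (op_adj h \<cdot> h)" by (intro psd_adj_comp bops assms)
  show "op_adj h \<cdot> h \<cdot> kerp h = 0" by (simp add: comp_assoc comp_kerp assms)
  show "kerp h \<cdot> kerp (op_adj h \<cdot> h) = kerp (op_adj h \<cdot> h)"
    using null(1,4)[OF assms(1)] unfolding null_def by (intro kerp_fix[OF assms(2)] bops)
qed (rule kerp_sa[OF assms(2)])

lemma \<tau>_comp_proj_le:
  assumes y: "y \<in> A" and p: "p \<in> A" "sa p" "p \<cdot> p = p"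
  shows "\<tau> (op_adj (y \<cdot> p) \<cdot> (y \<cdot> p)) \<le> \<tau> (op_adj y \<cdot> y)"
proof -
  let ?q = "id_blinfun - p"
  have q: "sa ?q" "?q \<cdot> ?q = ?q" "?q \<in> A" using p by (auto simp: sa_diff comp_simps diff_in)
  have y': "op_adj y \<in> A" by (rule adj_in[OF y])
  have "\<tau> (op_adj (y \<cdot> p) \<cdot> (y \<cdot> p)) = \<tau> ((y \<cdot> p) \<cdot> op_adj (y \<cdot> p))"
    by (intro \<tau>_comm in_intros y p)
  also have "(y \<cdot> p) \<cdot> op_adj (y \<cdot> p) = y \<cdot> (p \<cdot> p) \<cdot> op_adj y"
    using p(1,2) y by (simp add: op_adj_comp bops sa_def comp_assoc)
  also have "\<tau> \<dots> \<le> \<tau> (y \<cdot> op_adj y)"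
  proof (rule \<tau>_mono)
    have "psd (op_adj (op_adj y) \<cdot> ?q \<cdot> op_adj y)" by (rule psd_conj[OF proj_psd[OF q(1,2)] bops[OF y']])
    then show "psd (y \<cdot> op_adj y - y \<cdot> (p \<cdot> p) \<cdot> op_adj y)" by (simp add: bops y p comp_simps)
  qed (intro in_intros y p)+
  also have "\<dots> = \<tau> (op_adj y \<cdot> y)" by (rule \<tau>_comm[OF y y'])
  finally show ?thesis .
qed

text \<open>For a left ideal \<open>I\<close> whose elements all have a large kernel, the kernel projections of a sequence
  in \<open>I\<close> of minimal nullity decrease to the complement of the unit of the closure of \<open>I\<close>.\<close>

lemma ideal_complement:
  assumes I: "I \<subseteq> A" and add: "\<And>x y. x \<in> I \<Longrightarrow> y \<in> I \<Longrightarrow> x + y \<in> I" and z: "0 \<in> I"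
    and mult: "\<And>a x. a \<in> A \<Longrightarrow> x \<in> I \<Longrightarrow> a \<cdot> x \<in> I"
    and e: "e > 0" and large: "\<And>c. c \<in> I \<Longrightarrow> e < \<nu> c"
  shows "\<exists>p\<in>A. sa p \<and> p \<cdot> p = p \<and> p \<noteq> 0 \<and> (\<forall>b\<in>A. b \<cdot> p \<in> I \<longrightarrow> b \<cdot> p = 0)"
proof -
  define \<kappa> where "\<kappa> = Inf (\<nu> ` I)"
  have ne: "\<nu> ` I \<noteq> {}" using z by blast
  have bd: "bdd_below (\<nu> ` I)" using large by (intro bdd_belowI[of _ e]) (auto intro: less_imp_le)
  have \<kappa>e: "e \<le> \<kappa>" unfolding \<kappa>_def by (rule cInf_greatest[OF ne]) (use large in \<open>auto intro: less_imp_le\<close>)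
  have \<kappa>le: "\<kappa> \<le> \<nu> c" if "c \<in> I" for c unfolding \<kappa>_def by (rule cInf_lower[OF imageI[OF that] bd])
  have "\<exists>c\<in>I. \<nu> c < \<kappa> + 1 / Suc n" for n
    using cInf_lessD[OF ne, of "\<kappa> + 1 / Suc n"] by (auto simp: \<kappa>_def)
  then obtain c where c: "\<And>n. c n \<in> I" "\<And>n. \<nu> (c n) < \<kappa> + 1 / Suc n" by metis
  have cA: "c n \<in> A" for n using c I by blast
  have I_sum: "finite J \<Longrightarrow> (\<And>j. j \<in> J \<Longrightarrow> f j \<in> I) \<Longrightarrow> sum f J \<in> I" for f :: "nat \<Rightarrow> _" and J
    by (induction J rule: finite_induct) (auto intro: add z)
  have colI: "colh J f \<in> I" if "finite J" "\<And>j. j \<in> J \<Longrightarrow> f j \<in> I" for f :: "nat \<Rightarrow> _" and J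
    unfolding colh_def using that I by (intro I_sum mult adj_in) auto
  have colp: "psd (colh J f)" if "finite J" "\<And>j. j \<in> J \<Longrightarrow> f j \<in> I" for f :: "nat \<Rightarrow> _" and J
    using that I by (intro colh_psd' ) auto
  have colk: "f j \<cdot> kerp (colh J f) = 0" if "finite J" "\<And>j. j \<in> J \<Longrightarrow> f j \<in> I" "j \<in> J" for f :: "nat \<Rightarrow> _" and J j
    using kills_colh[of J f j] that I bops by blast
  \<comment> \<open>The Gram operator of finitely many elements of \<open>I\<close> is again in
    \<open>I\<close> and its kernel is their common kernel, so even common kernels have trace at
    least \<kappa>.\<close>
  have \<kappa>col: "\<kappa> \<le> \<tau> (kerp (colh J f))" if "finite J" "\<And>j. j \<in> J \<Longrightarrow> f j \<in> I" for f :: "nat \<Rightarrow> _" and J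
  proof -
    have c: "colh J f \<in> I" by (rule colI[OF that])
    then have "null (colh J f) = kerp (colh J f)" using I by (intro null_eq_kerp colp that) auto
    then show ?thesis using \<kappa>le[OF c] by (simp add: \<nu>_def)
  qed
  have kA: "kerp (colh J f) \<in> A" if "finite J" "\<And>j. j \<in> J \<Longrightarrow> f j \<in> I" for f :: "nat \<Rightarrow> _" and J
    using colI[OF that] I by (intro kerp_in colp that) auto
  have sub: "kerp (colh J f) \<cdot> kerp (colh J' g) = kerp (colh J' g)"
    if J: "finite J" "\<And>j. j \<in> J \<Longrightarrow> f j \<in> I" and J': "finite J'" "\<And>j. j \<in> J' \<Longrightarrow> g j \<in> I"
      and k: "\<And>j. j \<in> J \<Longrightarrow> f j \<cdot> kerp (colh J' g) = 0" for f g :: "nat \<Rightarrow> _" and J J'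
  proof -
    have "colh J f \<cdot> x = (\<Sum>i\<in>J. op_adj (f i) \<cdot> (f i \<cdot> x))" for x
      by (simp add: colh_def comp.sum_left comp_assoc)
    also have "(\<Sum>i\<in>J. op_adj (f i) \<cdot> (f i \<cdot> kerp (colh J' g))) = 0"
      by (rule sum.neutral) (simp add: k)
    finally have 0: "colh J f \<cdot> kerp (colh J' g) = 0" .
    have "psd (colh J f)" by (rule colp[OF J])
    moreover have "kerp (colh J' g) \<in> bounded_ops" by (rule bops, rule kA[OF J'])
    ultimately show ?thesis using 0 by (rule kerp_fix)
  qed
  define k where "k = (\<lambda>n. kerp (colh {..n} c))"
  have k: "k n \<in> A" "sa (k n)" "k n \<cdot> k n = k n" for n
    unfolding k_def using c by (auto intro!: kA kerp_sa kerp_idem colp)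
  have ck: "c j \<cdot> k n = 0" if "j \<le> n" for j n unfolding k_def using that c by (intro colk) auto
  have kk: "k m \<cdot> k n = k n" if "m \<le> n" for m n
    unfolding k_def using c ck that by (intro sub) (auto simp: k_def)
  have kdec: "psd (k n - k (Suc n))" for n by (intro proj_diff_psd k kk) simp
  have k\<kappa>: "\<kappa> \<le> \<tau> (k n)" for n unfolding k_def using c by (intro \<kappa>col) auto
  have k\<kappa>': "\<tau> (k n) < \<kappa> + 1 / Suc n" for n
    using \<tau>_le_\<nu>[OF cA k(1-3) ck, of n n] c(2)[of n] by simp
  have "\<exists>s. sot (\<lambda>n. id_blinfun - k n) s \<and> sa s \<and> (\<forall>n. psd (s - (id_blinfun - k n))) \<and> norm s \<le> 1"
  proof (rule monotone_limit[where C=1])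
    have "psd (id_blinfun - k n)" for n using k by (intro proj_psd) (auto simp: sa_diff comp_simps)
    then show "psd (id_blinfun - k 0)" by simp
    have "psd (k n)" for n by (intro proj_psd k)
    then show "psd (1 *\<^sub>R id_blinfun - (id_blinfun - k n))" for n by simp
  qed (use kdec in auto)
  then obtain s where s: "sot (\<lambda>n. id_blinfun - k n) s" "sa s" by blast
  define p where "p = id_blinfun - s"
  have kp: "sot k p" using sot_diff[OF sot_const[OF bounded_ops_id] s(1)] by (simp add: p_def)
  have p: "p \<in> A" "sa p" using sot_in[OF kp k(1)] s(2) by (auto simp: p_def sa_diff)
  have knp: "k n \<cdot> p = p" for n
  proof (rule sot_unique[OF sot_comp_left[OF bops[OF k(1)] kp]])
    show "sot (\<lambda>m. k n \<cdot> k m) p" by (rule sot_cong_eventually[OF kp, of n]) (simp add: kk)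
  qed
  have pp: "p \<cdot> p = p"
    using sot_unique[OF sot_comp_right[OF bops[OF p(1)] kp]] sot_const[OF bops[OF p(1)]] by (simp add: knp)
  have "(\<lambda>n. \<tau> (k n)) \<longlonglongrightarrow> \<tau> p" by (rule \<tau>_decreasing[OF k(1) kdec kp])
  then have "\<kappa> \<le> \<tau> p" by (rule LIMSEQ_le_const) (use k\<kappa> in blast)
  then have "p \<noteq> 0" using e \<kappa>e by auto
  moreover have "b \<cdot> p = 0" if b: "b \<in> A" "b \<cdot> p \<in> I" for b
  proof -
    define d where "d = b \<cdot> p"
    have d: "d \<in> I" "d \<in> A" using b I by (auto simp: d_def)
    have dp: "d \<cdot> p = d" by (simp add: d_def comp_assoc pp)
    define K where "K = norm (op_adj d \<cdot> d)"
    \<comment> \<open>Adding \<open>d\<close> to \<open>c 0, ..., c n\<close> shrinks the common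
      kernel from \<open>k n\<close> to \<open>k'\<close>. By minimality of \<kappa> the trace drops
      by less than \<open>1 / Suc n\<close>, and \<open>d\<close> vanishes on \<open>k'\<close>, so
      only the gap \<open>q\<close> contributes.\<close>
    have est: "\<tau> (op_adj d \<cdot> d) \<le> K * (1 / Suc n)" for n
    proof -
      define f where "f = (\<lambda>j. if j \<le> n then c j else d)"
      define k' where "k' = kerp (colh {..Suc n} f)"
      have fI: "f j \<in> I" for j using c d by (simp add: f_def)
      have k': "k' \<in> A" "sa k'" "k' \<cdot> k' = k'" "\<kappa> \<le> \<tau> k'"
        unfolding k'_def using fI by (auto intro!: kA kerp_sa kerp_idem colp \<kappa>col)
      have fk: "f j \<cdot> k' = 0" if "j \<le> Suc n" for j unfolding k'_def using that fI by (intro colk) auto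
      have dk': "d \<cdot> k' = 0" using fk[of "Suc n"] by (simp add: f_def)
      have "c j \<cdot> k' = 0" if "j \<le> n" for j using fk[of j] that by (simp add: f_def)
      then have kk': "k n \<cdot> k' = k'" unfolding k_def k'_def using c fI by (intro sub) auto
      define q where "q = k n - k'"
      have q: "psd q" "q \<in> A" unfolding q_def using proj_diff_psd[OF k'(2,3) k(2,3) kk'] diff_in[OF k(1) k'(1)] by auto
      have "op_adj (k n \<cdot> k') = k' \<cdot> k n" using k k' by (simp add: op_adj_comp sa_def)
      then have k'k: "k' \<cdot> k n = k'" using kk' k' by (simp add: sa_def)
      have qq: "q \<cdot> q = q" by (simp add: q_def comp_simps k k' kk' k'k)
      have dk: "d \<cdot> k n = d \<cdot> q" by (simp add: q_def comp_simps dk')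
      have dkp: "d \<cdot> k n \<cdot> p = d" by (simp add: comp_assoc knp dp)
      have "\<tau> (op_adj d \<cdot> d) \<le> \<tau> (op_adj (d \<cdot> k n) \<cdot> (d \<cdot> k n))"
        using \<tau>_comp_proj_le[OF comp_in[OF d(2) k(1)] p pp, of n] by (simp add: dkp)
      also have "\<dots> = \<tau> (q \<cdot> (op_adj d \<cdot> d) \<cdot> q)"
        unfolding dk using psd_sa[OF q(1)] d by (simp add: op_adj_comp bops sa_def comp_assoc)
      also have "\<dots> \<le> \<tau> (K *\<^sub>R q)"
      proof (rule \<tau>_mono)
        have "psd (op_adj q \<cdot> (K *\<^sub>R id_blinfun - op_adj d \<cdot> d) \<cdot> q)"
          unfolding K_def by (intro psd_conj psd_norm_bound psd_sa psd_adj_comp bops d q)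
        then show "psd (K *\<^sub>R q - q \<cdot> (op_adj d \<cdot> d) \<cdot> q)"
          using psd_sa[OF q(1)] by (simp add: sa_def comp_simps qq)
      qed (intro in_intros q d)+
      also have "\<dots> = K * (\<tau> (k n) - \<tau> k')" by (simp add: \<tau>_scaleR q q_def[symmetric]) (simp add: q_def \<tau>_diff k k')
      also have "\<dots> \<le> K * (1 / Suc n)"
        using k\<kappa>'[of n] k'(4) by (intro mult_left_mono) (auto simp: K_def)
      finally show ?thesis .
    qed
    have "(\<lambda>n. K * (1 / Suc n)) \<longlonglongrightarrow> K * 0" by (intro tendsto_intros LIMSEQ_Suc[OF lim_1_over_n])
    then have "\<tau> (op_adj d \<cdot> d) \<le> K * 0" by (rule LIMSEQ_le_const) (use est in blast)
    then show ?thesis using \<tau>_adj_comp_zero[OF d(2)] by (simp add: d_def)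
  qed
  ultimately show ?thesis using p pp by blast
qed

section \<open>Dimension of finitely generated projective submodules\<close>

lemma projection_matrix_pmat: "projection_matrix A n F \<Longrightarrow> pmat {..<n} F"
  by (auto simp: projection_matrix_def pmat_def)

lemma pmat_zero:
  assumes F: "pmat I F" "finite I" and t: "Tr I F \<le> 0" and i: "i \<in> I" "j \<in> I"
  shows "F i j = 0"
proof -
  have nn: "0 \<le> \<tau> (F k k)" if "k \<in> I" for k using that F by (intro \<tau>_nonneg pmat_in pmat_diag_psd)
  have "\<tau> (F j j) \<le> Tr I F" unfolding Tr_def by (rule member_le_sum[OF i(2) nn F(2)]) auto
  then have "F j j = 0" using t F i(2) by (intro \<tau>_faithful pmat_in pmat_diag_psd) auto
  then have "psd (- (op_adj (F i j) \<cdot> F i j))" using pmat_diag_ge[OF F i] by simp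
  then have "op_adj (F i j) \<cdot> F i j = 0"
    using pmat_in[OF F(1) i] by (intro psd_antisym psd_adj_comp bops)
  then show ?thesis using adj_comp_zero bops pmat_in[OF F(1) i] by blast
qed

lemma Re_tr_sum: "(\<And>i. i \<in> I \<Longrightarrow> F i i \<in> A) \<Longrightarrow> Re (\<Sum>i\<in>I. tr (F i i)) = Tr I F"
  by (simp add: Tr_def \<tau>_def)

lemma restrict_in_free_module:
  "(\<And>i. i < n \<Longrightarrow> f i \<in> A) \<Longrightarrow> (\<lambda>i\<in>{..<n}. f i) \<in> carrier (free_module (vn_ring A) n)"
  by (simp only: free_module_def partial_object.select_convs) (rule iffD2[OF restrict_PiE_iff], simp)

text \<open>The zero row and the \<open>i\<close>-th unit row have the same image.\<close>

lemma matrix_image_const: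
  assumes "card (matrix_image A n F) = 1" "projection_matrix A n F" "i < n" "j < n"
  shows "F i j = 0"
proof -
  have F: "F i j \<in> A" if "i < n" "j < n" for i j using assms(2) that by (auto simp: projection_matrix_def)
  obtain z where z: "matrix_image A n F = {z}" using assms(1) card_1_singletonE by blast
  let ?f = "\<lambda>x. \<lambda>j\<in>{..<n}. \<Sum>i<n. x i \<cdot> F i j"
  have "?f (\<lambda>k\<in>{..<n}. 0) \<in> matrix_image A n F"
    unfolding matrix_image_def by (intro imageI restrict_in_free_module) simp
  then have 0: "?f (\<lambda>k\<in>{..<n}. 0) = z" unfolding z by (rule singletonD)
  have "?f (\<lambda>k\<in>{..<n}. if k = i then id_blinfun else 0) \<in> matrix_image A n F"
    unfolding matrix_image_def by (intro imageI restrict_in_free_module) simp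
  then have "?f (\<lambda>k\<in>{..<n}. if k = i then id_blinfun else 0) = z" unfolding z by (rule singletonD)
  with 0 have "?f (\<lambda>k\<in>{..<n}. 0) j = ?f (\<lambda>k\<in>{..<n}. if k = i then id_blinfun else 0) j" by (metis (no_types))
  then have "0 = (\<Sum>k<n. (if k = i then id_blinfun else 0) \<cdot> F k j)" using assms(4) by simp
  also have "\<dots> = (\<Sum>k<n. if k = i then F i j else 0)" by (intro sum.cong) auto
  also have "\<dots> = F i j" using assms(3) by simp
  finally show ?thesis by simp
qed

text \<open>If \<open>c \<cdot> v = 0\<close> then the range of \<open>v\<close> lies under
  \<open>null c\<close>, so the rank of \<open>v\<close> is at most \<open>\<nu> c\<close>.\<close>

lemma killed_zero:
  assumes v: "v \<in> A" and k: "\<And>e. e > 0 \<Longrightarrow> \<exists>c\<in>A. \<nu> c \<le> e \<and> c \<cdot> v = 0"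
  shows "v = 0"
proof -
  have "\<tau> id_blinfun \<le> \<nu> v + e" if e: "e > 0" for e
  proof -
    obtain c where c: "c \<in> A" "\<nu> c \<le> e" "c \<cdot> v = 0" using k[OF e] by blast
    have "null c \<cdot> v = v" by (intro null_fix c bops v)
    moreover have "op_adj (null c \<cdot> v) = op_adj v \<cdot> null c"
      using null_sa[OF c(1)] v by (simp add: op_adj_comp bops sa_def)
    ultimately have "op_adj v \<cdot> (id_blinfun - null c) = 0" by (simp add: comp_simps)
    then have "\<tau> (id_blinfun - null c) \<le> \<nu> (op_adj v)"
      using null[OF c(1)] by (intro \<tau>_le_\<nu> adj_in v) (auto simp: diff_in sa_diff comp_simps)
    then show ?thesis using null_in[OF c(1)] c(2) by (simp add: \<nu>_adj v \<tau>_diff \<nu>_def[of c])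
  qed
  then have "\<tau> id_blinfun \<le> \<nu> v" by (rule field_le_epsilon)
  then have "\<tau> (id_blinfun - null v) \<le> 0" using null_in[OF v] by (simp add: \<tau>_diff \<nu>_def)
  moreover have "psd (id_blinfun - null v)" using null[OF v] by (intro proj_psd) (auto simp: sa_diff comp_simps)
  ultimately have "id_blinfun - null v = 0" by (intro \<tau>_faithful diff_in id_in null_in v)
  then show ?thesis using comp_null[OF v] by simp
qed

text \<open>Inside a free module an annihilator acts on each coordinate, and
  \<open>killed_zero\<close> removes every coordinate.\<close>

lemma fg_projective_tors_zero:
  fixes M :: "('h \<Rightarrow>\<^sub>L 'h, 'm, 'k) module_scheme"
  assumes M: "left_module (vn_ring A) M" and P: "P \<subseteq> tors A tr {0<..} M" "\<zero>\<^bsub>M\<^esub> \<in> P"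
    and fg: "fg_projective (vn_ring A) (M\<lparr>carrier := P\<rparr>)"
  shows "P = {\<zero>\<^bsub>M\<^esub>}"
proof -
  interpret M: left_module "vn_ring A" M by fact
  obtain n S g where S: "submodule S (vn_ring A) (free_module (vn_ring A) n)"
    and g: "g \<in> left_module_iso (vn_ring A) (M\<lparr>carrier := P\<rparr>) ((free_module (vn_ring A) n)\<lparr>carrier := S\<rparr>)"
    using fg unfolding fg_projective_def by blast
  have gS: "g x \<in> {..<n} \<rightarrow>\<^sub>E A" if "x \<in> P" for x
    using g that submodule_subset[OF S] by (auto simp: left_module_iso_def left_module_hom_def free_module_def)
  have inj: "inj_on g P" using g by (auto simp: left_module_iso_def bij_betw_def)
  have gsm: "g (a \<odot>\<^bsub>M\<^esub> x) = (\<lambda>i\<in>{..<n}. a \<cdot> g x i)" if "a \<in> A" "x \<in> P" for a x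
    using g that by (auto simp: left_module_iso_def left_module_hom_def free_module_def)
  have g0: "g \<zero>\<^bsub>M\<^esub> = (\<lambda>i\<in>{..<n}. 0)"
    using gsm[of 0 "\<zero>\<^bsub>M\<^esub>"] left_module_zero_smult[OF M, of "\<zero>\<^bsub>M\<^esub>"] P(2) by simp
  have "x = \<zero>\<^bsub>M\<^esub>" if x: "x \<in> P" for x
  proof -
    have "g x i = 0" if i: "i < n" for i
    proof -
      let ?v = "g x i"
      have v: "?v \<in> A" using gS[OF x] i by (auto simp: PiE_def)
      show ?thesis
      proof (rule killed_zero[OF v])
        fix e :: real assume "e > 0"
        then obtain c where c: "c \<in> A" "\<nu> c \<le> e" "c \<odot>\<^bsub>M\<^esub> x = \<zero>\<^bsub>M\<^esub>" using x P(1) by (auto simp: tors_def)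
        have "c \<cdot> ?v = 0" using fun_cong[OF gsm[OF c(1) x], of i] i by (simp add: c(3) g0)
        then show "\<exists>c\<in>A. \<nu> c \<le> e \<and> c \<cdot> ?v = 0" using c by blast
      qed
    qed
    then have "g x = g \<zero>\<^bsub>M\<^esub>" unfolding g0 using gS[OF x] by (intro ext) (auto simp: PiE_def extensional_def)
    then show ?thesis using inj x P(2) by (auto dest: inj_onD)
  qed
  then show ?thesis using P(2) by blast
qed

lemma free_module_zero_carrier: "carrier (free_module (vn_ring A) 0) = {\<lambda>_. undefined}"
  by (auto simp: free_module_def)

text \<open>The dimension is a choice among representing matrices, so every candidate is examined:
  its image is a single point, hence its entries vanish. The empty matrix shows that there is a
  candidate.\<close>

lemma vn_dim_proj_zero:
  fixes M :: "('h \<Rightarrow>\<^sub>L 'h, 'm, 'k) module_scheme"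
  assumes M: "left_module (vn_ring A) M" and c: "carrier M = {\<zero>\<^bsub>M\<^esub>}"
  shows "vn_dim_proj A tr M = 0" "fg_projective (vn_ring A) M"
proof -
  interpret M: left_module "vn_ring A" M by fact
  let ?F = "free_module (vn_ring A) 0" and ?g = "\<lambda>x. (\<lambda>_. undefined) :: nat \<Rightarrow> 'h \<Rightarrow>\<^sub>L 'h"
  have iso: "?g \<in> left_module_iso (vn_ring A) M (?F\<lparr>carrier := {\<lambda>_. undefined}\<rparr>)"
    by (auto simp: left_module_iso_def left_module_hom_def c bij_betw_def free_module_def)
  have im: "matrix_image A 0 F = {\<lambda>_. undefined}" for F
    by (auto simp: matrix_image_def free_module_zero_carrier)
  have pm: "projection_matrix A 0 F" for F by (simp add: projection_matrix_def)
  let ?P = "\<lambda>d. \<exists>n F. projection_matrix A n F \<and>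
     left_module_iso (vn_ring A) M ((free_module (vn_ring A) n)\<lparr>carrier := matrix_image A n F\<rparr>) \<noteq> {} \<and>
     d = Re (\<Sum>i<n. tr (F i i))"
  have "?P 0" using pm iso im by (intro exI[of _ 0]) auto
  moreover have "d = 0" if Pd: "?P d" for d
  proof -
    obtain n F h where F: "projection_matrix A n F" "d = Re (\<Sum>i<n. tr (F i i))"
      and h: "h \<in> left_module_iso (vn_ring A) M ((free_module (vn_ring A) n)\<lparr>carrier := matrix_image A n F\<rparr>)"
      using Pd by blast
    have "card (matrix_image A n F) = 1"
      using h bij_betw_same_card[of h "carrier M"] c by (auto simp: left_module_iso_def)
    then have "F i i = 0" if "i < n" for i using matrix_image_const F(1) that by blast
    then show ?thesis using F(2) \<tau>_zero by (simp add: \<tau>_def)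
  qed
  ultimately show "vn_dim_proj A tr M = 0"
    unfolding vn_dim_proj_def by (rule some_equality)
  have z: "submodule {\<lambda>_. undefined} (vn_ring A) ?F"
    unfolding submodule_def subgroup_def submodule_axioms_def
  proof (intro conjI allI impI ballI)
    fix x assume "x \<in> {\<lambda>_ :: nat. undefined :: 'h \<Rightarrow>\<^sub>L 'h}"
    have "inv\<^bsub>add_monoid ?F\<^esub> (\<lambda>_. undefined) = (\<lambda>_. undefined)"
      unfolding m_inv_def by (rule the_equality) (auto simp: free_module_def)
    then show "inv\<^bsub>add_monoid ?F\<^esub> x \<in> {\<lambda>_. undefined}" using \<open>x \<in> _\<close> by simp
  qed (auto simp: free_module_def)
  have zz: "\<zero>\<^bsub>?F\<^esub> = (\<lambda>_. undefined)" by (auto simp: free_module_def)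
  show "fg_projective (vn_ring A) M"
    unfolding fg_projective_def
    by (rule exI[of _ 0], rule exI[of _ "{\<lambda>_. undefined}"], rule exI[of _ "{\<lambda>_. undefined}"])
       (use z iso in \<open>auto simp: zz set_add_def' free_module_def\<close>)
qed

lemma vn_dim_tors:
  fixes M :: "('h \<Rightarrow>\<^sub>L 'h, 'm, 'k) module_scheme"
  assumes M: "left_module (vn_ring A) M"
  shows "vn_dim A tr (M\<lparr>carrier := tors A tr {0<..} M\<rparr>) = 0"
proof -
  let ?T = "tors A tr {0<..} M"
  have T: "submodule ?T (vn_ring A) M" by (rule tors_submodule[OF M]) auto
  let ?N = "M\<lparr>carrier := ?T\<rparr>"
  have N: "left_module (vn_ring A) ?N" by (rule left_module_submodule[OF M T])
  have Z: "submodule {\<zero>\<^bsub>M\<^esub>} (vn_ring A) ?N"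
    using left_module_smult_zero[OF M] submodule_zero[OF T] abelian_group.axioms M
    by (intro left_module_submoduleI[OF N]) (auto simp: left_module_def abelian_group_def abelian_monoid.l_zero abelian_monoid.zero_closed)
  have Z0: "vn_dim_proj A tr (?N\<lparr>carrier := {\<zero>\<^bsub>M\<^esub>}\<rparr>) = 0" "fg_projective (vn_ring A) (?N\<lparr>carrier := {\<zero>\<^bsub>M\<^esub>}\<rparr>)"
    using vn_dim_proj_zero[OF left_module_submodule[OF N Z]] by simp_all
  have only: "P = {\<zero>\<^bsub>M\<^esub>}" if "submodule P (vn_ring A) ?N" "fg_projective (vn_ring A) (?N\<lparr>carrier := P\<rparr>)" for P
    using fg_projective_tors_zero[OF M, of P] submoduleD(1,2)[OF that(1)] that(2) by simp
  have "P = {\<zero>\<^bsub>M\<^esub>} \<longleftrightarrow> submodule P (vn_ring A) ?N \<and> fg_projective (vn_ring A) (?N\<lparr>carrier := P\<rparr>)" for P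
    using only[of P] Z Z0(2) by blast
  then have "{ereal (vn_dim_proj A tr (?N\<lparr>carrier := P\<rparr>)) |P.
     submodule P (vn_ring A) ?N \<and> fg_projective (vn_ring A) (?N\<lparr>carrier := P\<rparr>)}
     = {ereal (vn_dim_proj A tr (?N\<lparr>carrier := P\<rparr>)) |P. P = {\<zero>\<^bsub>M\<^esub>}}" by simp
  also have "\<dots> = {0}" using Z0(1) by (simp add: zero_ereal_def)
  finally have "{ereal (vn_dim_proj A tr (?N\<lparr>carrier := P\<rparr>)) |P.
     submodule P (vn_ring A) ?N \<and> fg_projective (vn_ring A) (?N\<lparr>carrier := P\<rparr>)} = {0}" .
  then show ?thesis unfolding vn_dim_def by simp
qed

lemma left_module_free_module: "left_module (vn_ring A) (free_module (vn_ring A) n)"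
proof (intro left_module.intro left_module_axioms.intro ring_vn_ring)
  let ?F = "free_module (vn_ring A) n"
  have P: "x \<in> {..<n} \<rightarrow>\<^sub>E A \<longleftrightarrow> (\<forall>i<n. x i \<in> A) \<and> x \<in> extensional {..<n}" for x by (auto simp: PiE_def)
  have ext: "x = y" if "x \<in> extensional {..<n}" "y \<in> extensional {..<n}" "\<And>i. i < n \<Longrightarrow> x i = y i"
    for x y :: "nat \<Rightarrow> 'h \<Rightarrow>\<^sub>L 'h"
    by (rule extensionalityI[OF that(1,2)]) (use that(3) in auto)
  show "abelian_group ?F"
  proof (rule abelian_groupI)
    fix x assume "x \<in> carrier ?F"
    then have x: "\<And>i. i < n \<Longrightarrow> x i \<in> A" by (auto simp: free_module_def)
    have "- a \<in> A" if "a \<in> A" for a using scaleR_in[OF that, of "-1"] by simp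
    then show "\<exists>y\<in>carrier ?F. y \<oplus>\<^bsub>?F\<^esub> x = \<zero>\<^bsub>?F\<^esub>"
      using x by (intro bexI[of _ "\<lambda>i\<in>{..<n}. - x i"]) (auto simp: free_module_def)
  qed (auto simp: free_module_def P add_in add_ac intro!: ext)
qed (auto simp: free_module_def comp_in add_in comp_simps comp_assoc fun_eq_iff PiE_def Pi_iff extensional_def)

lemma submodule_row:
  assumes q: "q \<in> A"
  shows "submodule {\<lambda>j\<in>{..<1}. a \<cdot> q |a. a \<in> A} (vn_ring A) (free_module (vn_ring A) 1)" (is "submodule ?S _ ?F")
proof (rule left_module_submoduleI[OF left_module_free_module])
  show "?S \<subseteq> carrier ?F" using q by (blast intro: restrict_in_free_module comp_in)
  show "\<zero>\<^bsub>?F\<^esub> \<in> ?S" by (auto simp: free_module_def intro!: exI[of _ 0])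
  show "x \<oplus>\<^bsub>?F\<^esub> y \<in> ?S" if xy: "x \<in> ?S" "y \<in> ?S" for x y
  proof -
    obtain a b where "x = (\<lambda>j\<in>{..<1}. a \<cdot> q)" "y = (\<lambda>j\<in>{..<1}. b \<cdot> q)" "a \<in> A" "b \<in> A" using xy by blast
    then show ?thesis by (intro CollectI exI[of _ "a + b"]) (auto simp: free_module_def comp_simps add_in)
  qed
  show "a \<odot>\<^bsub>?F\<^esub> x \<in> ?S" if a: "a \<in> carrier (vn_ring A)" and x: "x \<in> ?S" for a x
  proof -
    obtain b where "x = (\<lambda>j\<in>{..<1}. b \<cdot> q)" "b \<in> A" using x by blast
    then show ?thesis using a by (intro CollectI exI[of _ "a \<cdot> b"]) (auto simp: free_module_def comp_assoc comp_in)
  qed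
qed

text \<open>\<open>y\<close> and \<open>p\<close> have the same annihilator, so
  \<open>a y \<mapsto> a p\<close> identifies the submodule with A p, a summand of \<open>A\<close>
  with complement A (1 - p). A representing matrix of trace zero would be zero and could not
  represent the nonzero \<open>y\<close>.\<close>

lemma cyclic_projective:
  fixes M :: "('h \<Rightarrow>\<^sub>L 'h, 'm, 'k) module_scheme"
  assumes M: "left_module (vn_ring A) M" and y: "y \<in> carrier M" "y \<noteq> \<zero>\<^bsub>M\<^esub>"
    and p: "p \<in> A" "sa p" "p \<cdot> p = p" and ann: "\<And>a. a \<in> A \<Longrightarrow> a \<odot>\<^bsub>M\<^esub> y = \<zero>\<^bsub>M\<^esub> \<longleftrightarrow> a \<cdot> p = 0"
  defines "P \<equiv> {a \<odot>\<^bsub>M\<^esub> y |a. a \<in> A}"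
  shows "submodule P (vn_ring A) M" "fg_projective (vn_ring A) (M\<lparr>carrier := P\<rparr>)"
    and "0 < vn_dim_proj A tr (M\<lparr>carrier := P\<rparr>)"
proof -
  interpret M: left_module "vn_ring A" M by fact
  let ?F = "free_module (vn_ring A) 1"
  let ?S = "{\<lambda>j\<in>{..<1}. a \<cdot> p |a. a \<in> A} :: (nat \<Rightarrow> 'h \<Rightarrow>\<^sub>L 'h) set"
    and ?Q = "{\<lambda>j\<in>{..<1}. a \<cdot> (id_blinfun - p) |a. a \<in> A} :: (nat \<Rightarrow> 'h \<Rightarrow>\<^sub>L 'h) set"
  have q: "id_blinfun - p \<in> A" by (intro diff_in id_in p)
  have cl: "a \<odot>\<^bsub>M\<^esub> y \<in> carrier M" if "a \<in> A" for a using M.lsmult_closed[of a y] that y by simp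
  have eq: "a \<cdot> p = b \<cdot> p \<longleftrightarrow> a \<odot>\<^bsub>M\<^esub> y = b \<odot>\<^bsub>M\<^esub> y" if ab: "a \<in> A" "b \<in> A" for a b
  proof -
    have d: "a - b \<in> A" by (intro diff_in ab)
    have "a \<odot>\<^bsub>M\<^esub> y = (a - b) \<odot>\<^bsub>M\<^esub> y \<oplus>\<^bsub>M\<^esub> b \<odot>\<^bsub>M\<^esub> y"
      using M.lsmult_l_distr[of "a - b" b y] d ab y by simp
    then have "a \<odot>\<^bsub>M\<^esub> y = b \<odot>\<^bsub>M\<^esub> y \<longleftrightarrow> (a - b) \<odot>\<^bsub>M\<^esub> y = \<zero>\<^bsub>M\<^esub>"
      using cl[OF d] cl[OF ab(2)] by (metis M.add.l_cancel_one M.add.r_cancel_one M.a_comm M.l_zero)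
    also have "\<dots> \<longleftrightarrow> (a - b) \<cdot> p = 0" by (rule ann[OF d])
    finally show ?thesis by (simp add: comp_simps)
  qed
  show sub: "submodule P (vn_ring A) M"
  proof (rule left_module_submoduleI[OF M])
    show "P \<subseteq> carrier M" using cl by (auto simp: P_def)
    show "\<zero>\<^bsub>M\<^esub> \<in> P" using left_module_zero_smult[OF M y(1)] unfolding P_def by (intro CollectI exI[of _ 0]) simp
    show "u \<oplus>\<^bsub>M\<^esub> v \<in> P" if uv: "u \<in> P" "v \<in> P" for u v
    proof -
      obtain a b where "u = a \<odot>\<^bsub>M\<^esub> y" "v = b \<odot>\<^bsub>M\<^esub> y" "a \<in> A" "b \<in> A" using uv by (auto simp: P_def)
      then show ?thesis using M.lsmult_l_distr[of a b y] y unfolding P_def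
        by (intro CollectI exI[of _ "a + b"]) (auto simp: add_in)
    qed
    show "a \<odot>\<^bsub>M\<^esub> u \<in> P" if a: "a \<in> carrier (vn_ring A)" and u: "u \<in> P" for a u
    proof -
      obtain b where "u = b \<odot>\<^bsub>M\<^esub> y" "b \<in> A" using u by (auto simp: P_def)
      then show ?thesis using M.lsmult_assoc[of a b y] y a unfolding P_def
        by (intro CollectI exI[of _ "a \<cdot> b"]) (auto simp: comp_in)
    qed
  qed
  define g where "g = (\<lambda>z. \<lambda>j\<in>{..<1::nat}. (SOME a. a \<in> A \<and> z = a \<odot>\<^bsub>M\<^esub> y) \<cdot> p)"
  have g: "g (a \<odot>\<^bsub>M\<^esub> y) = (\<lambda>j\<in>{..<1}. a \<cdot> p)" if a: "a \<in> A" for a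
  proof -
    have "(SOME b. b \<in> A \<and> a \<odot>\<^bsub>M\<^esub> y = b \<odot>\<^bsub>M\<^esub> y) \<in> A \<and> a \<odot>\<^bsub>M\<^esub> y = (SOME b. b \<in> A \<and> a \<odot>\<^bsub>M\<^esub> y = b \<odot>\<^bsub>M\<^esub> y) \<odot>\<^bsub>M\<^esub> y"
      by (rule someI[of _ a]) (use a in simp)
    then have "(SOME b. b \<in> A \<and> a \<odot>\<^bsub>M\<^esub> y = b \<odot>\<^bsub>M\<^esub> y) \<cdot> p = a \<cdot> p" using eq[OF a] by metis
    then show ?thesis by (simp add: g_def)
  qed
  have iso: "g \<in> left_module_iso (vn_ring A) (M\<lparr>carrier := P\<rparr>) (?F\<lparr>carrier := ?S\<rparr>)"
    unfolding left_module_iso_def left_module_hom_def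
  proof (intro CollectI conjI ballI)
    show "g \<in> carrier (M\<lparr>carrier := P\<rparr>) \<rightarrow> carrier (?F\<lparr>carrier := ?S\<rparr>)" by (auto simp: P_def g)
    show "g (u \<oplus>\<^bsub>M\<lparr>carrier := P\<rparr>\<^esub> v) = g u \<oplus>\<^bsub>?F\<lparr>carrier := ?S\<rparr>\<^esub> g v"
      if uv: "u \<in> carrier (M\<lparr>carrier := P\<rparr>)" "v \<in> carrier (M\<lparr>carrier := P\<rparr>)" for u v
    proof -
      obtain a b where ab: "u = a \<odot>\<^bsub>M\<^esub> y" "v = b \<odot>\<^bsub>M\<^esub> y" "a \<in> A" "b \<in> A" using uv by (auto simp: P_def)
      then have "u \<oplus>\<^bsub>M\<^esub> v = (a + b) \<odot>\<^bsub>M\<^esub> y" using M.lsmult_l_distr[of a b y] y by simp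
      then show ?thesis using ab by (simp add: g add_in) (auto simp: free_module_def comp_simps)
    qed
    show "g (a \<odot>\<^bsub>M\<lparr>carrier := P\<rparr>\<^esub> u) = a \<odot>\<^bsub>?F\<lparr>carrier := ?S\<rparr>\<^esub> g u"
      if au: "a \<in> carrier (vn_ring A)" "u \<in> carrier (M\<lparr>carrier := P\<rparr>)" for a u
    proof -
      obtain b where b: "u = b \<odot>\<^bsub>M\<^esub> y" "b \<in> A" using au by (auto simp: P_def)
      then have "a \<odot>\<^bsub>M\<^esub> u = (a \<cdot> b) \<odot>\<^bsub>M\<^esub> y" using M.lsmult_assoc[of a b y] y au by simp
      then show ?thesis using b au by (simp add: g comp_in) (auto simp: free_module_def comp_assoc)
    qed
    have "inj_on g P"
    proof (rule inj_onI)
      fix u v assume uv: "u \<in> P" "v \<in> P" "g u = g v"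
      obtain a b where ab: "u = a \<odot>\<^bsub>M\<^esub> y" "v = b \<odot>\<^bsub>M\<^esub> y" "a \<in> A" "b \<in> A" using uv by (auto simp: P_def)
      have "a \<cdot> p = b \<cdot> p" using fun_cong[OF uv(3), of 0] ab by (simp add: g)
      then show "u = v" using eq ab by simp
    qed
    moreover have "g ` P = ?S" by (force simp: P_def g)
    ultimately show "bij_betw g (carrier (M\<lparr>carrier := P\<rparr>)) (carrier (?F\<lparr>carrier := ?S\<rparr>))"
      by (simp add: bij_betw_def)
  qed
  have im: "matrix_image A 1 (\<lambda>_ _. p) = ?S"
  proof (intro Set.set_eqI iffI)
    fix z assume "z \<in> matrix_image A 1 (\<lambda>_ _. p)"
    then obtain x where x: "z = (\<lambda>j\<in>{..<1}. \<Sum>i<1. x i \<cdot> p)" "x \<in> carrier ?F"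
      unfolding matrix_image_def by (rule imageE)
    have "x 0 \<in> A" using x(2) by (auto simp: free_module_def PiE_def)
    with x(1)
    show "z \<in> ?S" by (intro CollectI exI[of _ "x 0"]) simp
  next
    fix z assume "z \<in> ?S"
    then obtain a where a: "z = (\<lambda>j\<in>{..<1}. a \<cdot> p)" "a \<in> A" by blast
    then show "z \<in> matrix_image A 1 (\<lambda>_ _. p)" unfolding matrix_image_def
      by (intro image_eqI[of _ _ "\<lambda>j\<in>{..<1}. a"] restrict_in_free_module) auto
  qed
  have sum: "?S <+>\<^bsub>?F\<^esub> ?Q = carrier ?F"
  proof (intro Set.set_eqI iffI)
    fix z assume "z \<in> ?S <+>\<^bsub>?F\<^esub> ?Q"
    then obtain s t where st: "z = s \<oplus>\<^bsub>?F\<^esub> t" "s \<in> ?S" "t \<in> ?Q" unfolding set_add_def' by blast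
    interpret F: left_module "vn_ring A" ?F by (rule left_module_free_module)
    show "z \<in> carrier ?F"
      unfolding st(1) using st(2,3) submodule_subset[OF submodule_row[OF p(1)]] submodule_subset[OF submodule_row[OF q]]
      by (intro F.a_closed) auto
  next
    fix z assume "z \<in> carrier ?F"
    then have z: "z \<in> {..<1} \<rightarrow>\<^sub>E A" by (simp add: free_module_def)
    then have z0: "z 0 \<in> A" by auto
    have "z = (\<lambda>j\<in>{..<1}. z 0 \<cdot> p) \<oplus>\<^bsub>?F\<^esub> (\<lambda>j\<in>{..<1}. z 0 \<cdot> (id_blinfun - p))"
      using z by (auto simp: free_module_def comp_simps fun_eq_iff PiE_def extensional_def)
    then show "z \<in> ?S <+>\<^bsub>?F\<^esub> ?Q" unfolding set_add_def' using z0 by blast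
  qed
  have int: "?S \<inter> ?Q = {\<zero>\<^bsub>?F\<^esub>}"
  proof (intro Set.set_eqI iffI)
    fix z assume "z \<in> ?S \<inter> ?Q"
    then obtain a b where z: "z = (\<lambda>j\<in>{..<1}. a \<cdot> p)" "z = (\<lambda>j\<in>{..<1}. b \<cdot> (id_blinfun - p))" by blast
    have "a \<cdot> p = b \<cdot> (id_blinfun - p)" using fun_cong[OF trans[OF z(1)[symmetric] z(2)], of 0] by simp
    then have "a \<cdot> p \<cdot> p = b \<cdot> (id_blinfun - p) \<cdot> p" by simp
    then have "a \<cdot> p = 0" by (simp add: comp_assoc p comp_simps)
    then show "z \<in> {\<zero>\<^bsub>?F\<^esub>}" using z(1) by (simp add: free_module_def)
  next
    fix z assume "z \<in> {\<zero>\<^bsub>?F\<^esub>}"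
    then show "z \<in> ?S \<inter> ?Q"
      using submodule_zero[OF submodule_row[OF p(1)]] submodule_zero[OF submodule_row[OF q]] by auto
  qed
  show "fg_projective (vn_ring A) (M\<lparr>carrier := P\<rparr>)"
    unfolding fg_projective_def
    using submodule_row[OF p(1)] submodule_row[OF q] sum int iso by blast
  let ?d = "\<lambda>d. \<exists>n F. projection_matrix A n F \<and>
     left_module_iso (vn_ring A) (M\<lparr>carrier := P\<rparr>) ((free_module (vn_ring A) n)\<lparr>carrier := matrix_image A n F\<rparr>) \<noteq> {} \<and>
     d = Re (\<Sum>i<n. tr (F i i))"
  have "projection_matrix A 1 (\<lambda>_ _. p)" using p by (simp add: projection_matrix_def sa_def)
  moreover have "g \<in> left_module_iso (vn_ring A) (M\<lparr>carrier := P\<rparr>) (?F\<lparr>carrier := matrix_image A 1 (\<lambda>_ _. p)\<rparr>)"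
    unfolding im by (rule iso)
  ultimately have "?d (Re (\<Sum>i<(1::nat). tr p))" by blast
  then have "?d (vn_dim_proj A tr (M\<lparr>carrier := P\<rparr>))" unfolding vn_dim_proj_def by (rule someI)
  then obtain n F h where F: "projection_matrix A n F"
    and h: "h \<in> left_module_iso (vn_ring A) (M\<lparr>carrier := P\<rparr>) ((free_module (vn_ring A) n)\<lparr>carrier := matrix_image A n F\<rparr>)"
    and d: "vn_dim_proj A tr (M\<lparr>carrier := P\<rparr>) = Re (\<Sum>i<n. tr (F i i))" by blast
  note Fp = projection_matrix_pmat[OF F]
  have d': "vn_dim_proj A tr (M\<lparr>carrier := P\<rparr>) = Tr {..<n} F"
    unfolding d by (rule Re_tr_sum) (use pmat_in[OF Fp] in auto)
  show "0 < vn_dim_proj A tr (M\<lparr>carrier := P\<rparr>)"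
  proof (rule ccontr)
    assume "\<not> 0 < vn_dim_proj A tr (M\<lparr>carrier := P\<rparr>)"
    then have "F i j = 0" if "i < n" "j < n" for i j
      using pmat_zero[OF Fp, of i j] that d' by simp
    then have "matrix_image A n F \<subseteq> {\<lambda>j\<in>{..<n}. 0}" by (auto simp: matrix_image_def)
    moreover have "bij_betw h P (matrix_image A n F)" using h by (simp add: left_module_iso_def)
    moreover have "y \<in> P" unfolding P_def using M.lsmult_one[OF y(1)] by (intro CollectI exI[of _ id_blinfun]) simp
    moreover have "\<zero>\<^bsub>M\<^esub> \<in> P" by (rule submodule_zero[OF sub])
    ultimately have "h y \<in> {\<lambda>j\<in>{..<n}. 0}" "h \<zero>\<^bsub>M\<^esub> \<in> {\<lambda>j\<in>{..<n}. 0}" "inj_on h P"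
      unfolding bij_betw_def by blast+
    then have "h y = h \<zero>\<^bsub>M\<^esub>" "inj_on h P" by (metis singletonD)+
    then show False using y(2) \<open>y \<in> P\<close> \<open>\<zero>\<^bsub>M\<^esub> \<in> P\<close> by (auto dest: inj_onD)
  qed
qed

text \<open>For \<open>m\<close> outside the torsion set, \<open>ideal_complement\<close> applies to
  the annihilator of \<open>m\<close> and gives a projection \<open>p\<close> for which
  \<open>p m\<close> has the same annihilator as \<open>p\<close>. This element generates a
  submodule of positive dimension.\<close>

lemma dim_zero_tors:
  fixes M :: "('h \<Rightarrow>\<^sub>L 'h, 'm, 'k) module_scheme"
  assumes M: "left_module (vn_ring A) M" and N: "submodule N (vn_ring A) M"
    and d: "vn_dim A tr (M\<lparr>carrier := N\<rparr>) = 0"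
  shows "N \<subseteq> tors A tr {0<..} M"
proof (rule ccontr)
  interpret M: left_module "vn_ring A" M by fact
  assume "\<not> N \<subseteq> tors A tr {0<..} M"
  then obtain m where m: "m \<in> N" "m \<notin> tors A tr {0<..} M" by blast
  have mM: "m \<in> carrier M" using m submodule_subset[OF N] by blast
  then obtain e where e: "e > 0" "\<And>c. c \<in> A \<Longrightarrow> c \<odot>\<^bsub>M\<^esub> m = \<zero>\<^bsub>M\<^esub> \<Longrightarrow> e < \<nu> c"
  proof -
    have "\<exists>e\<in>{0<..}. \<forall>c\<in>A. \<nu> c \<le> e \<longrightarrow> c \<odot>\<^bsub>M\<^esub> m \<noteq> \<zero>\<^bsub>M\<^esub>"
      using m(2) mM by (auto simp: tors_def)
    then show thesis using that by (metis greaterThan_iff not_le)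
  qed
  define I where "I = {c \<in> A. c \<odot>\<^bsub>M\<^esub> m = \<zero>\<^bsub>M\<^esub>}"
  have "\<exists>p\<in>A. sa p \<and> p \<cdot> p = p \<and> p \<noteq> 0 \<and> (\<forall>b\<in>A. b \<cdot> p \<in> I \<longrightarrow> b \<cdot> p = 0)"
  proof (rule ideal_complement[OF _ _ _ _ e(1)])
    show "x + y \<in> I" if "x \<in> I" "y \<in> I" for x y
      using that M.lsmult_l_distr[of x y m] mM by (simp add: I_def add_in)
    show "a \<cdot> x \<in> I" if "a \<in> A" "x \<in> I" for a x
      using that M.lsmult_assoc[of a x m] mM left_module_smult_zero[OF M, of a] by (simp add: I_def comp_in)
    show "0 \<in> I" using left_module_zero_smult[OF M mM] by (simp add: I_def)
  qed (use e in \<open>auto simp: I_def\<close>)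
  then obtain p where p: "p \<in> A" "sa p" "p \<cdot> p = p" "p \<noteq> 0" "\<And>b. b \<in> A \<Longrightarrow> b \<cdot> p \<in> I \<Longrightarrow> b \<cdot> p = 0" by blast
  let ?N = "M\<lparr>carrier := N\<rparr>" and ?y = "p \<odot>\<^bsub>M\<^esub> m"
  have N': "left_module (vn_ring A) ?N" by (rule left_module_submodule[OF M N])
  have ann: "a \<odot>\<^bsub>M\<^esub> ?y = \<zero>\<^bsub>M\<^esub> \<longleftrightarrow> a \<cdot> p = 0" if a: "a \<in> A" for a
  proof -
    have "a \<odot>\<^bsub>M\<^esub> ?y = (a \<cdot> p) \<odot>\<^bsub>M\<^esub> m" using M.lsmult_assoc[of a p m] a p(1) mM by simp
    then have "a \<odot>\<^bsub>M\<^esub> ?y = \<zero>\<^bsub>M\<^esub> \<longleftrightarrow> a \<cdot> p \<in> I" using a p(1) by (simp add: I_def comp_in)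
    moreover have "0 \<in> I" using left_module_zero_smult[OF M mM] by (simp add: I_def)
    ultimately show ?thesis using p(5)[OF a] by metis
  qed
  have y0: "?y \<noteq> \<zero>\<^bsub>M\<^esub>"
  proof
    assume "?y = \<zero>\<^bsub>M\<^esub>"
    then have "id_blinfun \<odot>\<^bsub>M\<^esub> ?y = \<zero>\<^bsub>M\<^esub>" using left_module_smult_zero[OF M, of id_blinfun] by simp
    then show False using ann[of id_blinfun] p(4) by simp
  qed
  have yN: "?y \<in> N" using submodule_smult[OF N _ m(1)] p(1) by simp
  let ?P = "{a \<odot>\<^bsub>?N\<^esub> ?y |a. a \<in> A}"
  have "submodule ?P (vn_ring A) ?N \<and> fg_projective (vn_ring A) (?N\<lparr>carrier := ?P\<rparr>) \<and>
      0 < vn_dim_proj A tr (?N\<lparr>carrier := ?P\<rparr>)"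
    using cyclic_projective[OF N', of ?y p] yN y0 p(1-3) ann by simp
  then have "ereal (vn_dim_proj A tr (?N\<lparr>carrier := ?P\<rparr>)) \<le> vn_dim A tr ?N" "0 < vn_dim_proj A tr (?N\<lparr>carrier := ?P\<rparr>)"
    unfolding vn_dim_def by (auto intro!: Sup_upper)
  then show False using d by simp
qed

lemma dim_torsion_eq_tors:
  fixes M :: "('h \<Rightarrow>\<^sub>L 'h, 'm, 'k) module_scheme"
  assumes M: "left_module (vn_ring A) M"
  shows "dim_torsion A tr M = tors A tr {0<..} M"
  unfolding dim_torsion_def
proof (rule Greatest_equality)
  show "submodule (tors A tr {0<..} M) (vn_ring A) M \<and> vn_dim A tr (M\<lparr>carrier := tors A tr {0<..} M\<rparr>) = 0"
    by (intro conjI vn_dim_tors[OF M] tors_submodule[OF M]) auto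
  show "N \<subseteq> tors A tr {0<..} M"
    if "submodule N (vn_ring A) M \<and> vn_dim A tr (M\<lparr>carrier := N\<rparr>) = 0" for N
    by (rule dim_zero_tors[OF M]) (use that in auto)
qed

end

section \<open>Flatness\<close>

locale induced_module =
  A: tracial_algebra A tr + B: tracial_algebra B tr + M: left_module "vn_ring B" M
  for A B :: "('h::complex_hilbert \<Rightarrow>\<^sub>L 'h) set" and tr and M :: "('h \<Rightarrow>\<^sub>L 'h, 'm, 'k) module_scheme" +
  assumes BA: "B \<subseteq> A"
begin

sublocale T: scalar_extension "vn_ring A" "\<lambda>b. b" "vn_ring B" M
  by unfold_locales (use BA in \<open>auto simp: A.add_in intro: A.comp_in\<close>)

text \<open>Elements of the free \<open>B\<close>-module on the elements of \<open>M\<close>;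
  \<open>ev\<close> is the canonical map onto \<open>M\<close> and \<open>K\<close> its
  kernel.\<close>

definition fs :: "('m \<Rightarrow> 'h \<Rightarrow>\<^sub>L 'h) \<Rightarrow> bool" where
  "fs \<beta> \<longleftrightarrow> finite {m. \<beta> m \<noteq> 0} \<and> {m. \<beta> m \<noteq> 0} \<subseteq> carrier M \<and> (\<forall>m. \<beta> m \<in> B)"

definition ev :: "('m \<Rightarrow> 'h \<Rightarrow>\<^sub>L 'h) \<Rightarrow> 'm" where
  "ev \<beta> = finsum M (\<lambda>m. \<beta> m \<odot>\<^bsub>M\<^esub> m) {m. \<beta> m \<noteq> 0}"

lemma smult_in: "b \<in> B \<Longrightarrow> m \<in> carrier M \<Longrightarrow> b \<odot>\<^bsub>M\<^esub> m \<in> carrier M"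
  using M.lsmult_closed by simp

lemma ev_eq: assumes b: "fs \<beta>" and X: "finite X" "X \<subseteq> carrier M" "\<And>m. m \<notin> X \<Longrightarrow> \<beta> m = 0"
  shows "ev \<beta> = finsum M (\<lambda>m. \<beta> m \<odot>\<^bsub>M\<^esub> m) X"
  unfolding ev_def
proof (rule M.add.finprod_mono_neutral_cong_left)
  show "\<beta> m \<odot>\<^bsub>M\<^esub> m = \<zero>\<^bsub>M\<^esub>" if "m \<in> X - {m. \<beta> m \<noteq> 0}" for m
    using that X left_module_zero_smult[OF M.left_module_axioms, of m] by auto
  show "(\<lambda>m. \<beta> m \<odot>\<^bsub>M\<^esub> m) \<in> X \<rightarrow> carrier M" using b X by (auto simp: fs_def intro!: smult_in)
qed (use X in auto)

lemma fs_in: "fs \<beta> \<Longrightarrow> \<beta> m \<in> B" by (simp add: fs_def)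

lemma fsI:
  assumes "finite X" "X \<subseteq> carrier M" "\<And>m. \<beta> m \<in> B" "\<And>m. m \<notin> X \<Longrightarrow> \<beta> m = 0"
  shows "fs \<beta>"
proof -
  have "{m. \<beta> m \<noteq> 0} \<subseteq> X" using assms(4) by auto
  then have "finite {m. \<beta> m \<noteq> 0}" "{m. \<beta> m \<noteq> 0} \<subseteq> carrier M" by (fact finite_subset[OF _ assms(1)], fact subset_trans[OF _ assms(2)])
  then show ?thesis unfolding fs_def by (intro conjI allI assms(3))
qed

lemma fs_support: assumes "fs \<beta>" obtains X where "finite X" "X \<subseteq> carrier M" "\<And>m. m \<notin> X \<Longrightarrow> \<beta> m = 0"
  by (rule that[of "{m. \<beta> m \<noteq> 0}"]) (use assms in \<open>simp_all add: fs_def\<close>)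

lemma finsum_closed': "finite X \<Longrightarrow> X \<subseteq> carrier M \<Longrightarrow> (\<And>m. \<beta> m \<in> B) \<Longrightarrow> finsum M (\<lambda>m. \<beta> m \<odot>\<^bsub>M\<^esub> m) X \<in> carrier M"
  by (intro M.finsum_closed) (auto intro!: smult_in)

lemma ev_closed: assumes "fs \<beta>" shows "ev \<beta> \<in> carrier M"
  unfolding ev_def using assms by (intro finsum_closed') (auto simp: fs_def)

lemma ev_add: assumes "fs \<beta>" "fs \<gamma>" shows fs_add: "fs (\<lambda>m. \<beta> m + \<gamma> m)"
  and "ev (\<lambda>m. \<beta> m + \<gamma> m) = ev \<beta> \<oplus>\<^bsub>M\<^esub> ev \<gamma>"
proof -
  obtain X where X: "finite X" "X \<subseteq> carrier M" "\<And>m. m \<notin> X \<Longrightarrow> \<beta> m = 0" using fs_support[OF assms(1)] by blast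
  obtain Y where Y: "finite Y" "Y \<subseteq> carrier M" "\<And>m. m \<notin> Y \<Longrightarrow> \<gamma> m = 0" using fs_support[OF assms(2)] by blast
  let ?Z = "X \<union> Y"
  have Z: "finite ?Z" "?Z \<subseteq> carrier M" using X Y by auto
  show f: "fs (\<lambda>m. \<beta> m + \<gamma> m)" by (rule fsI[OF Z]) (use X Y assms in \<open>auto simp: fs_in B.add_in\<close>)
  have "ev (\<lambda>m. \<beta> m + \<gamma> m) = finsum M (\<lambda>m. (\<beta> m + \<gamma> m) \<odot>\<^bsub>M\<^esub> m) ?Z" by (rule ev_eq[OF f Z]) (use X Y in auto)
  also have "\<dots> = finsum M (\<lambda>m. \<beta> m \<odot>\<^bsub>M\<^esub> m \<oplus>\<^bsub>M\<^esub> \<gamma> m \<odot>\<^bsub>M\<^esub> m) ?Z"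
    using Z fs_in[OF assms(1)] fs_in[OF assms(2)] M.lsmult_l_distr
    by (intro M.finsum_cong' refl) (auto intro!: smult_in simp: subset_iff)
  also have "\<dots> = finsum M (\<lambda>m. \<beta> m \<odot>\<^bsub>M\<^esub> m) ?Z \<oplus>\<^bsub>M\<^esub> finsum M (\<lambda>m. \<gamma> m \<odot>\<^bsub>M\<^esub> m) ?Z"
    using Z fs_in[OF assms(1)] fs_in[OF assms(2)] by (intro M.finsum_addf) (auto intro!: smult_in)
  also have "\<dots> = ev \<beta> \<oplus>\<^bsub>M\<^esub> ev \<gamma>"
    using ev_eq[OF assms(1) Z] ev_eq[OF assms(2) Z] X Y by simp
  finally show "ev (\<lambda>m. \<beta> m + \<gamma> m) = ev \<beta> \<oplus>\<^bsub>M\<^esub> ev \<gamma>" .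
qed

lemma ev_smult: assumes "fs \<beta>" "b \<in> B" shows fs_smult: "fs (\<lambda>m. b \<cdot> \<beta> m)"
  and "ev (\<lambda>m. b \<cdot> \<beta> m) = b \<odot>\<^bsub>M\<^esub> ev \<beta>"
proof -
  obtain X where X: "finite X" "X \<subseteq> carrier M" "\<And>m. m \<notin> X \<Longrightarrow> \<beta> m = 0" using fs_support[OF assms(1)] by blast
  show f: "fs (\<lambda>m. b \<cdot> \<beta> m)" by (rule fsI[OF X(1,2)]) (use X assms in \<open>auto simp: fs_in B.comp_in\<close>)
  have "b \<odot>\<^bsub>M\<^esub> finsum M (\<lambda>m. \<beta> m \<odot>\<^bsub>M\<^esub> m) X = finsum M (\<lambda>m. (b \<cdot> \<beta> m) \<odot>\<^bsub>M\<^esub> m) X"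
    using X(1,2)
  proof (induction X rule: finite_induct)
    case empty
    then show ?case using left_module_smult_zero[OF M.left_module_axioms, of b] assms by simp
  next
    case (insert x X)
    have x: "x \<in> carrier M" "X \<subseteq> carrier M" using insert by auto
    have c: "finsum M (\<lambda>m. \<beta> m \<odot>\<^bsub>M\<^esub> m) X \<in> carrier M" by (intro finsum_closed' insert x fs_in assms)
    have "finsum M (\<lambda>m. \<beta> m \<odot>\<^bsub>M\<^esub> m) (insert x X) = \<beta> x \<odot>\<^bsub>M\<^esub> x \<oplus>\<^bsub>M\<^esub> finsum M (\<lambda>m. \<beta> m \<odot>\<^bsub>M\<^esub> m) X"
      using insert x fs_in[OF assms(1)] by (intro M.finsum_insert) (auto intro!: smult_in)
    moreover have "finsum M (\<lambda>m. (b \<cdot> \<beta> m) \<odot>\<^bsub>M\<^esub> m) (insert x X) = (b \<cdot> \<beta> x) \<odot>\<^bsub>M\<^esub> x \<oplus>\<^bsub>M\<^esub> finsum M (\<lambda>m. (b \<cdot> \<beta> m) \<odot>\<^bsub>M\<^esub> m) X"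
      using insert x fs_in[OF assms(1)] assms(2) by (intro M.finsum_insert) (auto intro!: smult_in B.comp_in)
    ultimately show ?case
      using insert.IH[OF x(2)] M.lsmult_r_distr[of b "\<beta> x \<odot>\<^bsub>M\<^esub> x" "finsum M (\<lambda>m. \<beta> m \<odot>\<^bsub>M\<^esub> m) X"]
        M.lsmult_assoc[of b "\<beta> x" x] c x(1) fs_in[OF assms(1)] assms(2) by (simp add: smult_in)
  qed
  then show "ev (\<lambda>m. b \<cdot> \<beta> m) = b \<odot>\<^bsub>M\<^esub> ev \<beta>"
    using ev_eq[OF f X(1,2)] ev_eq[OF assms(1) X] X(3) by simp
qed

lemma ev_single: assumes "b \<in> B" "n \<in> carrier M" shows fs_single: "fs (\<lambda>m. if m = n then b else 0)"
  and "ev (\<lambda>m. if m = n then b else 0) = b \<odot>\<^bsub>M\<^esub> n"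
proof -
  show f: "fs (\<lambda>m. if m = n then b else 0)" by (rule fsI[of "{n}"]) (use assms in auto)
  have "finsum M (\<lambda>m. (if m = n then b else 0) \<odot>\<^bsub>M\<^esub> m) {n} = b \<odot>\<^bsub>M\<^esub> n"
    by (subst M.finsum_insert) (use assms smult_in in auto)
  then show "ev (\<lambda>m. if m = n then b else 0) = b \<odot>\<^bsub>M\<^esub> n"
    using ev_eq[OF f, of "{n}"] assms by simp
qed

lemma ev_zero: "fs (\<lambda>_. 0)" "ev (\<lambda>_. 0) = \<zero>\<^bsub>M\<^esub>"
  by (auto simp: fs_def ev_def)

section \<open>Relations over \<open>B\<close> and their combinations over \<open>A\<close>\<close>

definition K :: "('m \<Rightarrow> 'h \<Rightarrow>\<^sub>L 'h) set" where "K = {\<beta>. fs \<beta> \<and> ev \<beta> = \<zero>\<^bsub>M\<^esub>}"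

lemma K_add: "\<beta> \<in> K \<Longrightarrow> \<gamma> \<in> K \<Longrightarrow> (\<lambda>m. \<beta> m + \<gamma> m) \<in> K"
  by (simp add: K_def fs_add ev_add)

lemma K_smult: "b \<in> B \<Longrightarrow> \<beta> \<in> K \<Longrightarrow> (\<lambda>m. b \<cdot> \<beta> m) \<in> K"
  using left_module_smult_zero[OF M.left_module_axioms, of b] by (simp add: K_def fs_smult ev_smult)

lemma K_zero: "(\<lambda>_. 0) \<in> K" by (simp add: K_def ev_zero)

lemma K_sum: "finite J \<Longrightarrow> (\<And>j. j \<in> J \<Longrightarrow> \<beta> j \<in> K) \<Longrightarrow> (\<lambda>m. \<Sum>j\<in>J. \<beta> j m) \<in> K"
  by (induction J rule: finite_induct) (auto intro: K_zero K_add)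

text \<open>The \<open>A\<close>-span of the relations inside the free \<open>A\<close>-module on
  the elements of \<open>M\<close>; the quotient by it is a second model of the induced
  module.\<close>

inductive AK :: "('m \<Rightarrow> 'h \<Rightarrow>\<^sub>L 'h) \<Rightarrow> bool" where
  AK_zero: "AK (\<lambda>_. 0)"
| AK_step: "AK \<gamma> \<Longrightarrow> a \<in> A \<Longrightarrow> \<beta> \<in> K \<Longrightarrow> AK (\<lambda>m. \<gamma> m + a \<cdot> \<beta> m)"

lemma AK_add: assumes "AK \<delta>" "AK \<gamma>" shows "AK (\<lambda>m. \<gamma> m + \<delta> m)"
  using assms(1)
proof (induction rule: AK.induct)
  case AK_zero
  then show ?case using assms(2) by simp
next
  case (AK_step \<delta> a \<beta>)
  then show ?case using AK.AK_step[of "\<lambda>m. \<gamma> m + \<delta> m" a \<beta>] by (simp add: add.assoc)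
qed

lemma AK_single: "a \<in> A \<Longrightarrow> \<beta> \<in> K \<Longrightarrow> AK (\<lambda>m. a \<cdot> \<beta> m)"
  using AK_step[OF AK_zero, of a \<beta>] by simp

lemma AK_uminus: "AK \<gamma> \<Longrightarrow> AK (\<lambda>m. - \<gamma> m)"
proof (induction rule: AK.induct)
  case (AK_step \<gamma> a \<beta>)
  have "- a \<in> A" using A.scaleR_in[OF AK_step(2), of "-1"] by simp
  from AK.AK_step[OF AK_step.IH this AK_step(3)] show ?case by (simp add: comp.minus_left)
qed (simp add: AK.AK_zero)

lemma AK_sum: "finite J \<Longrightarrow> (\<And>j. j \<in> J \<Longrightarrow> AK (\<gamma> j)) \<Longrightarrow> AK (\<lambda>m. \<Sum>j\<in>J. \<gamma> j m)"
  by (induction J rule: finite_induct) (auto intro: AK_zero AK_add)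

lemma AK_obtain:
  assumes "AK \<gamma>"
  shows "\<exists>q (a :: nat \<Rightarrow> _) \<beta>. (\<forall>k<q. a k \<in> A \<and> \<beta> k \<in> K) \<and> \<gamma> = (\<lambda>m. \<Sum>k<q. a k \<cdot> \<beta> k m)"
  using assms
proof (induction rule: AK.induct)
  case AK_zero
  show ?case by (rule exI[of _ 0]) auto
next
  case (AK_step \<gamma> a \<beta>)
  then obtain q :: nat and a' \<beta>' where q: "\<forall>k<q. a' k \<in> A \<and> \<beta>' k \<in> K" "\<gamma> = (\<lambda>m. \<Sum>k<q. a' k \<cdot> \<beta>' k m)" by blast
  have "(\<Sum>k<q. (a'(q := a)) k \<cdot> (\<beta>'(q := \<beta>)) k m) = (\<Sum>k<q. a' k \<cdot> \<beta>' k m)" for m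
    by (intro sum.cong) auto
  then show ?case using q AK_step(2,3)
    by (intro exI[of _ "Suc q"] exI[of _ "a'(q := a)"] exI[of _ "\<beta>'(q := \<beta>)"]) (auto simp: less_Suc_eq)
qed

lemma AK_sumI:
  "(\<And>k. k < q \<Longrightarrow> a k \<in> A \<and> \<beta> k \<in> K) \<Longrightarrow> AK (\<lambda>m. \<Sum>k<(q::nat). a k \<cdot> \<beta> k m)"
  by (intro AK_sum AK_single) auto

text \<open>Project away the columns one after the other; the projections have entries in \<open>B\<close>.\<close>

lemma column_elimination:
  fixes a :: "nat \<Rightarrow> 'h \<Rightarrow>\<^sub>L 'h"
  assumes Q: "finite Q" and a: "\<And>k. k < q \<Longrightarrow> a k \<in> A" and b: "\<And>k s. k < q \<Longrightarrow> b k s \<in> B"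
    and z: "\<And>s. s \<in> Q \<Longrightarrow> (\<Sum>k<q. a k \<cdot> b k s) = 0"
  shows "\<exists>c. (\<forall>l<q. \<forall>k<q. c l k \<in> B) \<and> (\<forall>k<q. (\<Sum>l<q. a l \<cdot> c l k) = a k) \<and>
    (\<forall>l<q. \<forall>s\<in>Q. (\<Sum>k<q. c l k \<cdot> b k s) = 0)"
  using Q z
proof (induction Q rule: finite_induct)
  case empty
  let ?c = "\<lambda>l k. if l = k then id_blinfun else 0 :: 'h \<Rightarrow>\<^sub>L 'h"
  have "(\<Sum>l<q. a l \<cdot> ?c l k) = (\<Sum>l<q. if l = k then a k else 0)" for k by (intro sum.cong) auto
  then show ?case by (intro exI[of _ ?c]) auto
next
  case (insert p Q)
  then obtain c where c: "\<And>l k. l < q \<Longrightarrow> k < q \<Longrightarrow> c l k \<in> B" "\<And>k. k < q \<Longrightarrow> (\<Sum>l<q. a l \<cdot> c l k) = a k"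
    "\<And>l s. l < q \<Longrightarrow> s \<in> Q \<Longrightarrow> (\<Sum>k<q. c l k \<cdot> b k s) = 0" by blast
  define \<beta> where "\<beta> = (\<lambda>l. \<Sum>k<q. c l k \<cdot> b k p)"
  define P where "P = colproj {..<q} \<beta>"
  have \<beta>B: "\<beta> l \<in> B" if "l \<in> {..<q}" for l unfolding \<beta>_def using that b c by (intro B.sum_in B.comp_in) auto
  have \<beta>b: "\<beta> l \<in> bounded_ops" if "l \<in> {..<q}" for l using \<beta>B[OF that] B.bops by blast
  have PB: "P l k \<in> B" if "l < q" "k < q" for l k
    unfolding P_def using that by (intro B.colproj_in \<beta>B) auto
  have swap: "(\<Sum>l<q. x l \<cdot> (\<Sum>k<q. c l k \<cdot> y k)) = (\<Sum>k<q. (\<Sum>l<q. x l \<cdot> c l k) \<cdot> y k)" for x y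
    by (simp add: comp.sum_left comp.sum_right comp_assoc) (rule sum.swap)
  have "(\<Sum>l<q. a l \<cdot> \<beta> l) = (\<Sum>k<q. a k \<cdot> b k p)"
    unfolding \<beta>_def swap by (simp add: c(2))
  then have "(\<Sum>l<q. a l \<cdot> \<beta> l) = 0" using insert.prems by simp
  then have aP: "(\<Sum>l<q. a l \<cdot> P l j) = 0" if "j < q" for j
    unfolding P_def using that a A.bops by (intro colproj_left \<beta>b) auto
  have P\<beta>: "(\<Sum>j<q. P l j \<cdot> \<beta> j) = \<beta> l" if "l < q" for l
    unfolding P_def using that by (intro colproj_fix \<beta>b) auto
  \<comment> \<open>This is (1 - P) c: column \<open>p\<close> becomes zero because \<open>P\<close>
    fixes it, the columns already cleared stay zero, and \<open>a\<close> is preserved because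
    \<open>a P = 0\<close>.\<close>
  define c' where "c' = (\<lambda>l k. c l k - (\<Sum>j<q. P l j \<cdot> c j k))"
  have c'b: "(\<Sum>k<q. c' l k \<cdot> y k) = (\<Sum>k<q. c l k \<cdot> y k) - (\<Sum>j<q. P l j \<cdot> (\<Sum>k<q. c j k \<cdot> y k))" for l y
    by (simp add: c'_def comp_simps sum_subtractf swap)
  show ?case
  proof (intro exI[of _ c'] conjI allI impI ballI)
    show "c' l k \<in> B" if "l < q" "k < q" for l k
      unfolding c'_def using that c PB by (intro B.in_intros) auto
    show "(\<Sum>l<q. a l \<cdot> c' l k) = a k" if k: "k < q" for k
    proof -
      have "(\<Sum>l<q. a l \<cdot> (\<Sum>j<q. P l j \<cdot> c j k)) = (\<Sum>j<q. (\<Sum>l<q. a l \<cdot> P l j) \<cdot> c j k)"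
        by (simp add: comp.sum_left comp.sum_right comp_assoc) (rule sum.swap)
      also have "\<dots> = 0" by (intro sum.neutral) (simp add: aP)
      finally show ?thesis using c(2)[OF k] by (simp add: c'_def comp_simps sum_subtractf)
    qed
    show "(\<Sum>k<q. c' l k \<cdot> b k s) = 0" if l: "l < q" and s: "s \<in> insert p Q" for l s
    proof (cases "s = p")
      case True
      then show ?thesis unfolding c'b using P\<beta>[OF l] by (simp add: \<beta>_def)
    next
      case False
      then have "s \<in> Q" using s by simp
      then show ?thesis unfolding c'b using c(3) l by simp
    qed
  qed
qed

text \<open>The core of flatness: the relations used may be supported in elements outside
  \<open>X\<close>, but their combination vanishes in these finitely many columns, which
  \<open>column_elimination\<close> then clears in each relation.\<close>

lemma AK_restrict:
  assumes "AK \<gamma>" and X: "\<And>m. m \<notin> X \<Longrightarrow> \<gamma> m = 0"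
  shows "\<exists>q (a :: nat \<Rightarrow> _) \<beta>. (\<forall>k<q. a k \<in> A \<and> \<beta> k \<in> K \<and> (\<forall>m. m \<notin> X \<longrightarrow> \<beta> k m = 0)) \<and>
    \<gamma> = (\<lambda>m. \<Sum>k<q. a k \<cdot> \<beta> k m)"
proof -
  obtain q :: nat and a \<beta> where q: "\<And>k. k < q \<Longrightarrow> a k \<in> A" "\<And>k. k < q \<Longrightarrow> \<beta> k \<in> K"
    and g: "\<gamma> = (\<lambda>m. \<Sum>k<q. a k \<cdot> \<beta> k m)" using AK_obtain[OF assms(1)] by blast
  define Q where "Q = (\<Union>k<q. {m. \<beta> k m \<noteq> 0}) - X"
  have "finite Q" unfolding Q_def using q by (auto simp: K_def fs_def)
  have \<beta>B: "\<beta> k m \<in> B" if "k < q" for k m using q(2)[OF that] by (simp add: K_def fs_def)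
  have z: "(\<Sum>k<q. a k \<cdot> \<beta> k m) = 0" if "m \<in> Q" for m
  proof -
    have "m \<notin> X" using that unfolding Q_def by blast
    from X[OF this] show ?thesis unfolding g .
  qed
  have "\<exists>c. (\<forall>l<q. \<forall>k<q. c l k \<in> B) \<and> (\<forall>k<q. (\<Sum>l<q. a l \<cdot> c l k) = a k) \<and>
    (\<forall>l<q. \<forall>m\<in>Q. (\<Sum>k<q. c l k \<cdot> \<beta> k m) = 0)"
    by (rule column_elimination) (fact \<open>finite Q\<close> q(1) \<beta>B z)+
  then obtain c where "\<forall>l<q. \<forall>k<q. c l k \<in> B" "\<forall>k<q. (\<Sum>l<q. a l \<cdot> c l k) = a k"
    "\<forall>l<q. \<forall>m\<in>Q. (\<Sum>k<q. c l k \<cdot> \<beta> k m) = 0" by (elim exE conjE) (rule that)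
  then have c: "\<And>l k. l < q \<Longrightarrow> k < q \<Longrightarrow> c l k \<in> B" "\<And>k. k < q \<Longrightarrow> (\<Sum>l<q. a l \<cdot> c l k) = a k"
    "\<And>l m. l < q \<Longrightarrow> m \<in> Q \<Longrightarrow> (\<Sum>k<q. c l k \<cdot> \<beta> k m) = 0" by simp_all
  define \<beta>' where "\<beta>' = (\<lambda>l m. \<Sum>k<q. c l k \<cdot> \<beta> k m)"
  have "\<beta>' l \<in> K" if "l < q" for l unfolding \<beta>'_def by (intro K_sum K_smult c q) (use that in auto)
  moreover have "\<beta>' l m = 0" if "l < q" "m \<notin> X" for l m
  proof (cases "m \<in> Q")
    case True
    then show ?thesis using c(3) that by (simp add: \<beta>'_def)
  next
    case False
    then have "\<beta> k m = 0" if "k < q" for k using that \<open>m \<notin> X\<close> by (auto simp: Q_def)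
    then show ?thesis by (simp add: \<beta>'_def)
  qed
  moreover have "\<gamma> m = (\<Sum>l<q. a l \<cdot> \<beta>' l m)" for m
  proof -
    have "(\<Sum>l<q. a l \<cdot> \<beta>' l m) = (\<Sum>k<q. (\<Sum>l<q. a l \<cdot> c l k) \<cdot> \<beta> k m)"
      unfolding \<beta>'_def by (simp add: comp.sum_left comp.sum_right comp_assoc) (rule sum.swap)
    then show ?thesis by (simp add: c(2) g)
  qed
  ultimately show ?thesis using q(1) by (intro exI[of _ q] exI[of _ a] exI[of _ \<beta>']) auto
qed

text \<open>The additive map from the free abelian group to rows over \<open>A\<close> that sends
  \<open>(a, m)\<close> to \<open>a\<close> in position \<open>m\<close>.\<close>

definition coef :: "(('h \<Rightarrow>\<^sub>L 'h) \<times> 'm \<Rightarrow>\<^sub>0 int) \<Rightarrow> 'm \<Rightarrow> 'h \<Rightarrow>\<^sub>L 'h" where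
  "coef c m = (\<Sum>k\<in>Poly_Mapping.keys c. real_of_int (Poly_Mapping.lookup c k) *\<^sub>R (if snd k = m then fst k else 0))"

lemma coef_eq: "finite X \<Longrightarrow> Poly_Mapping.keys c \<subseteq> X \<Longrightarrow>
    coef c m = (\<Sum>k\<in>X. real_of_int (Poly_Mapping.lookup c k) *\<^sub>R (if snd k = m then fst k else 0))"
  unfolding coef_def by (rule sum.mono_neutral_left) (auto simp: in_keys_iff)

lemma coef_diff: "coef (c - d) m = coef c m - coef d m"
proof -
  let ?X = "Poly_Mapping.keys c \<union> Poly_Mapping.keys d"
  have X: "finite ?X" "Poly_Mapping.keys c \<subseteq> ?X" "Poly_Mapping.keys d \<subseteq> ?X" "Poly_Mapping.keys (c - d) \<subseteq> ?X"
    using keys_diff[of c d] by auto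
  show ?thesis unfolding coef_eq[OF X(1,2)] coef_eq[OF X(1,3)] coef_eq[OF X(1,4)]
    by (simp add: lookup_minus scaleR_diff_left sum_subtractf)
qed

lemma coef_zero [simp]: "coef 0 m = 0" by (simp add: coef_def)
lemma coef_uminus: "coef (- c) m = - coef c m" using coef_diff[of 0 c m] by simp
lemma coef_add: "coef (c + d) m = coef c m + coef d m" using coef_diff[of c "- d" m] by (simp add: coef_uminus)
lemma coef_sum: "coef (\<Sum>i\<in>I. f i) m = (\<Sum>i\<in>I. coef (f i) m)"
  by (induction I rule: infinite_finite_induct) (auto simp: coef_add)
lemma coef_frag [simp]: "coef (frag_of (x, n)) m = (if n = m then x else 0)"
  by (simp add: coef_def)

lemma coef_in: "Poly_Mapping.keys c \<subseteq> T.base \<Longrightarrow> coef c m \<in> A"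
  unfolding coef_def by (intro A.sum_in A.scaleR_in) auto

lemma coef_support: "m \<notin> snd ` Poly_Mapping.keys c \<Longrightarrow> coef c m = 0"
  unfolding coef_def by (intro sum.neutral) auto

text \<open>Additivity in \<open>A\<close> disappears on coefficients. The other two kinds of
  generators become multiples of the elements e_(m+n) - e_m - e_n and r e_m - e_(r m) of
  \<open>K\<close>.\<close>

lemma rel_AK: assumes "c \<in> T.rel" shows "AK (coef c)"
proof -
  have "Poly_Mapping.keys c \<subseteq> T.base \<and> AK (coef c)"
    using assms
  proof (induction rule: T.rel_induct)
    case zero
    then show ?case using AK_zero by (simp add: coef_def[abs_def])
  next
    case (add_left x y m)
    have "coef (frag_of (x \<oplus>\<^bsub>vn_ring A\<^esub> y, m) - frag_of (x, m) - frag_of (y, m)) = (\<lambda>_. 0)"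
      by (auto simp: coef_diff)
    then show ?case using AK_zero by simp
  next
    case (add_right x m n)
    let ?\<delta> = "\<lambda>n m. if m = n then id_blinfun else 0 :: 'h \<Rightarrow>\<^sub>L 'h"
    let ?\<delta>' = "\<lambda>n m. if m = n then - id_blinfun else 0 :: 'h \<Rightarrow>\<^sub>L 'h"
    have mn: "m \<oplus>\<^bsub>M\<^esub> n \<in> carrier M" using add_right by simp
    have neg: "- id_blinfun \<in> B" using B.scaleR_in[OF B.id_in, of "-1"] by simp
    have negs: "(- id_blinfun) \<odot>\<^bsub>M\<^esub> p = \<ominus>\<^bsub>M\<^esub> p" if p: "p \<in> carrier M" for p
    proof -
      have "(- id_blinfun) \<odot>\<^bsub>M\<^esub> p \<oplus>\<^bsub>M\<^esub> p = \<zero>\<^bsub>M\<^esub>"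
        using M.lsmult_l_distr[of "- id_blinfun" id_blinfun p] M.lsmult_one[OF p] neg p
          left_module_zero_smult[OF M.left_module_axioms p] by simp
      then show ?thesis using M.minus_equality smult_in[OF neg p] p by fastforce
    qed
    let ?\<beta> = "\<lambda>k. ?\<delta> (m \<oplus>\<^bsub>M\<^esub> n) k + (?\<delta>' m k + ?\<delta>' n k)"
    have f: "fs (?\<delta> (m \<oplus>\<^bsub>M\<^esub> n))" "fs (?\<delta>' m)" "fs (?\<delta>' n)"
      using add_right mn neg by (auto intro!: fs_single)
    have "ev ?\<beta> = (m \<oplus>\<^bsub>M\<^esub> n) \<oplus>\<^bsub>M\<^esub> (\<ominus>\<^bsub>M\<^esub> m \<oplus>\<^bsub>M\<^esub> \<ominus>\<^bsub>M\<^esub> n)"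
      using f mn neg add_right M.lsmult_one[OF mn] by (simp add: ev_add fs_add ev_single negs)
    also have "\<dots> = \<zero>\<^bsub>M\<^esub>"
      using add_right(2,3) M.minus_add[OF add_right(2,3)] mn M.r_neg[OF mn] by (simp add: M.a_comm)
    finally have "?\<beta> \<in> K" using f by (simp add: K_def fs_add)
    then have "AK (\<lambda>k. x \<cdot> ?\<beta> k)" using add_right(1) by (intro AK_single) auto
    moreover have "coef (frag_of (x, m \<oplus>\<^bsub>M\<^esub> n) - frag_of (x, m) - frag_of (x, n)) = (\<lambda>k. x \<cdot> ?\<beta> k)"
      by (auto simp: coef_diff comp_simps fun_eq_iff)
    ultimately show ?case by simp
  next
    case (mult x r m)
    let ?\<beta> = "\<lambda>k. (if k = m then r else 0) + (if k = r \<odot>\<^bsub>M\<^esub> m then - id_blinfun else 0)"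
    have r: "r \<in> B" "r \<odot>\<^bsub>M\<^esub> m \<in> carrier M" using mult smult_in by auto
    have neg: "- id_blinfun \<in> B" using B.scaleR_in[OF B.id_in, of "-1"] by simp
    have "(- id_blinfun) \<odot>\<^bsub>M\<^esub> (r \<odot>\<^bsub>M\<^esub> m) = (- r) \<odot>\<^bsub>M\<^esub> m"
      using M.lsmult_assoc[of "- id_blinfun" r m] neg r mult(3) by (simp add: comp.minus_left)
    moreover have "r \<odot>\<^bsub>M\<^esub> m \<oplus>\<^bsub>M\<^esub> (- r) \<odot>\<^bsub>M\<^esub> m = \<zero>\<^bsub>M\<^esub>"
      using M.lsmult_l_distr[of r "- r" m] B.scaleR_in[OF r(1), of "-1"] r mult(3)
        left_module_zero_smult[OF M.left_module_axioms mult(3)] by simp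
    ultimately have "?\<beta> \<in> K"
      using r neg mult(3) by (simp add: K_def fs_add ev_add fs_single ev_single)
    then have "AK (\<lambda>k. x \<cdot> ?\<beta> k)" using mult(1) by (intro AK_single) auto
    moreover have "coef (frag_of (x \<otimes>\<^bsub>vn_ring A\<^esub> r, m) - frag_of (x, r \<odot>\<^bsub>M\<^esub> m)) = (\<lambda>k. x \<cdot> ?\<beta> k)"
      by (auto simp: coef_diff comp_simps fun_eq_iff)
    ultimately show ?case by simp
  next
    case (uminus c)
    then show ?case using AK_uminus by (simp add: coef_uminus[abs_def])
  next
    case (add c d)
    then show ?case using AK_add[of "coef d" "coef c"] by (simp add: coef_add[abs_def])
  qed
  then show ?thesis by blast
qed

lemma rel_frag_finsum:
  assumes "finite Y" "\<And>m. m \<in> Y \<Longrightarrow> f m \<in> carrier M" and a: "a \<in> A"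
  shows "frag_of (a, finsum M f Y) - (\<Sum>m\<in>Y. frag_of (a, f m)) \<in> T.rel"
  using assms(1,2)
proof (induction Y rule: finite_induct)
  case empty
  then show ?case using T.rel_frag_zero[of a] a by simp
next
  case (insert y Y)
  have c: "finsum M f Y \<in> carrier M" using insert by (intro M.finsum_closed) auto
  have "finsum M f (insert y Y) = f y \<oplus>\<^bsub>M\<^esub> finsum M f Y" using insert by (intro M.finsum_insert) auto
  then have "frag_of (a, finsum M f (insert y Y)) - (\<Sum>m\<in>insert y Y. frag_of (a, f m))
    = (frag_of (a, f y \<oplus>\<^bsub>M\<^esub> finsum M f Y) - frag_of (a, f y) - frag_of (a, finsum M f Y))
      + (frag_of (a, finsum M f Y) - (\<Sum>m\<in>Y. frag_of (a, f m)))"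
    using insert by simp
  also have "\<dots> \<in> T.rel" using insert c a by (intro T.rel_add T.rel_add_right) auto
  finally show ?case .
qed

lemma rel_frag_zero_left: "m \<in> carrier M \<Longrightarrow> frag_of (0, m) \<in> T.rel"
  using T.rel_uminus[OF T.rel_add_left[of 0 0 m]] by simp

text \<open>A normal form modulo the relations, with one term for each element of \<open>Y\<close>;
  positions with coefficient 0 contribute relations only.\<close>

definition nf :: "'m set \<Rightarrow> ('m \<Rightarrow> 'h \<Rightarrow>\<^sub>L 'h) \<Rightarrow> (('h \<Rightarrow>\<^sub>L 'h) \<times> 'm \<Rightarrow>\<^sub>0 int)" where
  "nf Y \<gamma> = (\<Sum>m\<in>Y. frag_of (\<gamma> m, m))"

lemma nf_add:
  assumes "\<And>m. m \<in> Y \<Longrightarrow> \<gamma> m \<in> A" "\<And>m. m \<in> Y \<Longrightarrow> \<delta> m \<in> A" "Y \<subseteq> carrier M"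
  shows "nf Y (\<lambda>m. \<gamma> m + \<delta> m) - nf Y \<gamma> - nf Y \<delta> \<in> T.rel"
proof -
  have "nf Y (\<lambda>m. \<gamma> m + \<delta> m) - nf Y \<gamma> - nf Y \<delta>
      = (\<Sum>m\<in>Y. frag_of (\<gamma> m \<oplus>\<^bsub>vn_ring A\<^esub> \<delta> m, m) - frag_of (\<gamma> m, m) - frag_of (\<delta> m, m))"
    by (simp add: nf_def sum_subtractf)
  also have "\<dots> \<in> T.rel" using assms by (intro T.rel_sum T.rel_add_left) auto
  finally show ?thesis .
qed

text \<open>The claim for all sufficiently large \<open>Y\<close> lets summands with different
  supports share one index set.\<close>

lemma AK_nf:
  assumes "AK \<gamma>"
  shows "(\<forall>m. \<gamma> m \<in> A) \<and> (\<exists>Y0. finite Y0 \<and> Y0 \<subseteq> carrier M \<and>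
    (\<forall>Y. finite Y \<longrightarrow> Y0 \<subseteq> Y \<longrightarrow> Y \<subseteq> carrier M \<longrightarrow> nf Y \<gamma> \<in> T.rel))"
  using assms
proof (induction rule: AK.induct)
  case AK_zero
  have "nf Y (\<lambda>_. 0) \<in> T.rel" if "Y \<subseteq> carrier M" for Y
    unfolding nf_def using that by (intro T.rel_sum rel_frag_zero_left) auto
  then show ?case by (auto intro: exI[of _ "{}"])
next
  case (AK_step \<gamma> a \<beta>)
  then obtain Y0 where Y0: "finite Y0" "Y0 \<subseteq> carrier M" "\<And>m. \<gamma> m \<in> A"
    "\<And>Y. finite Y \<Longrightarrow> Y0 \<subseteq> Y \<Longrightarrow> Y \<subseteq> carrier M \<Longrightarrow> nf Y \<gamma> \<in> T.rel" by blast
  have \<beta>: "fs \<beta>" "ev \<beta> = \<zero>\<^bsub>M\<^esub>" using AK_step(3) by (auto simp: K_def)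
  obtain X where X: "finite X" "X \<subseteq> carrier M" "\<And>m. m \<notin> X \<Longrightarrow> \<beta> m = 0" using fs_support[OF \<beta>(1)] by blast
  have \<beta>B: "\<beta> m \<in> B" for m by (rule fs_in[OF \<beta>(1)])
  have a\<beta>: "a \<cdot> \<beta> m \<in> A" for m using AK_step(2) \<beta>B BA by (intro A.comp_in) auto
  have "nf Y (\<lambda>m. \<gamma> m + a \<cdot> \<beta> m) \<in> T.rel" if Y: "finite Y" "Y0 \<union> X \<subseteq> Y" "Y \<subseteq> carrier M" for Y
  proof -
    have "nf Y (\<lambda>m. a \<cdot> \<beta> m) - (\<Sum>m\<in>Y. frag_of (a, \<beta> m \<odot>\<^bsub>M\<^esub> m))
        = (\<Sum>m\<in>Y. frag_of (a \<otimes>\<^bsub>vn_ring A\<^esub> \<beta> m, m) - frag_of (a, \<beta> m \<odot>\<^bsub>M\<^esub> m))"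
      by (simp add: nf_def sum_subtractf)
    also have "\<dots> \<in> T.rel" using Y AK_step(2) \<beta>B by (intro T.rel_sum T.rel_mult) auto
    finally have 1: "nf Y (\<lambda>m. a \<cdot> \<beta> m) - (\<Sum>m\<in>Y. frag_of (a, \<beta> m \<odot>\<^bsub>M\<^esub> m)) \<in> T.rel" .
    have "finsum M (\<lambda>m. \<beta> m \<odot>\<^bsub>M\<^esub> m) Y = \<zero>\<^bsub>M\<^esub>" 
      using ev_eq[OF \<beta>(1) Y(1,3)] X(3) Y(2) \<beta>(2) by (metis Un_subset_iff subsetD)
    then have 2: "frag_of (a, \<zero>\<^bsub>M\<^esub>) - (\<Sum>m\<in>Y. frag_of (a, \<beta> m \<odot>\<^bsub>M\<^esub> m)) \<in> T.rel"
      using rel_frag_finsum[OF Y(1), of "\<lambda>m. \<beta> m \<odot>\<^bsub>M\<^esub> m" a] Y AK_step(2) \<beta>B by (auto intro!: smult_in)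
    have 3: "frag_of (a, \<zero>\<^bsub>M\<^esub>) \<in> T.rel" using T.rel_frag_zero AK_step(2) by simp
    have 4: "nf Y (\<lambda>m. a \<cdot> \<beta> m) \<in> T.rel"
      using T.rel_add[OF T.rel_diff[OF 1 2] 3] by simp
    have 5: "nf Y (\<lambda>m. \<gamma> m + a \<cdot> \<beta> m) - nf Y \<gamma> - nf Y (\<lambda>m. a \<cdot> \<beta> m) \<in> T.rel"
      using Y0 a\<beta> Y by (intro nf_add) auto
    have "nf Y \<gamma> \<in> T.rel" using Y by (intro Y0(4)) auto
    from T.rel_add[OF T.rel_add[OF 5 4] this] show ?thesis by simp
  qed
  then show ?case using Y0 X a\<beta> by (intro conjI allI A.add_in exI[of _ "Y0 \<union> X"]) auto
qed

lemma coef_nf: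
  assumes "Poly_Mapping.keys c \<subseteq> T.base"
  shows "\<exists>Y0. finite Y0 \<and> Y0 \<subseteq> carrier M \<and>
    (\<forall>Y. finite Y \<longrightarrow> Y0 \<subseteq> Y \<longrightarrow> Y \<subseteq> carrier M \<longrightarrow> c - nf Y (coef c) \<in> T.rel)"
  using assms
proof (induction c rule: free_Abelian_group_induct[consumes 1, case_names 1 2 3])
  case 1
  have "nf Y (coef 0) \<in> T.rel" if "Y \<subseteq> carrier M" for Y
    unfolding nf_def using that by (intro T.rel_sum) (auto intro: rel_frag_zero_left)
  then show ?case by (intro exI[of _ "{}"]) (auto intro: T.rel_uminus simp del: coef_zero)
next
  case (2 c d)
  obtain Y1 where Y1: "finite Y1" "Y1 \<subseteq> carrier M"
    "\<And>Y. finite Y \<Longrightarrow> Y1 \<subseteq> Y \<Longrightarrow> Y \<subseteq> carrier M \<Longrightarrow> c - nf Y (coef c) \<in> T.rel" using 2(3) by blast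
  obtain Y2 where Y2: "finite Y2" "Y2 \<subseteq> carrier M"
    "\<And>Y. finite Y \<Longrightarrow> Y2 \<subseteq> Y \<Longrightarrow> Y \<subseteq> carrier M \<Longrightarrow> d - nf Y (coef d) \<in> T.rel" using 2(4) by blast
  have "(c - d) - nf Y (coef (c - d)) \<in> T.rel" if Y: "finite Y" "Y1 \<union> Y2 \<subseteq> Y" "Y \<subseteq> carrier M" for Y
  proof -
    have "coef c = (\<lambda>m. coef (c - d) m + coef d m)" by (simp add: coef_diff)
    then have "nf Y (coef c) - nf Y (coef (c - d)) - nf Y (coef d) \<in> T.rel"
      using nf_add[of Y "coef (c - d)" "coef d"] coef_in[OF keys_diffI[OF 2(1,2)]] coef_in[OF 2(2)] Y by simp
    moreover have "c - nf Y (coef c) \<in> T.rel" "d - nf Y (coef d) \<in> T.rel" using Y by (auto intro: Y1 Y2)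
    ultimately have "(c - nf Y (coef c)) - (d - nf Y (coef d)) + (nf Y (coef c) - nf Y (coef (c - d)) - nf Y (coef d)) \<in> T.rel"
      by (rule T.rel_add[OF T.rel_diff, rotated 2])
    then show ?thesis by (simp add: algebra_simps)
  qed
  then show ?case using Y1 Y2 by (intro exI[of _ "Y1 \<union> Y2"]) auto
next
  case (3 k)
  obtain x n where k: "k = (x, n)" "x \<in> A" "n \<in> carrier M" using 3 by auto
  have "frag_of k - nf Y (coef (frag_of k)) \<in> T.rel" if Y: "finite Y" "{n} \<subseteq> Y" "Y \<subseteq> carrier M" for Y
  proof -
    have "nf Y (coef (frag_of k)) = frag_of (x, n) + (\<Sum>m\<in>Y - {n}. frag_of (coef (frag_of (x, n)) m, m))"
      unfolding nf_def k(1) using Y by (subst sum.remove[of Y n]) auto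
    moreover have "(\<Sum>m\<in>Y - {n}. frag_of (coef (frag_of (x, n)) m, m)) \<in> T.rel"
      using Y by (intro T.rel_sum) (auto intro: rel_frag_zero_left)
    ultimately show ?thesis using T.rel_uminus by (simp add: k(1))
  qed
  then show ?case using k by (intro exI[of _ "{n}"]) (auto simp del: coef_frag)
qed

text \<open>Converse of \<open>rel_AK\<close>: the tensor relations are the elements whose
  coefficient row lies in \<open>AK\<close>, since every element is congruent to the normal form of
  its row.\<close>

lemma AK_rel: assumes "AK (coef c)" "Poly_Mapping.keys c \<subseteq> T.base" shows "c \<in> T.rel"
proof -
  obtain Y1 where Y1: "finite Y1" "Y1 \<subseteq> carrier M"
    "\<And>Y. finite Y \<Longrightarrow> Y1 \<subseteq> Y \<Longrightarrow> Y \<subseteq> carrier M \<Longrightarrow> c - nf Y (coef c) \<in> T.rel" using coef_nf[OF assms(2)] by blast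
  obtain Y2 where Y2: "finite Y2" "Y2 \<subseteq> carrier M"
    "\<And>Y. finite Y \<Longrightarrow> Y2 \<subseteq> Y \<Longrightarrow> Y \<subseteq> carrier M \<Longrightarrow> nf Y (coef c) \<in> T.rel" using AK_nf[OF assms(1)] by blast
  have "c - nf (Y1 \<union> Y2) (coef c) \<in> T.rel" "nf (Y1 \<union> Y2) (coef c) \<in> T.rel" using Y1 Y2 by auto
  from T.rel_add[OF this] show ?thesis by simp
qed

end

section \<open>Quotient modules and base change\<close>

context left_module
begin

lemma submodule_abelian_subgroup: "submodule N R M \<Longrightarrow> abelian_subgroup N M"
  by (intro abelian_subgroupI3 additive_subgroup.intro M.abelian_group_axioms) (simp add: submodule_def)

lemma coset_eq_iff:
  assumes N: "submodule N R M" and x: "x \<in> carrier M" "y \<in> carrier M"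
  shows "N +>\<^bsub>M\<^esub> x = N +>\<^bsub>M\<^esub> y \<longleftrightarrow> x \<ominus>\<^bsub>M\<^esub> y \<in> N"
proof -
  interpret N: abelian_subgroup N M by (rule submodule_abelian_subgroup[OF N])
  have "x \<in> N +>\<^bsub>M\<^esub> y \<longleftrightarrow> x \<ominus>\<^bsub>M\<^esub> y \<in> N" using N.a_rcos_module[OF x(2,1)] by (simp add: a_minus_def)
  moreover have "x \<in> N +>\<^bsub>M\<^esub> x" by (rule N.a_rcos_self[OF x(1)])
  ultimately show ?thesis using N.a_repr_independence'[OF _ x(2), of x] by auto
qed

lemma quot_carrier: "carrier (quot_module M N) = (\<lambda>x. N +>\<^bsub>M\<^esub> x) ` carrier M"
  by (auto simp: quot_module_def A_RCOSETS_def')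

lemma quot_zero: "\<zero>\<^bsub>quot_module M N\<^esub> = N" by (simp add: quot_module_def)

lemma quot_add:
  assumes N: "submodule N R M" and x: "x \<in> carrier M" "y \<in> carrier M"
  shows "(N +>\<^bsub>M\<^esub> x) \<oplus>\<^bsub>quot_module M N\<^esub> (N +>\<^bsub>M\<^esub> y) = N +>\<^bsub>M\<^esub> (x \<oplus>\<^bsub>M\<^esub> y)"
proof -
  interpret N: abelian_subgroup N M by (rule submodule_abelian_subgroup[OF N])
  show ?thesis using N.a_rcos_sum[OF x] by (simp add: quot_module_def)
qed

lemma smult_diff:
  assumes "a \<in> carrier R" "x \<in> carrier M" "y \<in> carrier M"
  shows "a \<odot>\<^bsub>M\<^esub> (x \<ominus>\<^bsub>M\<^esub> y) = a \<odot>\<^bsub>M\<^esub> x \<ominus>\<^bsub>M\<^esub> a \<odot>\<^bsub>M\<^esub> y"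
proof -
  have "a \<odot>\<^bsub>M\<^esub> (x \<ominus>\<^bsub>M\<^esub> y) \<oplus>\<^bsub>M\<^esub> a \<odot>\<^bsub>M\<^esub> y = a \<odot>\<^bsub>M\<^esub> ((x \<ominus>\<^bsub>M\<^esub> y) \<oplus>\<^bsub>M\<^esub> y)"
    using assms by (simp add: lsmult_r_distr)
  also have "(x \<ominus>\<^bsub>M\<^esub> y) \<oplus>\<^bsub>M\<^esub> y = x" using assms by (simp add: a_minus_def M.a_assoc M.l_neg)
  finally show ?thesis using assms lsmult_closed by (simp add: M.add.inv_solve_right a_minus_def)
qed

lemma quot_smult:
  assumes N: "submodule N R M" and a: "a \<in> carrier R" and x: "x \<in> carrier M"
  shows "a \<odot>\<^bsub>quot_module M N\<^esub> (N +>\<^bsub>M\<^esub> x) = N +>\<^bsub>M\<^esub> (a \<odot>\<^bsub>M\<^esub> x)"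
proof -
  interpret N: abelian_subgroup N M by (rule submodule_abelian_subgroup[OF N])
  have "N +>\<^bsub>M\<^esub> (a \<odot>\<^bsub>M\<^esub> y) = N +>\<^bsub>M\<^esub> (a \<odot>\<^bsub>M\<^esub> x)" if y: "y \<in> N +>\<^bsub>M\<^esub> x" for y
  proof -
    have yc: "y \<in> carrier M" using y M.a_r_coset_subset_G[OF N.a_subset x] by blast
    then have "y \<ominus>\<^bsub>M\<^esub> x \<in> N" using y N.a_rcos_module[OF x yc] by (simp add: a_minus_def)
    then have "a \<odot>\<^bsub>M\<^esub> (y \<ominus>\<^bsub>M\<^esub> x) \<in> N" using submodule_smult[OF N a] by blast
    then show ?thesis using coset_eq_iff[OF N] smult_diff[OF a yc x] lsmult_closed a yc x by simp
  qed
  moreover have "x \<in> N +>\<^bsub>M\<^esub> x" by (rule N.a_rcos_self[OF x])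
  ultimately have "(\<Union>y\<in>N +>\<^bsub>M\<^esub> x. N +>\<^bsub>M\<^esub> (a \<odot>\<^bsub>M\<^esub> y)) = N +>\<^bsub>M\<^esub> (a \<odot>\<^bsub>M\<^esub> x)" by blast
  then show ?thesis by (simp add: quot_module_def)
qed

lemma coset_zero: assumes "submodule N R M" shows "N +>\<^bsub>M\<^esub> \<zero>\<^bsub>M\<^esub> = N"
proof -
  interpret N: abelian_subgroup N M by (rule submodule_abelian_subgroup[OF assms])
  show ?thesis using N.a_subset by (rule M.a_coset_add_zero)
qed

lemma left_module_quot: assumes N: "submodule N R M" shows "left_module R (quot_module M N)"
proof (intro left_module.intro left_module_axioms.intro)
  note q = quot_carrier quot_zero quot_add[OF N] quot_smult[OF N] lsmult_closed
  show "abelian_group (quot_module M N)"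
  proof (rule abelian_groupI)
    fix C assume "C \<in> carrier (quot_module M N)"
    then obtain x where x: "x \<in> carrier M" "C = N +>\<^bsub>M\<^esub> x" by (auto simp: q)
    show "\<exists>D\<in>carrier (quot_module M N). D \<oplus>\<^bsub>quot_module M N\<^esub> C = \<zero>\<^bsub>quot_module M N\<^esub>"
      by (rule bexI[of _ "N +>\<^bsub>M\<^esub> (\<ominus>\<^bsub>M\<^esub> x)"]) (use x coset_zero[OF N] in \<open>auto simp: q M.l_neg\<close>)
    show "\<zero>\<^bsub>quot_module M N\<^esub> \<oplus>\<^bsub>quot_module M N\<^esub> C = C"
      using quot_add[OF N M.zero_closed x(1)] x coset_zero[OF N] by (simp add: q)
  next
    show "\<zero>\<^bsub>quot_module M N\<^esub> \<in> carrier (quot_module M N)"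
      using coset_zero[OF N] unfolding q by (metis M.zero_closed imageI)
  qed (auto simp: q M.a_ac)
qed (use R.ring_axioms in \<open>auto simp: quot_carrier quot_add[OF N] quot_smult[OF N] lsmult_closed
  lsmult_l_distr lsmult_r_distr lsmult_assoc lsmult_one\<close>)

end

section \<open>Homomorphisms and their base change\<close>

lemma left_module_homD:
  assumes "h \<in> left_module_hom R M N"
  shows "x \<in> carrier M \<Longrightarrow> h x \<in> carrier N"
    and "x \<in> carrier M \<Longrightarrow> y \<in> carrier M \<Longrightarrow> h (x \<oplus>\<^bsub>M\<^esub> y) = h x \<oplus>\<^bsub>N\<^esub> h y"
    and "a \<in> carrier R \<Longrightarrow> x \<in> carrier M \<Longrightarrow> h (a \<odot>\<^bsub>M\<^esub> x) = a \<odot>\<^bsub>N\<^esub> h x"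
  using assms by (auto simp: left_module_hom_def)

lemma left_module_hom_eq_iff:
  assumes X: "left_module R X" and Y: "left_module R Y" and p: "p \<in> left_module_hom R X Y"
    and x: "x \<in> carrier X" "y \<in> carrier X"
  shows "p x = p y \<longleftrightarrow> p (x \<ominus>\<^bsub>X\<^esub> y) = \<zero>\<^bsub>Y\<^esub>"
proof -
  interpret X: left_module R X by fact
  interpret Y: left_module R Y by fact
  note p = left_module_homD[OF p]
  have "(x \<ominus>\<^bsub>X\<^esub> y) \<oplus>\<^bsub>X\<^esub> y = x" using x by (simp add: a_minus_def X.M.a_assoc X.M.l_neg)
  then have "p x = p (x \<ominus>\<^bsub>X\<^esub> y) \<oplus>\<^bsub>Y\<^esub> p y" using p(2)[of "x \<ominus>\<^bsub>X\<^esub> y" y] x by simp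
  then show ?thesis using p(1) x Y.M.add.l_cancel_one[of "p y" "p (x \<ominus>\<^bsub>X\<^esub> y)"] by (metis X.M.minus_closed Y.M.add.r_cancel_one')
qed

lemma first_isomorphism:
  assumes X: "left_module R X" and Y: "left_module R Y" and p: "p \<in> left_module_hom R X Y"
    and surj: "p ` carrier X = carrier Y" and L: "submodule L R X"
    and ker: "\<And>x. x \<in> carrier X \<Longrightarrow> p x = \<zero>\<^bsub>Y\<^esub> \<longleftrightarrow> x \<in> L"
  shows "\<exists>\<Phi>\<in>left_module_iso R Y (quot_module X L). \<forall>x\<in>carrier X. \<Phi> (p x) = L +>\<^bsub>X\<^esub> x"
proof -
  interpret X: left_module R X by fact
  interpret Y: left_module R Y by fact
  note ph = left_module_homD[OF p]
  have eq: "p x = p y \<longleftrightarrow> L +>\<^bsub>X\<^esub> x = L +>\<^bsub>X\<^esub> y" if "x \<in> carrier X" "y \<in> carrier X" for x y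
    using left_module_hom_eq_iff[OF X Y p that] ker[of "x \<ominus>\<^bsub>X\<^esub> y"] X.coset_eq_iff[OF L that] that by simp
  define \<Phi> where "\<Phi> y = L +>\<^bsub>X\<^esub> (inv_into (carrier X) p y)" for y
  have \<Phi>: "\<Phi> (p x) = L +>\<^bsub>X\<^esub> x" if x: "x \<in> carrier X" for x
  proof -
    have "p (inv_into (carrier X) p (p x)) = p x" "inv_into (carrier X) p (p x) \<in> carrier X"
      using x by (auto intro: f_inv_into_f inv_into_into)
    then show ?thesis unfolding \<Phi>_def using eq x by blast
  qed
  have "\<Phi> \<in> left_module_hom R Y (quot_module X L)"
    unfolding left_module_hom_def
  proof (intro CollectI conjI Pi_I ballI)
    fix y assume "y \<in> carrier Y"
    then obtain x where x: "x \<in> carrier X" "y = p x" using surj by auto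
    then show "\<Phi> y \<in> carrier (quot_module X L)" using \<Phi> by (auto simp: X.quot_carrier)
    show "\<Phi> (y \<oplus>\<^bsub>Y\<^esub> y') = \<Phi> y \<oplus>\<^bsub>quot_module X L\<^esub> \<Phi> y'" if y': "y' \<in> carrier Y" for y'
    proof -
      obtain x' where x': "x' \<in> carrier X" "y' = p x'" using surj y' by auto
      have "y \<oplus>\<^bsub>Y\<^esub> y' = p (x \<oplus>\<^bsub>X\<^esub> x')" using x x' ph(2) by simp
      then show ?thesis using \<Phi> x x' X.quot_add[OF L] by simp
    qed
    show "\<Phi> (a \<odot>\<^bsub>Y\<^esub> y) = a \<odot>\<^bsub>quot_module X L\<^esub> \<Phi> y" if "a \<in> carrier R" for a
    proof -
      have "a \<odot>\<^bsub>Y\<^esub> y = p (a \<odot>\<^bsub>X\<^esub> x)" using x ph(3) that by simp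
      then show ?thesis using \<Phi> x X.quot_smult[OF L that] X.lsmult_closed[OF that] by simp
    qed
  qed
  moreover have "bij_betw \<Phi> (carrier Y) (carrier (quot_module X L))"
    unfolding bij_betw_def
  proof
    show "inj_on \<Phi> (carrier Y)"
      unfolding surj[symmetric] using eq \<Phi> by (auto simp: inj_on_def)
    show "\<Phi> ` carrier Y = carrier (quot_module X L)"
      unfolding surj[symmetric] image_image X.quot_carrier by (rule image_cong[OF refl \<Phi>])
  qed
  ultimately show ?thesis using \<Phi> by (intro bexI[of _ \<Phi>]) (auto simp: left_module_iso_def)
qed

locale base_change = left_module R M + T: ring T
  for T :: "('t, 's) ring_scheme" and \<phi> :: "'r \<Rightarrow> 't" and R :: "('r, 'q) ring_scheme" and M :: "('r, 'm, 'k) module_scheme" +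
  assumes \<phi>_in: "r \<in> carrier R \<Longrightarrow> \<phi> r \<in> carrier T"
begin

sublocale scalar_extension T \<phi> R M
  by unfold_locales (auto simp: \<phi>_in)

abbreviation ext where "ext \<equiv> ext_scalars T \<phi> R M"

definition act :: "'t \<Rightarrow> ('t \<times> 'm \<Rightarrow>\<^sub>0 int) \<Rightarrow> ('t \<times> 'm \<Rightarrow>\<^sub>0 int)" where
  "act t = frag_extend (\<lambda>(x, m). frag_of (t \<otimes>\<^bsub>T\<^esub> x, m))"

lemma act_frag [simp]: "act t (frag_of (x, m)) = frag_of (t \<otimes>\<^bsub>T\<^esub> x, m)" by (simp add: act_def)
lemma act_0 [simp]: "act t 0 = 0" by (simp add: act_def)
lemma act_diff [simp]: "act t (c - d) = act t c - act t d" by (simp add: act_def frag_extend_diff)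
lemma act_add [simp]: "act t (c + d) = act t c + act t d" by (simp add: act_def frag_extend_add)
lemma act_minus [simp]: "act t (- c) = - act t c" by (simp add: act_def frag_extend_minus)

lemma act_keys:
  assumes "t \<in> carrier T" "Poly_Mapping.keys c \<subseteq> carrier T \<times> N"
  shows "Poly_Mapping.keys (act t c) \<subseteq> carrier T \<times> N"
  using assms(2)
  by (induction c rule: free_Abelian_group_induct[consumes 1]) (use assms(1) in \<open>auto simp: keys_diffI\<close>)

lemma act_rel: assumes t: "t \<in> carrier T" and c: "c \<in> rel" shows "act t c \<in> rel"
proof -
  have "Poly_Mapping.keys c \<subseteq> base \<and> act t c \<in> rel"
    using c
  proof (induction rule: rel_induct)
    case (add_left x y m)
    then show ?case using rel_add_left[of "t \<otimes>\<^bsub>T\<^esub> x" "t \<otimes>\<^bsub>T\<^esub> y" m] t by (simp add: T.r_distr)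
  next
    case (add_right x m n)
    then show ?case using rel_add_right[of "t \<otimes>\<^bsub>T\<^esub> x" m n] t by simp
  next
    case (mult x r m)
    then show ?case using rel_mult[of "t \<otimes>\<^bsub>T\<^esub> x" r m] t by (simp add: T.m_assoc \<phi>_in)
  qed (auto intro: rel_zero rel_uminus rel_add)
  then show ?thesis by blast
qed

lemma smult_ext: assumes t: "t \<in> carrier T" shows "t \<odot>\<^bsub>ext\<^esub> cls c = cls (act t c)"
proof -
  have "t \<odot>\<^bsub>ext\<^esub> cls c = (\<Union>d\<in>cls c. cls (act t d))"
    by (simp add: ext_scalars_def quot_module_def tensor_free_def act_def cls_def)
  also have "\<dots> = (\<Union>d\<in>cls c. cls (act t c))"
    using act_rel[OF t] by (intro SUP_cong refl) (simp add: cls_eq_iff mem_cls flip: act_diff)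
  also have "\<dots> = cls (act t c)" using mem_cls[of c c] rel_zero by auto
  finally show ?thesis .
qed

lemma ext_cases: assumes "x \<in> carrier ext" obtains c where "Poly_Mapping.keys c \<subseteq> base" "x = cls c"
  using assms by (auto simp: carrier_ext)

lemma act_add_left:
  assumes "s \<in> carrier T" "t \<in> carrier T" "Poly_Mapping.keys c \<subseteq> base"
  shows "act (s \<oplus>\<^bsub>T\<^esub> t) c - (act s c + act t c) \<in> rel"
  using assms(3)
proof (induction c rule: free_Abelian_group_induct[consumes 1, case_names zero diff frag])
  case (diff c d)
  from rel_diff[OF diff(3,4)] show ?case by (simp add: algebra_simps)
next
  case (frag k)
  then obtain x m where k: "k = (x, m)" "x \<in> carrier T" "m \<in> carrier M" by auto
  then show ?case
    using rel_add_left[of "s \<otimes>\<^bsub>T\<^esub> x" "t \<otimes>\<^bsub>T\<^esub> x" m] assms(1,2) by (simp add: T.l_distr diff_diff_eq)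
qed (simp add: rel_zero)

lemma act_act:
  assumes "s \<in> carrier T" "t \<in> carrier T" "Poly_Mapping.keys c \<subseteq> base"
  shows "act (s \<otimes>\<^bsub>T\<^esub> t) c = act s (act t c)"
  using assms(3)
  by (induction c rule: free_Abelian_group_induct[consumes 1]) (use assms(1,2) in \<open>auto simp: T.m_assoc\<close>)

lemma act_one: "Poly_Mapping.keys c \<subseteq> base \<Longrightarrow> act \<one>\<^bsub>T\<^esub> c = c"
  by (induction c rule: free_Abelian_group_induct[consumes 1]) auto

lemma left_module_ext: "left_module T ext"
proof (intro left_module.intro left_module_axioms.intro T.ring_axioms)
  have cl: "cls c \<in> carrier ext" if "Poly_Mapping.keys c \<subseteq> base" for c using that by (simp add: carrier_ext)
  have ze: "\<zero>\<^bsub>ext\<^esub> = cls 0" by (simp add: zero_ext cls_zero)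
  show "abelian_group ext"
  proof (rule abelian_groupI)
    fix x assume "x \<in> carrier ext"
    then obtain c where c: "Poly_Mapping.keys c \<subseteq> base" "x = cls c" by (rule ext_cases)
    then show "\<exists>y\<in>carrier ext. y \<oplus>\<^bsub>ext\<^esub> x = \<zero>\<^bsub>ext\<^esub>"
      by (intro bexI[of _ "cls (- c)"]) (auto simp: add_ext ze cl)
  qed (auto elim!: ext_cases simp: add_ext ze cl keys_addI add_ac)
  fix a b x y
  assume "x \<in> carrier ext"
  then obtain c where c: "Poly_Mapping.keys c \<subseteq> base" "x = cls c" by (rule ext_cases)
  show "\<one>\<^bsub>T\<^esub> \<odot>\<^bsub>ext\<^esub> x = x" using c by (simp add: smult_ext act_one)
  assume a: "a \<in> carrier T"
  show "a \<odot>\<^bsub>ext\<^esub> x \<in> carrier ext" using c a by (simp add: smult_ext cl act_keys)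
  { assume "b \<in> carrier T"
    then show "(a \<oplus>\<^bsub>T\<^esub> b) \<odot>\<^bsub>ext\<^esub> x = a \<odot>\<^bsub>ext\<^esub> x \<oplus>\<^bsub>ext\<^esub> b \<odot>\<^bsub>ext\<^esub> x"
      and "(a \<otimes>\<^bsub>T\<^esub> b) \<odot>\<^bsub>ext\<^esub> x = a \<odot>\<^bsub>ext\<^esub> (b \<odot>\<^bsub>ext\<^esub> x)"
      using c a act_add_left[of a b c] by (simp_all add: smult_ext add_ext cls_eq_iff act_act rel_zero) }
  assume "y \<in> carrier ext"
  then obtain d where "Poly_Mapping.keys d \<subseteq> base" "y = cls d" by (rule ext_cases)
  then show "a \<odot>\<^bsub>ext\<^esub> (x \<oplus>\<^bsub>ext\<^esub> y) = a \<odot>\<^bsub>ext\<^esub> x \<oplus>\<^bsub>ext\<^esub> a \<odot>\<^bsub>ext\<^esub> y"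
    using c a by (simp add: smult_ext add_ext)
qed

end

locale base_change_hom = M: base_change T \<phi> R M + N: base_change T \<phi> R N
  for T :: "('t, 's) ring_scheme" and \<phi> :: "'r \<Rightarrow> 't" and R :: "('r, 'q) ring_scheme"
    and M :: "('r, 'm, 'k) module_scheme" and N :: "('r, 'n, 'l) module_scheme" +
  fixes h :: "'m \<Rightarrow> 'n"
  assumes hom: "h \<in> left_module_hom R M N"
begin

definition push :: "('t \<times> 'm \<Rightarrow>\<^sub>0 int) \<Rightarrow> ('t \<times> 'n \<Rightarrow>\<^sub>0 int)" where
  "push = frag_extend (\<lambda>(x, m). frag_of (x, h m))"

lemma push_frag [simp]: "push (frag_of (x, m)) = frag_of (x, h m)" by (simp add: push_def)
lemma push_0 [simp]: "push 0 = 0" by (simp add: push_def)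
lemma push_diff [simp]: "push (c - d) = push c - push d" by (simp add: push_def frag_extend_diff)
lemma push_add [simp]: "push (c + d) = push c + push d" by (simp add: push_def frag_extend_add)
lemma push_minus [simp]: "push (- c) = - push c" by (simp add: push_def frag_extend_minus)

lemma push_keys: "Poly_Mapping.keys c \<subseteq> M.base \<Longrightarrow> Poly_Mapping.keys (push c) \<subseteq> N.base"
  by (induction c rule: free_Abelian_group_induct[consumes 1])
     (use left_module_homD(1)[OF hom] in \<open>auto simp: keys_diffI\<close>)

lemma push_rel: assumes c: "c \<in> M.rel" shows "push c \<in> N.rel"
proof -
  note h = left_module_homD[OF hom]
  have "Poly_Mapping.keys c \<subseteq> M.base \<and> push c \<in> N.rel"
    using c
    by (induction rule: M.rel_induct)
       (auto simp: h intro: N.rel_zero N.rel_uminus N.rel_add N.rel_add_left N.rel_add_right N.rel_mult)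
  then show ?thesis by blast
qed

lemma ext_map_cls: "ext_scalars_map T \<phi> R N h (M.cls c) = N.cls (push c)"
proof -
  have "ext_scalars_map T \<phi> R N h (M.cls c) = (\<Union>d\<in>M.cls c. N.cls (push d))"
    by (simp add: ext_scalars_map_def push_def N.cls_def)
  also have "\<dots> = (\<Union>d\<in>M.cls c. N.cls (push c))"
    using push_rel by (intro SUP_cong refl) (simp add: N.cls_eq_iff M.mem_cls flip: push_diff)
  also have "\<dots> = N.cls (push c)" using M.mem_cls[of c c] M.rel_zero by auto
  finally show ?thesis .
qed

lemma push_act:
  assumes "t \<in> carrier T" "Poly_Mapping.keys c \<subseteq> M.base"
  shows "push (M.act t c) = N.act t (push c)"
  using assms(2) by (induction c rule: free_Abelian_group_induct[consumes 1]) auto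

lemma ext_map_hom: "ext_scalars_map T \<phi> R N h \<in> left_module_hom T M.ext N.ext"
  unfolding left_module_hom_def
  by (auto elim!: M.ext_cases simp: ext_map_cls N.carrier_ext push_keys M.add_ext N.add_ext M.smult_ext N.smult_ext push_act)

end

context base_change
begin

text \<open>The image of the induced module of \<open>N\<close> in that of \<open>M\<close>.\<close>

definition ext_sub :: "'m set \<Rightarrow> ('t \<times> 'm \<Rightarrow>\<^sub>0 int) set set" where
  "ext_sub N = cls ` {c. Poly_Mapping.keys c \<subseteq> carrier T \<times> N}"

lemma ext_sub_submodule:
  assumes N: "N \<subseteq> carrier M" shows "submodule (ext_sub N) T ext"
proof (rule left_module_submoduleI[OF left_module_ext])
  have sub: "Poly_Mapping.keys c \<subseteq> base" if "Poly_Mapping.keys c \<subseteq> carrier T \<times> N" for c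
    using that N by blast
  then show "ext_sub N \<subseteq> carrier ext" by (auto simp: ext_sub_def carrier_ext)
  show "\<zero>\<^bsub>ext\<^esub> \<in> ext_sub N" unfolding ext_sub_def zero_ext cls_zero[symmetric] by (intro imageI) simp
  fix x assume "x \<in> ext_sub N"
  then obtain c where c: "Poly_Mapping.keys c \<subseteq> carrier T \<times> N" "x = cls c" by (auto simp: ext_sub_def)
  show "x \<oplus>\<^bsub>ext\<^esub> y \<in> ext_sub N" if y: "y \<in> ext_sub N" for y
  proof -
    obtain d where d: "Poly_Mapping.keys d \<subseteq> carrier T \<times> N" "y = cls d" using y by (auto simp: ext_sub_def)
    show ?thesis unfolding c(2) d(2) add_ext ext_sub_def using c(1) d(1) by (intro imageI) (simp add: keys_addI)
  qed
  show "a \<odot>\<^bsub>ext\<^esub> x \<in> ext_sub N" if a: "a \<in> carrier T" for a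
    unfolding c(2) smult_ext[OF a] ext_sub_def using c(1) a by (intro imageI) (simp add: act_keys)
qed

lemma cls_diff: assumes "Poly_Mapping.keys c \<subseteq> base" "Poly_Mapping.keys d \<subseteq> base"
  shows "cls c \<ominus>\<^bsub>ext\<^esub> cls d = cls (c - d)"
proof -
  interpret X: left_module T ext by (rule left_module_ext)
  have i: "cls c \<in> carrier ext" "cls d \<in> carrier ext" "cls (c - d) \<in> carrier ext"
    using assms by (auto simp: carrier_ext keys_diffI)
  have "cls (c - d) \<oplus>\<^bsub>ext\<^esub> cls d = cls c" by (simp add: add_ext)
  then show ?thesis using i by (metis X.M.add.inv_solve_right a_minus_def)
qed

lemma base_change_submodule:
  assumes N: "submodule N R M" shows "base_change T \<phi> R (M\<lparr>carrier := N\<rparr>)"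
  by (intro base_change.intro base_change_axioms.intro left_module_submodule[OF left_module_axioms N] T.ring_axioms \<phi>_in)

lemma ext_sub_iso:
  assumes N: "submodule N R M"
    and flat: "\<And>c. Poly_Mapping.keys c \<subseteq> carrier T \<times> N \<Longrightarrow> c \<in> rel \<Longrightarrow> c \<in> tensor_rel T \<phi> R (M\<lparr>carrier := N\<rparr>)"
  shows "ext_scalars_map T \<phi> R M (\<lambda>x. x) \<in>
    left_module_iso T (ext_scalars T \<phi> R (M\<lparr>carrier := N\<rparr>)) (ext\<lparr>carrier := ext_sub N\<rparr>)"
proof -
  note S = submodule_subset[OF N]
  interpret N: base_change T \<phi> R "M\<lparr>carrier := N\<rparr>" by (rule base_change_submodule[OF N])
  have incl: "(\<lambda>x. x) \<in> left_module_hom R (M\<lparr>carrier := N\<rparr>) M" using S by (auto simp: left_module_hom_def)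
  interpret h: base_change_hom T \<phi> R "M\<lparr>carrier := N\<rparr>" M "\<lambda>x. x"
    by unfold_locales (rule incl)
  have push: "h.push c = c" for c
  proof -
    have "h.push = frag_extend frag_of" unfolding h.push_def by (rule arg_cong[of _ _ frag_extend]) auto
    then show ?thesis using frag_expansion[of c] by simp
  qed
  let ?i = "ext_scalars_map T \<phi> R M (\<lambda>x. x)"
  have i: "?i (N.cls c) = cls c" for c using h.ext_map_cls[of c] by (simp add: push)
  have im: "?i ` carrier N.ext = ext_sub N"
    by (auto simp: N.carrier_ext ext_sub_def image_image i)
  have "?i \<in> left_module_hom T N.ext (ext\<lparr>carrier := ext_sub N\<rparr>)"
    using h.ext_map_hom im by (auto simp: left_module_hom_def)
  moreover have "inj_on ?i (carrier N.ext)"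
  proof (rule inj_onI)
    fix x y assume "x \<in> carrier N.ext" "y \<in> carrier N.ext" and e: "?i x = ?i y"
    then obtain c d where c: "Poly_Mapping.keys c \<subseteq> N.base" "x = N.cls c" and d: "Poly_Mapping.keys d \<subseteq> N.base" "y = N.cls d"
      by (metis N.ext_cases)
    have "c - d \<in> rel" using e by (simp add: c d i cls_eq_iff)
    then have "c - d \<in> N.rel" using c(1) d(1) by (intro flat) (simp_all add: keys_diffI)
    then show "x = y" by (simp add: c d N.cls_eq_iff)
  qed
  ultimately show ?thesis using im by (simp add: left_module_iso_def bij_betw_def)
qed

text \<open>Right exactness of the tensor product: lifting along a section of the quotient map
  inverts the induced map modulo \<open>ext_sub N\<close>.\<close>

lemma ext_sub_quotient:
  assumes N: "submodule N R M"
  shows "\<exists>\<Phi>\<in>left_module_iso T (ext_scalars T \<phi> R (quot_module M N)) (quot_module ext (ext_sub N)).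
    \<forall>x\<in>carrier ext. \<Phi> (ext_scalars_map T \<phi> R (quot_module M N) (\<lambda>m. N +>\<^bsub>M\<^esub> m) x) = ext_sub N +>\<^bsub>ext\<^esub> x"
proof (rule first_isomorphism[OF left_module_ext])
  note S = submodule_subset[OF N] and L = ext_sub_submodule[OF submodule_subset[OF N]]
  let ?q = "\<lambda>m. N +>\<^bsub>M\<^esub> m" and ?Q = "quot_module M N"
  interpret Q: base_change T \<phi> R ?Q
    by (intro base_change.intro base_change_axioms.intro left_module_quot[OF N] T.ring_axioms \<phi>_in)
  have q: "?q \<in> left_module_hom R M ?Q"
    by (auto simp: left_module_hom_def quot_carrier quot_add[OF N] quot_smult[OF N])
  interpret h: base_change_hom T \<phi> R M ?Q ?q by unfold_locales (rule q)
  show "left_module T (ext_scalars T \<phi> R ?Q)" by (rule Q.left_module_ext)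
  show "ext_scalars_map T \<phi> R ?Q ?q \<in> left_module_hom T ext (ext_scalars T \<phi> R ?Q)" by (rule h.ext_map_hom)
  show "submodule (ext_sub N) T ext" by (rule L)
  \<comment> \<open>The preimage of \<open>ext_sub N\<close> in the free group, where the lifts can
    be compared.\<close>
  define W where "W = {c. Poly_Mapping.keys c \<subseteq> base \<and> cls c \<in> ext_sub N}"
  have W_diff: "c - d \<in> W" if "c \<in> W" "d \<in> W" for c d
  proof -
    have "cls c \<in> ext_sub N" "cls d \<in> ext_sub N" using that by (simp_all add: W_def)
    then obtain c' d' where "Poly_Mapping.keys c' \<subseteq> carrier T \<times> N" "cls c = cls c'"
      "Poly_Mapping.keys d' \<subseteq> carrier T \<times> N" "cls d = cls d'" by (auto simp: ext_sub_def)
    then have "Poly_Mapping.keys (c' - d') \<subseteq> carrier T \<times> N" "cls (c - d) = cls (c' - d')"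
      using rel_diff[of "c - c'" "d - d'"] by (simp_all add: keys_diffI cls_eq_iff algebra_simps)
    then show ?thesis using that by (auto simp: W_def ext_sub_def keys_diffI)
  qed
  have W_rel: "c \<in> W" if "c \<in> rel" for c
  proof -
    have "cls c = cls 0" using that by (simp add: cls_eq_iff)
    then show ?thesis using rel_keys[OF that] by (auto simp: W_def ext_sub_def intro!: image_eqI[of _ _ 0])
  qed
  have W_add: "c + d \<in> W" if "c \<in> W" "d \<in> W" for c d
    using W_diff[OF that(1) W_diff[OF W_rel[OF rel_zero] that(2)]] by simp
  have W_frag: "frag_of (x, u) - frag_of (x, v) \<in> W"
    if x: "x \<in> carrier T" and u: "u \<in> carrier M" "v \<in> carrier M" and e: "?q u = ?q v" for x u v
  proof -
    have n: "u \<ominus>\<^bsub>M\<^esub> v \<in> N" using coset_eq_iff[OF N u] e by simp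
    have "frag_of (x, u \<ominus>\<^bsub>M\<^esub> v) \<in> W"
      using n x S by (auto simp: W_def ext_sub_def intro!: imageI)
    moreover have "(u \<ominus>\<^bsub>M\<^esub> v) \<oplus>\<^bsub>M\<^esub> v = u" using u by (simp add: a_minus_def M.a_assoc M.l_neg)
    then have "frag_of (x, u) - frag_of (x, u \<ominus>\<^bsub>M\<^esub> v) - frag_of (x, v) \<in> W"
      using W_rel[OF rel_add_right[of x "u \<ominus>\<^bsub>M\<^esub> v" v]] x u by simp
    ultimately show ?thesis using W_add by fastforce
  qed
  \<comment> \<open>The section is not additive; by \<open>W_frag\<close> its failure to respect
    sums and multiples lies in \<open>W\<close>.\<close>
  define \<sigma> where "\<sigma> = inv_into (carrier M) ?q"
  have \<sigma>: "\<sigma> C \<in> carrier M" "?q (\<sigma> C) = C" if "C \<in> carrier ?Q" for C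
    using that unfolding quot_carrier \<sigma>_def by (rule inv_into_into, rule f_inv_into_f)
  have \<sigma>q: "\<sigma> (?q m) \<in> carrier M" "?q (\<sigma> (?q m)) = ?q m" if "m \<in> carrier M" for m
    using \<sigma>[of "?q m"] that by (auto simp: quot_carrier)
  define lift :: "('t \<times> 'm set \<Rightarrow>\<^sub>0 int) \<Rightarrow> ('t \<times> 'm \<Rightarrow>\<^sub>0 int)" where "lift = frag_extend (\<lambda>(x, C). frag_of (x, \<sigma> C))"
  have lift [simp]: "lift (frag_of (x, C)) = frag_of (x, \<sigma> C)" "lift 0 = 0"
    "lift (c - d) = lift c - lift d" "lift (c + d) = lift c + lift d" "lift (- c) = - lift c" for x C c d
    by (simp_all add: lift_def frag_extend_diff frag_extend_add frag_extend_minus)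
  have lift_keys: "Poly_Mapping.keys (lift c) \<subseteq> base" if "Poly_Mapping.keys c \<subseteq> Q.base" for c
    using that by (induction c rule: free_Abelian_group_induct[consumes 1]) (auto simp: keys_diffI \<sigma>)
  have push_lift: "h.push (lift c) = c" if "Poly_Mapping.keys c \<subseteq> Q.base" for c
    using that by (induction c rule: free_Abelian_group_induct[consumes 1]) (auto simp: \<sigma>)
  have lift_push: "c - lift (h.push c) \<in> W" if "Poly_Mapping.keys c \<subseteq> base" for c
    using that
  proof (induction c rule: free_Abelian_group_induct[consumes 1, case_names zero diff frag])
    case (diff c d)
    from W_diff[OF diff(3,4)] show ?case by (simp add: algebra_simps)
  next
    case (frag k)
    then obtain x m where k: "k = (x, m)" "x \<in> carrier T" "m \<in> carrier M" by auto
    show ?case using W_frag[of x m "\<sigma> (?q m)"] \<sigma>q k by simp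
  qed (simp add: W_rel rel_zero)
  have lift_rel: "lift c \<in> W" if "c \<in> Q.rel" for c
  proof -
    have "Poly_Mapping.keys c \<subseteq> Q.base \<and> lift c \<in> W"
      using that
    proof (induction rule: Q.rel_induct)
      case zero
      show ?case by (simp add: W_rel rel_zero)
    next
      case (add_left x y C)
      then show ?case using W_rel[OF rel_add_left[of x y "\<sigma> C"]] \<sigma> by simp
    next
      case (add_right x C D)
      let ?s = "\<sigma> C \<oplus>\<^bsub>M\<^esub> \<sigma> D" and ?t = "\<sigma> (C \<oplus>\<^bsub>?Q\<^esub> D)"
      have CD: "C \<oplus>\<^bsub>?Q\<^esub> D \<in> carrier ?Q" using add_right by simp
      have "?q ?s = C \<oplus>\<^bsub>?Q\<^esub> D" using quot_add[OF N \<sigma>(1)[OF add_right(2)] \<sigma>(1)[OF add_right(3)]] \<sigma>(2) add_right by simp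
      then have "frag_of (x, ?t) - frag_of (x, ?s) \<in> W"
        using add_right \<sigma> CD by (intro W_frag) auto
      then have "(frag_of (x, ?t) - frag_of (x, ?s)) + (frag_of (x, ?s) - frag_of (x, \<sigma> C) - frag_of (x, \<sigma> D)) \<in> W"
        using add_right \<sigma> by (intro W_add[OF _ W_rel[OF rel_add_right]]) auto
      then show ?case by (simp add: algebra_simps)
    next
      case (mult x r C)
      let ?s = "r \<odot>\<^bsub>M\<^esub> \<sigma> C" and ?t = "\<sigma> (r \<odot>\<^bsub>?Q\<^esub> C)"
      have rC: "r \<odot>\<^bsub>?Q\<^esub> C \<in> carrier ?Q" using mult Q.lsmult_closed by simp
      have "?q ?s = r \<odot>\<^bsub>?Q\<^esub> C" using quot_smult[OF N mult(2) \<sigma>(1)[OF mult(3)]] \<sigma>(2) mult by simp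
      then have "frag_of (x, ?s) - frag_of (x, ?t) \<in> W"
        using mult \<sigma> rC lsmult_closed by (intro W_frag) auto
      then have "(frag_of (x \<otimes>\<^bsub>T\<^esub> \<phi> r, \<sigma> C) - frag_of (x, ?s)) + (frag_of (x, ?s) - frag_of (x, ?t)) \<in> W"
        using mult \<sigma> by (intro W_add[OF W_rel[OF rel_mult]]) auto
      then show ?case by simp
    next
      case (uminus c)
      then show ?case using W_diff[OF W_rel[OF rel_zero], of "lift c"] by simp
    next
      case (add c d)
      then show ?case using W_add by simp
    qed
    then show ?thesis by blast
  qed
  show "ext_scalars_map T \<phi> R ?Q ?q ` carrier ext = carrier (ext_scalars T \<phi> R ?Q)"
  proof
    show "ext_scalars_map T \<phi> R ?Q ?q ` carrier ext \<subseteq> carrier Q.ext"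
      using left_module_homD(1)[OF h.ext_map_hom] by auto
    show "carrier Q.ext \<subseteq> ext_scalars_map T \<phi> R ?Q ?q ` carrier ext"
    proof
      fix y assume "y \<in> carrier Q.ext"
      then obtain c where c: "Poly_Mapping.keys c \<subseteq> Q.base" "y = Q.cls c" by (rule Q.ext_cases)
      then have "y = ext_scalars_map T \<phi> R ?Q ?q (cls (lift c))" by (simp add: h.ext_map_cls push_lift)
      then show "y \<in> ext_scalars_map T \<phi> R ?Q ?q ` carrier ext" using lift_keys[OF c(1)] by (simp add: carrier_ext)
    qed
  qed
  show "ext_scalars_map T \<phi> R ?Q ?q x = \<zero>\<^bsub>Q.ext\<^esub> \<longleftrightarrow> x \<in> ext_sub N" if x: "x \<in> carrier ext" for x
  proof -
    obtain c where c: "Poly_Mapping.keys c \<subseteq> base" "x = cls c" using x by (rule ext_cases)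
    have "ext_scalars_map T \<phi> R ?Q ?q x = \<zero>\<^bsub>Q.ext\<^esub> \<longleftrightarrow> h.push c \<in> Q.rel"
      using Q.cls_eq_iff[of "h.push c" 0] by (simp add: c(2) h.ext_map_cls Q.zero_ext Q.cls_zero)
    also have "\<dots> \<longleftrightarrow> x \<in> ext_sub N"
    proof
      assume p: "h.push c \<in> Q.rel"
      have "c \<in> W" using W_add[OF lift_push[OF c(1)] lift_rel[OF p]] by simp
      then show "x \<in> ext_sub N" by (simp add: W_def c)
    next
      assume "x \<in> ext_sub N"
      then obtain d where d: "Poly_Mapping.keys d \<subseteq> carrier T \<times> N" "x = cls d" by (auto simp: ext_sub_def)
      have "h.push d \<in> Q.rel" using d(1)
      proof (induction d rule: free_Abelian_group_induct[consumes 1, case_names zero diff frag])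
        case (frag k)
        then obtain x n where k: "k = (x, n)" "x \<in> carrier T" "n \<in> N" by auto
        have n: "n \<in> carrier M" using k S by blast
        have "n \<ominus>\<^bsub>M\<^esub> \<zero>\<^bsub>M\<^esub> = n" using n by (simp add: a_minus_def M.add.inv_one)
        then have "?q n = \<zero>\<^bsub>?Q\<^esub>"
          using coset_eq_iff[OF N n M.zero_closed] k coset_zero[OF N] by (simp add: quot_zero)
        then show ?case using Q.rel_frag_zero[OF k(2)] k by simp
      qed (auto intro: Q.rel_zero Q.rel_diff)
      moreover have "h.push (c - d) \<in> Q.rel" using c(2) d(2) by (intro h.push_rel) (simp flip: cls_eq_iff)
      ultimately show "h.push c \<in> Q.rel" using Q.rel_add by fastforce
    qed
    finally show ?thesis .
  qed
qed

end

context induced_module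
begin

sublocale T: base_change "vn_ring A" "\<lambda>b. b" "vn_ring B" M
  by (intro base_change.intro base_change_axioms.intro M.left_module_axioms A.ring_vn_ring) (use BA in auto)

text \<open>By \<open>AK_restrict\<close> the relations can be taken with support in
  \<open>N\<close>, and such relations among elements of \<open>M\<close> are relations in the
  submodule.\<close>

lemma flat:
  assumes N: "submodule N (vn_ring B) M" and c: "Poly_Mapping.keys c \<subseteq> A \<times> N" "c \<in> T.rel"
  shows "c \<in> tensor_rel (vn_ring A) (\<lambda>b. b) (vn_ring B) (M\<lparr>carrier := N\<rparr>)"
proof -
  note S = submodule_subset[OF N]
  interpret N: induced_module A B tr "M\<lparr>carrier := N\<rparr>"
    by (intro induced_module.intro induced_module_axioms.intro left_module_submodule[OF M.left_module_axioms N]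
      A.tracial_algebra_axioms B.tracial_algebra_axioms BA)
  have fin: "finsum (M\<lparr>carrier := N\<rparr>) f X = finsum M f X" if "finite X" "\<And>x. x \<in> X \<Longrightarrow> f x \<in> N" for f and X :: "'m set"
    using that
  proof (induction X rule: finite_induct)
    case empty
    then show ?case by simp
  next
    case (insert x X)
    have "finsum (M\<lparr>carrier := N\<rparr>) f (insert x X) = f x \<oplus>\<^bsub>M\<^esub> finsum (M\<lparr>carrier := N\<rparr>) f X"
      using insert by (subst N.M.finsum_insert) auto
    also have "\<dots> = finsum M f (insert x X)" using insert S by (subst M.finsum_insert) auto
    finally show ?case .
  qed
  have K: "\<beta> \<in> N.K" if \<beta>: "\<beta> \<in> K" "\<And>m. m \<notin> N \<Longrightarrow> \<beta> m = 0" for \<beta>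
  proof -
    have s: "{m. \<beta> m \<noteq> 0} \<subseteq> N" using \<beta>(2) by auto
    have f: "finite {m. \<beta> m \<noteq> 0}" and B: "\<And>m. \<beta> m \<in> B" and e: "ev \<beta> = \<zero>\<^bsub>M\<^esub>" using \<beta>(1) by (simp_all add: K_def fs_def)
    have "N.ev \<beta> = ev \<beta>"
      unfolding N.ev_def ev_def using fin[OF f, of "\<lambda>m. \<beta> m \<odot>\<^bsub>M\<^esub> m"] s B submodule_smult[OF N] by (simp add: subset_iff)
    then show ?thesis using f s B e by (simp add: N.K_def N.fs_def)
  qed
  have supp: "coef c m = 0" if "m \<notin> N" for m using c(1) that by (intro coef_support) auto
  obtain q :: nat and a \<beta> where q: "\<And>k. k < q \<Longrightarrow> a k \<in> A" "\<And>k. k < q \<Longrightarrow> \<beta> k \<in> K" "\<And>k m. k < q \<Longrightarrow> m \<notin> N \<Longrightarrow> \<beta> k m = 0"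
    and g: "coef c = (\<lambda>m. \<Sum>k<q. a k \<cdot> \<beta> k m)" using AK_restrict[OF rel_AK[OF c(2)], of N] supp by blast
  have "N.AK (coef c)" unfolding g using q K by (intro N.AK_sumI) blast
  then show ?thesis using c(1) by (intro N.AK_rel) simp_all
qed

lemma induced_eqI:
  assumes N: "submodule N (vn_ring B) M" and L: "L = T.ext_sub N"
  shows "induced_submodule_eq A B M N L" "induced_quotient_eq A B M N L"
  using N T.ext_sub_submodule[OF submodule_subset[OF N]] T.ext_sub_iso[OF N flat[OF N]] T.ext_sub_quotient[OF N]
  unfolding L induced_submodule_eq_def induced_quotient_eq_def induction_def induction_map_def by simp_all

end

section \<open>Projections onto row spans\<close>

definition rmul :: "'i set \<Rightarrow> ('i \<Rightarrow> 'h::complex_hilbert \<Rightarrow>\<^sub>L 'h) \<Rightarrow> ('i \<Rightarrow> 'i \<Rightarrow> 'h \<Rightarrow>\<^sub>L 'h) \<Rightarrow> 'i \<Rightarrow> 'h \<Rightarrow>\<^sub>L 'h" where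
  "rmul X a g j = (\<Sum>l\<in>X. a l \<cdot> g l j)"

lemma rmul_assoc: "rmul X (rmul X a g) k j = rmul X a (\<lambda>l. rmul X (g l) k) j"
  by (simp add: rmul_def comp.sum_left comp.sum_right comp_assoc) (rule sum.swap)

lemma rmul_linear:
  "rmul X (\<lambda>l. a l + b l) g j = rmul X a g j + rmul X b g j"
  "rmul X (\<lambda>l. a l - b l) g j = rmul X a g j - rmul X b g j"
  "rmul X a (\<lambda>l m. g l m + k l m) j = rmul X a g j + rmul X a k j"
  "rmul X a (\<lambda>l m. g l m - k l m) j = rmul X a g j - rmul X a k j"
  "rmul X (\<lambda>l. s \<cdot> a l) g j = s \<cdot> rmul X a g j"
  by (simp_all add: rmul_def comp_simps sum.distrib sum_subtractf comp.sum_right comp_assoc)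

lemma rmul_zero [simp]: "rmul X (\<lambda>_. 0) g j = 0" "rmul X a (\<lambda>_ _. 0) j = 0" by (simp_all add: rmul_def)

lemma rmul_cong:
  "(\<And>l. l \<in> X \<Longrightarrow> a l = b l) \<Longrightarrow> (\<And>l. l \<in> X \<Longrightarrow> g l j = k l j) \<Longrightarrow> rmul X a g j = rmul X b k j"
  by (simp add: rmul_def)

lemma rmul_adj:
  assumes "\<And>l. l \<in> X \<Longrightarrow> a l \<in> bounded_ops" "\<And>l. l \<in> X \<Longrightarrow> b l \<in> bounded_ops"
  shows "op_adj (\<Sum>l\<in>X. a l \<cdot> op_adj (b l)) = (\<Sum>l\<in>X. b l \<cdot> op_adj (a l))"
proof -
  have "op_adj (\<Sum>l\<in>X. a l \<cdot> op_adj (b l)) = (\<Sum>l\<in>X. op_adj (a l \<cdot> op_adj (b l)))"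
    by (intro op_adj_sum bounded_ops_comp op_adj_bounded_ops assms)
  also have "\<dots> = (\<Sum>l\<in>X. b l \<cdot> op_adj (a l))"
    by (intro sum.cong refl) (simp add: op_adj_comp op_adj_bounded_ops assms)
  finally show ?thesis .
qed

context tracial_algebra
begin

lemma pmat_rmul: "pmat X g \<Longrightarrow> i \<in> X \<Longrightarrow> j \<in> X \<Longrightarrow> rmul X (g i) g j = g i j"
  by (simp add: rmul_def pmat_idem)

lemma pmat_rmul_adj:
  assumes "pmat X g" "pmat X r" "i \<in> X" "j \<in> X"
  shows "op_adj (rmul X (g i) r j) = rmul X (r j) g i"
proof -
  have "rmul X (g i) r j = (\<Sum>l\<in>X. g i l \<cdot> op_adj (r j l))"
    unfolding rmul_def using assms by (intro sum.cong refl) (simp add: pmat_adj)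
  also have "op_adj \<dots> = (\<Sum>l\<in>X. r j l \<cdot> op_adj (g i l))"
    using assms by (intro rmul_adj) (auto intro: bops pmat_in)
  also have "\<dots> = rmul X (r j) g i" unfolding rmul_def using assms by (intro sum.cong refl) (simp add: pmat_adj)
  finally show ?thesis .
qed

lemma pmat_add:
  assumes g: "pmat X g" and r: "pmat X r" and gr: "\<And>i j. i \<in> X \<Longrightarrow> j \<in> X \<Longrightarrow> rmul X (g i) r j = 0"
  shows "pmat X (\<lambda>i j. g i j + r i j)"
  unfolding pmat_def
proof (intro ballI conjI)
  fix i j assume i: "i \<in> X" and j: "j \<in> X"
  show "g i j + r i j \<in> A" by (intro add_in pmat_in[OF g i j] pmat_in[OF r i j])
  show "op_adj (g j i + r j i) = g i j + r i j"
    by (simp add: op_adj_add bops pmat_in[OF g j i] pmat_in[OF r j i] pmat_adj[OF g i j] pmat_adj[OF r i j])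
  have "rmul X (r i) g j = 0" using pmat_rmul_adj[OF g r j i] gr[OF j i] by simp
  then have "rmul X (\<lambda>l. g i l + r i l) (\<lambda>l m. g l m + r l m) j = g i j + r i j"
    by (simp add: rmul_linear gr i j pmat_rmul[OF g i j] pmat_rmul[OF r i j])
  then show "(\<Sum>k\<in>X. (g i k + r i k) \<cdot> (g k j + r k j)) = g i j + r i j" by (simp add: rmul_def)
qed

text \<open>The projection onto the closed span of the row, obtained from the column of adjoints;
  matrices act on rows from the right.\<close>

definition rowproj :: "'i set \<Rightarrow> ('i \<Rightarrow> 'h \<Rightarrow>\<^sub>L 'h) \<Rightarrow> 'i \<Rightarrow> 'i \<Rightarrow> 'h \<Rightarrow>\<^sub>L 'h" where
  "rowproj X \<rho> = colproj X (\<lambda>i. op_adj (\<rho> i))"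

context
  fixes X :: "'i set" and \<rho> :: "'i \<Rightarrow> 'h \<Rightarrow>\<^sub>L 'h"
  assumes fin: "finite X" and r: "\<And>i. i \<in> X \<Longrightarrow> \<rho> i \<in> A"
begin

lemma rowproj_pmat: "pmat X (rowproj X \<rho>)"
  unfolding rowproj_def by (intro colproj_pmat fin adj_in r)

lemma rowproj_fix_adj: assumes "i \<in> X" shows "(\<Sum>j\<in>X. rowproj X \<rho> i j \<cdot> op_adj (\<rho> j)) = op_adj (\<rho> i)"
  unfolding rowproj_def
  by (rule colproj_fix[where \<beta>="\<lambda>i. op_adj (\<rho> i)", OF fin bops[OF adj_in[OF r]] assms])

lemma rowproj_fix: assumes i: "i \<in> X" shows "rmul X \<rho> (rowproj X \<rho>) i = \<rho> i"
proof -
  have "op_adj (\<Sum>j\<in>X. rowproj X \<rho> i j \<cdot> op_adj (\<rho> j)) = (\<Sum>j\<in>X. \<rho> j \<cdot> op_adj (rowproj X \<rho> i j))"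
    by (intro rmul_adj bops r pmat_in[OF rowproj_pmat i])
  also have "\<dots> = rmul X \<rho> (rowproj X \<rho>) i"
    unfolding rmul_def by (intro sum.cong refl) (simp add: pmat_adj[OF rowproj_pmat _ i])
  finally show ?thesis unfolding rowproj_fix_adj[OF i] by (simp add: bops r i)
qed

lemma rowproj_left:
  assumes "\<And>i. i \<in> X \<Longrightarrow> a i \<in> A" "(\<Sum>i\<in>X. a i \<cdot> op_adj (\<rho> i)) = 0" "j \<in> X"
  shows "rmul X a (rowproj X \<rho>) j = 0"
  unfolding rowproj_def rmul_def
  by (rule colproj_left[where \<beta>="\<lambda>i. op_adj (\<rho> i)", OF fin bops[OF adj_in[OF r]] bops[OF assms(1)] assms(2,3)])

end

text \<open>Gram--Schmidt: \<open>span_proj X b k\<close> is the projection onto the span of the rows \<open>b\<^sub>0, \<dots>, b\<^sub>k\<^sub>-\<^sub>1\<close>.\<close>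

primrec span_proj :: "'i set \<Rightarrow> (nat \<Rightarrow> 'i \<Rightarrow> 'h \<Rightarrow>\<^sub>L 'h) \<Rightarrow> nat \<Rightarrow> 'i \<Rightarrow> 'i \<Rightarrow> 'h \<Rightarrow>\<^sub>L 'h" where
  "span_proj X b 0 = (\<lambda>i j. 0)"
| "span_proj X b (Suc k) = (\<lambda>i j. span_proj X b k i j + rowproj X (\<lambda>m. b k m - rmul X (b k) (span_proj X b k) m) i j)"

context
  fixes X :: "'i set" and b :: "nat \<Rightarrow> 'i \<Rightarrow> 'h \<Rightarrow>\<^sub>L 'h"
  assumes fin: "finite X" and b: "\<And>k i. i \<in> X \<Longrightarrow> b k i \<in> A"
begin

abbreviation (input) "e \<equiv> span_proj X b"
abbreviation (input) "residual k \<equiv> (\<lambda>m. b k m - rmul X (b k) (e k) m)"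

lemma residual_in: assumes "pmat X (e k)" "i \<in> X" shows "residual k i \<in> A"
  unfolding rmul_def using assms b by (intro diff_in sum_in comp_in) (auto intro: pmat_in)

text \<open>The residual is \<open>b k\<close> times (1 - e k), hence orthogonal to the rows of
  \<open>e k\<close>.\<close>

lemma residual_orthogonal:
  assumes e: "pmat X (e k)" and i: "i \<in> X" and j: "j \<in> X"
  shows "rmul X (e k i) (rowproj X (residual k)) j = 0"
proof (rule rowproj_left[OF fin residual_in[OF e] _ _ j])
  show "e k i l \<in> A" if "l \<in> X" for l by (rule pmat_in[OF e i that])
  have z: "rmul X (residual k) (e k) i = 0"
  proof -
    have "rmul X (rmul X (b k) (e k)) (e k) i = rmul X (b k) (e k) i"
      unfolding rmul_assoc by (intro rmul_cong refl) (simp add: pmat_rmul[OF e] i)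
    then show ?thesis by (simp add: rmul_linear)
  qed
  have "(\<Sum>l\<in>X. e k i l \<cdot> op_adj (residual k l)) = op_adj (\<Sum>l\<in>X. residual k l \<cdot> op_adj (e k i l))"
    by (rule rmul_adj[symmetric]) (auto intro: bops residual_in[OF e] pmat_in[OF e i])
  also have "(\<Sum>l\<in>X. residual k l \<cdot> op_adj (e k i l)) = rmul X (residual k) (e k) i"
    unfolding rmul_def[of X _ _ i] by (intro sum.cong refl) (simp add: pmat_adj[OF e _ i])
  finally show "(\<Sum>l\<in>X. e k i l \<cdot> op_adj (residual k l)) = 0" using z by simp
qed

lemma span_proj_pmat: "pmat X (e k)"
proof (induction k)
  case 0
  show ?case by (simp add: pmat_def)
next
  case (Suc k)
  show ?case unfolding span_proj.simps
    by (intro pmat_add Suc rowproj_pmat fin residual_in residual_orthogonal)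
qed

lemma span_proj_mono:
  assumes i: "i \<in> X" and j: "j \<in> X" and kl: "k \<le> l"
  shows "rmul X (e k i) (e l) j = e k i j"
  using kl j
proof (induction l arbitrary: j rule: dec_induct)
  case base
  then show ?case by (intro pmat_rmul[OF span_proj_pmat i])
next
  case (step l)
  let ?r = "rowproj X (residual l)"
  have "rmul X (e k i) ?r j = rmul X (rmul X (e k i) (e l)) ?r j"
    by (intro rmul_cong refl step.IH[symmetric])
  also have "\<dots> = rmul X (e k i) (\<lambda>_ _. 0) j"
    unfolding rmul_assoc by (intro rmul_cong refl residual_orthogonal[OF span_proj_pmat] step.prems)
  finally show ?case using step.IH[OF step.prems] by (simp add: rmul_linear)
qed

lemma span_proj_fix_Suc: assumes j: "j \<in> X" shows "rmul X (b k) (e (Suc k)) j = b k j"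
proof -
  let ?r = "rowproj X (residual k)"
  note p = span_proj_pmat[of k]
  have "rmul X (rmul X (b k) (e k)) ?r j = 0"
  proof -
    have "rmul X (b k) (\<lambda>l. rmul X (e k l) ?r) j = rmul X (b k) (\<lambda>_ _. 0) j"
      by (intro rmul_cong refl residual_orthogonal[OF p _ j])
    then show ?thesis by (simp only: rmul_assoc rmul_zero)
  qed
  moreover have "rmul X (residual k) ?r j = residual k j"
    by (rule rowproj_fix[OF fin residual_in[OF p] j])
  ultimately show ?thesis by (simp add: rmul_linear)
qed

lemma span_proj_fix: assumes j: "j \<in> X" and k: "k < l" shows "rmul X (b k) (e l) j = b k j"
proof -
  have "rmul X (b k) (e l) j = rmul X (rmul X (b k) (e (Suc k))) (e l) j"
    by (intro rmul_cong refl) (simp only: span_proj_fix_Suc)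
  also have "\<dots> = rmul X (b k) (e (Suc k)) j"
    unfolding rmul_assoc using k by (intro rmul_cong refl span_proj_mono j) auto
  finally show ?thesis using span_proj_fix_Suc[OF j] by simp
qed

end

section \<open>Limits of increasing sequences of projections\<close>

lemma pmat_norm_le:
  assumes g: "pmat X g" and fin: "finite X" and i: "i \<in> X" and j: "j \<in> X"
  shows "(norm (g i j x))\<^sup>2 \<le> Re (cinner (g j j x) x)"
  using psd_nonneg[OF pmat_diag_ge[OF g fin i j], of x] norm_adj_comp_le[OF bops[OF pmat_in[OF g i j]], of x]
  by (simp add: blinfun.diff_left cinner.diff_left)

lemma pmat_diag_le:
  assumes g: "pmat X g" and fin: "finite X" and j: "j \<in> X"
  shows "Re (cinner (g j j x) x) \<le> (norm x)\<^sup>2"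
proof -
  have 1: "(norm (g j j x))\<^sup>2 \<le> Re (cinner (g j j x) x)" by (rule pmat_norm_le[OF g fin j j])
  also have 2: "\<dots> \<le> norm (g j j x) * norm x" by (rule Re_cinner_le)
  finally have "norm (g j j x) \<le> norm x" by (cases "norm (g j j x) = 0") (simp_all add: power2_eq_square)
  then have "norm (g j j x) * norm x \<le> (norm x)\<^sup>2" by (simp add: power2_eq_square mult_right_mono)
  with 2 show ?thesis by linarith
qed

text \<open>Differences are again projections, so increments of all entries are bounded by
  increments of the diagonal forms, which increase and are bounded. Normality on the diagonal gives
  the convergence of traces.\<close>

lemma pmat_limit:
  fixes g :: "nat \<Rightarrow> 'i \<Rightarrow> 'i \<Rightarrow> 'h \<Rightarrow>\<^sub>L 'h"
  assumes fin: "finite X" and g: "\<And>k. pmat X (g k)"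
    and mono: "\<And>k l i j. k \<le> l \<Longrightarrow> i \<in> X \<Longrightarrow> j \<in> X \<Longrightarrow> rmul X (g k i) (g l) j = g k i j"
  shows "\<exists>s. pmat X s \<and> (\<forall>k. \<forall>i\<in>X. \<forall>j\<in>X. rmul X (g k i) s j = g k i j) \<and> (\<lambda>k. Tr X (g k)) \<longlonglongrightarrow> Tr X s"
proof -
  have d: "pmat X (\<lambda>i j. g l i j - g k i j)" if "k \<le> l" for k l
    by (rule pmat_diff[OF g g]) (use mono[OF that] in \<open>simp add: rmul_def\<close>)
  have "\<exists>s. sot (\<lambda>k. g k i j) s" if i: "i \<in> X" and j: "j \<in> X" for i j
  proof -
    have le: "(norm (g k i j x))\<^sup>2 \<le> (norm x)\<^sup>2" for k x
      using pmat_norm_le[OF g fin i j] pmat_diag_le[OF g fin j] by (rule order_trans)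
    have nb: "norm (g k i j) \<le> 1" for k
      by (rule norm_blinfun_bound) (use power2_le_imp_le[OF le] in auto)
    have "Cauchy (\<lambda>k. g k i j x)" for x
    proof (rule Cauchy_increments[where q="\<lambda>k. Re (cinner (g k j j x) x)" and B="(norm x)\<^sup>2" and C=1])
      have *: "(norm (g l i j x - g k i j x))\<^sup>2 \<le> Re (cinner (g l j j x) x) - Re (cinner (g k j j x) x)" if "k \<le> l" for k l
        using pmat_norm_le[OF d[OF that] fin i j, of x] by (simp add: blinfun.diff_left cinner.diff_left)
      then show "(norm (g l i j x - g k i j x))\<^sup>2 \<le> 1 * (Re (cinner (g l j j x) x) - Re (cinner (g k j j x) x))" if "k \<le> l" for k l
        using that by simp
      show "incseq (\<lambda>k. Re (cinner (g k j j x) x))"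
      proof (rule monoI)
        fix k l :: nat assume "k \<le> l"
        from order_trans[OF zero_le_power2 *[OF this]]
        show "Re (cinner (g k j j x) x) \<le> Re (cinner (g l j j x) x)" by simp
      qed
      show "Re (cinner (g k j j x) x) \<le> (norm x)\<^sup>2" for k by (rule pmat_diag_le[OF g fin j])
    qed simp
    then show ?thesis
      using strong_limit_exists[of "\<lambda>k. g k i j" 1] nb pmat_in[OF g i j] bops unfolding sot_def by blast
  qed
  then have "\<exists>s. \<forall>i\<in>X. \<forall>j\<in>X. sot (\<lambda>k. g k i j) (s i j)"
    by (intro exI[of _ "\<lambda>i j. SOME s. sot (\<lambda>k. g k i j) s"]) (meson someI_ex)
  then obtain s where s: "\<And>i j. i \<in> X \<Longrightarrow> j \<in> X \<Longrightarrow> sot (\<lambda>k. g k i j) (s i j)" by blast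
  have sA: "s i j \<in> A" if "i \<in> X" "j \<in> X" for i j
    using sot_in[OF s[OF that]] pmat_in[OF g that] by blast
  have gs: "rmul X (g k i) s j = g k i j" if i: "i \<in> X" and j: "j \<in> X" for k i j
  proof (rule sot_unique)
    show "sot (\<lambda>l. rmul X (g k i) (g l) j) (rmul X (g k i) s j)"
      unfolding rmul_def using s i j by (intro sot_sum sot_comp_left bops pmat_in[OF g])
    show "sot (\<lambda>l. rmul X (g k i) (g l) j) (g k i j)"
      by (rule sot_cong_eventually[OF sot_const, where N=k]) (use mono i j in \<open>auto intro: bops pmat_in[OF g]\<close>)
  qed
  have "pmat X s"
    unfolding pmat_def
  proof (intro ballI conjI)
    fix i j assume i: "i \<in> X" and j: "j \<in> X"
    show "s i j \<in> A" by (rule sA[OF i j])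
    show "op_adj (s j i) = s i j"
    proof (rule sot_adj[OF s[OF j i]])
      show "sot (\<lambda>k. op_adj (g k j i)) (s i j)" using s[OF i j] by (simp add: pmat_adj[OF g i j])
      show "g k j i \<in> bounded_ops" for k by (rule bops[OF pmat_in[OF g j i]])
    qed
    have "sot (\<lambda>k. rmul X (g k i) s j) (rmul X (s i) s j)"
      unfolding rmul_def using s i j by (intro sot_sum sot_comp_right bops sA)
    then have "rmul X (s i) s j = s i j" unfolding gs[OF i j] using s[OF i j] sot_unique by blast
    then show "(\<Sum>k\<in>X. s i k \<cdot> s k j) = s i j" by (simp add: rmul_def)
  qed
  moreover have "(\<lambda>k. Tr X (g k)) \<longlonglongrightarrow> Tr X s"
    unfolding Tr_def \<tau>_def
  proof (intro tendsto_sum tr_increasing[OF _ _ _ s])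
    fix i assume i: "i \<in> X"
    show "g k i i \<in> A" for k by (rule pmat_in[OF g i i])
    show "psd (g 0 i i)" by (rule pmat_diag_psd[OF g i])
    show "psd (g (Suc k) i i - g k i i)" for k using pmat_diag_psd[OF d[of k "Suc k"] i] by simp
  qed
  ultimately show ?thesis using gs by blast
qed

lemma \<nu>_proj: assumes z: "z \<in> A" "sa z" "z \<cdot> z = z" shows "\<nu> z = \<tau> id_blinfun - \<tau> z"
proof -
  let ?w = "id_blinfun - z"
  have "null z \<cdot> ?w = ?w" using z by (intro null_fix) (simp_all add: comp_simps diff_in bops)
  then have "op_adj (null z \<cdot> ?w) = op_adj ?w" by simp
  moreover have "sa ?w" using z by (simp add: sa_diff)
  ultimately have "?w \<cdot> null z = ?w"
    using null_sa[OF z(1)] by (simp add: op_adj_comp sa_bounded_ops sa_def)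
  moreover have "?w \<cdot> null z = null z" using comp_null[OF z(1)] by (simp add: comp_simps)
  ultimately have "null z = ?w" by simp
  then show ?thesis using z by (simp add: \<nu>_def \<tau>_diff)
qed

end

section \<open>Torsion of induced modules\<close>

lemma (in left_module) submodule_minus:
  assumes N: "submodule N R M" and x: "x \<in> N" "y \<in> N" shows "x \<ominus>\<^bsub>M\<^esub> y \<in> N"
proof -
  interpret N: abelian_subgroup N M by (rule submodule_abelian_subgroup[OF N])
  show ?thesis using x by (simp add: a_minus_def)
qed

context tracial_algebra
begin

text \<open>Left multiplication by an element of nullity 0 does not raise the nullity, so it
  suffices to annihilate \<open>z\<close> modulo \<open>tors A tr {0} M\<close>.\<close>

lemma tors_saturated:
  fixes M :: "('h \<Rightarrow>\<^sub>L 'h, 'm, 'k) module_scheme"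
  assumes M: "left_module (vn_ring A) M" and z: "z \<in> carrier M"
    and w: "\<And>e. e \<in> E \<Longrightarrow> \<exists>u\<in>A. \<nu> u \<le> e \<and> u \<odot>\<^bsub>M\<^esub> z \<in> tors A tr {0} M"
  shows "z \<in> tors A tr E M"
proof -
  interpret M: left_module "vn_ring A" M by fact
  have "\<exists>c\<in>A. \<nu> c \<le> e \<and> c \<odot>\<^bsub>M\<^esub> z = \<zero>\<^bsub>M\<^esub>" if e: "e \<in> E" for e
  proof -
    obtain u where u: "u \<in> A" "\<nu> u \<le> e" "u \<odot>\<^bsub>M\<^esub> z \<in> tors A tr {0} M" using w[OF e] by blast
    then obtain c where c: "c \<in> A" "\<nu> c \<le> 0" "c \<odot>\<^bsub>M\<^esub> (u \<odot>\<^bsub>M\<^esub> z) = \<zero>\<^bsub>M\<^esub>" by (auto simp: tors_def)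
    have "(c \<cdot> u) \<odot>\<^bsub>M\<^esub> z = \<zero>\<^bsub>M\<^esub>" using M.lsmult_assoc[of c u z] c u z by simp
    moreover have "\<nu> (c \<cdot> u) \<le> e" using \<nu>_comp_le[OF c(1) u(1)] u c by simp
    ultimately show ?thesis using c u by (intro bexI[of _ "c \<cdot> u"]) (auto intro: comp_in)
  qed
  then show ?thesis using z by (simp add: tors_def)
qed

text \<open>With \<open>h = \<rho> \<rho>\<^sup>*\<close>, the operator \<open>t = h + kerp h\<close> is injective, and the Ore condition
  \<open>u \<rho>\<^sub>i\<^sup>* = x t\<close> turns into \<open>u r\<^sub>i\<^sub>j = x \<rho>\<^sub>j\<close> for the projection \<open>r\<close>.\<close>

lemma rowproj_multiple:
  fixes \<rho> :: "'i \<Rightarrow> 'h \<Rightarrow>\<^sub>L 'h"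
  assumes fin: "finite X" and r: "\<And>i. i \<in> X \<Longrightarrow> \<rho> i \<in> A" and i: "i \<in> X"
  shows "\<exists>u\<in>A. \<exists>x\<in>A. \<nu> u \<le> 0 \<and> (\<forall>j\<in>X. u \<cdot> rowproj X \<rho> i j = x \<cdot> \<rho> j)"
proof -
  define h where "h = rowh X \<rho>"
  have h: "h \<in> A" "psd h" unfolding h_def by (rule rowh_in[OF fin r] rowh_psd[OF fin r]; assumption)+
  have k: "kerp h \<in> A" by (rule kerp_in[OF h])
  define t where "t = h + kerp h"
  have t: "t \<in> A" unfolding t_def by (intro add_in h k)
  \<comment> \<open>\<open>h\<close> and \<open>kerp h\<close> act on complementary subspaces, so an
    operator killed by their sum is killed by both.\<close>
  have "\<nu> t \<le> 0"
    unfolding \<nu>_zero_iff_cancel[OF t]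
  proof (intro ballI impI)
    fix y assume y: "y \<in> A" "t \<cdot> y = 0"
    have e: "h \<cdot> y + kerp h \<cdot> y = 0" using y(2) by (simp add: t_def comp_simps)
    have "kerp h \<cdot> (h \<cdot> y + kerp h \<cdot> y) = kerp h \<cdot> y"
      by (simp add: comp_simps kerp_comp[OF h(2)] kerp_idem[OF h(2)] flip: comp_assoc)
    then have k0: "kerp h \<cdot> y = 0" unfolding e by simp
    then have "h \<cdot> y = 0" using e by simp
    then have "kerp h \<cdot> y = y" by (intro kerp_fix h bops y)
    then show "y = 0" using k0 by simp
  qed
  moreover obtain u x where u: "u \<in> A" "x \<in> A" "u \<cdot> op_adj (\<rho> i) = x \<cdot> t" "\<nu> u \<le> \<nu> t"
    using ore[OF adj_in[OF r[OF i]] t] by blast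
  ultimately have \<nu>u: "\<nu> u \<le> 0" by simp
  have "op_adj (kerp h \<cdot> \<rho> i) = op_adj (\<rho> i) \<cdot> kerp h"
    using kerp_sa[OF h(2)] by (simp add: op_adj_comp bops r i k sa_def)
  then have rk: "op_adj (\<rho> i) \<cdot> kerp h = 0" using kerp_rowh[where \<rho>=\<rho>, OF fin r i] by (simp add: h_def)
  have tk: "t \<cdot> kerp h = kerp h" by (simp add: t_def comp_simps comp_kerp[OF h(2)] kerp_idem[OF h(2)])
  have "x \<cdot> kerp h = x \<cdot> (t \<cdot> kerp h)" by (simp only: tk)
  also have "\<dots> = u \<cdot> (op_adj (\<rho> i) \<cdot> kerp h)" by (simp only: comp_assoc[symmetric] u(3))
  finally have "x \<cdot> kerp h = 0" by (simp add: rk)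
  then have uh: "u \<cdot> op_adj (\<rho> i) = x \<cdot> h" using u(3) by (simp add: t_def comp_simps)
  let ?r = "rowproj X \<rho>"
  have p: "pmat X ?r" by (rule rowproj_pmat[OF fin r])
  have "u \<cdot> ?r i j = x \<cdot> \<rho> j" if j: "j \<in> X" for j
  proof -
    \<comment> \<open>The difference of the two rows is orthogonal to \<rho> and therefore killed by
      the projection, which fixes both rows.\<close>
    have "(\<Sum>l\<in>X. (u \<cdot> ?r i l - x \<cdot> \<rho> l) \<cdot> op_adj (\<rho> l)) = u \<cdot> (\<Sum>l\<in>X. ?r i l \<cdot> op_adj (\<rho> l)) - x \<cdot> h"
      by (simp add: h_def rowh_def comp_simps sum_subtractf comp.sum_right comp_assoc)
    also have "\<dots> = 0" by (simp add: rowproj_fix_adj[OF fin r i] uh)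
    finally have "rmul X (\<lambda>l. u \<cdot> ?r i l - x \<cdot> \<rho> l) ?r j = 0"
      by (intro rowproj_left fin r j) (auto intro!: diff_in comp_in u r pmat_in[OF p i])
    then show ?thesis
      by (simp add: rmul_linear pmat_rmul[OF p i j] rowproj_fix[OF fin r j])
  qed
  then show ?thesis using u(1,2) \<nu>u by blast
qed

end

context induced_module
begin

definition evin :: "'m set \<Rightarrow> ('m \<Rightarrow> 'h \<Rightarrow>\<^sub>L 'h) \<Rightarrow> bool" where "evin N \<beta> \<longleftrightarrow> fs \<beta> \<and> ev \<beta> \<in> N"

lemma evin_zero: "submodule N (vn_ring B) M \<Longrightarrow> evin N (\<lambda>_. 0)"
  by (simp add: evin_def ev_zero submodule_zero)

lemma evin_add: "submodule N (vn_ring B) M \<Longrightarrow> evin N \<beta> \<Longrightarrow> evin N \<gamma> \<Longrightarrow> evin N (\<lambda>m. \<beta> m + \<gamma> m)"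
  by (simp add: evin_def fs_add ev_add submodule_add)

lemma evin_smult: "submodule N (vn_ring B) M \<Longrightarrow> b \<in> B \<Longrightarrow> evin N \<beta> \<Longrightarrow> evin N (\<lambda>m. b \<cdot> \<beta> m)"
  by (simp add: evin_def fs_smult ev_smult submodule_smult)

lemma evin_diff:
  assumes "submodule N (vn_ring B) M" "evin N \<beta>" "evin N \<gamma>" shows "evin N (\<lambda>m. \<beta> m - \<gamma> m)"
proof -
  have "- id_blinfun \<in> B" using B.scaleR_in[OF B.id_in, of "-1"] by simp
  from evin_add[OF assms(1,2) evin_smult[OF assms(1) this assms(3)]] show ?thesis by (simp add: comp.minus_left)
qed

lemma evin_sum:
  assumes "submodule N (vn_ring B) M" "\<And>j. j \<in> J \<Longrightarrow> evin N (\<beta> j)" shows "evin N (\<lambda>m. \<Sum>j\<in>J. \<beta> j m)"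
  using assms(2) by (induction J rule: infinite_finite_induct) (simp_all add: evin_zero evin_add assms(1))

lemma evin_K: "submodule N (vn_ring B) M \<Longrightarrow> \<beta> \<in> K \<Longrightarrow> evin N \<beta>"
  by (simp add: evin_def K_def submodule_zero)

text \<open>Projections are specified on \<open>X\<close> only; the extension by zero makes their
  rows finitely supported elements on which \<open>ev\<close> can act.\<close>

definition row :: "'m set \<Rightarrow> ('m \<Rightarrow> 'h \<Rightarrow>\<^sub>L 'h) \<Rightarrow> 'm \<Rightarrow> 'h \<Rightarrow>\<^sub>L 'h" where
  "row X r j = (if j \<in> X then r j else 0)"

lemma row_fs: "finite X \<Longrightarrow> X \<subseteq> carrier M \<Longrightarrow> (\<And>j. j \<in> X \<Longrightarrow> r j \<in> B) \<Longrightarrow> fs (row X r)"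
  by (rule fsI[of X]) (auto simp: row_def B.zero_in)

abbreviation "tors0 \<equiv> tors B tr {0} M"

lemma tors0_submodule: "submodule tors0 (vn_ring B) M"
  by (rule B.tors_submodule[OF M.left_module_axioms]) simp

text \<open>An injective multiple of the row of the projection is a multiple of \<rho>, which
  evaluates into the torsion submodule; saturation removes the multiplier.\<close>

lemma rowproj_evin:
  assumes X: "finite X" "X \<subseteq> carrier M" and r: "\<And>j. j \<in> X \<Longrightarrow> \<rho> j \<in> B" and e: "evin tors0 (row X \<rho>)" and i: "i \<in> X"
  shows "evin tors0 (row X (B.rowproj X \<rho> i))"
proof -
  note p = B.rowproj_pmat[OF X(1) r]
  have f: "fs (row X (B.rowproj X \<rho> i))" by (intro row_fs X B.pmat_in[OF p i])
  obtain u x where u: "u \<in> B" "x \<in> B" "B.\<nu> u \<le> 0" and ux: "\<And>j. j \<in> X \<Longrightarrow> u \<cdot> B.rowproj X \<rho> i j = x \<cdot> \<rho> j"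
    using B.rowproj_multiple[where \<rho>=\<rho>, OF X(1) r i] by blast
  have "(\<lambda>m. u \<cdot> row X (B.rowproj X \<rho> i) m) = (\<lambda>m. x \<cdot> row X \<rho> m)"
    by (auto simp: row_def ux)
  then have "u \<odot>\<^bsub>M\<^esub> ev (row X (B.rowproj X \<rho> i)) = x \<odot>\<^bsub>M\<^esub> ev (row X \<rho>)"
    using ev_smult[OF f u(1)] ev_smult[OF _ u(2), of "row X \<rho>"] e by (simp add: evin_def)
  also have "\<dots> \<in> tors0" using e u(2) submodule_smult[OF tors0_submodule] by (simp add: evin_def)
  finally have "ev (row X (B.rowproj X \<rho> i)) \<in> tors0"
    using u by (intro B.tors_saturated[OF M.left_module_axioms] ev_closed f) auto
  then show ?thesis using f by (simp add: evin_def)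
qed

context
  fixes X :: "'m set" and b :: "nat \<Rightarrow> 'm \<Rightarrow> 'h \<Rightarrow>\<^sub>L 'h"
  assumes X: "finite X" "X \<subseteq> carrier M" and b: "\<And>k. b k \<in> K" "\<And>k m. m \<notin> X \<Longrightarrow> b k m = 0"
begin

lemma b_in: "b k m \<in> B" using b(1)[of k] by (simp add: K_def fs_def)

text \<open>The residual differs from a relation by a combination of earlier rows, so it evaluates
  into the torsion submodule and \<open>rowproj_evin\<close> applies.\<close>

lemma span_proj_evin: "i \<in> X \<Longrightarrow> evin tors0 (row X (B.span_proj X b k i))"
proof (induction k arbitrary: i)
  case 0
  have "row X (B.span_proj X b 0 i) = (\<lambda>_. 0)" by (simp add: row_def fun_eq_iff)
  then show ?case using evin_zero[OF tors0_submodule] by simp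
next
  case (Suc k)
  note S = tors0_submodule
  let ?e = "B.span_proj X b k" and ?\<rho> = "\<lambda>m. b k m - rmul X (b k) (B.span_proj X b k) m"
  have p: "B.pmat X ?e" by (rule B.span_proj_pmat[OF X(1) b_in])
  have "row X ?\<rho> = (\<lambda>m. b k m - (\<Sum>l\<in>X. b k l \<cdot> row X (?e l) m))"
    using b(2) by (auto simp: row_def rmul_def fun_eq_iff)
  moreover have "evin tors0 (\<lambda>m. b k m - (\<Sum>l\<in>X. b k l \<cdot> row X (?e l) m))"
    by (intro evin_diff S evin_sum evin_K evin_smult b b_in Suc.IH)
  ultimately have "evin tors0 (row X ?\<rho>)" by simp
  then have "evin tors0 (row X (B.rowproj X ?\<rho> i))"
    using Suc.prems by (intro rowproj_evin X B.residual_in[OF X(1) b_in p])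
  from evin_add[OF S Suc.IH[OF Suc.prems] this] show ?case
    by (rule back_subst[of "evin tors0"]) (auto simp: row_def fun_eq_iff)
qed

text \<open>The rows of the limit are compared with those of the finite stages. The traces converge,
  so an operator of arbitrarily small nullity makes a row of \<open>s\<close> agree with one whose
  value is in \<open>tors0\<close>.\<close>

lemma span_limit:
  "\<exists>s. (\<forall>i\<in>X. \<forall>j\<in>X. s i j \<in> B) \<and> (\<forall>k. \<forall>j\<in>X. rmul X (b k) s j = b k j) \<and>
    (\<forall>i\<in>X. evin (tors B tr {0<..} M) (row X (s i)))"
proof -
  let ?e = "B.span_proj X b"
  have p: "B.pmat X (?e k)" for k by (rule B.span_proj_pmat[OF X(1) b_in])
  have mono: "rmul X (?e k i) (?e l) j = ?e k i j" if "k \<le> l" "i \<in> X" "j \<in> X" for k l i j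
    by (rule B.span_proj_mono[OF X(1) b_in that(2,3,1)])
  have "\<exists>s. B.pmat X s \<and> (\<forall>k. \<forall>i\<in>X. \<forall>j\<in>X. rmul X (?e k i) s j = ?e k i j) \<and> (\<lambda>k. B.Tr X (?e k)) \<longlonglongrightarrow> B.Tr X s"
    by (rule B.pmat_limit[where g="?e", OF X(1) p mono])
  then obtain s where s: "B.pmat X s"
    and es: "\<And>k i j. i \<in> X \<Longrightarrow> j \<in> X \<Longrightarrow> rmul X (?e k i) s j = ?e k i j"
    and Tr: "(\<lambda>k. B.Tr X (?e k)) \<longlonglongrightarrow> B.Tr X s"
    by blast
  have bs: "rmul X (b k) s j = b k j" if j: "j \<in> X" for k j
  proof -
    have fix': "rmul X (b k) (?e (Suc k)) l = b k l" if "l \<in> X" for l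
      by (rule B.span_proj_fix_Suc[OF X(1) b_in that])
    have "rmul X (b k) s j = rmul X (rmul X (b k) (?e (Suc k))) s j"
      by (intro rmul_cong refl fix'[symmetric])
    also have "\<dots> = rmul X (b k) (?e (Suc k)) j"
      unfolding rmul_assoc by (intro rmul_cong refl es j)
    finally show ?thesis by (simp only: fix'[OF j])
  qed
  have "evin (tors B tr {0<..} M) (row X (s i))" if i: "i \<in> X" for i
  proof -
    have f: "fs (row X (s i))" by (intro row_fs X B.pmat_in[OF s i])
    have "ev (row X (s i)) \<in> tors B tr {0<..} M"
    proof (rule B.tors_saturated[OF M.left_module_axioms ev_closed[OF f]])
      fix d :: real assume "d \<in> {0<..}"
      then have "\<forall>\<^sub>F k in sequentially. B.Tr X s - d < B.Tr X (?e k)"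
        using order_tendstoD(1)[OF Tr] by simp
      then obtain k where k: "B.Tr X s - B.Tr X (?e k) \<le> d"
        unfolding eventually_sequentially by (metis add.commute diff_le_eq le_refl less_imp_le)
      let ?g = "\<lambda>i j. s i j - ?e k i j"
      have g: "B.pmat X ?g" by (rule B.pmat_diff[OF s p]) (use es in \<open>simp add: rmul_def\<close>)
      have gA: "?g i j \<in> B" if "j \<in> X" for j by (rule B.pmat_in[OF g i that])
      \<comment> \<open>\<open>u\<close> annihilates row \<open>i\<close> of the difference, so
        \<open>u\<close> times the two rows agree; the nullity of \<open>u\<close> is the rank of
        that row, at most the trace of the difference.\<close>
      define u where "u = kerp (B.rowh X (?g i))"
      have h: "B.rowh X (?g i) \<in> B" "psd (B.rowh X (?g i))"
        by (rule B.rowh_in[OF X(1) gA] B.rowh_psd[OF X(1) gA]; assumption)+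
      have u: "u \<in> B" "sa u" "u \<cdot> u = u" unfolding u_def
        using B.kerp_in[OF h] kerp_sa[OF h(2)] kerp_idem[OF h(2)] by auto
      have "B.\<nu> u = B.\<tau> id_blinfun - B.\<tau> (kerp (B.rowh X (?g i)))" using B.\<nu>_proj[OF u] by (simp add: u_def)
      also have "\<dots> \<le> B.Tr X ?g"
        by (rule B.row_rank_le[OF X(1) gA g]) (use B.pmat_idem[OF g i] in auto)
      also have "\<dots> = B.Tr X s - B.Tr X (?e k)"
        by (simp add: B.Tr_def B.\<tau>_diff B.pmat_in[OF s] B.pmat_in[OF p] sum_subtractf)
      also note k
      finally have "B.\<nu> u \<le> d" .
      moreover have "u \<odot>\<^bsub>M\<^esub> ev (row X (s i)) \<in> tors0"
      proof -
        have "u \<cdot> s i j = u \<cdot> ?e k i j" if "j \<in> X" for j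
          using B.kerp_rowh[OF X(1) gA that] by (simp add: u_def comp_simps)
        then have "(\<lambda>m. u \<cdot> row X (s i) m) = (\<lambda>m. u \<cdot> row X (?e k i) m)"
          by (auto simp: row_def)
        moreover have ek: "evin tors0 (row X (?e k i))" by (rule span_proj_evin[OF i])
        ultimately have "u \<odot>\<^bsub>M\<^esub> ev (row X (s i)) = u \<odot>\<^bsub>M\<^esub> ev (row X (?e k i))"
          using ev_smult[OF f u(1)] ev_smult[OF _ u(1), of "row X (?e k i)"] by (simp add: evin_def)
        also have "\<dots> \<in> tors0" using ek u(1) submodule_smult[OF tors0_submodule] by (simp add: evin_def)
        finally show ?thesis .
      qed
      ultimately show "\<exists>u\<in>B. B.\<nu> u \<le> d \<and> u \<odot>\<^bsub>M\<^esub> ev (row X (s i)) \<in> tors0" using u(1) by blast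
    qed
    then show ?thesis using f by (simp add: evin_def)
  qed
  then show ?thesis using B.pmat_in[OF s] bs by blast
qed

end

text \<open>If the coefficient row \<gamma> satisfies \<gamma> = \<gamma> s, the tensor is rewritten
  with the values of the rows of \<open>s\<close>, which lie in \<open>N\<close>.\<close>

lemma ext_subI:
  assumes c: "Poly_Mapping.keys c \<subseteq> A \<times> carrier M" and N: "submodule N (vn_ring B) M"
    and sB: "\<And>i j. i \<in> snd ` Poly_Mapping.keys c \<Longrightarrow> j \<in> snd ` Poly_Mapping.keys c \<Longrightarrow> s i j \<in> B"
    and s: "\<And>i. i \<in> snd ` Poly_Mapping.keys c \<Longrightarrow> evin N (row (snd ` Poly_Mapping.keys c) (s i))"
    and fix': "\<And>j. j \<in> snd ` Poly_Mapping.keys c \<Longrightarrow> rmul (snd ` Poly_Mapping.keys c) (coef c) s j = coef c j"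
  shows "T.cls c \<in> T.ext_sub N"
proof -
  let ?X = "snd ` Poly_Mapping.keys c" and ?\<gamma> = "coef c"
  define n where "n = (\<lambda>i. ev (row ?X (s i)))"
  have nN: "n i \<in> N" and nf: "fs (row ?X (s i))" if "i \<in> ?X" for i using s[OF that] by (simp_all add: n_def evin_def)
  have nM: "n i \<in> carrier M" if "i \<in> ?X" for i using nN[OF that] submodule_subset[OF N] by blast
  have \<gamma>: "?\<gamma> i \<in> A" for i using coef_in[of c] c by simp
  define d where "d = (\<Sum>i\<in>?X. frag_of (?\<gamma> i, n i))"
  have d: "Poly_Mapping.keys d \<subseteq> A \<times> N"
  proof -
    have "Poly_Mapping.keys (\<Sum>i\<in>Y. frag_of (?\<gamma> i, n i)) \<subseteq> A \<times> N" if "Y \<subseteq> ?X" for Y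
      using finite_subset[OF that] that
      by (induction Y rule: infinite_finite_induct) (simp_all add: keys_addI \<gamma> nN)
    then show ?thesis by (simp add: d_def)
  qed
  \<comment> \<open>The relation stating that the row \<open>s i\<close> evaluates to
    \<open>n i\<close>.\<close>
  let ?\<kappa> = "\<lambda>i m. row ?X (s i) m - (if m = n i then id_blinfun else 0)"
  have "?\<kappa> i \<in> K" if i: "i \<in> ?X" for i
  proof -
    have neg: "- id_blinfun \<in> B" using B.scaleR_in[OF B.id_in, of "-1"] by simp
    have f: "fs (\<lambda>m. if m = n i then - id_blinfun else 0)" using neg nM[OF i] by (rule fs_single)
    have "ev (\<lambda>m. row ?X (s i) m + (if m = n i then - id_blinfun else 0)) = n i \<oplus>\<^bsub>M\<^esub> (- id_blinfun) \<odot>\<^bsub>M\<^esub> n i"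
      using ev_add[OF nf[OF i] f] ev_single[OF neg nM[OF i]] by (simp add: n_def)
    also have "\<dots> = \<zero>\<^bsub>M\<^esub>"
      using M.lsmult_l_distr[of id_blinfun "- id_blinfun" "n i"] M.lsmult_one[OF nM[OF i]] neg nM[OF i]
          left_module_zero_smult[OF M.left_module_axioms nM[OF i]] by simp
    finally have "(\<lambda>m. row ?X (s i) m + (if m = n i then - id_blinfun else 0)) \<in> K"
      using fs_add[OF nf[OF i] f] by (simp add: K_def)
    then show ?thesis by (rule back_subst[of "\<lambda>x. x \<in> K"]) (auto simp: fun_eq_iff)
  qed
  then have "AK (\<lambda>m. \<Sum>i\<in>?X. ?\<gamma> i \<cdot> ?\<kappa> i m)" by (intro AK_sum AK_single \<gamma>) auto
  moreover have "coef (c - d) = (\<lambda>m. \<Sum>i\<in>?X. ?\<gamma> i \<cdot> ?\<kappa> i m)"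
  proof
    fix m
    have "(\<Sum>i\<in>?X. ?\<gamma> i \<cdot> row ?X (s i) m) = ?\<gamma> m"
      using fix'[of m] coef_support[of m c] by (cases "m \<in> ?X") (simp_all add: row_def rmul_def)
    moreover have "coef d m = (\<Sum>i\<in>?X. ?\<gamma> i \<cdot> (if m = n i then id_blinfun else 0))"
      unfolding d_def coef_sum by (intro sum.cong refl) simp
    ultimately show "coef (c - d) m = (\<Sum>i\<in>?X. ?\<gamma> i \<cdot> ?\<kappa> i m)"
      by (simp add: coef_diff comp_simps sum_subtractf)
  qed
  moreover have "Poly_Mapping.keys (c - d) \<subseteq> T.base"
    using c d submodule_subset[OF N] by (intro keys_diffI) auto
  ultimately have "c - d \<in> T.rel" by (intro AK_rel) simp_all
  then have "T.cls c = T.cls d" by (simp add: T.cls_eq_iff)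
  then show ?thesis using d by (simp add: T.ext_sub_def)
qed

lemma coef_act: "Poly_Mapping.keys c \<subseteq> T.base \<Longrightarrow> coef (T.act t c) m = t \<cdot> coef c m"
  by (induction c rule: free_Abelian_group_induct[consumes 1]) (auto simp: coef_diff comp_simps)

text \<open>Annihilation by \<open>t\<close> means that \<open>t\<close> times the coefficient row
  lies in \<open>AK\<close>; \<open>AK_restrict\<close> keeps the relations on the finite support of
  \<open>c\<close>.\<close>

lemma killed_rows:
  assumes c: "Poly_Mapping.keys c \<subseteq> A \<times> carrier M" and t: "t \<in> A" and z: "t \<odot>\<^bsub>T.ext\<^esub> T.cls c = \<zero>\<^bsub>T.ext\<^esub>"
  shows "\<exists>(q::nat) a b. (\<forall>k<q. a k \<in> A \<and> b k \<in> K \<and> (\<forall>m. m \<notin> snd ` Poly_Mapping.keys c \<longrightarrow> b k m = 0)) \<and>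
    (\<lambda>m. t \<cdot> coef c m) = (\<lambda>m. \<Sum>k<q. a k \<cdot> b k m)"
proof -
  have "T.act t c \<in> T.rel" using z t T.cls_eq_iff[of "T.act t c" 0] by (simp add: T.smult_ext T.zero_ext T.cls_zero)
  then have "AK (coef (T.act t c))" by (rule rel_AK)
  moreover have "coef (T.act t c) = (\<lambda>m. t \<cdot> coef c m)" using c by (simp add: coef_act fun_eq_iff)
  ultimately have "AK (\<lambda>m. t \<cdot> coef c m)" by simp
  then show ?thesis by (rule AK_restrict) (simp add: coef_support)
qed

text \<open>With rows written as matrices: t \<gamma> = a b and b s = b give t \<gamma> (1 - s) =
  0.\<close>

lemma killed_fix:
  assumes X: "finite X" and \<gamma>: "\<And>m. t \<cdot> \<gamma> m = (\<Sum>k<q. a k \<cdot> b k m)"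
    and fix': "\<And>k. k < q \<Longrightarrow> rmul X (b k) s j = b k j"
  shows "t \<cdot> (\<gamma> j - rmul X \<gamma> s j) = 0"
proof -
  have "t \<cdot> rmul X \<gamma> s j = (\<Sum>l\<in>X. (t \<cdot> \<gamma> l) \<cdot> s l j)" by (simp add: rmul_def comp.sum_right comp_assoc)
  also have "\<dots> = (\<Sum>k<q. a k \<cdot> rmul X (b k) s j)"
    unfolding \<gamma> by (simp add: rmul_def comp.sum_left comp.sum_right comp_assoc) (rule sum.swap)
  also have "\<dots> = t \<cdot> \<gamma> j" unfolding \<gamma> by (intro sum.cong refl) (simp add: fix')
  finally show ?thesis by (simp add: comp_simps)
qed

lemma tors_induced_le:
  assumes c: "Poly_Mapping.keys c \<subseteq> A \<times> carrier M" and E: "E = {0} \<or> E = {0<..}"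
    and t: "T.cls c \<in> tors A tr E T.ext"
  shows "T.cls c \<in> T.ext_sub (tors B tr E M)"
proof -
  let ?X = "snd ` Poly_Mapping.keys c"
  have X: "finite ?X" "?X \<subseteq> carrier M" using c by auto
  have \<gamma>: "coef c i \<in> A" for i using coef_in[of c] c by simp
  have S: "submodule (tors B tr E M) (vn_ring B) M"
    using E by (intro B.tors_submodule[OF M.left_module_axioms]) auto
  have rmA: "rmul ?X (coef c) s j \<in> A" if "\<And>i j. i \<in> ?X \<Longrightarrow> j \<in> ?X \<Longrightarrow> s i j \<in> B" "j \<in> ?X" for s j
    unfolding rmul_def using that BA \<gamma> by (intro A.sum_in A.comp_in) auto
  show ?thesis
    using E
  proof
    assume E: "E = {0}"
    obtain t where t: "t \<in> A" "A.\<nu> t \<le> 0" "t \<odot>\<^bsub>T.ext\<^esub> T.cls c = \<zero>\<^bsub>T.ext\<^esub>" using t E by (auto simp: tors_def)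
    obtain q :: nat and a b where b: "\<And>k. k < q \<Longrightarrow> b k \<in> K" "\<And>k m. k < q \<Longrightarrow> m \<notin> ?X \<Longrightarrow> b k m = 0"
      and tc': "(\<lambda>m. t \<cdot> coef c m) = (\<lambda>m. \<Sum>k<q. a k \<cdot> b k m)"
      using killed_rows[OF c t(1,3)] by (elim exE conjE) (rule that; simp)
    note tc = fun_cong[OF tc']
    \<comment> \<open>Zero rows pad the family to a sequence in \<open>K\<close>; the projection
      onto the first \<open>q\<close> rows is the one used.\<close>
    define b' where "b' = (\<lambda>k. if k < q then b k else (\<lambda>_. 0))"
    have b': "b' k \<in> K" "m \<notin> ?X \<Longrightarrow> b' k m = 0" for k m using b by (auto simp: b'_def K_zero)
    have b'B: "b' k m \<in> B" for k m by (rule b_in[OF X b'])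
    let ?s = "B.span_proj ?X b' q"
    have p: "B.pmat ?X ?s" by (rule B.span_proj_pmat[OF X(1) b'B])
    show ?thesis
    proof (rule ext_subI[OF c S, where s="?s"])
      show sB: "?s i j \<in> B" if "i \<in> ?X" "j \<in> ?X" for i j by (rule B.pmat_in[OF p that])
      show "evin (tors B tr E M) (row ?X (?s i))" if "i \<in> ?X" for i
        unfolding E by (rule span_proj_evin[OF X b' that])
      fix j assume j: "j \<in> ?X"
      have "t \<cdot> (coef c j - rmul ?X (coef c) ?s j) = 0"
      proof (rule killed_fix[OF X(1) tc])
        show "rmul ?X (b k) ?s j = b k j" if k: "k < q" for k
          using B.span_proj_fix[where b=b', OF X(1) b'B j k] k by (simp add: b'_def)
      qed
      then have "coef c j - rmul ?X (coef c) ?s j = 0"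
        using t A.\<nu>_zero_iff_cancel[OF t(1)] A.diff_in[OF \<gamma> rmA[of "?s" j, OF sB j]] by blast
      then show "rmul ?X (coef c) ?s j = coef c j" by simp
    qed
  next
    assume E: "E = {0<..}"
    have "\<exists>t\<in>A. A.\<nu> t \<le> inverse (Suc n) \<and> t \<odot>\<^bsub>T.ext\<^esub> T.cls c = \<zero>\<^bsub>T.ext\<^esub>" for n
      using t E by (auto simp: tors_def)
    then obtain t where t: "\<And>n. t n \<in> A" "\<And>n. A.\<nu> (t n) \<le> inverse (Suc n)" "\<And>n. t n \<odot>\<^bsub>T.ext\<^esub> T.cls c = \<zero>\<^bsub>T.ext\<^esub>" by metis
    have "\<forall>n. \<exists>(q::nat) a b. (\<forall>k<q. a k \<in> A \<and> b k \<in> K \<and> (\<forall>m. m \<notin> ?X \<longrightarrow> b k m = 0)) \<and>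
      (\<lambda>m. t n \<cdot> coef c m) = (\<lambda>m. \<Sum>k<q. a k \<cdot> b k m)"
      by (intro allI killed_rows[OF c t(1,3)])
    then obtain q :: "nat \<Rightarrow> nat" and a b where n: "\<forall>n. (\<forall>k<q n. a n k \<in> A \<and> b n k \<in> K \<and>
      (\<forall>m. m \<notin> ?X \<longrightarrow> b n k m = 0)) \<and> (\<lambda>m. t n \<cdot> coef c m) = (\<lambda>m. \<Sum>k<q n. a n k \<cdot> b n k m)"
      unfolding choice_iff by (elim exE)
    then have b: "\<And>n k. k < q n \<Longrightarrow> b n k \<in> K" "\<And>n k m. k < q n \<Longrightarrow> m \<notin> ?X \<Longrightarrow> b n k m = 0" by simp_all
    have tc: "t n \<cdot> coef c m = (\<Sum>k<q n. a n k \<cdot> b n k m)" for n m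
      by (rule fun_cong[OF conjunct2[OF spec[OF n]]])
    define b' where "b' = (\<lambda>l. case prod_decode l of (n, k) \<Rightarrow> if k < q n then b n k else (\<lambda>_. 0))"
    have b': "b' l \<in> K" "m \<notin> ?X \<Longrightarrow> b' l m = 0" for l m using b by (auto simp: b'_def K_zero split: prod.split)
    have "\<exists>s. (\<forall>i\<in>?X. \<forall>j\<in>?X. s i j \<in> B) \<and> (\<forall>k. \<forall>j\<in>?X. rmul ?X (b' k) s j = b' k j) \<and>
      (\<forall>i\<in>?X. evin (tors B tr {0<..} M) (row ?X (s i)))"
      by (rule span_limit[OF X b'])
    then obtain s where S3: "\<forall>i\<in>?X. \<forall>j\<in>?X. s i j \<in> B" "\<forall>k. \<forall>j\<in>?X. rmul ?X (b' k) s j = b' k j"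
      "\<forall>i\<in>?X. evin (tors B tr {0<..} M) (row ?X (s i))" by (elim exE conjE) (rule that)
    note sB = S3(1)[rule_format] and bs = S3(2)[rule_format] and s = S3(3)[rule_format]
    show ?thesis
    proof (rule ext_subI[OF c S sB])
      show "evin (tors B tr E M) (row ?X (s i))" if "i \<in> ?X" for i unfolding E by (rule s[OF that])
      fix j assume j: "j \<in> ?X"
      let ?v = "coef c j - rmul ?X (coef c) s j"
      have tv: "t n \<cdot> ?v = 0" for n
      proof (rule killed_fix[OF X(1) tc])
        show "rmul ?X (b n k) s j = b n k j" if k: "k < q n" for k
          using bs[OF j, of "prod_encode (n, k)"] k by (simp add: b'_def)
      qed
      \<comment> \<open>Every \<open>t n\<close> kills \<open>?v\<close>, and the nullities of the
        \<open>t n\<close> tend to 0.\<close>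
      have "?v = 0"
      proof (rule A.killed_zero[OF A.diff_in[OF \<gamma> rmA[of s j, OF sB j]]])
        fix e :: real assume "e > 0"
        then obtain n where "inverse (Suc n) < e" using reals_Archimedean by blast
        then show "\<exists>c\<in>A. A.\<nu> c \<le> e \<and> c \<cdot> ?v = 0" using t(1,2)[of n] tv[of n] by (intro bexI[of _ "t n"]) auto
      qed
      then show "rmul ?X (coef c) s j = coef c j" by simp
    qed
  qed
qed

text \<open>If \<open>b n = 0\<close>, the exchange \<open>u \<cdot> a = x \<cdot> b\<close> in
  \<open>A\<close> gives u (a \<otimes> n) = x \<otimes> b n = 0, with \<open>u\<close> of nullity
  at most that of \<open>b\<close>.\<close>

lemma tors_induced_ge:
  assumes E: "\<And>e. e \<in> E \<Longrightarrow> 0 \<le> e \<and> e / 2 \<in> E" and c: "Poly_Mapping.keys c \<subseteq> A \<times> tors B tr E M"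
  shows "T.cls c \<in> tors A tr E T.ext"
proof -
  interpret X: left_module "vn_ring A" T.ext by (rule T.left_module_ext)
  have S: "submodule (tors A tr E T.ext) (vn_ring A) T.ext" by (rule A.tors_submodule[OF T.left_module_ext E])
  have "Poly_Mapping.keys c \<subseteq> A \<times> tors B tr E M \<and> T.cls c \<in> tors A tr E T.ext"
    using c
  proof (induction c rule: free_Abelian_group_induct[consumes 1, case_names zero diff frag])
    case zero
    show ?case using submodule_zero[OF S] by (simp add: T.zero_ext T.cls_zero)
  next
    case (diff c d)
    have "T.cls (c - d) = T.cls c \<ominus>\<^bsub>T.ext\<^esub> T.cls d"
      using diff(1,2) by (intro T.cls_diff[symmetric]) (auto simp: tors_def)
    then show ?case using X.submodule_minus[OF S] diff by (simp add: keys_diffI)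
  next
    case (frag k)
    then obtain a n where k: "k = (a, n)" "a \<in> A" "n \<in> tors B tr E M" by auto
    have n: "n \<in> carrier M" using k(3) by (simp add: tors_def)
    have "\<exists>u\<in>A. A.\<nu> u \<le> e \<and> u \<odot>\<^bsub>T.ext\<^esub> T.cls (frag_of k) = \<zero>\<^bsub>T.ext\<^esub>" if e: "e \<in> E" for e
    proof -
      obtain b where b: "b \<in> B" "B.\<nu> b \<le> e" "b \<odot>\<^bsub>M\<^esub> n = \<zero>\<^bsub>M\<^esub>" using k(3) e by (auto simp: tors_def)
      obtain u x where u: "u \<in> A" "x \<in> A" "u \<cdot> a = x \<cdot> b" "A.\<nu> u \<le> A.\<nu> b" using A.ore[OF k(2)] b(1) BA by blast
      have "frag_of (x \<cdot> b, n) - frag_of (x, \<zero>\<^bsub>M\<^esub>) \<in> T.rel" using T.rel_mult[of x b n] u b n by simp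
      from T.rel_add[OF this T.rel_frag_zero[of x]] have "frag_of (u \<cdot> a, n) \<in> T.rel" using u by simp
      then have "u \<odot>\<^bsub>T.ext\<^esub> T.cls (frag_of k) = \<zero>\<^bsub>T.ext\<^esub>"
        using T.cls_eq_iff[of "frag_of (u \<cdot> a, n)" 0] u(1) by (simp add: k(1) T.smult_ext T.zero_ext T.cls_zero)
      then show ?thesis using u b by (intro bexI[of _ u]) auto
    qed
    moreover have "T.cls (frag_of k) \<in> carrier T.ext" using k n by (simp add: T.carrier_ext)
    ultimately show ?case using frag by (simp add: tors_def)
  qed
  then show ?thesis by blast
qed

lemma tors_induced:
  assumes E: "E = {0} \<or> E = {0<..}"
  shows "tors A tr E (induction A B M) = T.ext_sub (tors B tr E M)"
proof
  show "tors A tr E (induction A B M) \<subseteq> T.ext_sub (tors B tr E M)"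
  proof
    fix x assume x: "x \<in> tors A tr E (induction A B M)"
    then have "x \<in> carrier T.ext" by (simp add: tors_def induction_def)
    then obtain c where c: "Poly_Mapping.keys c \<subseteq> T.base" "x = T.cls c" by (rule T.ext_cases)
    then show "x \<in> T.ext_sub (tors B tr E M)" using tors_induced_le[OF _ E, of c] x by (simp add: induction_def)
  qed
  show "T.ext_sub (tors B tr E M) \<subseteq> tors A tr E (induction A B M)"
    using E tors_induced_ge[of E] by (auto simp: T.ext_sub_def induction_def)
qed

lemma induced_tors:
  assumes "E = {0} \<or> E = {0<..}"
  shows "induced_submodule_eq A B M (tors B tr E M) (tors A tr E (induction A B M))"
    and "induced_quotient_eq A B M (tors B tr E M) (tors A tr E (induction A B M))"
proof -
  have "submodule (tors B tr E M) (vn_ring B) M"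
    using assms by (intro B.tors_submodule[OF M.left_module_axioms]) auto
  from induced_eqI[OF this tors_induced[OF assms]]
  show "induced_submodule_eq A B M (tors B tr E M) (tors A tr E (induction A B M))"
    and "induced_quotient_eq A B M (tors B tr E M) (tors A tr E (induction A B M))" .
qed

end

section \<open>From normal faithful traces to the working assumptions\<close>

lemma psd_op_le: assumes "psd (b - a)" shows "op_le a b"
  unfolding op_le_def
proof
  fix x
  let ?z = "cinner ((b - a) x) x"
  have "?z = cnj ?z" using sa_cinner[OF psd_sa[OF assms], of x x] cinner_commute[of "(b - a) x" x] by simp
  then have "Im ?z = 0" by (metis Im_complex_of_real Reals_cnj_iff complex_is_Real_iff)
  then show "?z \<in> \<real>\<^sub>\<ge>\<^sub>0" using psd_nonneg[OF assms, of x] by (simp add: complex_nonneg_Reals_iff)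
qed

lemma sot_op_le: assumes "sot f s" "\<And>n. op_le (f n) u" shows "op_le s u"
  unfolding op_le_def
proof
  fix x
  have "(\<lambda>n. cinner ((u - f n) x) x) \<longlonglongrightarrow> cinner ((u - s) x) x"
    unfolding blinfun.diff_left by (intro cinner.tendsto tendsto_diff sotD assms tendsto_const)
  then show "cinner ((u - s) x) x \<in> \<real>\<^sub>\<ge>\<^sub>0"
    by (rule closed_sequentially[OF closed_nonneg_Reals_complex, rotated]) (use assms(2) in \<open>simp add: op_le_def\<close>)
qed

text \<open>Normality concerns directed sets with a least upper bound in \<open>A\<close>. The
  strong limit is one: it lies in the bicommutant, and an order bound on the sequence passes to
  strong limits.\<close>

lemma trace_increasing:
  assumes A: "von_neumann_algebra A" and tr: "normal_faithful_trace A tr"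
    and f: "\<And>n. f n \<in> A" "psd (f 0)" "\<And>n. psd (f (Suc n) - f n)" and s: "sot f s"
  shows "(\<lambda>n. Re (tr (f n))) \<longlonglongrightarrow> Re (tr s)"
proof -
  have ops: "A \<subseteq> bounded_ops" and bic: "commutant (commutant A) = A"
    using A by (simp_all add: von_neumann_algebra_def c_star_algebra_def)
  have "s \<in> commutant (commutant A)"
    unfolding commutant_def[of "commutant A"]
  proof (intro CollectI conjI ballI)
    show "s \<in> bounded_ops" using s by (simp add: sot_def)
    fix S assume "S \<in> commutant A"
    then have S: "S \<in> bounded_ops" "\<And>n. f n \<cdot> S = S \<cdot> f n" using f(1) by (auto simp: commutant_def)
    show "s \<cdot> S = S \<cdot> s"
      using sot_comp_right[OF S(1) s] sot_comp_left[OF S(1) s] S(2) by (auto intro: sot_unique)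
  qed
  then have sA: "s \<in> A" by (simp only: bic)
  have mono: "psd (f n - f m)" if "m \<le> n" for m n by (rule psd_mono_seq[of f, OF f(3) that])
  have pos: "psd (f n)" for n using psd_add[OF mono[OF le0] f(2), of n] by simp
  have ub: "psd (s - f m)" for m
    by (rule sot_psd_ge[OF sot_diff[OF s sot_const], where k=m])
       (auto intro: sa_diff psd_sa pos mono sa_bounded_ops)
  have diff: "Re (tr b) \<le> Re (tr c)" if "b \<in> A" "c \<in> A" "psd (c - b)" for b c
  proof -
    have "c - b = c + op_scale (-1) b" by (rule blinfun_eqI) (simp add: blinfun.diff_left blinfun.add_left scaleC_minus_left)
    also have "\<dots> \<in> A" using A that by (simp add: von_neumann_algebra_def c_star_algebra_def)
    finally have "c - b \<in> A" .
    moreover have "op_le 0 (c - b)" using psd_op_le[of "c - b" 0] that by simp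
    moreover have "\<forall>a\<in>A. op_le 0 a \<longrightarrow> tr a \<in> \<real>\<^sub>\<ge>\<^sub>0" and add: "\<forall>a\<in>A. \<forall>b\<in>A. tr (a + b) = tr a + tr b"
      using tr unfolding normal_faithful_trace_def by simp_all
    ultimately have "tr (c - b) \<in> \<real>\<^sub>\<ge>\<^sub>0" and "tr ((c - b) + b) = tr (c - b) + tr b"
      using add[rule_format, of "c - b" b] that(1) by blast+
    then show ?thesis by (simp add: complex_nonneg_Reals_iff)
  qed
  have norm: "\<forall>D s. D \<subseteq> A \<and> D \<noteq> {} \<and> (\<forall>d\<in>D. op_le 0 d) \<and> (\<forall>d\<in>D. \<forall>e\<in>D. \<exists>f\<in>D. op_le d f \<and> op_le e f) \<and>
      s \<in> A \<and> (\<forall>d\<in>D. op_le d s) \<and> (\<forall>u\<in>A. (\<forall>d\<in>D. op_le d u) \<longrightarrow> op_le s u) \<longrightarrow> Re (tr s) = (SUP d\<in>D. Re (tr d))"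
    using tr unfolding normal_faithful_trace_def by (elim conjE)
  have "Re (tr s) = (SUP d\<in>range f. Re (tr d))"
  proof (rule norm[rule_format], intro conjI ballI impI)
    show "range f \<subseteq> A" using f(1) by auto
    show "s \<in> A" by (rule sA)
    fix d assume "d \<in> range f"
    then obtain m where m: "d = f m" by auto
    show "op_le 0 d" using psd_op_le[of d 0] pos m by simp
    show "op_le d s" unfolding m by (intro psd_op_le ub)
    fix e assume "e \<in> range f"
    then obtain n where "e = f n" by auto
    then show "\<exists>g\<in>range f. op_le d g \<and> op_le e g"
      using m by (intro bexI[of _ "f (max m n)"] conjI) (simp_all add: psd_op_le mono)
  next
    fix u assume "\<forall>d\<in>range f. op_le d u"
    then show "op_le s u" by (intro sot_op_le[OF s]) auto
  qed simp
  moreover have "(\<lambda>n. Re (tr (f n))) \<longlonglongrightarrow> (SUP n. Re (tr (f n)))"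
  proof (rule LIMSEQ_incseq_SUP)
    show "bdd_above (range (\<lambda>n. Re (tr (f n))))"
      by (rule bdd_aboveI[of _ "Re (tr s)"]) (auto intro: diff f(1) sA ub)
    show "incseq (\<lambda>n. Re (tr (f n)))" by (intro incseq_SucI diff f)
  qed
  ultimately show ?thesis by (simp add: image_image)
qed

text \<open>Normality for \<open>B\<close> is taken from \<open>A\<close>: a sequence in
  \<open>B\<close> and its strong limit are the same operators in either algebra, whereas least
  upper bounds would have to be compared.\<close>

lemma tracial_algebraI:
  assumes A: "von_neumann_algebra A" and tr: "normal_faithful_trace A tr"
    and B: "von_neumann_algebra B" and BA: "B \<subseteq> A"
  shows "tracial_algebra B tr"
proof
  have pos: "op_le 0 a" if "psd a" for a :: "'a \<Rightarrow>\<^sub>L 'a" using psd_op_le[of a 0] that by simp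
  have T: "\<forall>a\<in>A. op_le 0 a \<longrightarrow> tr a \<in> \<real>\<^sub>\<ge>\<^sub>0" "\<forall>a\<in>A. op_le 0 a \<and> tr a = 0 \<longrightarrow> a = 0"
    using tr unfolding normal_faithful_trace_def by simp_all
  show "tr a \<in> \<real>\<^sub>\<ge>\<^sub>0" if "a \<in> B" "psd a" for a
    using T(1)[rule_format, OF subsetD[OF BA that(1)] pos[OF that(2)]] .
  show "a = 0" if "a \<in> B" "psd a" "tr a = 0" for a
    using T(2)[rule_format, OF subsetD[OF BA that(1)] conjI[OF pos[OF that(2)] that(3)]] .
  show "(\<lambda>n. Re (tr (f n))) \<longlonglongrightarrow> Re (tr s)"
    if "\<And>n. f n \<in> B" "psd (f 0)" "\<And>n. psd (f (Suc n) - f n)" "sot f s" for f s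
    by (rule trace_increasing[OF A tr]) (use that BA in auto)
qed (use B BA tr in \<open>auto simp: von_neumann_algebra_def c_star_algebra_def normal_faithful_trace_def subset_iff\<close>)

theorem proposition7p3:
  fixes A B :: "('h::complex_hilbert \<Rightarrow>\<^sub>L 'h) set"
    and tr :: "('h \<Rightarrow>\<^sub>L 'h) \<Rightarrow> complex"
    and \<iota>\<^sub>A :: "('h \<Rightarrow>\<^sub>L 'h) \<Rightarrow> 'la::complex_hilbert"
    and \<iota>\<^sub>B :: "('h \<Rightarrow>\<^sub>L 'h) \<Rightarrow> 'lb::complex_hilbert"
    and M :: "('h \<Rightarrow>\<^sub>L 'h, 'm) module"
  assumes "von_neumann_algebra A"
    and "normal_faithful_trace A tr"
    and "von_neumann_subalgebra B A"
    and "l2_completion A tr \<iota>\<^sub>A"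
    and "l2_completion B tr \<iota>\<^sub>B"
    and "left_module (vn_ring B) M"
  shows "induced_submodule_eq A B M (alg_torsion B \<iota>\<^sub>B M) (alg_torsion A \<iota>\<^sub>A (induction A B M))
       \<and> induced_quotient_eq A B M (alg_torsion B \<iota>\<^sub>B M) (alg_torsion A \<iota>\<^sub>A (induction A B M))
       \<and> induced_submodule_eq A B M (dim_torsion B tr M) (dim_torsion A tr (induction A B M))
       \<and> induced_quotient_eq A B M (dim_torsion B tr M) (dim_torsion A tr (induction A B M))"
proof -
  have B: "von_neumann_algebra B" "B \<subseteq> A" using assms(3) by (simp_all add: von_neumann_subalgebra_def)
  interpret A: l2_algebra A tr \<iota>\<^sub>A
    by (intro l2_algebra.intro l2_algebra_axioms.intro tracial_algebraI[OF assms(1,2,1) subset_refl] assms(4))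
  interpret B: l2_algebra B tr \<iota>\<^sub>B
    by (intro l2_algebra.intro l2_algebra_axioms.intro tracial_algebraI[OF assms(1,2) B] assms(5))
  interpret I: induced_module A B tr M
    by (intro induced_module.intro induced_module_axioms.intro A.tracial_algebra_axioms B.tracial_algebra_axioms B(2) assms(6))
  have ext: "left_module (vn_ring A) (induction A B M)"
    unfolding induction_def by (rule I.T.left_module_ext)
  show ?thesis
    unfolding A.alg_torsion_eq_tors[OF ext] B.alg_torsion_eq_tors[OF assms(6)]
      A.dim_torsion_eq_tors[OF ext] B.dim_torsion_eq_tors[OF assms(6)]
    by (intro conjI I.induced_tors) simp_all
qed

end
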